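(* Let $\lambda \in \mathbb{Z}_{>0}$ and let $\mathcal{M}$ be a holonomic $\mathcal{D}_\lambda$-module on $X = \mathbb{CP}^1$ with exactly one regular singularity. Consider the $\mathfrak{sl}_2(\mathbb{C})$-representation $V = \Gamma(X,\mathcal{M})$ corresponding to $\mathcal{M}$. There exists a composition series of $\mathfrak{sl}_2(\mathbb{C})$-representations $$0 = V_{n+1} \leq V_n \leq V_{n-1} \leq \ldots \leq V_1 = V$$ such that each quotient $V_i/V_{i+1}$ is one of the following: (a) the irreducible Verma module of highest weight $-\lambda - 1$; (b) the irreducible finite-dimensional representation of highest weight $\lambda - 1$.
   Context: Let $\mathfrak{sl}_2(\mathbb{C})$ have the standard basis $E=\begin{pmatrix}0&1\\0&0\end{pmatrix}$, $F=\begin{pmatrix}0&0\\1&0\end{pmatrix}$, $H=\begin{pmatrix}1&0\\0&-1\end{pmatrix}$. Weights are eigenvalues of $H$, highest weight vectors are killed by $E$, and the Verma module of highest weight $\mu$ is $U(\mathfrak{sl}_2)/(U(\mathfrak{sl}_2)E+U(\mathfrak{sl}_2)(H-\mu))$. On $X=\mathbb{CP}^1$ put $0=[1:0]$, $\infty=[0:1]$, $U_0=X\setminus\{\infty\}$ with coordinate $z=y/x$, and $U_\infty=X\setminus\{0\}$ with coordinate $w=x/y=z^{-1}$. For $n\in\mathbb{Z}$, $\mathcal{O}_n$ is the line bundle on $X$ trivialised on $U_0$ and $U_\infty$, whose sections are pairs $(f,g)$ of functions (on the $U_0$- and $U_\infty$-parts) with $f(z)=z^{n}g(z^{-1})$ on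 the overlap. The sheaf $\mathcal{D}_\lambda$ of twisted differential operators is the sheaf of differential operators from $\mathcal{O}_{\lambda-1}$ to itself. There is an algebra homomorphism $\Phi_\lambda:U(\mathfrak{sl}_2)\to\Gamma(X,\mathcal{D}_\lambda)$ given on $U_0$ by $E\mapsto z^2\partial_z-(\lambda-1)z$, $F\mapsto-\partial_z$, $H\mapsto 2z\partial_z-(\lambda-1)$, and on $U_\infty$ by $E\mapsto-\partial_w$, $F\mapsto w^2\partial_w-(\lambda-1)w$, $H\mapsto-2w\partial_w+(\lambda-1)$. Through $\Phi_\lambda$, global sections of a $\mathcal{D}_\lambda$-module form an $\mathfrak{sl}_2(\mathbb{C})$-representation. The functor $\mathcal{O}_{\lambda-1}\otimes_{\mathcal{O}_X}-$ is an equivalence from $\mathcal{D}_X$-modules to $\mathcal{D}_\lambda$-modules; a $\mathcal{D}_\lambda$-module is called holonomic (resp. holonomic with regular singularities) if it corresponds to a holonomic (resp. regular holonomic) $\mathcal{D}_X$-module. A point is a singularity of a holonomic $\mathcal{D}_\lambda$-module if the module is not $\mathcal{O}_X$-coherent in any neighbourhood of it. "Exactly one regular singularity" means that the module is regular holonomic and has exactly one singular point.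
   Formalization: If the singularity p is not 0=[1:0] the claim fails for the standard Verma module (e.g. the delta module at infinity, where E acts freely); in (a) the Verma module is taken for gEg^-1, gHg^-1 with g in SL_2 and g[1:0]=p, which is the original module for p=0, g=1. *)

theory Defs
  imports "HOL-Analysis.Analysis" "HOL-Computational_Algebra.Fraction_Field"
    "HOL-Computational_Algebra.Polynomial"
begin

section \<open>The projective line\<close>

text \<open>
  We work in the algebraic category: \<open>X\<close> carries the Zariski topology, and its structure sheaf
  is a subsheaf of the constant sheaf of rational functions.
\<close>

quotient_type cp1 = "complex \<times> complex" / partial:
  "\<lambda>u v. u \<noteq> (0, 0) \<and> v \<noteq> (0, 0) \<and> fst u * snd v = fst v * snd u"
  morphisms homogeneous_coords of_homogeneous_coords
proof (rule part_equivpI)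
  show "\<exists>u :: complex \<times> complex. u \<noteq> (0, 0) \<and> u \<noteq> (0, 0) \<and> fst u * snd u = fst u * snd u"
    by (rule exI[of _ "(1, 0)"]) simp
  show "symp (\<lambda>u v :: complex \<times> complex. u \<noteq> (0, 0) \<and> v \<noteq> (0, 0) \<and> fst u * snd v = fst v * snd u)"
    by (auto intro!: sympI)
  show "transp (\<lambda>u v :: complex \<times> complex. u \<noteq> (0, 0) \<and> v \<noteq> (0, 0) \<and> fst u * snd v = fst v * snd u)"
  proof (rule transpI, elim conjE, intro conjI)
    fix u v w :: "complex \<times> complex"
    assume v: "v \<noteq> (0, 0)" and uv: "fst u * snd v = fst v * snd u"
      and vw: "fst v * snd w = fst w * snd v"
    have "fst v * (fst u * snd w) = fst u * (fst v * snd w)" by (simp only: mult.left_commute)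
    also have "\<dots> = fst w * (fst u * snd v)" by (simp only: vw mult.left_commute)
    also have "\<dots> = fst v * (fst w * snd u)" by (simp only: uv mult.left_commute)
    finally have 1: "fst v * (fst u * snd w) = fst v * (fst w * snd u)" .
    have "snd v * (fst u * snd w) = snd w * (fst u * snd v)" by (simp only: mult_ac)
    also have "\<dots> = snd u * (fst v * snd w)" by (simp only: uv mult_ac)
    also have "\<dots> = snd v * (fst w * snd u)" by (simp only: vw mult_ac)
    finally have 2: "snd v * (fst u * snd w) = snd v * (fst w * snd u)" .
    show "fst u * snd w = fst w * snd u"
      using 1 2 v by (cases v) auto
  qed auto
qed

text \<open>The point \<open>[x : y]\<close>, for \<open>(x, y) \<noteq> (0, 0)\<close>.\<close>

definition pt :: "complex \<Rightarrow> complex \<Rightarrow> cp1" where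
  "pt x y = of_homogeneous_coords (x, y)"

definition U_zero :: "cp1 set" where
  "U_zero = UNIV - {pt 0 1}"

definition U_infty :: "cp1 set" where
  "U_infty = UNIV - {pt 1 0}"

definition zariski_open :: "cp1 set \<Rightarrow> bool" where
  "zariski_open U \<longleftrightarrow> U = {} \<or> finite (- U)"

text \<open>An open subset of the projective line is affine iff it is not the whole line.\<close>

definition affine_open :: "cp1 set \<Rightarrow> bool" where
  "affine_open U \<longleftrightarrow> zariski_open U \<and> U \<noteq> UNIV"

text \<open>Rational functions on \<open>X\<close>, written in the coordinate \<open>z = y / x\<close>.\<close>

type_synonym ratfun = "complex poly fract"

definition zcoord :: ratfun where
  "zcoord = Fract [:0, 1:] 1"

definition const_fun :: "complex \<Rightarrow> ratfun" where
  "const_fun c = Fract [:c:] 1"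

text \<open>Homogenisation of degree \<open>d \<ge> degree p\<close>: the form \<open>x\<^sup>d p(y / x)\<close>.\<close>

definition homogenise :: "nat \<Rightarrow> complex poly \<Rightarrow> complex \<Rightarrow> complex \<Rightarrow> complex" where
  "homogenise d p x y = (\<Sum>i\<le>d. coeff p i * y ^ i * x ^ (d - i))"

text \<open>\<open>f\<close> is regular at \<open>P\<close> with value \<open>c\<close>: near \<open>P\<close> it is a quotient of two forms of the same
  degree whose denominator does not vanish at \<open>P\<close>.\<close>

definition has_value :: "ratfun \<Rightarrow> cp1 \<Rightarrow> complex \<Rightarrow> bool" where
  "has_value f P c \<longleftrightarrow>
     (\<exists>x y d p q. (x, y) \<noteq> (0, 0) \<and> P = pt x y \<and> degree p \<le> d \<and> degree q \<le> d \<and>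
        f = Fract p q \<and> homogenise d q x y \<noteq> 0 \<and>
        c = homogenise d p x y / homogenise d q x y)"

definition regular_at :: "ratfun \<Rightarrow> cp1 \<Rightarrow> bool" where
  "regular_at f P \<longleftrightarrow> (\<exists>c. has_value f P c)"

definition value_at :: "ratfun \<Rightarrow> cp1 \<Rightarrow> complex" where
  "value_at f P = (THE c. has_value f P c)"

text \<open>
  Sections of the line bundle \<open>O\<^sub>n\<close> over \<open>U\<close>.  A section \<open>(f, g)\<close> with \<open>f(z) = z\<^sup>n g(1/z)\<close> is
  encoded by its first component \<open>f\<close>, a rational function; the second component is then
  \<open>z\<^sup>-\<^sup>n f\<close>, as a rational function on \<open>X\<close>.  (For \<open>U = {}\<close> this gives all rational functions
  instead of \<open>0\<close>; a sheaf of modules vanishes on \<open>{}\<close>, so this is harmless below.)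
\<close>

definition O_sec :: "int \<Rightarrow> cp1 set \<Rightarrow> ratfun set" where
  "O_sec n U = {f. (\<forall>P \<in> U \<inter> U_zero. regular_at f P) \<and>
                   (\<forall>P \<in> U \<inter> U_infty. regular_at (zcoord powi (- n) * f) P)}"

abbreviation O_X :: "cp1 set \<Rightarrow> ratfun set" where
  "O_X \<equiv> O_sec 0"


section \<open>Differential operators\<close>

definition mult_op :: "ratfun \<Rightarrow> ratfun \<Rightarrow> ratfun" where
  "mult_op f = (\<lambda>h. f * h)"

definition commutator_with :: "ratfun \<Rightarrow> (ratfun \<Rightarrow> ratfun) \<Rightarrow> ratfun \<Rightarrow> ratfun" where
  "commutator_with f P = (\<lambda>h. P (f * h) - f * P h)"

definition c_linear :: "(ratfun \<Rightarrow> ratfun) \<Rightarrow> bool" where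
  "c_linear P \<longleftrightarrow> (\<forall>f g. P (f + g) = P f + P g) \<and> (\<forall>c f. P (const_fun c * f) = const_fun c * P f)"

primrec order_le :: "nat \<Rightarrow> (ratfun \<Rightarrow> ratfun) \<Rightarrow> bool" where
  "order_le 0 P \<longleftrightarrow> (\<forall>f. commutator_with f P = (\<lambda>_. 0))"
| "order_le (Suc k) P \<longleftrightarrow> (\<forall>f. order_le k (commutator_with f P))"

text \<open>
  Differential operators (in the sense of Grothendieck) from \<open>O\<^sub>n\<close> to itself over \<open>U\<close>.  As
  \<open>O\<^sub>n\<close> is a subsheaf of the constant sheaf of rational functions, such an operator extends
  uniquely to rational functions, and is encoded by this extension; restriction maps become
  inclusions.  It acts on the first components of sections of \<open>O\<^sub>n\<close>.
\<close>

definition diff_ops :: "int \<Rightarrow> cp1 set \<Rightarrow> (ratfun \<Rightarrow> ratfun) set" where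
  "diff_ops n U =
     {P. c_linear P \<and> (\<exists>k. order_le k P) \<and>
         (\<forall>W f. zariski_open W \<and> W \<subseteq> U \<and> f \<in> O_sec n W \<longrightarrow> P f \<in> O_sec n W)}"

definition diff_ops_le :: "int \<Rightarrow> cp1 set \<Rightarrow> nat \<Rightarrow> (ratfun \<Rightarrow> ratfun) set" where
  "diff_ops_le n U k = {P \<in> diff_ops n U. order_le k P}"

text \<open>
  Principal symbol of an operator \<open>P\<close> on \<open>O_X\<close> of order \<open>\<le> k\<close>, at the covector \<open>\<xi> dt\<close> at the
  point \<open>x\<close>, where \<open>t\<close> is a local coordinate: if \<open>P = \<Sum>i\<le>k. a\<^sub>i \<partial>\<^sub>t\<^sup>i\<close>, the \<open>k\<close>-fold commutator of
  \<open>P\<close> with \<open>t\<close> is multiplication by \<open>k! a\<^sub>k\<close>.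
\<close>

definition principal_symbol ::
    "ratfun \<Rightarrow> nat \<Rightarrow> (ratfun \<Rightarrow> ratfun) \<Rightarrow> cp1 \<Rightarrow> complex \<Rightarrow> complex" where
  "principal_symbol t k P x \<xi> = value_at ((commutator_with t ^^ k) P 1) x / fact k * \<xi> ^ k"

definition vector_fields_vanishing_at :: "cp1 \<Rightarrow> cp1 set \<Rightarrow> (ratfun \<Rightarrow> ratfun) set" where
  "vector_fields_vanishing_at x U =
     {v \<in> diff_ops 0 U. (\<forall>f h. v (f * h) = v f * h + f * v h) \<and> (\<forall>f \<in> O_X U. has_value (v f) x 0)}"


section \<open>Sheaves of modules over twisted differential operators\<close>

text \<open>
  The sections over the various open sets are subgroups of one ambient abelian group; this is
  no restriction, since a family of abelian groups embeds into its product.  The argument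
  \<open>U\<close> of \<open>act\<close> is the open set over which the section acted upon lives.
\<close>

record 'm dsheaf =
  sec :: "cp1 set \<Rightarrow> 'm set"
  res :: "cp1 set \<Rightarrow> cp1 set \<Rightarrow> 'm \<Rightarrow> 'm"
  act :: "cp1 set \<Rightarrow> (ratfun \<Rightarrow> ratfun) \<Rightarrow> 'm \<Rightarrow> 'm"

text \<open>Modules over the sheaf of differential operators from \<open>O\<^sub>n\<close> to itself.\<close>

locale diff_ops_module =
  fixes n :: int and M :: "'m::ab_group_add dsheaf"
  assumes sec_zero: "zariski_open U \<Longrightarrow> 0 \<in> sec M U"
    and sec_add: "zariski_open U \<Longrightarrow> s \<in> sec M U \<Longrightarrow> t \<in> sec M U \<Longrightarrow> s + t \<in> sec M U"
    and sec_minus: "zariski_open U \<Longrightarrow> s \<in> sec M U \<Longrightarrow> - s \<in> sec M U"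
    and res_sec: "zariski_open U \<Longrightarrow> zariski_open W \<Longrightarrow> W \<subseteq> U \<Longrightarrow> s \<in> sec M U \<Longrightarrow> res M U W s \<in> sec M W"
    and res_add: "zariski_open U \<Longrightarrow> zariski_open W \<Longrightarrow> W \<subseteq> U \<Longrightarrow> s \<in> sec M U \<Longrightarrow> t \<in> sec M U \<Longrightarrow>
          res M U W (s + t) = res M U W s + res M U W t"
    and res_id: "zariski_open U \<Longrightarrow> s \<in> sec M U \<Longrightarrow> res M U U s = s"
    and res_res: "zariski_open U \<Longrightarrow> zariski_open W \<Longrightarrow> zariski_open W' \<Longrightarrow> W' \<subseteq> W \<Longrightarrow> W \<subseteq> U \<Longrightarrow>
          s \<in> sec M U \<Longrightarrow> res M W W' (res M U W s) = res M U W' s"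
    and separated: "(\<And>W. W \<in> \<W> \<Longrightarrow> zariski_open W) \<Longrightarrow> s \<in> sec M (\<Union>\<W>) \<Longrightarrow>
          (\<And>W. W \<in> \<W> \<Longrightarrow> res M (\<Union>\<W>) W s = 0) \<Longrightarrow> s = 0"
    and gluing: "(\<And>W. W \<in> \<W> \<Longrightarrow> zariski_open W) \<Longrightarrow> (\<And>W. W \<in> \<W> \<Longrightarrow> \<sigma> W \<in> sec M W) \<Longrightarrow>
          (\<And>W W'. W \<in> \<W> \<Longrightarrow> W' \<in> \<W> \<Longrightarrow>
             res M W (W \<inter> W') (\<sigma> W) = res M W' (W \<inter> W') (\<sigma> W')) \<Longrightarrow>
          \<exists>s \<in> sec M (\<Union>\<W>). \<forall>W \<in> \<W>. res M (\<Union>\<W>) W s = \<sigma> W"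
    and act_sec: "zariski_open U \<Longrightarrow> P \<in> diff_ops n U \<Longrightarrow> s \<in> sec M U \<Longrightarrow> act M U P s \<in> sec M U"
    and act_add_right: "zariski_open U \<Longrightarrow> P \<in> diff_ops n U \<Longrightarrow> s \<in> sec M U \<Longrightarrow> t \<in> sec M U \<Longrightarrow>
          act M U P (s + t) = act M U P s + act M U P t"
    and act_add_left: "zariski_open U \<Longrightarrow> P \<in> diff_ops n U \<Longrightarrow> Q \<in> diff_ops n U \<Longrightarrow> s \<in> sec M U \<Longrightarrow>
          act M U (\<lambda>f. P f + Q f) s = act M U P s + act M U Q s"
    and act_comp: "zariski_open U \<Longrightarrow> P \<in> diff_ops n U \<Longrightarrow> Q \<in> diff_ops n U \<Longrightarrow> s \<in> sec M U \<Longrightarrow>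
          act M U (P \<circ> Q) s = act M U P (act M U Q s)"
    and act_id: "zariski_open U \<Longrightarrow> s \<in> sec M U \<Longrightarrow> act M U id s = s"
    and res_act: "zariski_open U \<Longrightarrow> zariski_open W \<Longrightarrow> W \<subseteq> U \<Longrightarrow> P \<in> diff_ops n U \<Longrightarrow> s \<in> sec M U \<Longrightarrow>
          res M U W (act M U P s) = act M W P (res M U W s)"

abbreviation D_lambda_module :: "int \<Rightarrow> 'm::ab_group_add dsheaf \<Rightarrow> bool" where
  "D_lambda_module lam \<equiv> diff_ops_module (lam - 1)"

text \<open>
  The tensor product \<open>O\<^sub>k \<otimes> M\<close> over \<open>O_X\<close>, which takes \<open>diff_ops n\<close>-modules to
  \<open>diff_ops (n + k)\<close>-modules.  With the trivialising sections \<open>e\<^sub>0\<close>, \<open>e\<^sub>\<infinity> = z\<^sup>k e\<^sub>0\<close> of \<open>O\<^sub>k\<close>, a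
  section over \<open>U\<close> is a pair \<open>(a, b)\<close> standing for \<open>e\<^sub>0 \<otimes> a\<close> on \<open>U \<inter> U_zero\<close> and \<open>e\<^sub>\<infinity> \<otimes> b\<close> on
  \<open>U \<inter> U_infty\<close>.  Operators are written in the trivialisation \<open>e\<^sub>0\<close>, hence the conjugation by
  \<open>z\<^sup>k\<close> in the second component.
\<close>

definition line_bundle_tensor :: "int \<Rightarrow> 'm::ab_group_add dsheaf \<Rightarrow> ('m \<times> 'm) dsheaf" where
  "line_bundle_tensor k M =
     \<lparr>sec = (\<lambda>U. {(a, b). a \<in> sec M (U \<inter> U_zero) \<and> b \<in> sec M (U \<inter> U_infty) \<and>
               res M (U \<inter> U_zero) (U \<inter> U_zero \<inter> U_infty) a =
               act M (U \<inter> U_zero \<inter> U_infty) (mult_op (zcoord powi k))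
                 (res M (U \<inter> U_infty) (U \<inter> U_zero \<inter> U_infty) b)}),
      res = (\<lambda>U W (a, b). (res M (U \<inter> U_zero) (W \<inter> U_zero) a, res M (U \<inter> U_infty) (W \<inter> U_infty) b)),
      act = (\<lambda>U P (a, b). (act M (U \<inter> U_zero) P a,
               act M (U \<inter> U_infty) (mult_op (zcoord powi (- k)) \<circ> P \<circ> mult_op (zcoord powi k)) b))\<rparr>"

text \<open>\<open>N\<close> is a subgroup of \<open>M(U)\<close> stable under the operators in \<open>R\<close>.\<close>

definition submodule :: "(ratfun \<Rightarrow> ratfun) set \<Rightarrow> 'm::ab_group_add dsheaf \<Rightarrow> cp1 set \<Rightarrow> 'm set \<Rightarrow> bool" where
  "submodule R M U N \<longleftrightarrow> N \<subseteq> sec M U \<and> 0 \<in> N \<and> (\<forall>s \<in> N. \<forall>t \<in> N. s + t \<in> N) \<and> (\<forall>s \<in> N. - s \<in> N) \<and>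
     (\<forall>P \<in> R. \<forall>s \<in> N. act M U P s \<in> N)"

definition finitely_generated ::
    "(ratfun \<Rightarrow> ratfun) set \<Rightarrow> 'm::ab_group_add dsheaf \<Rightarrow> cp1 set \<Rightarrow> 'm set \<Rightarrow> bool" where
  "finitely_generated R M U N \<longleftrightarrow>
     submodule R M U N \<and> (\<exists>S. finite S \<and> S \<subseteq> N \<and> submodule R M U hull S = N)"

definition O_ops :: "cp1 set \<Rightarrow> (ratfun \<Rightarrow> ratfun) set" where
  "O_ops U = mult_op ` O_X U"

text \<open>For each affine open \<open>W\<close> and each \<open>f\<close> regular on \<open>W\<close>, the sections over the non-vanishing
  locus of \<open>f\<close> are the localisation of \<open>M(W)\<close> at \<open>f\<close>.\<close>

definition quasi_coherent_on :: "'m::ab_group_add dsheaf \<Rightarrow> cp1 set \<Rightarrow> bool" where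
  "quasi_coherent_on M U \<longleftrightarrow>
     (\<forall>W f. affine_open W \<and> W \<subseteq> U \<and> f \<in> O_X W \<longrightarrow>
        (let Wf = {x \<in> W. \<not> has_value f x 0} in
          (\<forall>s \<in> sec M W. res M W Wf s = 0 \<longrightarrow> (\<exists>k. act M W (mult_op (f ^ k)) s = 0)) \<and>
          (\<forall>s \<in> sec M Wf. \<exists>k. \<exists>t \<in> sec M W. act M Wf (mult_op (f ^ k)) s = res M W Wf t)))"

definition O_coherent_on :: "'m::ab_group_add dsheaf \<Rightarrow> cp1 set \<Rightarrow> bool" where
  "O_coherent_on M U \<longleftrightarrow> quasi_coherent_on M U \<and>
     (\<forall>W. affine_open W \<and> W \<subseteq> U \<longrightarrow> finitely_generated (O_ops W) M W (sec M W))"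

definition singular_points :: "'m::ab_group_add dsheaf \<Rightarrow> cp1 set" where
  "singular_points M = {x. \<forall>U. zariski_open U \<and> x \<in> U \<longrightarrow> \<not> O_coherent_on M U}"


section \<open>Holonomic and regular holonomic modules\<close>

subsection \<open>Dimension of algebraic subsets of the affine plane\<close>

definition zariski_closed2 :: "(complex \<times> complex) set \<Rightarrow> bool" where
  "zariski_closed2 Z \<longleftrightarrow>
     (\<exists>S :: complex poly poly set. Z = {(a, b). \<forall>p \<in> S. poly (poly p [:b:]) a = 0})"

definition irreducible_closed2 :: "(complex \<times> complex) set \<Rightarrow> bool" where
  "irreducible_closed2 Z \<longleftrightarrow> zariski_closed2 Z \<and> Z \<noteq> {} \<and>
     (\<forall>A B. zariski_closed2 A \<and> zariski_closed2 B \<and> Z = A \<union> B \<longrightarrow> Z = A \<or> Z = B)"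

text \<open>Krull dimension at most \<open>d\<close>: there is no chain \<open>Y 0 \<subset> \<dots> \<subset> Y (d + 1)\<close> of irreducible closed
  subsets.\<close>

definition krull_dim_le :: "nat \<Rightarrow> (complex \<times> complex) set \<Rightarrow> bool" where
  "krull_dim_le d Z \<longleftrightarrow>
     \<not> (\<exists>Y :: nat \<Rightarrow> _. (\<forall>i \<in> {0..d + 1}. irreducible_closed2 (Y i) \<and> Y i \<subseteq> Z) \<and>
           (\<forall>i \<in> {0..d}. Y i \<subset> Y (Suc i)))"

subsection \<open>Good filtrations and the characteristic variety\<close>

definition good_filtration :: "'m::ab_group_add dsheaf \<Rightarrow> cp1 set \<Rightarrow> (int \<Rightarrow> 'm set) \<Rightarrow> bool" where
  "good_filtration M U F \<longleftrightarrow>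
     (\<forall>j < 0. F j = {0}) \<and>
     (\<forall>j. finitely_generated (O_ops U) M U (F j)) \<and>
     (\<forall>j. F j \<subseteq> F (j + 1)) \<and>
     (\<Union>j. F j) = sec M U \<and>
     (\<forall>k j. \<forall>P \<in> diff_ops_le 0 U k. \<forall>s \<in> F j. act M U P s \<in> F (j + int k)) \<and>
     (\<exists>j0. \<forall>j \<ge> j0. \<forall>k.
        F (j + int k) = submodule (O_ops U) M U hull {act M U P s |P s. P \<in> diff_ops_le 0 U k \<and> s \<in> F j})"

text \<open>
  The characteristic variety over the chart \<open>U\<close> with coordinate \<open>t\<close>: the zero set in the
  cotangent bundle of the annihilator of \<open>gr M(U)\<close>, the covector \<open>\<xi> dt\<close> at \<open>x\<close> being given the
  coordinates \<open>(t(x), \<xi>)\<close>.  The annihilator is homogeneous, and the class of \<open>P\<close> in degree \<open>k\<close>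
  annihilates \<open>gr M(U)\<close> iff \<open>P F\<^sub>j \<subseteq> F\<^sub>j\<^sub>+\<^sub>k\<^sub>-\<^sub>1\<close> for all \<open>j\<close>.
\<close>

definition char_variety ::
    "'m::ab_group_add dsheaf \<Rightarrow> cp1 set \<Rightarrow> ratfun \<Rightarrow> (int \<Rightarrow> 'm set) \<Rightarrow> (complex \<times> complex) set" where
  "char_variety M U t F =
     {(value_at t x, \<xi>) |x \<xi>. x \<in> U \<and>
        (\<forall>k. \<forall>P \<in> diff_ops_le 0 U k.
           (\<forall>j. \<forall>s \<in> F j. act M U P s \<in> F (j + int k - 1)) \<longrightarrow> principal_symbol t k P x \<xi> = 0)}"

text \<open>
  The following three notions are for modules over the untwisted sheaf \<open>diff_ops 0\<close>.  The
  characteristic variety does not depend on the good filtration.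
\<close>

definition D_coherent :: "'m::ab_group_add dsheaf \<Rightarrow> bool" where
  "D_coherent M \<longleftrightarrow> quasi_coherent_on M UNIV \<and>
     (\<forall>U. affine_open U \<longrightarrow> finitely_generated (diff_ops 0 U) M U (sec M U))"

definition holonomic :: "'m::ab_group_add dsheaf \<Rightarrow> bool" where
  "holonomic M \<longleftrightarrow> D_coherent M \<and>
     (\<forall>(U, t) \<in> {(U_zero, zcoord), (U_infty, inverse zcoord)}.
        \<exists>F. good_filtration M U F \<and> krull_dim_le 1 (char_variety M U t F))"

text \<open>
  Regularity at \<open>x\<close>: on a punctured neighbourhood of \<open>x\<close> the module is a connection admitting
  an \<open>O_X\<close>-lattice across \<open>x\<close> which is stable under the vector fields vanishing at \<open>x\<close>.
\<close>

definition regular_sing_at :: "'m::ab_group_add dsheaf \<Rightarrow> cp1 \<Rightarrow> bool" where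
  "regular_sing_at M x \<longleftrightarrow>
     (\<exists>U L. affine_open U \<and> x \<in> U \<and>
        finitely_generated (O_ops U) M (U - {x}) L \<and>
        submodule (O_ops (U - {x})) M (U - {x}) hull L = sec M (U - {x}) \<and>
        (\<forall>v \<in> vector_fields_vanishing_at x U. \<forall>s \<in> L. act M (U - {x}) v s \<in> L))"

definition regular_holonomic :: "'m::ab_group_add dsheaf \<Rightarrow> bool" where
  "regular_holonomic M \<longleftrightarrow> holonomic M \<and> (\<forall>x. regular_sing_at M x)"

text \<open>The module over the untwisted differential operators which corresponds to a
  \<open>D_lambda\<close>-module \<open>M\<close>, i.e. the \<open>N\<close> with \<open>M \<cong> O\<^bsub>\<lambda>-1\<^esub> \<otimes> N\<close>.\<close>

definition untwist :: "int \<Rightarrow> 'm::ab_group_add dsheaf \<Rightarrow> ('m \<times> 'm) dsheaf" where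
  "untwist lam M = line_bundle_tensor (1 - lam) M"

definition holonomic_twisted :: "int \<Rightarrow> 'm::ab_group_add dsheaf \<Rightarrow> bool" where
  "holonomic_twisted lam M \<longleftrightarrow> holonomic (untwist lam M)"

definition regular_holonomic_twisted :: "int \<Rightarrow> 'm::ab_group_add dsheaf \<Rightarrow> bool" where
  "regular_holonomic_twisted lam M \<longleftrightarrow> regular_holonomic (untwist lam M)"


section \<open>Representations of \<open>sl\<^sub>2\<close>\<close>

datatype sl2_basis = bE | bF | bH

primrec sl2_matrix :: "sl2_basis \<Rightarrow> complex^2^2" where
  "sl2_matrix bE = vector [vector [0, 1], vector [0, 0]]"
| "sl2_matrix bF = vector [vector [0, 0], vector [1, 0]]"
| "sl2_matrix bH = vector [vector [1, 0], vector [0, -1]]"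

subsection \<open>The universal enveloping algebra\<close>

text \<open>The associative unital complex algebra presented by the generators \<open>E\<close>, \<open>F\<close>, \<open>H\<close> and the
  relations \<open>EF - FE = H\<close>, \<open>HE - EH = 2E\<close>, \<open>HF - FH = -2F\<close>.\<close>

datatype uterm = UGen sl2_basis | UConst complex | UAdd uterm uterm | UMul uterm uterm

inductive ueq :: "uterm \<Rightarrow> uterm \<Rightarrow> bool" where
  ueq_refl: "ueq a a"
| ueq_sym: "ueq a b \<Longrightarrow> ueq b a"
| ueq_trans: "ueq a b \<Longrightarrow> ueq b c \<Longrightarrow> ueq a c"
| ueq_add: "ueq a a' \<Longrightarrow> ueq b b' \<Longrightarrow> ueq (UAdd a b) (UAdd a' b')"
| ueq_mul: "ueq a a' \<Longrightarrow> ueq b b' \<Longrightarrow> ueq (UMul a b) (UMul a' b')"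
| add_assoc: "ueq (UAdd (UAdd a b) c) (UAdd a (UAdd b c))"
| add_commute: "ueq (UAdd a b) (UAdd b a)"
| add_zero: "ueq (UAdd (UConst 0) a) a"
| add_uminus: "ueq (UAdd (UMul (UConst (-1)) a) a) (UConst 0)"
| mul_assoc: "ueq (UMul (UMul a b) c) (UMul a (UMul b c))"
| mul_one_left: "ueq (UMul (UConst 1) a) a"
| mul_one_right: "ueq (UMul a (UConst 1)) a"
| distrib_left: "ueq (UMul a (UAdd b c)) (UAdd (UMul a b) (UMul a c))"
| distrib_right: "ueq (UMul (UAdd a b) c) (UAdd (UMul a c) (UMul b c))"
| const_add: "ueq (UAdd (UConst x) (UConst y)) (UConst (x + y))"
| const_mul: "ueq (UMul (UConst x) (UConst y)) (UConst (x * y))"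
| const_central: "ueq (UMul (UConst x) a) (UMul a (UConst x))"
| rel_EF: "ueq (UMul (UGen bE) (UGen bF)) (UAdd (UMul (UGen bF) (UGen bE)) (UGen bH))"
| rel_HE: "ueq (UMul (UGen bH) (UGen bE)) (UAdd (UMul (UGen bE) (UGen bH)) (UMul (UConst 2) (UGen bE)))"
| rel_HF: "ueq (UMul (UGen bH) (UGen bF)) (UAdd (UMul (UGen bF) (UGen bH)) (UMul (UConst (-2)) (UGen bF)))"

quotient_type usl2 = uterm / ueq
  by (auto intro!: equivpI reflpI sympI transpI intro: ueq_refl ueq_sym ueq_trans)

text \<open>The augmentation, used only for \<open>0 \<noteq> 1\<close>.\<close>

primrec augmentation :: "uterm \<Rightarrow> complex" where
  "augmentation (UGen b) = 0"
| "augmentation (UConst c) = c"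
| "augmentation (UAdd a b) = augmentation a + augmentation b"
| "augmentation (UMul a b) = augmentation a * augmentation b"

lemma ueq_augmentation: "ueq a b \<Longrightarrow> augmentation a = augmentation b"
  by (induction rule: ueq.induct) (auto simp: algebra_simps)

lift_definition uconst :: "complex \<Rightarrow> usl2" is UConst .

lift_definition ugen :: "sl2_basis \<Rightarrow> usl2" is UGen .

instantiation usl2 :: ring_1
begin

lift_definition zero_usl2 :: usl2 is "UConst 0" .

lift_definition one_usl2 :: usl2 is "UConst 1" .

lift_definition plus_usl2 :: "usl2 \<Rightarrow> usl2 \<Rightarrow> usl2" is UAdd
  by (rule ueq_add)

lift_definition times_usl2 :: "usl2 \<Rightarrow> usl2 \<Rightarrow> usl2" is UMul
  by (rule ueq_mul)

lift_definition uminus_usl2 :: "usl2 \<Rightarrow> usl2" is "UMul (UConst (-1))"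
  by (intro ueq_mul ueq_refl)

definition minus_usl2 :: "usl2 \<Rightarrow> usl2 \<Rightarrow> usl2" where
  "minus_usl2 a b = a + - b"

instance
proof
  fix a b c :: usl2
  show "a + b + c = a + (b + c)" by transfer (rule add_assoc)
  show "a + b = b + a" by transfer (rule add_commute)
  show "0 + a = a" by transfer (rule add_zero)
  show "- a + a = 0" by transfer (rule add_uminus)
  show "a - b = a + - b" by (rule minus_usl2_def)
  show "a * b * c = a * (b * c)" by transfer (rule mul_assoc)
  show "1 * a = a" by transfer (rule mul_one_left)
  show "a * 1 = a" by transfer (rule mul_one_right)
  show "(a + b) * c = a * c + b * c" by transfer (rule distrib_right)
  show "a * (b + c) = a * b + a * c" by transfer (rule distrib_left)
  show "(0::usl2) \<noteq> 1" by transfer (auto dest: ueq_augmentation)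
qed

end

definition sl2_to_U :: "complex^2^2 \<Rightarrow> usl2" where
  "sl2_to_U A = uconst (A$1$2) * ugen bE + uconst (A$2$1) * ugen bF + uconst (A$1$1) * ugen bH"

subsection \<open>Representations, quotients, highest weights\<close>

record 'v sl2_rep =
  space :: "'v set"
  rzero :: 'v
  radd :: "'v \<Rightarrow> 'v \<Rightarrow> 'v"
  rscale :: "complex \<Rightarrow> 'v \<Rightarrow> 'v"
  ract :: "sl2_basis \<Rightarrow> 'v \<Rightarrow> 'v"

definition linear_subspace :: "('v, 'z) sl2_rep_scheme \<Rightarrow> 'v set \<Rightarrow> bool" where
  "linear_subspace V W \<longleftrightarrow> W \<subseteq> space V \<and> rzero V \<in> W \<and>
     (\<forall>u \<in> W. \<forall>w \<in> W. radd V u w \<in> W) \<and> (\<forall>c. \<forall>w \<in> W. rscale V c w \<in> W)"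

definition subrep :: "('v, 'z) sl2_rep_scheme \<Rightarrow> 'v set \<Rightarrow> bool" where
  "subrep V W \<longleftrightarrow> linear_subspace V W \<and> (\<forall>b. \<forall>w \<in> W. ract V b w \<in> W)"

definition rcoset :: "('v, 'z) sl2_rep_scheme \<Rightarrow> 'v set \<Rightarrow> 'v \<Rightarrow> 'v set" where
  "rcoset V W v = radd V v ` W"

definition quotient_rep :: "'v sl2_rep \<Rightarrow> 'v set \<Rightarrow> 'v set sl2_rep" where
  "quotient_rep V W =
     \<lparr>space = rcoset V W ` space V,
      rzero = W,
      radd = (\<lambda>A B. \<Union>a \<in> A. \<Union>b \<in> B. rcoset V W (radd V a b)),
      rscale = (\<lambda>c A. \<Union>a \<in> A. rcoset V W (rscale V c a)),
      ract = (\<lambda>b A. \<Union>a \<in> A. rcoset V W (ract V b a))\<rparr>"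

definition subquotient :: "'v sl2_rep \<Rightarrow> 'v set \<Rightarrow> 'v set \<Rightarrow> 'v set sl2_rep" where
  "subquotient V W W' = quotient_rep (V\<lparr>space := W\<rparr>) W'"

definition rep_iso :: "'v sl2_rep \<Rightarrow> 'w sl2_rep \<Rightarrow> bool" where
  "rep_iso V W \<longleftrightarrow>
     (\<exists>\<phi>. bij_betw \<phi> (space V) (space W) \<and>
        (\<forall>u \<in> space V. \<forall>v \<in> space V. \<phi> (radd V u v) = radd W (\<phi> u) (\<phi> v)) \<and>
        (\<forall>c. \<forall>v \<in> space V. \<phi> (rscale V c v) = rscale W c (\<phi> v)) \<and>
        (\<forall>b. \<forall>v \<in> space V. \<phi> (ract V b v) = ract W b (\<phi> v)))"

definition irreducible_rep :: "'v sl2_rep \<Rightarrow> bool" where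
  "irreducible_rep V \<longleftrightarrow> space V \<noteq> {rzero V} \<and> (\<forall>W. subrep V W \<longrightarrow> W = {rzero V} \<or> W = space V)"

definition finite_dimensional :: "'v sl2_rep \<Rightarrow> bool" where
  "finite_dimensional V \<longleftrightarrow> (\<exists>S. finite S \<and> S \<subseteq> space V \<and> linear_subspace V hull S = space V)"

definition has_highest_weight :: "'v sl2_rep \<Rightarrow> complex \<Rightarrow> bool" where
  "has_highest_weight V \<mu> \<longleftrightarrow>
     (\<exists>v \<in> space V. v \<noteq> rzero V \<and> ract V bE v = rzero V \<and> ract V bH v = rscale V \<mu> v)"

definition U_rep :: "usl2 sl2_rep" where
  "U_rep = \<lparr>space = UNIV, rzero = 0, radd = (+), rscale = (\<lambda>c u. uconst c * u),
            ract = (\<lambda>b u. ugen b * u)\<rparr>"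

text \<open>
  The Verma module of highest weight \<open>\<mu>\<close> with respect to the basis \<open>gEg\<^sup>-\<^sup>1\<close>, \<open>gFg\<^sup>-\<^sup>1\<close>, \<open>gHg\<^sup>-\<^sup>1\<close>, i.e.
  with respect to the Borel subalgebra of the stabiliser of the point \<open>g[1:0]\<close>.  For \<open>g = mat 1\<close>
  it is \<open>U(sl\<^sub>2) / (U(sl\<^sub>2) E + U(sl\<^sub>2) (H - \<mu>))\<close>.
\<close>

definition verma_ideal :: "complex^2^2 \<Rightarrow> complex \<Rightarrow> usl2 set" where
  "verma_ideal g \<mu> =
     {a * sl2_to_U (g ** sl2_matrix bE ** matrix_inv g) +
      b * (sl2_to_U (g ** sl2_matrix bH ** matrix_inv g) - uconst \<mu>) |a b. True}"

lemma verma_ideal_mat_1: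
  "verma_ideal (mat 1) \<mu> = {a * ugen bE + b * (ugen bH - uconst \<mu>) |a b. True}"
proof -
  have c: "uconst 0 = 0" "uconst 1 = 1"
    by (transfer, rule ueq_refl)+
  have "matrix_inv (mat 1 :: complex^2^2) = mat 1"
    unfolding matrix_inv_def by (rule some_equality) simp_all
  then show ?thesis
    by (simp add: verma_ideal_def sl2_to_U_def vector_2 c)
qed

definition verma :: "complex^2^2 \<Rightarrow> complex \<Rightarrow> usl2 set sl2_rep" where
  "verma g \<mu> = quotient_rep U_rep (verma_ideal g \<mu>)"

subsection \<open>Global sections as a representation\<close>

lift_definition ratfun_deriv :: "ratfun \<Rightarrow> ratfun" is
  "\<lambda>(p, q). (pderiv p * q - p * pderiv q, q * q)"
proof (clarsimp, goal_cases)
  case (1 p q p' q')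
  have "pderiv (p * q') = pderiv (p' * q)" using 1 by simp
  then have d: "pderiv p * q' + p * pderiv q' = pderiv p' * q + p' * pderiv q"
    by (simp add: pderiv_mult algebra_simps)
  have "(pderiv p * q - p * pderiv q) * (q' * q') - (pderiv p' * q' - p' * pderiv q') * (q * q)
      = q * q' * ((pderiv p * q' + p * pderiv q') - (pderiv p' * q + p' * pderiv q))
        - (q * pderiv q' + q' * pderiv q) * (p * q' - p' * q)"
    by (simp add: algebra_simps)
  then show ?case using d 1 by simp
qed

text \<open>The images of the basis in the global sections of \<open>diff_ops (lam - 1)\<close>, written on
  \<open>U_zero\<close>.\<close>

primrec Phi :: "int \<Rightarrow> sl2_basis \<Rightarrow> ratfun \<Rightarrow> ratfun" where
  "Phi lam bE = (\<lambda>f. zcoord ^ 2 * ratfun_deriv f - of_int (lam - 1) * zcoord * f)"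
| "Phi lam bF = (\<lambda>f. - ratfun_deriv f)"
| "Phi lam bH = (\<lambda>f. 2 * zcoord * ratfun_deriv f - of_int (lam - 1) * f)"

definition global_sections :: "int \<Rightarrow> 'm::ab_group_add dsheaf \<Rightarrow> 'm sl2_rep" where
  "global_sections lam M =
     \<lparr>space = sec M UNIV, rzero = 0, radd = (+),
      rscale = (\<lambda>c. act M UNIV (mult_op (const_fun c))),
      ract = (\<lambda>b. act M UNIV (Phi lam b))\<rparr>"

end

theory Submission
  imports Defs "HOL-Computational_Algebra.Fundamental_Theorem_Algebra"
begin

text \<open>
  Let \<open>n = \<lambda> - 1\<close>, let \<open>q = g[0:1]\<close>, and let \<open>w\<close> be a coordinate with a pole at \<open>p\<close> and a zero at
  \<open>q\<close>.  The conjugates \<open>E\<close>, \<open>F\<close>, \<open>H\<close> of the standard basis by \<open>g\<close> satisfy \<open>(H + 1)\<^sup>2 + 4FE = \<lambda>\<^sup>2\<close>,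
  and \<open>E\<close> is, up to a trivialisation, the derivation \<open>- \<partial>\<^sub>w\<close>.  Away from \<open>p\<close> the module is a connection
  over the polynomial ring in \<open>w\<close>; the lattice at the regular singularity bounds how much a
  section can vanish at \<open>p\<close>, and this makes \<open>E\<close> locally nilpotent.  Then \<open>H\<close> is locally
  finite on the sections over \<open>X - q\<close>, which are finitely generated over a Weyl algebra, so the
  eigenspaces of \<open>H\<close> are finite-dimensional there, and so is the kernel of \<open>E\<close> on \<open>V\<close>.

  Modulo any subrepresentation \<open>W\<close>, the Casimir relation splits the vectors killed by \<open>E\<close> into
  vectors of weight \<open>\<lambda> - 1\<close> and of weight \<open>- \<lambda> - 1\<close>.  Adjoin to \<open>W\<close> the subrepresentation generated by
  such a vector, of weight \<open>- \<lambda> - 1\<close> as long as there is one: the quotient is the Verma module for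
  weight \<open>- \<lambda> - 1\<close> and finite-dimensional for weight \<open>\<lambda> - 1\<close>, and the two dimensions of spaces
  of highest weight vectors decrease lexicographically.
\<close>

subsection \<open>Values of rational functions\<close>

text \<open>The module may contain sections supported at p and need not split, so the factors are
  produced by adjoining highest weight vectors one at a time; for this it is enough that E is
  locally nilpotent with finite-dimensional kernel. Nilpotency rests on two opposing facts:
  logarithmic stability of the lattice makes each application of E gain one order of vanishing at p,
  while sections over X - p have polynomial coordinates in w, whose order of vanishing at p is
  bounded. The weight - \<lambda> - 1 is exhausted before \<lambda> - 1 is touched because
  F^\<lambda> v, for v of weight \<lambda> - 1, is again killed by E and has weight - \<lambda> - 1;
  it then lies in W already, and the quotient is finite-dimensional. Such a step can create new
  vectors of weight - \<lambda> - 1, hence the lexicographic induction. Until the end no quotient is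
  formed: statements modulo W are membership conditions in W. The finite-dimensional factor is built
  in the rotated basis, but its highest weight is asserted for the standard one, so a vector of the
  form exp(s F) v has to be exhibited in it.\<close>

lemma pt_eq_iff:
  assumes "(x, y) \<noteq> (0, 0)" "(x', y') \<noteq> (0, 0)"
  shows "pt x y = pt x' y' \<longleftrightarrow> x * y' = x' * y"
proof -
  have "pt x y = pt x' y' \<longleftrightarrow> (x, y) \<noteq> (0, 0) \<and> (x', y') \<noteq> (0, 0) \<and> x * y' = x' * y"
    using Quotient3_rel[OF Quotient3_cp1, of "(x, y)" "(x', y')"] assms
    by (auto simp: pt_def)
  then show ?thesis using assms by simp
qed

lemma pt_cases: obtains x y where "(x, y) \<noteq> (0, 0)" "P = pt x y"
proof -
  have "\<exists>x y. (x, y) \<noteq> (0, 0) \<and> P = pt x y"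
    unfolding pt_def
    by (induct P rule: cp1.abs_induct) auto
  then show ?thesis using that by blast
qed

lemma pt_scale:
  assumes "s \<noteq> 0" "(x, y) \<noteq> (0, 0)"
  shows "pt (s * x) (s * y) = pt x y"
  using assms by (subst pt_eq_iff) auto

lemma pt_normal_cases:
  obtains t where "P = pt 1 t" | "P = pt 0 1"
proof -
  obtain x y where P: "(x, y) \<noteq> (0, 0)" "P = pt x y" by (rule pt_cases)
  show ?thesis
  proof (cases "x = 0")
    case True
    then have "P = pt 0 1" using P by (simp add: pt_eq_iff)
    then show ?thesis by (rule that(2))
  next
    case False
    then have "P = pt 1 (y / x)" using P by (simp add: pt_eq_iff)
    then show ?thesis by (rule that(1))
  qed
qed

lemma const_fun_simps:
  "const_fun 0 = 0" "const_fun 1 = 1" "const_fun (a + b) = const_fun a + const_fun b"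
  "const_fun (a * b) = const_fun a * const_fun b" "const_fun (- a) = - const_fun a"
  "const_fun (a - b) = const_fun a - const_fun b"
  by (simp_all add: const_fun_def Zero_fract_def One_fract_def pCons_one mult.commute)

lemma const_fun_power: "const_fun (a ^ k) = const_fun a ^ k"
  by (induction k) (simp_all add: const_fun_simps)

lemma const_fun_of_nat: "const_fun (of_nat k) = of_nat k"
  by (induction k) (simp_all add: const_fun_simps)

lemma const_fun_of_int: "const_fun (of_int k) = of_int k"
  by (cases k) (simp_all add: const_fun_simps const_fun_of_nat del: of_nat_Suc)

lemma const_fun_numeral: "const_fun (numeral k) = numeral k"
  using const_fun_of_nat[of "numeral k"] by simp

lemma const_fun_eq_iff: "const_fun a = const_fun b \<longleftrightarrow> a = b"
  by (simp add: const_fun_def eq_fract)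

lemma homogenise_affine:
  assumes "x \<noteq> 0" "degree p \<le> d"
  shows "homogenise d p x y = x ^ d * poly p (y / x)"
proof -
  have "poly p (y / x) = (\<Sum>i\<le>d. coeff p i * (y / x) ^ i)"
    unfolding poly_altdef
    by (rule sum.mono_neutral_left) (use assms(2) in \<open>auto simp: coeff_eq_0\<close>)
  also have "x ^ d * \<dots> = (\<Sum>i\<le>d. coeff p i * y ^ i * x ^ (d - i))"
    unfolding sum_distrib_left
    by (rule sum.cong) (use assms in \<open>auto simp: power_diff power_divide\<close>)
  finally show ?thesis by (simp add: homogenise_def)
qed

lemma homogenise_infinity: "homogenise d p 0 y = coeff p d * y ^ d"
proof -
  have "homogenise d p 0 y = (\<Sum>i\<in>{d}. coeff p i * y ^ i * 0 ^ (d - i))"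
    unfolding homogenise_def by (rule sum.mono_neutral_right) auto
  then show ?thesis by simp
qed

lemma homogenise_scale: "homogenise d p (s * x) (s * y) = s ^ d * homogenise d p x y"
  unfolding homogenise_def sum_distrib_left
proof (rule sum.cong)
  fix i assume "i \<in> {..d}"
  then have "s ^ d = s ^ i * s ^ (d - i)" by (simp flip: power_add)
  then show "coeff p i * (s * y) ^ i * (s * x) ^ (d - i) = s ^ d * (coeff p i * y ^ i * x ^ (d - i))"
    by (simp add: power_mult_distrib mult_ac)
qed simp

text \<open>Two coordinate vectors of one point differ by a factor s, and forms of degree d scale by
  s^d, so the quotient does not depend on the representative. This removes the choice of
  representatives from \<open>has_value\<close>.\<close>

lemma has_value_iff_homogenise:
  assumes xy: "(x, y) \<noteq> (0, 0)"
  shows "has_value f (pt x y) c \<longleftrightarrow> (\<exists>d p q. degree p \<le> d \<and> degree q \<le> d \<and> f = Fract p q \<and>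
    homogenise d q x y \<noteq> 0 \<and> c = homogenise d p x y / homogenise d q x y)" (is "?L \<longleftrightarrow> ?R")
proof
  assume ?L
  then obtain x' y' d p q where *: "(x', y') \<noteq> (0, 0)" "pt x y = pt x' y'" "degree p \<le> d" "degree q \<le> d"
    "f = Fract p q" "homogenise d q x' y' \<noteq> 0" "c = homogenise d p x' y' / homogenise d q x' y'"
    unfolding has_value_def by blast
  have e: "x * y' = x' * y" using * xy by (simp add: pt_eq_iff)
  obtain s where s: "s \<noteq> 0" "x' = s * x" "y' = s * y"
  proof (cases "x = 0")
    case True
    then have "y \<noteq> 0" "x' = 0" using xy e by auto
    then show ?thesis using that[of "y' / y"] *(1) True by auto
  next
    case False
    have "x' \<noteq> 0" using False e *(1) by auto
    then show ?thesis using that[of "x' / x"] False e by (auto simp: field_simps)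
  qed
  show ?R
    by (intro exI[of _ d] exI[of _ p] exI[of _ q]) (use * s in \<open>auto simp: homogenise_scale\<close>)
next
  assume ?R then show ?L unfolding has_value_def using xy by blast
qed

lemma has_value_affine_iff:
  "has_value f (pt 1 t) c \<longleftrightarrow> (\<exists>p q. f = Fract p q \<and> poly q t \<noteq> 0 \<and> c = poly p t / poly q t)"
proof
  assume "has_value f (pt 1 t) c"
  then obtain d p q where "degree p \<le> d" "degree q \<le> d" "f = Fract p q"
    "homogenise d q 1 t \<noteq> 0" "c = homogenise d p 1 t / homogenise d q 1 t"
    using has_value_iff_homogenise[of 1 t f c] by auto
  then show "\<exists>p q. f = Fract p q \<and> poly q t \<noteq> 0 \<and> c = poly p t / poly q t"
    by (intro exI[of _ p] exI[of _ q]) (simp add: homogenise_affine)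
next
  assume "\<exists>p q. f = Fract p q \<and> poly q t \<noteq> 0 \<and> c = poly p t / poly q t"
  then obtain p q where *: "f = Fract p q" "poly q t \<noteq> 0" "c = poly p t / poly q t" by blast
  have nz: "(1 :: complex, t) \<noteq> (0, 0)" by simp
  show "has_value f (pt 1 t) c"
    unfolding has_value_iff_homogenise[OF nz]
    by (rule exI[of _ "max (degree p) (degree q)"], rule exI[of _ p], rule exI[of _ q])
      (use * in \<open>simp add: homogenise_affine\<close>)
qed

lemma has_value_infinity_iff:
  "has_value f (pt 0 1) c \<longleftrightarrow> (\<exists>d p q. degree p \<le> d \<and> degree q \<le> d \<and> f = Fract p q \<and>
     coeff q d \<noteq> 0 \<and> c = coeff p d / coeff q d)"
  by (subst has_value_iff_homogenise) (simp_all add: homogenise_infinity)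

text \<open>Here d and e are only upper bounds for the degrees. At [0:1] the value of a quotient is
  the ratio of the coefficients at a common degree bound, which may exceed one of the two degrees;
  this multiplicativity plays the role of polynomial evaluation in the other chart.\<close>

lemma coeff_mult_bounds:
  fixes p q :: "'a::comm_semiring_1 poly"
  assumes "degree p \<le> d" "degree q \<le> e"
  shows "coeff (p * q) (d + e) = coeff p d * coeff q e"
proof -
  have "coeff (p * q) (d + e) = (\<Sum>i\<le>d + e. coeff p i * coeff q (d + e - i))"
    by (rule coeff_mult)
  also have "\<dots> = (\<Sum>i\<in>{d}. coeff p i * coeff q (d + e - i))"
  proof (rule sum.mono_neutral_right)
    show "\<forall>i\<in>{..d + e} - {d}. coeff p i * coeff q (d + e - i) = 0"
    proof
      fix i assume "i \<in> {..d + e} - {d}"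
      then consider "i > d" | "d + e - i > e" by fastforce
      then show "coeff p i * coeff q (d + e - i) = 0"
        using assms by cases (simp_all add: coeff_eq_0)
    qed
  qed auto
  finally show ?thesis by simp
qed

lemma has_value_const: "has_value (const_fun c) P c"
proof (cases P rule: pt_normal_cases)
  case (1 t)
  then show ?thesis unfolding 1 has_value_affine_iff const_fun_def
    by (intro exI[of _ "[:c:]"] exI[of _ 1]) simp
next
  case 2
  show ?thesis unfolding 2 has_value_infinity_iff const_fun_def
    by (intro exI[of _ 0] exI[of _ "[:c:]"] exI[of _ 1]) simp
qed

lemma has_value_unique:
  assumes "has_value f P c" "has_value f P c'"
  shows "c = c'"
proof (cases P rule: pt_normal_cases)
  case (1 t)
  obtain p q where *: "f = Fract p q" "poly q t \<noteq> 0" "c = poly p t / poly q t"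
    using assms(1) unfolding 1 has_value_affine_iff by blast
  obtain p' q' where **: "f = Fract p' q'" "poly q' t \<noteq> 0" "c' = poly p' t / poly q' t"
    using assms(2) unfolding 1 has_value_affine_iff by blast
  have "q \<noteq> 0" "q' \<noteq> 0" using * ** by auto
  then have "p * q' = p' * q" using * ** by (simp add: eq_fract)
  then have "poly p t * poly q' t = poly p' t * poly q t" by (metis poly_mult)
  then show ?thesis using * ** by (simp add: frac_eq_eq)
next
  case 2
  obtain d p q where *: "degree p \<le> d" "degree q \<le> d" "f = Fract p q" "coeff q d \<noteq> 0" "c = coeff p d / coeff q d"
    using assms(1) unfolding 2 has_value_infinity_iff by blast
  obtain d' p' q' where **: "degree p' \<le> d'" "degree q' \<le> d'" "f = Fract p' q'" "coeff q' d' \<noteq> 0" "c' = coeff p' d' / coeff q' d'"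
    using assms(2) unfolding 2 has_value_infinity_iff by blast
  have "q \<noteq> 0" "q' \<noteq> 0" using * ** by auto
  then have "p * q' = p' * q" using * ** by (simp add: eq_fract)
  then have "coeff p d * coeff q' d' = coeff p' d' * coeff q d"
    using coeff_mult_bounds[OF *(1) **(2)] coeff_mult_bounds[OF **(1) *(2)] by (simp add: add.commute)
  then show ?thesis using * ** by (simp add: frac_eq_eq)
qed

lemma has_value_add:
  assumes "has_value f P c" "has_value f' P c'"
  shows "has_value (f + f') P (c + c')"
proof (cases P rule: pt_normal_cases)
  case (1 t)
  obtain p q where *: "f = Fract p q" "poly q t \<noteq> 0" "c = poly p t / poly q t"
    using assms(1) unfolding 1 has_value_affine_iff by blast
  obtain p' q' where **: "f' = Fract p' q'" "poly q' t \<noteq> 0" "c' = poly p' t / poly q' t"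
    using assms(2) unfolding 1 has_value_affine_iff by blast
  have nz: "q \<noteq> 0" "q' \<noteq> 0" using * ** by auto
  show ?thesis unfolding 1 has_value_affine_iff
    by (intro exI[of _ "p * q' + p' * q"] exI[of _ "q * q'"])
      (use * ** nz in \<open>simp add: add_frac_eq\<close>)
next
  case 2
  obtain d p q where *: "degree p \<le> d" "degree q \<le> d" "f = Fract p q" "coeff q d \<noteq> 0" "c = coeff p d / coeff q d"
    using assms(1) unfolding 2 has_value_infinity_iff by blast
  obtain d' p' q' where **: "degree p' \<le> d'" "degree q' \<le> d'" "f' = Fract p' q'" "coeff q' d' \<noteq> 0" "c' = coeff p' d' / coeff q' d'"
    using assms(2) unfolding 2 has_value_infinity_iff by blast
  have nz: "q \<noteq> 0" "q' \<noteq> 0" using * ** by auto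
  have deg: "degree (p * q') \<le> d + d'" "degree (p' * q) \<le> d + d'" "degree (q * q') \<le> d + d'"
    using degree_mult_le[of p q'] degree_mult_le[of p' q] degree_mult_le[of q q'] * ** by linarith+
  have co: "coeff (p * q') (d + d') = coeff p d * coeff q' d'" "coeff (p' * q) (d + d') = coeff p' d' * coeff q d"
    "coeff (q * q') (d + d') = coeff q d * coeff q' d'"
    using coeff_mult_bounds[OF *(1) **(2)] coeff_mult_bounds[OF **(1) *(2)] coeff_mult_bounds[OF *(2) **(2)]
    by (simp_all add: add.commute)
  show ?thesis unfolding 2 has_value_infinity_iff
    by (intro exI[of _ "d + d'"] exI[of _ "p * q' + p' * q"] exI[of _ "q * q'"])
      (use * ** nz deg co in \<open>simp add: add_frac_eq degree_add_le\<close>)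
qed

lemma has_value_mult:
  assumes "has_value f P c" "has_value f' P c'"
  shows "has_value (f * f') P (c * c')"
proof (cases P rule: pt_normal_cases)
  case (1 t)
  obtain p q where *: "f = Fract p q" "poly q t \<noteq> 0" "c = poly p t / poly q t"
    using assms(1) unfolding 1 has_value_affine_iff by blast
  obtain p' q' where **: "f' = Fract p' q'" "poly q' t \<noteq> 0" "c' = poly p' t / poly q' t"
    using assms(2) unfolding 1 has_value_affine_iff by blast
  show ?thesis unfolding 1 has_value_affine_iff
    by (intro exI[of _ "p * p'"] exI[of _ "q * q'"]) (use * ** in simp)
next
  case 2
  obtain d p q where *: "degree p \<le> d" "degree q \<le> d" "f = Fract p q" "coeff q d \<noteq> 0" "c = coeff p d / coeff q d"
    using assms(1) unfolding 2 has_value_infinity_iff by blast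
  obtain d' p' q' where **: "degree p' \<le> d'" "degree q' \<le> d'" "f' = Fract p' q'" "coeff q' d' \<noteq> 0" "c' = coeff p' d' / coeff q' d'"
    using assms(2) unfolding 2 has_value_infinity_iff by blast
  have deg: "degree (p * p') \<le> d + d'" "degree (q * q') \<le> d + d'"
    using degree_mult_le[of p p'] degree_mult_le[of q q'] * ** by linarith+
  have co: "coeff (p * p') (d + d') = coeff p d * coeff p' d'" "coeff (q * q') (d + d') = coeff q d * coeff q' d'"
    using coeff_mult_bounds[OF *(1) **(1)] coeff_mult_bounds[OF *(2) **(2)] by simp_all
  show ?thesis unfolding 2 has_value_infinity_iff
    by (intro exI[of _ "d + d'"] exI[of _ "p * p'"] exI[of _ "q * q'"])
      (use * ** deg co in simp)
qed

lemma has_value_inverse: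
  assumes "has_value f P c" "c \<noteq> 0"
  shows "has_value (inverse f) P (inverse c)"
proof (cases P rule: pt_normal_cases)
  case (1 t)
  obtain p q where *: "f = Fract p q" "poly q t \<noteq> 0" "c = poly p t / poly q t"
    using assms(1) unfolding 1 has_value_affine_iff by blast
  show ?thesis unfolding 1 has_value_affine_iff
    by (intro exI[of _ q] exI[of _ p]) (use * assms(2) in auto)
next
  case 2
  obtain d p q where *: "degree p \<le> d" "degree q \<le> d" "f = Fract p q" "coeff q d \<noteq> 0" "c = coeff p d / coeff q d"
    using assms(1) unfolding 2 has_value_infinity_iff by blast
  show ?thesis unfolding 2 has_value_infinity_iff
    by (intro exI[of _ d] exI[of _ q] exI[of _ p]) (use * assms(2) in auto)
qed

lemma has_value_0_const_iff: "has_value (const_fun c) P 0 \<longleftrightarrow> c = 0"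
  using has_value_const[of c P] has_value_unique by blast

lemma not_has_value_of_inverse:
  assumes "has_value (inverse f) P 0" "f \<noteq> 0"
  shows "\<not> has_value f P t"
proof
  assume "has_value f P t"
  then have "has_value (f * inverse f) P (t * 0)" using assms(1) by (rule has_value_mult)
  then show False using assms(2) has_value_0_const_iff[of 1 P] by (simp add: const_fun_simps)
qed

lemma has_value_power: "has_value f P c \<Longrightarrow> has_value (f ^ k) P (c ^ k)"
  by (induction k) (use has_value_const[of 1 P] in \<open>simp_all add: const_fun_simps has_value_mult\<close>)

lemma has_value_minus: "has_value f P c \<Longrightarrow> has_value (- f) P (- c)"
  using has_value_mult[OF has_value_const[of "-1" P], of f c] by (simp add: const_fun_simps)

lemma regular_at_add: "regular_at f P \<Longrightarrow> regular_at h P \<Longrightarrow> regular_at (f + h) P"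
  unfolding regular_at_def using has_value_add by blast

lemma regular_at_mult: "regular_at f P \<Longrightarrow> regular_at h P \<Longrightarrow> regular_at (f * h) P"
  unfolding regular_at_def using has_value_mult by blast

lemma regular_at_minus: "regular_at f P \<Longrightarrow> regular_at (- f) P"
  unfolding regular_at_def using has_value_minus by blast

lemma regular_at_diff: "regular_at f P \<Longrightarrow> regular_at h P \<Longrightarrow> regular_at (f - h) P"
  using regular_at_add[of f P "- h"] regular_at_minus by auto

lemma regular_at_power: "regular_at f P \<Longrightarrow> regular_at (f ^ k) P"
  unfolding regular_at_def using has_value_power by blast

lemma regular_at_const: "regular_at (const_fun c) P"
  unfolding regular_at_def using has_value_const by blast

lemma regular_at_0: "regular_at 0 P" and regular_at_1: "regular_at 1 P"
  using regular_at_const[of 0] regular_at_const[of 1] by (simp_all add: const_fun_simps)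

text \<open>The linear form vanishing at \<open>[a : c]\<close>, divided by the homogeneous coordinate \<open>x\<close>.\<close>

definition lform :: "complex \<Rightarrow> complex \<Rightarrow> ratfun" where
  "lform a c = const_fun a * zcoord - const_fun c"

lemma lform_Fract: "lform a c = Fract [:- c, a:] 1"
  by (simp add: lform_def const_fun_def zcoord_def)

lemma lform_nonzero: "(a, c) \<noteq> (0, 0) \<Longrightarrow> lform a c \<noteq> 0"
  by (auto simp: lform_Fract Zero_fract_def eq_fract)

lemma lform_infinity: "lform 0 c = - const_fun c" and lform_zero: "lform 1 0 = zcoord"
  by (simp_all add: lform_def const_fun_simps)

lemma has_value_lform_ratio:
  assumes "(x, y) \<noteq> (0, 0)" "b * y - d * x \<noteq> 0"
  shows "has_value (lform a c / lform b d) (pt x y) ((a * y - c * x) / (b * y - d * x))"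
proof -
  have "lform a c / lform b d = Fract [:- c, a:] [:- d, b:]"
    by (simp add: lform_Fract)
  moreover have h: "homogenise 1 [:- c, a:] x y = a * y - c * x" for a c
    by (simp add: homogenise_def)
  ultimately show ?thesis
    unfolding has_value_iff_homogenise[OF assms(1)] using assms(2)
    by (intro exI[of _ 1] exI[of _ "[:- c, a:]"] exI[of _ "[:- d, b:]"]) (simp only: h, simp)
qed

lemma zcoord_nonzero: "zcoord \<noteq> 0"
  using lform_nonzero[of 1 0] by (simp add: lform_zero)

subsection \<open>Polynomials in an affine coordinate\<close>

text \<open>The substitution of w for the variable, a map from C[t] to the function field. For an
  affine coordinate w its image turns out to be the ring of functions regular off the pole, so that
  sections over X - p become a C[t]-module.\<close>

definition subst_poly :: "ratfun \<Rightarrow> complex poly \<Rightarrow> ratfun" where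
  "subst_poly w u = poly (map_poly const_fun u) w"

lemma subst_poly_0: "subst_poly w 0 = 0"
  by (simp add: subst_poly_def)

lemma subst_poly_pCons: "subst_poly w (pCons a u) = const_fun a + w * subst_poly w u"
  by (simp add: subst_poly_def map_poly_pCons const_fun_simps)

lemma subst_poly_add: "subst_poly w (u + v) = subst_poly w u + subst_poly w v"
  by (induction u v rule: poly_induct2)
    (simp_all add: subst_poly_pCons subst_poly_0 const_fun_simps algebra_simps)

lemma subst_poly_smult: "subst_poly w (smult c u) = const_fun c * subst_poly w u"
  by (induction u) (simp_all add: subst_poly_pCons subst_poly_0 const_fun_simps algebra_simps)

lemma subst_poly_mult: "subst_poly w (u * v) = subst_poly w u * subst_poly w v"
  by (induction u)
    (simp_all add: subst_poly_pCons subst_poly_0 subst_poly_add subst_poly_smult const_fun_simps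
      mult_pCons_left algebra_simps)

lemma subst_poly_1: "subst_poly w 1 = 1"
  by (simp add: one_pCons subst_poly_pCons subst_poly_0 const_fun_simps)

lemma subst_poly_const: "subst_poly w [:c:] = const_fun c"
  by (simp add: subst_poly_pCons subst_poly_0)

lemma subst_poly_X: "subst_poly w [:0, 1:] = w"
  by (simp add: subst_poly_pCons subst_poly_0 const_fun_simps)

lemma subst_poly_power: "subst_poly w (u ^ k) = subst_poly w u ^ k"
  by (induction k) (simp_all add: subst_poly_1 subst_poly_mult)

lemma subst_poly_minus: "subst_poly w (- u) = - subst_poly w u"
  using subst_poly_smult[of w "-1" u] by (simp add: const_fun_simps)

lemma has_value_subst_poly: "has_value w P t \<Longrightarrow> has_value (subst_poly w u) P (poly u t)"
proof (induction u)
  case 0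
  then show ?case using has_value_const[of 0 P] by (simp add: subst_poly_0 const_fun_simps)
next
  case (pCons a u)
  then show ?case using has_value_add[OF has_value_const has_value_mult]
    by (simp add: subst_poly_pCons)
qed

lemma subst_poly_zcoord: "subst_poly zcoord u = Fract u 1"
  by (induction u) (simp_all add: subst_poly_0 subst_poly_pCons Zero_fract_def const_fun_def zcoord_def)

text \<open>For finite T the non-vanishing locus is the complement of T in the affine line, and the
  powers are common denominators for the functions regular there.\<close>

definition root_poly :: "complex set \<Rightarrow> complex poly" where
  "root_poly T = (\<Prod>t\<in>T. [:- t, 1:])"

lemma root_poly_nonzero: "root_poly T \<noteq> 0"
  by (cases "finite T") (auto simp: root_poly_def)

lemma poly_root_poly_eq_0_iff: "finite T \<Longrightarrow> poly (root_poly T) t = 0 \<longleftrightarrow> t \<in> T"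
  by (auto simp: root_poly_def poly_prod)

text \<open>Each root is split off v together with one factor of the power; the exponent
  \<open>degree v\<close> suffices since v has that many roots with multiplicity.\<close>

lemma dvd_root_poly_power:
  assumes "finite T" "v \<noteq> 0" "\<And>t. poly v t = 0 \<Longrightarrow> t \<in> T"
  shows "v dvd root_poly T ^ degree v"
  using assms(2,3)
proof (induction "degree v" arbitrary: v)
  case 0
  then show ?case by (simp add: is_unit_iff_degree)
next
  case (Suc k)
  then have "\<not> constant (poly v)" using constant_degree[of v] by simp
  then obtain t where t: "poly v t = 0" using fundamental_theorem_of_algebra by blast
  then obtain v' where v': "v = [:- t, 1:] * v'" by (auto simp: poly_eq_0_iff_dvd elim: dvdE)
  have "v' \<noteq> 0" using v' Suc.prems by auto
  moreover have "degree v = degree [:- t, 1:] + degree v'"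
    unfolding v' by (rule degree_mult_eq) (use v' Suc.prems in auto)
  then have deg: "degree v = Suc (degree v')" by simp
  ultimately have 1: "v' dvd root_poly T ^ degree v'"
    using Suc.hyps(1)[of v'] Suc.hyps(2) Suc.prems v' by simp
  have "[:- t, 1:] dvd root_poly T"
    using poly_root_poly_eq_0_iff[OF assms(1)] Suc.prems t by (simp flip: poly_eq_0_iff_dvd)
  then show ?case unfolding deg power_Suc using 1 by (subst v') (rule mult_dvd_mono)
qed

lemma subst_poly_pcompose: "subst_poly w (pcompose u v) = subst_poly (subst_poly w v) u"
  by (induction u) (simp_all add: subst_poly_0 subst_poly_pCons pcompose_pCons subst_poly_add
      subst_poly_mult subst_poly_const)

text \<open>Evaluation identifies X - P0 with the complex line, 1/w vanishes at P0, and w generates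
  the function field. These facts are axiomatised because both coordinates of a frame satisfy
  them.\<close>

locale affine_coordinate =
  fixes w :: ratfun and P0 :: cp1
  assumes value_ex: "P \<noteq> P0 \<Longrightarrow> \<exists>t. has_value w P t"
    and point_ex: "\<exists>P. P \<noteq> P0 \<and> has_value w P t"
    and point_unique: "has_value w P t \<Longrightarrow> has_value w Q t \<Longrightarrow> P = Q"
    and pole: "has_value (inverse w) P0 0"
    and nonzero: "w \<noteq> 0"
    and rational: "\<exists>u v. subst_poly w v \<noteq> 0 \<and> f * subst_poly w v = subst_poly w u"
begin

lemma subst_poly_eq_0: "subst_poly w u = 0 \<Longrightarrow> u = 0"
proof -
  assume 0: "subst_poly w u = 0"
  have "poly u t = 0" for t
  proof -
    obtain P where "has_value w P t" using point_ex by blast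
    then have "has_value (subst_poly w u) P (poly u t)" by (rule has_value_subst_poly)
    moreover have "has_value (subst_poly w u) P 0"
      using has_value_const[of 0 P] by (simp add: 0 const_fun_simps)
    ultimately show ?thesis by (rule has_value_unique)
  qed
  then show "u = 0" using poly_all_0_iff_0 by blast
qed

text \<open>Take a representation u/v with v of least degree. At a root of v outside T, regularity
  of f forces u to vanish too, so a linear factor cancels, against minimality. Hence all roots of v
  lie in T and v divides a power of \<open>root_poly T\<close>.\<close>

lemma regular_off_roots:
  assumes "finite T" and reg: "\<And>P t. has_value w P t \<Longrightarrow> t \<notin> T \<Longrightarrow> regular_at f P"
  shows "\<exists>u k. f * subst_poly w (root_poly T ^ k) = subst_poly w u"
proof -
  define rep where "rep = (\<lambda>v u. v \<noteq> 0 \<and> f * subst_poly w v = subst_poly w u)"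
  obtain u0 v0 where uv0: "subst_poly w v0 \<noteq> 0" "f * subst_poly w v0 = subst_poly w u0"
    using rational[of f] by blast
  then have "v0 \<noteq> 0" by (auto simp: subst_poly_0)
  then have "rep v0 u0" using uv0 by (simp add: rep_def)
  then obtain v where "\<exists>u. rep v u" and min: "\<And>v'. \<exists>u. rep v' u \<Longrightarrow> degree v \<le> degree v'"
    using ex_has_least_nat[of "\<lambda>v. \<exists>u. rep v u" v0 degree] by blast
  then obtain u where v: "v \<noteq> 0" "f * subst_poly w v = subst_poly w u" by (auto simp: rep_def)
  have "t \<in> T" if t: "poly v t = 0" for t
  proof (rule ccontr)
    assume "t \<notin> T"
    obtain P where P: "has_value w P t" using point_ex by blast
    obtain c where c: "has_value f P c" using reg[OF P \<open>t \<notin> T\<close>] by (auto simp: regular_at_def)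
    have "has_value (f * subst_poly w v) P 0"
      using has_value_mult[OF c has_value_subst_poly[OF P, of v]] t by simp
    then have "poly u t = 0" using has_value_subst_poly[OF P, of u] v(2) has_value_unique by metis
    then obtain u' where u': "u = [:- t, 1:] * u'" by (auto simp: poly_eq_0_iff_dvd elim: dvdE)
    obtain v' where v': "v = [:- t, 1:] * v'" using t by (auto simp: poly_eq_0_iff_dvd elim: dvdE)
    have "subst_poly w [:- t, 1:] \<noteq> 0" using subst_poly_eq_0 by fastforce
    moreover have "(f * subst_poly w v') * subst_poly w [:- t, 1:] = subst_poly w u' * subst_poly w [:- t, 1:]"
      using v(2) unfolding u' v' subst_poly_mult by (simp add: mult_ac)
    ultimately have "f * subst_poly w v' = subst_poly w u'" by simp
    moreover have "v' \<noteq> 0" using v' v(1) by auto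
    ultimately have "rep v' u'" by (simp add: rep_def)
    then have "degree v \<le> degree v'" using min by blast
    moreover have "v' \<noteq> 0" using v' v by auto
    moreover have "degree v = degree [:- t, 1:] + degree v'"
      unfolding v' by (rule degree_mult_eq) (use v' v in auto)
    ultimately show False by simp
  qed
  then obtain r where "root_poly T ^ degree v = v * r"
    using dvd_root_poly_power[OF assms(1) v(1)] by (auto elim: dvdE)
  then have "f * subst_poly w (root_poly T ^ degree v) = subst_poly w (u * r)"
    using v(2) by (simp add: subst_poly_mult)
  then show ?thesis by blast
qed

lemma regular_imp_polynomial:
  assumes "\<And>P. P \<noteq> P0 \<Longrightarrow> regular_at f P"
  shows "\<exists>u. f = subst_poly w u"
proof -
  have "\<not> has_value w P0 t" for t
    using not_has_value_of_inverse[OF pole nonzero] .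
  then have "regular_at f P" if "has_value w P t" for P t
    using that assms by metis
  then have "\<exists>u k. f * subst_poly w (root_poly {} ^ k) = subst_poly w u"
    by (intro regular_off_roots) blast+
  then show ?thesis by (auto simp: root_poly_def subst_poly_1)
qed

lemma has_value_leading:
  "u \<noteq> 0 \<Longrightarrow> has_value (subst_poly w u * inverse w ^ degree u) P0 (lead_coeff u)"
proof (induction u)
  case 0
  then show ?case by simp
next
  case (pCons a u)
  show ?case
  proof (cases "u = 0")
    case True
    then show ?thesis using has_value_const[of a P0] by (simp add: subst_poly_pCons subst_poly_0)
  next
    case False
    have "subst_poly w (pCons a u) * inverse w ^ degree (pCons a u) =
      const_fun a * inverse w ^ Suc (degree u) + subst_poly w u * inverse w ^ degree u"
      using False nonzero by (simp add: subst_poly_pCons field_simps)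
    moreover have "has_value (const_fun a * inverse w ^ Suc (degree u) + subst_poly w u * inverse w ^ degree u)
      P0 (a * 0 ^ Suc (degree u) + lead_coeff u)"
      by (intro has_value_add has_value_mult has_value_const has_value_power pole pCons.IH False)
    ultimately show ?thesis using False by simp
  qed
qed

text \<open>The order of u/v at P0 is \<open>degree v - degree u\<close>. This turns regularity at p
  into a degree bound, which later limits how far a section can vanish at p.\<close>

lemma degree_le_of_regular:
  assumes "regular_at f P0" and f: "f * subst_poly w v = subst_poly w u" and "v \<noteq> 0"
  shows "degree u \<le> degree v"
proof (rule ccontr)
  assume "\<not> ?thesis"
  then have "u \<noteq> 0" by auto
  \<comment> \<open>If \<open>degree u\<close> exceeded \<open>degree v\<close>, then u divided by w
    to its degree would equal a regular function times the positive power \<open>Suc e\<close> of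
    1/w, hence vanish at P0, although its value there is the leading coefficient of u.\<close>
  define e where "e = degree u - degree v - 1"
  have e: "degree u = degree v + Suc e" using \<open>\<not> degree u \<le> degree v\<close> by (simp add: e_def)
  obtain c where "has_value f P0 c" using assms(1) by (auto simp: regular_at_def)
  then have "has_value (f * (subst_poly w v * inverse w ^ degree v) * inverse w ^ Suc e) P0
    (c * lead_coeff v * 0 ^ Suc e)"
    by (intro has_value_mult has_value_power pole has_value_leading assms)
  moreover have "f * (subst_poly w v * inverse w ^ degree v) * inverse w ^ Suc e
    = subst_poly w u * inverse w ^ degree u"
    by (simp only: e power_add flip: f) (simp only: mult_ac)
  ultimately have "has_value (subst_poly w u * inverse w ^ degree u) P0 0" by simp
  then have "lead_coeff u = 0" using has_value_leading[OF \<open>u \<noteq> 0\<close>] has_value_unique by blast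
  then show False using \<open>u \<noteq> 0\<close> by simp
qed

lemma regular_at_pole:
  assumes f: "f * subst_poly w v = subst_poly w u" and "v \<noteq> 0" "k \<ge> degree u"
  shows "regular_at (inverse w ^ k * f) P0"
proof (cases "u = 0")
  case True
  then have "f = 0" using f \<open>v \<noteq> 0\<close> subst_poly_eq_0[of v] by (auto simp: subst_poly_0)
  then show ?thesis by (simp add: regular_at_0)
next
  case False
  have nz: "subst_poly w v \<noteq> 0" using subst_poly_eq_0[of v] \<open>v \<noteq> 0\<close> by blast
  have "regular_at (inverse w ^ (k - degree u) * (subst_poly w u * inverse w ^ degree u) *
      (inverse w ^ degree v * inverse (subst_poly w v * inverse w ^ degree v))) P0"
    using has_value_mult[OF has_value_mult[OF has_value_power[OF pole] has_value_leading[OF False]]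
        has_value_mult[OF has_value_power[OF pole] has_value_inverse[OF has_value_leading[OF \<open>v \<noteq> 0\<close>]]]]
      \<open>v \<noteq> 0\<close> unfolding regular_at_def by auto
  also have "inverse w ^ (k - degree u) * (subst_poly w u * inverse w ^ degree u) *
      (inverse w ^ degree v * inverse (subst_poly w v * inverse w ^ degree v)) =
     inverse w ^ (k - degree u + degree u) * (subst_poly w u * inverse (subst_poly w v))"
    using nonzero by (simp add: power_add)
  also have "subst_poly w u * inverse (subst_poly w v) = f"
    using nz by (simp flip: f)
  finally show ?thesis using assms(3) by simp
qed

end

text \<open>Interchanging the two points of a frame produces the other coordinate only up to sign,
  which this absorbs.\<close>

lemma affine_coordinate_minus:
  assumes "affine_coordinate w P0"
  shows "affine_coordinate (- w) P0"
proof -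
  interpret affine_coordinate w P0 by fact
  have m: "has_value (- w) P t \<longleftrightarrow> has_value w P (- t)" for P t
    using has_value_minus[of w P "- t"] has_value_minus[of "- w" P t] by auto
  have s: "subst_poly w (pcompose u [:0, -1:]) = subst_poly (- w) u" for u
    by (simp add: subst_poly_pcompose subst_poly_pCons subst_poly_0 const_fun_simps)
  have m': "subst_poly (- w) (pcompose u [:0, -1:]) = subst_poly w u" for u
    by (simp add: subst_poly_pcompose subst_poly_pCons subst_poly_0 const_fun_simps)
  show ?thesis
  proof
    show "P \<noteq> P0 \<Longrightarrow> \<exists>t. has_value (- w) P t" for P using value_ex[of P] m by (metis minus_minus)
    show "\<exists>P. P \<noteq> P0 \<and> has_value (- w) P t" for t using point_ex[of "- t"] m by blast
    show "has_value (- w) P t \<Longrightarrow> has_value (- w) Q t \<Longrightarrow> P = Q" for P Q t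
      using point_unique[of P "- t" Q] m by blast
    show "has_value (inverse (- w)) P0 0" using has_value_minus[OF pole] by simp
    show "- w \<noteq> 0" using nonzero by simp
    show "\<exists>u v. subst_poly (- w) v \<noteq> 0 \<and> f * subst_poly (- w) v = subst_poly (- w) u" for f
      using rational[of f] by (metis m')
  qed
qed

section \<open>Frames: a pair of distinct points and the two affine coordinates attached to
  it\<close>

locale frame =
  fixes a b c d :: complex
  assumes det: "a * d - b * c = 1"
begin

abbreviation "lp \<equiv> lform a c"
abbreviation "lq \<equiv> lform b d"

text \<open>With g the matrix with columns (a, c) and (b, d), the value of \<open>wc\<close> at
  g[t:1] and that of \<open>zc\<close> at g[1:t] is t. The signs make the identity matrix give back
  w and z.\<close>

definition "wc = - lq / lp"
definition "zc = - lp / lq"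

lemma pq_nonzero: "(a, c) \<noteq> (0, 0)" "(b, d) \<noteq> (0, 0)" "lp \<noteq> 0" "lq \<noteq> 0"
  using det by (auto intro!: lform_nonzero)

lemma wc_zc: "wc * zc = 1" "inverse wc = zc" "inverse zc = wc" "wc \<noteq> 0" "zc \<noteq> 0"
  using pq_nonzero by (simp_all add: wc_def zc_def)

lemma has_value_wc:
  assumes "(x, y) \<noteq> (0, 0)" "a * y - c * x \<noteq> 0"
  shows "has_value wc (pt x y) (- (b * y - d * x) / (a * y - c * x))"
  using has_value_minus[OF has_value_lform_ratio[OF assms, of b d]]
  unfolding wc_def minus_divide_left .

lemma pt_distinct: "pt a c \<noteq> pt b d"
  using pq_nonzero det by (auto simp: pt_eq_iff mult.commute)

lemma affine_coordinate_wc: "affine_coordinate wc (pt a c)"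
proof
  fix P assume "P \<noteq> pt a c"
  moreover obtain x y where P: "(x, y) \<noteq> (0, 0)" "P = pt x y" by (rule pt_cases)
  ultimately have "a * y - c * x \<noteq> 0" using pq_nonzero by (simp add: pt_eq_iff mult.commute)
  then show "\<exists>t. has_value wc P t" using has_value_wc P by blast
next
  fix t
  \<comment> \<open>The point g[t:1]; since the determinant is 1, the two linear forms take the
    values 1 and - t there.\<close>
  define x y where "x = a * t + b" and "y = c * t + d"
  have ay: "a * y - c * x = 1" and byt: "b * y - d * x = - t"
  proof -
    have "a * y - c * x = a * d - b * c" by (simp add: x_def y_def algebra_simps)
    then show "a * y - c * x = 1" using det by simp
    have "b * y - d * x = - t * (a * d - b * c)" by (simp add: x_def y_def algebra_simps)
    then show "b * y - d * x = - t" using det by simp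
  qed
  have nz: "(x, y) \<noteq> (0, 0)" using ay by auto
  have "pt x y \<noteq> pt a c" using ay nz pq_nonzero by (auto simp: pt_eq_iff mult.commute)
  moreover have "has_value wc (pt x y) t" using has_value_wc[OF nz] ay byt by simp
  ultimately show "\<exists>P. P \<noteq> pt a c \<and> has_value wc P t" by blast
next
  have pole: "has_value (inverse wc) (pt a c) 0"
    unfolding wc_zc zc_def
    using has_value_minus[OF has_value_lform_ratio[of a c b d a c]] det pq_nonzero
    by (auto simp: algebra_simps)
  then show "has_value (inverse wc) (pt a c) 0" .
  fix P Q t assume PQ: "has_value wc P t" "has_value wc Q t"
  have np: "R \<noteq> pt a c" if "has_value wc R t" for R
    using not_has_value_of_inverse[OF pole wc_zc(4)] that by blast
  have "R = pt (a * t + b) (c * t + d)" if R: "has_value wc R t" for R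
  proof -
    obtain x y where R': "(x, y) \<noteq> (0, 0)" "R = pt x y" by (rule pt_cases)
    then have nz: "a * y - c * x \<noteq> 0" using np[OF R] pq_nonzero by (simp add: pt_eq_iff mult.commute)
    then have "t = - (b * y - d * x) / (a * y - c * x)"
      using has_value_wc[OF R'(1)] R R'(2) has_value_unique by blast
    then have t: "t * (a * y - c * x) = d * x - b * y" using nz by simp
    have "a * (c * t + d) - c * (a * t + b) = a * d - b * c" by (simp add: algebra_simps)
    then have ay: "a * (c * t + d) - c * (a * t + b) = 1" using det by simp
    have "x * (c * t + d) = (a * t + b) * y" using t by (simp add: algebra_simps)
    moreover have "(a * t + b, c * t + d) \<noteq> (0, 0)" using ay by auto
    ultimately show ?thesis using R' by (simp add: pt_eq_iff)
  qed
  then show "P = Q" using PQ by metis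
next
  show "wc \<noteq> 0" by (rule wc_zc)
next
  fix f :: ratfun
  \<comment> \<open>The functions rational in \<open>wc\<close> form a subfield; it contains the
    constants and z, hence everything.\<close>
  define R where "R = {f. \<exists>u v. subst_poly wc v \<noteq> 0 \<and> f * subst_poly wc v = subst_poly wc u}"
  have R_I: "f \<in> R" if "subst_poly wc v \<noteq> 0" "f * subst_poly wc v = subst_poly wc u" for f u v
    unfolding R_def using that by blast
  have R_const: "const_fun c \<in> R" for c
    by (rule R_I[of 1 _ "[:c:]"]) (simp_all add: subst_poly_1 subst_poly_const)
  have R_add: "f + h \<in> R" and R_mult: "f * h \<in> R" if fh: "f \<in> R" "h \<in> R" for f h
  proof -
    obtain u v u' v' where *: "subst_poly wc v \<noteq> 0" "f * subst_poly wc v = subst_poly wc u"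
       "subst_poly wc v' \<noteq> 0" "h * subst_poly wc v' = subst_poly wc u'"
      using fh unfolding R_def by blast
    show "f + h \<in> R"
      by (rule R_I[of "v * v'" _ "u * v' + u' * v"])
        (use *(1,3) in \<open>simp_all add: subst_poly_add subst_poly_mult algebra_simps flip: *(2,4)\<close>)
    show "f * h \<in> R"
      by (rule R_I[of "v * v'" _ "u * u'"])
        (use *(1,3) in \<open>simp_all add: subst_poly_add subst_poly_mult algebra_simps flip: *(2,4)\<close>)
  qed
  have R_inverse: "inverse f \<in> R" if "f \<in> R" for f
  proof (cases "f = 0")
    case True
    then show ?thesis using that by simp
  next
    case False
    obtain u v where *: "subst_poly wc v \<noteq> 0" "f * subst_poly wc v = subst_poly wc u"
      using \<open>f \<in> R\<close> unfolding R_def by blast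
    show ?thesis by (rule R_I[of u _ v]) (use *(1) False in \<open>simp_all flip: *(2)\<close>)
  qed
  \<comment> \<open>The inverse of the coordinate change: z = (c w + d) / (a w + b) with w =
    \<open>wc\<close>, and a w + b is the inverse of \<open>lp\<close>.\<close>
  have "zcoord \<in> R"
  proof (rule R_I[of "[:b, a:]" _ "[:d, c:]"])
    have K: "const_fun a * const_fun d - const_fun b * const_fun c = 1"
      using arg_cong[OF det, of const_fun] by (simp add: const_fun_simps)
    have wl: "wc * lp = - lq" using pq_nonzero by (simp add: wc_def)
    have s: "subst_poly wc [:b, a:] * lp = 1"
    proof -
      have "subst_poly wc [:b, a:] * lp = const_fun b * lp + const_fun a * (wc * lp)"
        by (simp add: subst_poly_pCons subst_poly_0 algebra_simps)
      also have "\<dots> = 1" unfolding wl using K by (simp add: lform_def algebra_simps)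
      finally show ?thesis .
    qed
    then show "subst_poly wc [:b, a:] \<noteq> 0" by auto
    have "subst_poly wc [:d, c:] * lp = const_fun d * lp + const_fun c * (wc * lp)"
      by (simp add: subst_poly_pCons subst_poly_0 algebra_simps)
    also have "\<dots> = zcoord * (const_fun a * const_fun d - const_fun b * const_fun c)"
      unfolding wl by (simp add: lform_def algebra_simps)
    also have "\<dots> = zcoord * subst_poly wc [:b, a:] * lp"
      by (simp add: K s mult.assoc)
    finally show "zcoord * subst_poly wc [:b, a:] = subst_poly wc [:d, c:]"
      using pq_nonzero by simp
  qed
  then have sub: "subst_poly zcoord u \<in> R" for u
    by (induction u) (use R_const[of 0] in \<open>simp_all add: subst_poly_0 subst_poly_pCons R_const R_add R_mult const_fun_simps\<close>)
  have "f \<in> R"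
  proof (cases f rule: Fract_cases)
    case (Fract u v)
    then have "f = subst_poly zcoord u * inverse (subst_poly zcoord v)"
      by (simp add: subst_poly_zcoord)
    then show ?thesis using sub R_mult R_inverse by simp
  qed
  then show "\<exists>u v. subst_poly wc v \<noteq> 0 \<and> f * subst_poly wc v = subst_poly wc u"
    unfolding R_def by blast
qed

text \<open>Right multiplication of g by a representative of the nontrivial Weyl group element
  exchanges p and q, so that facts about one coordinate carry over to the other.\<close>

lemma frame_swap: "frame b (- a) d (- c)"
  using det by unfold_locales (simp add: algebra_simps)

lemma affine_coordinate_zc: "affine_coordinate zc (pt b d)"
proof -
  interpret sw: frame b "- a" d "- c" by (rule frame_swap)
  have "lform (- a) (- c) = - lp" by (simp add: lform_def const_fun_simps)
  then have "sw.wc = - zc" unfolding sw.wc_def zc_def by simp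
  then show ?thesis using affine_coordinate_minus[OF sw.affine_coordinate_wc] by simp
qed

lemma has_value_zc_0: "has_value zc (pt a c) 0"
  using affine_coordinate.pole[OF affine_coordinate_wc] by (simp add: wc_zc)

end

subsection \<open>The derivation of the field of rational functions\<close>

lemma ratfun_deriv_Fract:
  "q \<noteq> 0 \<Longrightarrow> ratfun_deriv (Fract p q) = Fract (pderiv p * q - p * pderiv q) (q * q)"
  by transfer simp

lemma ratfun_deriv_add: "ratfun_deriv (f + h) = ratfun_deriv f + ratfun_deriv h"
proof (cases f rule: Fract_cases, cases h rule: Fract_cases)
  fix p q p' q' assume *: "f = Fract p q" "q \<noteq> 0" "h = Fract p' q'" "q' \<noteq> 0"
  then show ?thesis
    by (simp add: ratfun_deriv_Fract eq_fract pderiv_mult pderiv_add algebra_simps)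
qed

lemma ratfun_deriv_mult: "ratfun_deriv (f * h) = ratfun_deriv f * h + f * ratfun_deriv h"
proof (cases f rule: Fract_cases, cases h rule: Fract_cases)
  fix p q p' q' assume *: "f = Fract p q" "q \<noteq> 0" "h = Fract p' q'" "q' \<noteq> 0"
  then show ?thesis
    by (simp add: ratfun_deriv_Fract eq_fract pderiv_mult algebra_simps)
qed

lemma ratfun_deriv_const: "ratfun_deriv (const_fun c) = 0"
  by (simp add: const_fun_def ratfun_deriv_Fract Zero_fract_def pderiv_pCons)

lemma ratfun_deriv_0: "ratfun_deriv 0 = 0" and ratfun_deriv_1: "ratfun_deriv 1 = 0"
  using ratfun_deriv_const[of 0] ratfun_deriv_const[of 1] by (simp_all add: const_fun_simps)

lemma ratfun_deriv_minus: "ratfun_deriv (- f) = - ratfun_deriv f"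
  using ratfun_deriv_add[of f "- f"] by (simp add: ratfun_deriv_0 eq_neg_iff_add_eq_0 add.commute)

lemma ratfun_deriv_diff: "ratfun_deriv (f - h) = ratfun_deriv f - ratfun_deriv h"
  using ratfun_deriv_add[of f "- h"] by (simp add: ratfun_deriv_minus)

lemma ratfun_deriv_zcoord: "ratfun_deriv zcoord = 1"
  by (simp add: zcoord_def ratfun_deriv_Fract One_fract_def pderiv_pCons pCons_one)

lemma ratfun_deriv_lform: "ratfun_deriv (lform a c) = const_fun a"
  by (simp add: lform_def ratfun_deriv_diff ratfun_deriv_mult ratfun_deriv_const ratfun_deriv_zcoord)

lemma ratfun_deriv_power: "ratfun_deriv (f ^ k) = of_nat k * f ^ (k - 1) * ratfun_deriv f"
proof (induction k)
  case 0
  then show ?case by (simp add: ratfun_deriv_1)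
next
  case (Suc k)
  then show ?case
    by (cases k) (simp_all add: ratfun_deriv_mult algebra_simps)
qed

text \<open>For \<open>Q = [b : d]\<close>, the vector field \<open>lform b d\<^sup>2 \<partial>\<^sub>z\<close> is regular away from \<open>Q\<close>, being the
  derivation with respect to an affine coordinate with pole \<open>Q\<close>.\<close>

lemma regular_at_deriv:
  assumes f: "regular_at f P" and P: "P \<noteq> pt b d" and bd: "(b, d) \<noteq> (0, 0)"
  shows "regular_at (lform b d ^ 2 * ratfun_deriv f) P"
proof (cases P rule: pt_normal_cases)
  case (1 t)
  obtain p q where *: "f = Fract p q" "poly q t \<noteq> 0"
    using f unfolding 1 regular_at_def has_value_affine_iff by blast
  then have "q \<noteq> 0" by auto
  have "lform b d ^ 2 * ratfun_deriv f = Fract ([:- d, b:] ^ 2 * (pderiv p * q - p * pderiv q)) (q * q)"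
    using \<open>q \<noteq> 0\<close> by (simp add: * ratfun_deriv_Fract lform_Fract power2_eq_square)
  then show ?thesis unfolding 1 regular_at_def has_value_affine_iff
    using * by (metis mult_eq_0_iff poly_mult)
next
  case 2
  then have "b \<noteq> 0" using P bd by (auto simp: pt_eq_iff)
  obtain e p q where *: "degree p \<le> e" "degree q \<le> e" "f = Fract p q" "coeff q e \<noteq> 0"
    using f unfolding 2 regular_at_def has_value_infinity_iff by blast
  then have "q \<noteq> 0" by auto
  define r where "r = pderiv p * q - p * pderiv q"
  have r: "degree ([:- d, b:] ^ 2 * r) \<le> e + e"
  proof (cases "e = 0")
    case True
    then have "pderiv p = 0" "pderiv q = 0" using * by (simp_all add: pderiv_eq_0_iff)
    then show ?thesis by (simp add: r_def)
  next
    case False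
    then obtain e' where e': "e = Suc e'" by (cases e) auto
    have dp: "degree (pderiv p) \<le> e'" "degree (pderiv q) \<le> e'"
      using * e' by (simp_all add: degree_pderiv)
    have "degree (pderiv p * q) \<le> e' + e" "degree (p * pderiv q) \<le> e' + e"
      using degree_mult_le[of "pderiv p" q] degree_mult_le[of p "pderiv q"] dp *(1,2) by linarith+
    then have 1: "degree r \<le> e' + e" unfolding r_def by (rule degree_diff_le)
    \<comment> \<open>Both products contribute e times the product of the two top coefficients. This
      cancellation lowers the degree of r to at most 2e - 2 and so leaves room for the quadratic
      factor.\<close>
    have "coeff r (e' + e) = 0"
      using coeff_mult_bounds[OF dp(1) *(2)] coeff_mult_bounds[OF *(1) dp(2)]
      by (simp add: r_def e' coeff_pderiv add.commute)
    then have "degree r < e' + e \<or> r = 0" using 1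
      by (metis le_neq_implies_less leading_coeff_0_iff)
    moreover have "degree ([:- d, b:] ^ 2) = 2" using \<open>b \<noteq> 0\<close> by (simp add: degree_power_eq)
    ultimately show ?thesis
      using degree_mult_le[of "[:- d, b:] ^ 2" r] e' by auto
  qed
  have "degree (q * q) \<le> e + e" using degree_mult_le[of q q] * by linarith
  moreover have "coeff (q * q) (e + e) \<noteq> 0" using coeff_mult_bounds[OF *(2) *(2)] * by simp
  moreover have "lform b d ^ 2 * ratfun_deriv f = Fract ([:- d, b:] ^ 2 * r) (q * q)"
    using \<open>q \<noteq> 0\<close> by (simp add: * ratfun_deriv_Fract lform_Fract power2_eq_square r_def)
  ultimately show ?thesis unfolding 2 regular_at_def has_value_infinity_iff
    using r by blast
qed

lemma regular_at_lform:
  assumes "P \<in> U_zero" shows "regular_at (lform a c) P"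
proof -
  obtain x y where P: "(x, y) \<noteq> (0, 0)" "P = pt x y" by (rule pt_cases)
  have "x \<noteq> 0" using assms P by (auto simp: U_zero_def pt_eq_iff)
  \<comment> \<open>\<open>lform 0 (-1)\<close> is the constant 1, so the lemma on ratios evaluates
    a single form.\<close>
  have "has_value (lform a c / lform 0 (-1)) P ((a * y - c * x) / (0 * y - (-1) * x))"
    unfolding P(2) by (rule has_value_lform_ratio) (use P \<open>x \<noteq> 0\<close> in auto)
  then show ?thesis unfolding regular_at_def by (auto simp: lform_infinity const_fun_simps)
qed

lemma regular_at_zcoord: "P \<in> U_zero \<Longrightarrow> regular_at zcoord P"
  using regular_at_lform[of P 1 0] by (simp add: lform_zero)

lemma regular_at_inverse_zcoord:
  assumes "P \<in> U_infty" shows "regular_at (inverse zcoord) P"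
proof -
  obtain x y where P: "(x, y) \<noteq> (0, 0)" "P = pt x y" by (rule pt_cases)
  have "y \<noteq> 0" using assms P by (auto simp: U_infty_def pt_eq_iff)
  have "has_value (lform 0 (-1) / lform 1 0) P ((0 * y - (-1) * x) / (1 * y - 0 * x))"
    unfolding P(2) by (rule has_value_lform_ratio) (use P \<open>y \<noteq> 0\<close> in auto)
  then show ?thesis unfolding regular_at_def
    by (auto simp: lform_infinity lform_zero const_fun_simps divide_inverse)
qed

lemma U_zero_Un_U_infty: "U_zero \<union> U_infty = UNIV"
  by (auto simp: U_zero_def U_infty_def pt_eq_iff)

lemma O_X_iff: "f \<in> O_X U \<longleftrightarrow> (\<forall>P\<in>U. regular_at f P)"
  using U_zero_Un_U_infty by (auto simp: O_sec_def)

lemma O_sec_nat_iff: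
  "f \<in> O_sec (int n) U \<longleftrightarrow> (\<forall>P\<in>U \<inter> U_zero. regular_at f P) \<and>
     (\<forall>P\<in>U \<inter> U_infty. regular_at (inverse zcoord ^ n * f) P)"
  by (auto simp: O_sec_def power_int_minus power_inverse)

subsection \<open>Operators of finite order\<close>

lemma order_le_0_iff: "order_le 0 P \<longleftrightarrow> (\<forall>f h. P (f * h) = f * P h)"
  by (auto simp: commutator_with_def fun_eq_iff)

lemma order_le_zero: "order_le k (\<lambda>_. 0)"
  by (induction k) (simp_all add: commutator_with_def fun_eq_iff del: order_le.simps(1) add: order_le_0_iff)

lemma order_le_add: "order_le k P \<Longrightarrow> order_le k Q \<Longrightarrow> order_le k (\<lambda>f. P f + Q f)"
proof (induction k arbitrary: P Q)
  case 0
  then show ?case unfolding order_le_0_iff by (simp add: algebra_simps)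
next
  case (Suc k)
  have "commutator_with f (\<lambda>f. P f + Q f) = (\<lambda>h. commutator_with f P h + commutator_with f Q h)" for f
    by (simp add: commutator_with_def fun_eq_iff algebra_simps)
  then show ?case using Suc by simp
qed

lemma order_le_Suc: "order_le k P \<Longrightarrow> order_le (Suc k) P"
proof (induction k arbitrary: P)
  case 0
  then show ?case using order_le_zero[of 0] by simp
next
  case (Suc k)
  then show ?case by simp
qed

lemma order_le_mono: "order_le k P \<Longrightarrow> k \<le> l \<Longrightarrow> order_le l P"
  by (induction l) (auto intro: order_le_Suc elim: le_SucE simp del: order_le.simps)

definition additive_op :: "(ratfun \<Rightarrow> ratfun) \<Rightarrow> bool" where
  "additive_op P \<longleftrightarrow> (\<forall>f h. P (f + h) = P f + P h)"

lemma additive_op_diff: "additive_op P \<Longrightarrow> P (f - h) = P f - P h"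
  unfolding additive_op_def by (metis add_diff_cancel diff_add_cancel)

lemma additive_op_0: "additive_op P \<Longrightarrow> P 0 = 0"
  using additive_op_diff[of P 0 0] by simp

lemma additive_op_commutator: "additive_op P \<Longrightarrow> additive_op (commutator_with f P)"
  by (simp add: additive_op_def commutator_with_def algebra_simps)

text \<open>The commutator with f is a derivation: that of P Q is P times the commutator of Q plus
  the commutator of P times Q. Each summand has total order one less, or vanishes if the factor in
  the commutator has order 0. Additivity of P serves to expand the first summand.\<close>

lemma order_le_comp:
  "additive_op P \<Longrightarrow> order_le k P \<Longrightarrow> order_le l Q \<Longrightarrow> order_le (k + l) (P \<circ> Q)"
proof (induction "k + l" arbitrary: k l P Q)
  case 0
  then show ?case by (auto simp: order_le_0_iff simp del: order_le.simps(1))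
next
  case (Suc m)
  have c: "commutator_with f (P \<circ> Q) = (\<lambda>h. (P \<circ> commutator_with f Q) h + (commutator_with f P \<circ> Q) h)" for f
    using Suc.prems(1) by (simp add: commutator_with_def fun_eq_iff additive_op_diff)
  have 1: "order_le m (P \<circ> commutator_with f Q)" for f
  proof (cases l)
    case 0
    then have "P \<circ> commutator_with f Q = (\<lambda>_. 0)"
      using Suc.prems additive_op_0 by (auto simp: fun_eq_iff)
    then show ?thesis by (simp add: order_le_zero)
  next
    case (Suc l')
    then show ?thesis using Suc.hyps(1)[of k l' P "commutator_with f Q"] Suc.prems \<open>Suc m = k + l\<close> by simp
  qed
  have 2: "order_le m (commutator_with f P \<circ> Q)" for f
  proof (cases k)
    case 0
    then have "commutator_with f P \<circ> Q = (\<lambda>_. 0)"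
      using Suc.prems by (auto simp: fun_eq_iff)
    then show ?thesis by (simp add: order_le_zero)
  next
    case (Suc k')
    then show ?thesis
      using Suc.hyps(1)[of k' l "commutator_with f P" Q] Suc.prems \<open>Suc m = k + l\<close>
      by (simp add: additive_op_commutator)
  qed
  have "order_le (Suc m) (P \<circ> Q)"
    unfolding order_le.simps(2) c by (intro allI order_le_add 1 2)
  then show ?case using Suc.hyps(2) by simp
qed

lemma c_linear_imp_additive: "c_linear P \<Longrightarrow> additive_op P"
  by (simp add: c_linear_def additive_op_def)

lemma O_sec_add: "f \<in> O_sec n U \<Longrightarrow> h \<in> O_sec n U \<Longrightarrow> f + h \<in> O_sec n U"
  by (simp add: O_sec_def ring_distribs regular_at_add)

lemma O_sec_mult: "f \<in> O_X U \<Longrightarrow> h \<in> O_sec n U \<Longrightarrow> f * h \<in> O_sec n U"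
  unfolding O_X_iff by (auto simp: O_sec_def mult.left_commute[of _ f] intro: regular_at_mult)

lemma O_sec_diff: "f \<in> O_sec n U \<Longrightarrow> h \<in> O_sec n U \<Longrightarrow> f - h \<in> O_sec n U"
  by (simp add: O_sec_def right_diff_distrib regular_at_diff)

lemma diff_ops_add: "P \<in> diff_ops n U \<Longrightarrow> Q \<in> diff_ops n U \<Longrightarrow> (\<lambda>f. P f + Q f) \<in> diff_ops n U"
  unfolding diff_ops_def
proof (clarsimp, intro conjI)
  fix k l assume *: "c_linear P" "c_linear Q" "order_le k P" "order_le l Q"
  show "c_linear (\<lambda>f. P f + Q f)" using * by (simp add: c_linear_def algebra_simps)
  show "\<exists>k. order_le k (\<lambda>f. P f + Q f)"
    using * by (intro exI[of _ "max k l"] order_le_add) (auto elim: order_le_mono)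
qed (use O_sec_add in blast)

lemma diff_ops_comp: "P \<in> diff_ops n U \<Longrightarrow> Q \<in> diff_ops n U \<Longrightarrow> P \<circ> Q \<in> diff_ops n U"
  unfolding diff_ops_def
proof (clarsimp, intro conjI)
  fix k l assume *: "c_linear P" "c_linear Q" "order_le k P" "order_le l Q"
  show "c_linear (P \<circ> Q)" using * by (simp add: c_linear_def)
  show "\<exists>k. order_le k (P \<circ> Q)"
    using * order_le_comp c_linear_imp_additive by blast
qed

lemma diff_ops_mono: "W \<subseteq> U \<Longrightarrow> P \<in> diff_ops n U \<Longrightarrow> P \<in> diff_ops n W"
  unfolding diff_ops_def by blast

lemma mult_op_diff_ops:
  assumes "f \<in> O_X U" shows "mult_op f \<in> diff_ops n U"
  unfolding diff_ops_def
proof (clarsimp, intro conjI allI impI)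
  show "c_linear (mult_op f)" by (simp add: c_linear_def mult_op_def algebra_simps)
  show "\<exists>k. order_le k (mult_op f)"
    by (rule exI[of _ 0]) (simp add: mult_op_def order_le_0_iff mult_ac del: order_le.simps)
  fix W h assume "zariski_open W \<and> W \<subseteq> U \<and> h \<in> O_sec n W"
  then show "mult_op f h \<in> O_sec n W"
    using assms unfolding mult_op_def by (intro O_sec_mult) (auto simp: O_X_iff)
qed

lemma const_fun_O_X: "const_fun c \<in> O_X U"
  by (simp add: O_X_iff regular_at_const)

lemma const_op_diff_ops: "mult_op (const_fun c) \<in> diff_ops n U"
  by (intro mult_op_diff_ops const_fun_O_X)

lemma id_diff_ops: "id \<in> diff_ops n U"
proof -
  have 1: "id = mult_op (const_fun 1)" by (simp add: fun_eq_iff mult_op_def const_fun_simps)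
  show ?thesis unfolding 1 by (rule const_op_diff_ops)
qed

lemma diff_ops_funpow: "P \<in> diff_ops n U \<Longrightarrow> P ^^ k \<in> diff_ops n U"
  by (induction k) (simp_all add: id_diff_ops diff_ops_comp)

section \<open>First-order operators and the images of the Lie algebra\<close>

definition first_order :: "ratfun \<Rightarrow> ratfun \<Rightarrow> ratfun \<Rightarrow> ratfun" where
  "first_order \<alpha> \<beta> f = \<alpha> * ratfun_deriv f + \<beta> * f"

lemma first_order_mult: "first_order \<alpha> \<beta> (f * h) = f * first_order \<alpha> \<beta> h + \<alpha> * ratfun_deriv f * h"
  by (simp add: first_order_def ratfun_deriv_mult algebra_simps)

lemma first_order_linear:
  "first_order \<alpha> \<beta> (f + h) = first_order \<alpha> \<beta> f + first_order \<alpha> \<beta> h"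
  "first_order \<alpha> \<beta> (const_fun c * h) = const_fun c * first_order \<alpha> \<beta> h"
  by (simp_all add: first_order_mult ratfun_deriv_const)
    (simp_all add: first_order_def ratfun_deriv_add algebra_simps)

lemma order_le_first_order: "order_le 1 (first_order \<alpha> \<beta>)"
  unfolding One_nat_def order_le.simps(2)
proof
  fix f
  have "commutator_with f (first_order \<alpha> \<beta>) = mult_op (\<alpha> * ratfun_deriv f)"
    by (simp add: fun_eq_iff commutator_with_def first_order_mult mult_op_def)
  then show "order_le 0 (commutator_with f (first_order \<alpha> \<beta>))"
    by (simp add: order_le_0_iff mult_op_def mult_ac del: order_le.simps)
qed

lemma first_order_diff_opsI:
  assumes "\<And>W f. W \<subseteq> U \<Longrightarrow> f \<in> O_sec n W \<Longrightarrow> first_order \<alpha> \<beta> f \<in> O_sec n W"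
  shows "first_order \<alpha> \<beta> \<in> diff_ops n U"
proof -
  have "\<exists>k. order_le k (first_order \<alpha> \<beta>)" using order_le_first_order by blast
  then show ?thesis unfolding diff_ops_def using assms by (simp add: c_linear_def first_order_linear)
qed

lemma Phi_first_order:
  "Phi (int n + 1) bE = first_order (zcoord ^ 2) (- of_nat n * zcoord)"
  "Phi (int n + 1) bF = first_order (- 1) 0"
  "Phi (int n + 1) bH = first_order (2 * zcoord) (- of_nat n)"
  by (simp_all add: fun_eq_iff first_order_def)

text \<open>Over \<open>U_infty\<close> one passes to the second component h = z^(-n) f. In terms of
  h the operators take the form prescribed in the coordinate w, with z^2 d/dz in place of - d/dw,
  and z^2 d/dz preserves regularity away from [1:0] by \<open>regular_at_deriv\<close>.\<close>

lemma Phi_diff_ops: "Phi (int n + 1) g \<in> diff_ops (int n) U"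
proof -
  obtain \<alpha> \<beta> where ab: "Phi (int n + 1) g = first_order \<alpha> \<beta>"
    by (cases g) (simp_all only: Phi_first_order)
  have "Phi (int n + 1) g f \<in> O_sec (int n) W" if f: "f \<in> O_sec (int n) W" for f W
  proof -
    have reg0: "regular_at f P" if "P \<in> W \<inter> U_zero" for P
      using f that by (auto simp: O_sec_nat_iff)
    have regz: "regular_at zcoord P" if "P \<in> W \<inter> U_zero" for P
      using that regular_at_zcoord by auto
    have regd: "regular_at (ratfun_deriv f) P" if "P \<in> W \<inter> U_zero" for P
      using regular_at_deriv[OF reg0[OF that], of 0 1] that
      by (simp add: U_zero_def lform_infinity const_fun_simps)
    have nat0: "regular_at (of_nat k :: ratfun) P" for k P
      using regular_at_const[of "of_nat k" P] by (simp add: const_fun_of_nat)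
    have num0: "regular_at (2 :: ratfun) P" for P
      using regular_at_const[of 2 P] by (simp add: const_fun_numeral)
    define h where "h = inverse zcoord ^ n * f"
    have fh: "f = zcoord ^ n * h" using zcoord_nonzero by (simp add: h_def field_simps)
    have regh: "regular_at h P" if "P \<in> W \<inter> U_infty" for P
      using f that by (auto simp: O_sec_nat_iff h_def)
    have regi: "regular_at (inverse zcoord) P" if "P \<in> W \<inter> U_infty" for P
      using that regular_at_inverse_zcoord by auto
    have regdh: "regular_at (zcoord ^ 2 * ratfun_deriv h) P" if "P \<in> W \<inter> U_infty" for P
      using regular_at_deriv[OF regh[OF that], of 1 0] that
      by (simp add: U_infty_def lform_zero)
    have df: "inverse zcoord ^ n * ratfun_deriv f = of_nat n * inverse zcoord * h + ratfun_deriv h"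
    proof (cases n)
      case 0
      then show ?thesis by (simp add: fh)
    next
      case (Suc k)
      then show ?thesis using zcoord_nonzero unfolding fh ratfun_deriv_mult ratfun_deriv_power
        by (simp add: ratfun_deriv_zcoord field_simps)
    qed
    have E: "inverse zcoord ^ n * Phi (int n + 1) bE f = zcoord ^ 2 * ratfun_deriv h"
    proof -
      have "inverse zcoord ^ n * Phi (int n + 1) bE f = zcoord ^ 2 * (inverse zcoord ^ n * ratfun_deriv f)
        - of_nat n * zcoord * h" by (simp add: h_def algebra_simps)
      also have "\<dots> = zcoord ^ 2 * ratfun_deriv h"
        unfolding df using zcoord_nonzero by (simp add: field_simps power2_eq_square)
      finally show ?thesis .
    qed
    have F: "inverse zcoord ^ n * Phi (int n + 1) bF f = - (of_nat n * inverse zcoord * h +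
        inverse zcoord ^ 2 * (zcoord ^ 2 * ratfun_deriv h))"
      using df zcoord_nonzero by (simp add: field_simps)
    have H: "inverse zcoord ^ n * Phi (int n + 1) bH f = of_nat n * h +
        2 * (inverse zcoord * (zcoord ^ 2 * ratfun_deriv h))"
    proof -
      have "inverse zcoord ^ n * Phi (int n + 1) bH f = 2 * zcoord * (inverse zcoord ^ n * ratfun_deriv f)
        - of_nat n * h" by (simp add: h_def algebra_simps)
      also have "\<dots> = of_nat n * h + 2 * (inverse zcoord * (zcoord ^ 2 * ratfun_deriv h))"
        unfolding df using zcoord_nonzero by (simp add: field_simps power2_eq_square)
      finally show ?thesis .
    qed
    show ?thesis unfolding O_sec_nat_iff
    proof (intro conjI ballI)
      fix P assume P: "P \<in> W \<inter> U_zero"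
      note r = reg0[OF P] regz[OF P] regd[OF P]
      show "regular_at (Phi (int n + 1) g f) P"
        by (cases g) (auto simp: r nat0 num0 intro!: regular_at_diff regular_at_minus regular_at_mult regular_at_power)
    next
      fix P assume P: "P \<in> W \<inter> U_infty"
      note r = regh[OF P] regi[OF P] regdh[OF P]
      show "regular_at (inverse zcoord ^ n * Phi (int n + 1) g f) P"
        by (cases g) (simp_all only: E F H, (intro regular_at_add regular_at_minus
          regular_at_mult regular_at_power nat0 num0 r)+)
    qed
  qed
  then show ?thesis unfolding ab by (intro first_order_diff_opsI) blast
qed

section \<open>Trivialising the line bundle off one point\<close>

lemma lform_unit_zero:
  assumes "(b, d) \<noteq> (0, 0)" "P \<in> U_zero" "P \<noteq> pt b d"
  shows "\<exists>c. c \<noteq> 0 \<and> has_value (lform b d) P c"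
proof -
  obtain x y where P: "(x, y) \<noteq> (0, 0)" "P = pt x y" by (rule pt_cases)
  have x: "x \<noteq> 0" using assms P by (auto simp: U_zero_def pt_eq_iff)
  have nz: "b * y - d * x \<noteq> 0" using assms P by (auto simp: pt_eq_iff mult.commute)
  have "has_value (lform b d / lform 0 (-1)) P ((b * y - d * x) / (0 * y - (-1) * x))"
    unfolding P(2) by (rule has_value_lform_ratio) (use P x in auto)
  then show ?thesis using nz x
    by (intro exI[of _ "(b * y - d * x) / x"]) (simp add: lform_infinity const_fun_simps)
qed

lemma lform_unit_infty:
  assumes "(b, d) \<noteq> (0, 0)" "P \<in> U_infty" "P \<noteq> pt b d"
  shows "\<exists>c. c \<noteq> 0 \<and> has_value (lform b d * inverse zcoord) P c"
proof -
  obtain x y where P: "(x, y) \<noteq> (0, 0)" "P = pt x y" by (rule pt_cases)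
  have y: "y \<noteq> 0" using assms P by (auto simp: U_infty_def pt_eq_iff)
  have nz: "b * y - d * x \<noteq> 0" using assms P by (auto simp: pt_eq_iff mult.commute)
  have "has_value (lform b d / lform 1 0) P ((b * y - d * x) / (1 * y - 0 * x))"
    unfolding P(2) by (rule has_value_lform_ratio) (use P y in auto)
  then show ?thesis using nz y
    by (intro exI[of _ "(b * y - d * x) / y"]) (simp add: lform_zero divide_inverse)
qed

text \<open>As a section of O_1, \<open>lform b d\<close> vanishes only at [b:d]: off that point it
  is a unit in one chart, and z^(-1) times it is a unit in the other. Its n-th power therefore
  generates O_n there.\<close>

lemma O_sec_twist:
  assumes bd: "(b, d) \<noteq> (0, 0)" and W: "pt b d \<notin> W"
  shows "f \<in> O_sec (int n) W \<longleftrightarrow> inverse (lform b d) ^ n * f \<in> O_X W"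
proof -
  let ?m = "lform b d"
  have m0: "?m \<noteq> 0" using bd by (rule lform_nonzero)
  have 0: "regular_at f P \<longleftrightarrow> regular_at (inverse ?m ^ n * f) P" if P: "P \<in> W \<inter> U_zero" for P
  proof -
    obtain c where c: "c \<noteq> 0" "has_value ?m P c" using lform_unit_zero[OF bd, of P] P W by auto
    have 1: "regular_at (?m ^ n) P" "regular_at (inverse ?m ^ n) P"
      using has_value_power[OF c(2)] has_value_power[OF has_value_inverse[OF c(2,1)]]
      unfolding regular_at_def by blast+
    have "f = ?m ^ n * (inverse ?m ^ n * f)" using m0 by (simp add: field_simps)
    then show ?thesis using regular_at_mult 1 by metis
  qed
  have 1: "regular_at (inverse zcoord ^ n * f) P \<longleftrightarrow> regular_at (inverse ?m ^ n * f) P"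
    if P: "P \<in> W \<inter> U_infty" for P
  proof -
    let ?e = "?m * inverse zcoord"
    obtain c where c: "c \<noteq> 0" "has_value ?e P c" using lform_unit_infty[OF bd, of P] P W by auto
    have 1: "regular_at (?e ^ n) P" "regular_at (inverse ?e ^ n) P"
      using has_value_power[OF c(2)] has_value_power[OF has_value_inverse[OF c(2,1)]]
      unfolding regular_at_def by blast+
    have "inverse zcoord ^ n * f = ?e ^ n * (inverse ?m ^ n * f)"
      "inverse ?m ^ n * f = inverse ?e ^ n * (inverse zcoord ^ n * f)"
      using m0 zcoord_nonzero by (simp_all add: field_simps)
    then show ?thesis using regular_at_mult 1 by metis
  qed
  show ?thesis unfolding O_sec_nat_iff O_X_iff using 0 1 U_zero_Un_U_infty by blast
qed

text \<open>Conjugation by m^n, which carries operators on functions to operators on sections of O_n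
  wherever m^n is a generator of O_n.\<close>

definition twist_op :: "nat \<Rightarrow> ratfun \<Rightarrow> (ratfun \<Rightarrow> ratfun) \<Rightarrow> ratfun \<Rightarrow> ratfun" where
  "twist_op n m P = mult_op (m ^ n) \<circ> P \<circ> mult_op (inverse m ^ n)"

lemma c_linear_comp: "c_linear P \<Longrightarrow> c_linear Q \<Longrightarrow> c_linear (P \<circ> Q)"
  by (simp add: c_linear_def)

lemma c_linear_mult_op: "c_linear (mult_op f)"
  by (simp add: c_linear_def mult_op_def algebra_simps)

lemma order_le_mult_op: "order_le 0 (mult_op f)"
  by (simp add: order_le_0_iff mult_op_def mult_ac del: order_le.simps)

lemma twist_op_diff_ops:
  assumes bd: "(b, d) \<noteq> (0, 0)" and W: "pt b d \<notin> U" and P: "P \<in> diff_ops 0 U"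
  shows "twist_op n (lform b d) P \<in> diff_ops (int n) U"
proof -
  let ?m = "lform b d"
  obtain k where k: "c_linear P" "order_le k P" using P by (auto simp: diff_ops_def)
  have add: "additive_op (mult_op f)" for f by (simp add: additive_op_def mult_op_def algebra_simps)
  have "additive_op (mult_op (?m ^ n) \<circ> P)"
    using k by (simp add: c_linear_def additive_op_def mult_op_def algebra_simps)
  then have "order_le (0 + k + 0) (twist_op n ?m P)"
    unfolding twist_op_def by (intro order_le_comp order_le_mult_op add k)
  moreover have "c_linear (twist_op n ?m P)"
    unfolding twist_op_def by (intro c_linear_comp c_linear_mult_op k(1))
  moreover have "twist_op n ?m P f \<in> O_sec (int n) V" if V: "zariski_open V" "V \<subseteq> U" "f \<in> O_sec (int n) V" for V f
  proof -
    have "inverse ?m ^ n * f \<in> O_X V" using V W O_sec_twist[OF bd, of V f n] by blast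
    then have 1: "P (inverse ?m ^ n * f) \<in> O_X V" using P V by (auto simp: diff_ops_def)
    have "P (inverse ?m ^ n * f) = inverse ?m ^ n * twist_op n ?m P f"
      using lform_nonzero[OF bd] by (simp add: twist_op_def mult_op_def field_simps)
    then show ?thesis using 1 V W O_sec_twist[OF bd, of V _ n] by auto
  qed
  ultimately show ?thesis by (auto simp: diff_ops_def)
qed

section \<open>The basis conjugated by g, acting by twisted operators\<close>

locale twisted_frame = frame a b c d for a b c d +
  fixes n :: nat
begin

text \<open>The images under \<open>Phi\<close> of the conjugates of E, F, H by g, in closed form;
  \<open>Eg_Phi\<close>, \<open>Fg_Phi\<close> and \<open>Hg_Phi\<close> expand them in the standard
  basis. \<open>Eg\<close> involves (a, c) but not (b, d), which allows q to be moved later.\<close>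

definition "Eg = first_order (lp ^ 2) (- of_nat n * const_fun a * lp)"
definition "Fg = first_order (- (lq ^ 2)) (of_nat n * const_fun b * lq)"
definition "Hg = first_order (- 2 * lp * lq) (of_nat n * (const_fun a * lq + const_fun b * lp))"

lemma det_fun: "const_fun a * const_fun d - const_fun b * const_fun c = 1"
  using arg_cong[OF det, of const_fun] by (simp add: const_fun_simps)

lemma lform_det: "const_fun b * lp - const_fun a * lq = 1"
  using det_fun by (simp add: lform_def algebra_simps)

lemma Eg_Phi: "Eg f = const_fun (a ^ 2) * Phi (int n + 1) bE f + (const_fun (- (c ^ 2)) * Phi (int n + 1) bF f
    + const_fun (- (a * c)) * Phi (int n + 1) bH f)"
  by (simp add: Eg_def first_order_def lform_def const_fun_simps const_fun_power algebra_simps power2_eq_square)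

lemma Fg_Phi: "Fg f = const_fun (- (b ^ 2)) * Phi (int n + 1) bE f + (const_fun (d ^ 2) * Phi (int n + 1) bF f
    + const_fun (b * d) * Phi (int n + 1) bH f)"
  by (simp add: Fg_def first_order_def lform_def const_fun_simps const_fun_power algebra_simps power2_eq_square)

lemma Hg_Phi: "Hg f = const_fun (- (2 * a * b)) * Phi (int n + 1) bE f + (const_fun (2 * c * d) * Phi (int n + 1) bF f
    + const_fun (a * d + b * c) * Phi (int n + 1) bH f)"
  by (simp add: Hg_def first_order_def lform_def const_fun_simps const_fun_power const_fun_numeral
      algebra_simps power2_eq_square)

lemma zc_lq: "zc * lq = - lp" and wc_lp: "wc * lp = - lq"
  using pq_nonzero by (simp_all add: zc_def wc_def)

text \<open>Obtained by differentiating zc lq = - lp. It says that lq^2 d/dz is the derivation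
  d/dzc; the companion for \<open>wc\<close> carries a minus sign, the reason why E acts as -
  d/dw.\<close>

lemma ratfun_deriv_zc: "lq ^ 2 * ratfun_deriv zc = 1"
proof -
  have "ratfun_deriv zc * lq + zc * const_fun b = - const_fun a"
    using arg_cong[OF zc_lq, of ratfun_deriv]
    by (simp add: ratfun_deriv_mult ratfun_deriv_minus ratfun_deriv_lform)
  then have 1: "ratfun_deriv zc * lq = - const_fun a - zc * const_fun b" by (simp add: algebra_simps)
  have "lq ^ 2 * ratfun_deriv zc = lq * (ratfun_deriv zc * lq)" by (simp add: power2_eq_square)
  also have "\<dots> = - const_fun a * lq - const_fun b * (zc * lq)" unfolding 1 by (simp add: algebra_simps)
  also have "\<dots> = 1" unfolding zc_lq using lform_det by simp
  finally show ?thesis .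
qed

lemma ratfun_deriv_wc: "lp ^ 2 * ratfun_deriv wc = - 1"
proof -
  have "ratfun_deriv wc * lp + wc * const_fun a = - const_fun b"
    using arg_cong[OF wc_lp, of ratfun_deriv]
    by (simp add: ratfun_deriv_mult ratfun_deriv_minus ratfun_deriv_lform)
  then have 1: "ratfun_deriv wc * lp = - const_fun b - wc * const_fun a" by (simp add: algebra_simps)
  have "lp ^ 2 * ratfun_deriv wc = lp * (ratfun_deriv wc * lp)" by (simp add: power2_eq_square)
  also have "\<dots> = - const_fun b * lp - const_fun a * (wc * lp)" unfolding 1 by (simp add: algebra_simps)
  also have "\<dots> = - (const_fun b * lp - const_fun a * lq)" unfolding wc_lp by simp
  also have "\<dots> = - 1" unfolding lform_det ..
  finally show ?thesis .
qed

lemma Eg_wc: "Eg (wc * f) = wc * Eg f - f"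
  using ratfun_deriv_wc by (simp add: Eg_def first_order_mult)

lemma Fg_zc: "Fg (zc * f) = zc * Fg f - f"
  using ratfun_deriv_zc by (simp add: Fg_def first_order_mult)

text \<open>Together with \<open>Eg_Fg\<close> this writes all three operators through
  multiplication by zc and \<open>Fg\<close>, with the coefficients that the standard basis has in
  z. All relations between them then reduce to the single Weyl relation
  \<open>Fg_zc\<close>.\<close>

lemma Hg_Fg: "Hg f = - 2 * (zc * Fg f) - of_nat n * f"
proof -
  have "zc * Fg f = - (zc * lq) * lq * ratfun_deriv f + of_nat n * const_fun b * (zc * lq) * f"
    by (simp add: Fg_def first_order_def algebra_simps power2_eq_square)
  then have 1: "zc * Fg f = lp * lq * ratfun_deriv f - of_nat n * const_fun b * lp * f"
    unfolding zc_lq by simp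
  have 2: "const_fun a * lq = const_fun b * lp - 1" using lform_det by (simp add: algebra_simps)
  show ?thesis unfolding 1 Hg_def first_order_def 2 by (simp add: algebra_simps)
qed

lemma Eg_Fg: "Eg f = - (zc * (zc * Fg f)) - of_nat n * (zc * f)"
proof -
  have "zc * (zc * Fg f) = - (zc * lq) * (zc * lq) * ratfun_deriv f + of_nat n * const_fun b * zc * (zc * lq) * f"
    by (simp add: Fg_def first_order_def algebra_simps power2_eq_square)
  also have "\<dots> = - (lp ^ 2) * ratfun_deriv f - of_nat n * zc * (const_fun b * lp) * f"
    unfolding zc_lq by (simp add: power2_eq_square)
  finally have 1: "zc * (zc * Fg f) = - (lp ^ 2) * ratfun_deriv f - of_nat n * zc * (const_fun b * lp) * f" .
  have "const_fun a * lp = - (zc * (const_fun a * lq))"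
    using arg_cong[OF zc_lq, of "\<lambda>x. - const_fun a * x"] by (simp add: mult_ac)
  also have "const_fun a * lq = const_fun b * lp - 1" using lform_det by (simp add: algebra_simps)
  finally have 2: "const_fun a * lp = - (zc * (const_fun b * lp - 1))" .
  have "Eg f = lp ^ 2 * ratfun_deriv f - of_nat n * (const_fun a * lp) * f"
    by (simp add: Eg_def first_order_def algebra_simps)
  then show ?thesis unfolding 1 2 by (simp add: algebra_simps)
qed

lemma Hg_Eg: "Hg f = 2 * (wc * Eg f) + of_nat n * f"
proof -
  have "wc * Eg f = - (wc * zc * (zc * Fg f)) - of_nat n * (wc * zc * f)"
    unfolding Eg_Fg by (simp add: algebra_simps)
  then show ?thesis by (simp add: wc_zc Hg_Fg)
qed

lemma combination_diff_ops:
  assumes "P \<in> diff_ops m U" "Q \<in> diff_ops m U" "R \<in> diff_ops m U"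
  shows "(\<lambda>f. const_fun x * P f + (const_fun y * Q f + const_fun z * R f)) \<in> diff_ops m U"
proof -
  have "(\<lambda>f. (mult_op (const_fun x) \<circ> P) f + ((mult_op (const_fun y) \<circ> Q) f + (mult_op (const_fun z) \<circ> R) f)) \<in> diff_ops m U"
    using diff_ops_comp[OF const_op_diff_ops] assms by (intro diff_ops_add) blast+
  then show ?thesis by (simp add: mult_op_def)
qed

lemma Eg_diff_ops: "Eg \<in> diff_ops (int n) U" and Fg_diff_ops: "Fg \<in> diff_ops (int n) U"
  and Hg_diff_ops: "Hg \<in> diff_ops (int n) U"
  unfolding fun_eq_iff[THEN iffD2, OF allI, OF Eg_Phi] fun_eq_iff[THEN iffD2, OF allI, OF Fg_Phi]
    fun_eq_iff[THEN iffD2, OF allI, OF Hg_Phi]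
  by (intro combination_diff_ops Phi_diff_ops)+

lemma wc_O_X: "pt a c \<notin> U \<Longrightarrow> wc \<in> O_X U"
  using affine_coordinate.value_ex[OF affine_coordinate_wc] by (metis O_X_iff regular_at_def)

lemma zc_O_X: "pt b d \<notin> U \<Longrightarrow> zc \<in> O_X U"
  using affine_coordinate.value_ex[OF affine_coordinate_zc] by (metis O_X_iff regular_at_def)

lemma subst_poly_wc_O_X: "pt a c \<notin> U \<Longrightarrow> subst_poly wc u \<in> O_X U"
  using affine_coordinate.value_ex[OF affine_coordinate_wc] has_value_subst_poly
  by (metis O_X_iff regular_at_def)

lemma subst_poly_zc_O_X: "pt b d \<notin> U \<Longrightarrow> subst_poly zc u \<in> O_X U"
  using affine_coordinate.value_ex[OF affine_coordinate_zc] has_value_subst_poly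
  by (metis O_X_iff regular_at_def)

lemma O_X_minus_q: "f \<in> O_X (- {pt b d}) \<Longrightarrow> \<exists>u. f = subst_poly zc u"
  by (rule affine_coordinate.regular_imp_polynomial[OF affine_coordinate_zc]) (simp add: O_X_iff)

lemma Fg_linear: "Fg (f + h) = Fg f + Fg h" "Fg (const_fun x * h) = const_fun x * Fg h"
  by (simp_all add: Fg_def first_order_linear)

lemma Fg_funpow_zc: "(Fg ^^ Suc j) (zc * f) = zc * (Fg ^^ Suc j) f - of_nat (Suc j) * (Fg ^^ j) f"
proof (induction j)
  case 0
  then show ?case by (simp add: Fg_zc)
next
  case (Suc j)
  have 1: "(Fg ^^ Suc j) (zc * f) = zc * (Fg ^^ Suc j) f + const_fun (- of_nat (Suc j)) * (Fg ^^ j) f"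
    unfolding Suc by (simp add: const_fun_simps const_fun_of_nat algebra_simps)
  have "(Fg ^^ Suc (Suc j)) (zc * f) = Fg ((Fg ^^ Suc j) (zc * f))" by simp
  also have "\<dots> = zc * Fg ((Fg ^^ Suc j) f) - (Fg ^^ Suc j) f + const_fun (- of_nat (Suc j)) * Fg ((Fg ^^ j) f)"
    unfolding 1 Fg_linear Fg_zc ..
  finally show ?case by (simp add: const_fun_simps const_fun_of_nat algebra_simps)
qed

text \<open>An operator is determined by its commutator with zc up to a multiplication operator.
  Integrating the given normal form in \<open>Fg\<close> yields R with the same commutator as P;
  then P - R is linear over the polynomials in zc, hence over the function field, and so is
  multiplication by a function, which preservation of O_n forces to be a polynomial.\<close>

lemma diff_ops_normal_form_step:
  assumes P: "P \<in> diff_ops (int n) (- {pt b d})"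
    and comm: "\<forall>f. commutator_with zc P f = (\<Sum>j<N. subst_poly zc (u j) * (Fg ^^ j) f)"
  shows "\<exists>N u. \<forall>f. P f = (\<Sum>j<N. subst_poly zc (u j) * (Fg ^^ j) f)"
proof -
  let ?U = "- {pt b d}"
  interpret zc: affine_coordinate zc "pt b d" by (rule affine_coordinate_zc)
  \<comment> \<open>The divisor - (j + 1) undoes the factor that arises on commuting zc past the
    power \<open>Suc j\<close> of \<open>Fg\<close>.\<close>
  define v where "v = (\<lambda>j. smult (- (1 / of_nat (Suc j))) (u j))"
  have v: "subst_poly zc (v j) * - of_nat (Suc j) = subst_poly zc (u j)" for j
  proof -
    have "subst_poly zc (v j) * - of_nat (Suc j) = const_fun (- of_nat (Suc j)) * subst_poly zc (v j)"
      by (simp add: const_fun_simps const_fun_of_nat del: of_nat_Suc)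
    also have "\<dots> = subst_poly zc (smult (- of_nat (Suc j)) (v j))" by (simp only: subst_poly_smult)
    also have "smult (- of_nat (Suc j)) (v j) = u j" by (simp add: v_def del: of_nat_Suc)
    finally show ?thesis .
  qed
  define R where "R = (\<lambda>f. \<Sum>j<N. subst_poly zc (v j) * (Fg ^^ Suc j) f)"
  have R_zc: "R (zc * f) = zc * R f + commutator_with zc P f" for f
  proof -
    have "R (zc * f) = (\<Sum>j<N. zc * (subst_poly zc (v j) * (Fg ^^ Suc j) f) +
        (subst_poly zc (v j) * - of_nat (Suc j)) * (Fg ^^ j) f)"
      unfolding R_def Fg_funpow_zc by (simp add: algebra_simps del: funpow.simps of_nat_Suc)
    then show ?thesis unfolding v comm[rule_format] by (simp add: R_def sum.distrib sum_distrib_left)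
  qed
  have "(\<lambda>f. \<Sum>j<m. subst_poly zc (v j) * (Fg ^^ Suc j) f) \<in> diff_ops (int n) ?U" for m
  proof (induction m)
    case 0
    show ?case using const_op_diff_ops[of 0 "int n" ?U] by (simp add: mult_op_def const_fun_simps)
  next
    case (Suc m)
    have "mult_op (subst_poly zc (v m)) \<circ> Fg ^^ Suc m \<in> diff_ops (int n) ?U"
      by (intro diff_ops_comp mult_op_diff_ops subst_poly_zc_O_X diff_ops_funpow Fg_diff_ops) auto
    from diff_ops_add[OF Suc this] show ?case by (simp add: mult_op_def)
  qed
  then have R: "R \<in> diff_ops (int n) ?U" unfolding R_def .
  define T where "T = (\<lambda>f. P f - R f)"
  have T_zc: "T (zc * f) = zc * T f" for f
    using R_zc[of f] by (simp add: T_def commutator_with_def algebra_simps)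
  have T_lin: "T (f + h) = T f + T h" "T (const_fun x * f) = const_fun x * T f" for f h x
    using P R by (simp_all add: T_def diff_ops_def c_linear_def algebra_simps)
  have T_poly: "T (subst_poly zc w * f) = subst_poly zc w * T f" for w f
  proof (induction w)
    case 0
    then show ?case using T_lin(2)[of 0 0] by (simp add: subst_poly_0 const_fun_simps)
  next
    case (pCons x w)
    have "subst_poly zc (pCons x w) * f = const_fun x * f + zc * (subst_poly zc w * f)"
      by (simp add: subst_poly_pCons algebra_simps)
    then have "T (subst_poly zc (pCons x w) * f) = const_fun x * T f + zc * (subst_poly zc w * T f)"
      by (simp only: T_lin T_zc pCons.IH)
    then show ?case by (simp add: subst_poly_pCons algebra_simps)
  qed
  have "zariski_open ?U" by (simp add: zariski_open_def)
  \<comment> \<open>The generator of O_n over X - q: the value of T on it determines T.\<close>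
  moreover have "lq ^ n \<in> O_sec (int n) ?U"
    using pq_nonzero const_fun_O_X[of 1]
    by (subst O_sec_twist[of b d]) (auto simp: const_fun_simps field_simps)
  ultimately have "P (lq ^ n) \<in> O_sec (int n) ?U" "R (lq ^ n) \<in> O_sec (int n) ?U"
    using P R by (auto simp: diff_ops_def)
  then have "T (lq ^ n) \<in> O_sec (int n) ?U" unfolding T_def by (rule O_sec_diff)
  then have "inverse lq ^ n * T (lq ^ n) \<in> O_X ?U"
    using pq_nonzero by (subst (asm) O_sec_twist[of b d]) auto
  then obtain u0 where "inverse lq ^ n * T (lq ^ n) = subst_poly zc u0" using O_X_minus_q by blast
  then have T1: "T (lq ^ n) = subst_poly zc u0 * lq ^ n" using pq_nonzero by (simp add: field_simps)
  have T: "T f = subst_poly zc u0 * f" for f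
  proof -
    obtain w1 w2 where w: "subst_poly zc w2 \<noteq> 0" "(inverse lq ^ n * f) * subst_poly zc w2 = subst_poly zc w1"
      using zc.rational by blast
    \<comment> \<open>Every function is a quotient of polynomials in zc times the generator, so
      linearity fixes T on it after clearing the denominator.\<close>
    then have e: "subst_poly zc w2 * f = subst_poly zc w1 * lq ^ n" using pq_nonzero by (simp add: field_simps)
    have "subst_poly zc w2 * T f = subst_poly zc w1 * T (lq ^ n)" using T_poly e by metis
    also have "\<dots> = subst_poly zc w2 * (subst_poly zc u0 * f)"
      unfolding T1 using e by (metis mult.left_commute)
    finally show ?thesis using w(1) by simp
  qed
  have "P f = (\<Sum>j<Suc N. subst_poly zc (case j of 0 \<Rightarrow> u0 | Suc i \<Rightarrow> v i) * (Fg ^^ j) f)" for f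
    using T[of f] unfolding T_def R_def sum.lessThan_Suc_shift by (simp add: algebra_simps)
  then show ?thesis by blast
qed

text \<open>Over the affine line X - q the twisted operators form the Weyl algebra in zc and
  \<open>Fg\<close>. The induction is on the order, which the commutator with zc lowers.\<close>

lemma diff_ops_normal_form:
  assumes "P \<in> diff_ops (int n) (- {pt b d})"
  shows "\<exists>N u. \<forall>f. P f = (\<Sum>j<N. subst_poly zc (u j) * (Fg ^^ j) f)"
proof -
  let ?U = "- {pt b d}"
  interpret zc: affine_coordinate zc "pt b d" by (rule affine_coordinate_zc)
  obtain k where "order_le k P" using assms by (auto simp: diff_ops_def)
  then show ?thesis using assms
  proof (induction k arbitrary: P)
    case 0
    then have "P (zc * f) = zc * P f" for f by (simp only: order_le_0_iff)
    then show ?case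
      using diff_ops_normal_form_step[OF 0(2), where N = 0 and u = "\<lambda>_. 0"]
      by (simp add: commutator_with_def)
  next
    case (Suc k)
    let ?Q = "commutator_with zc P"
    have Q: "?Q = (\<lambda>f. (P \<circ> mult_op zc) f + (mult_op (const_fun (-1)) \<circ> (mult_op zc \<circ> P)) f)"
      by (simp add: fun_eq_iff commutator_with_def mult_op_def const_fun_simps)
    have "?Q \<in> diff_ops (int n) ?U" unfolding Q
      using Suc.prems(2) by (intro diff_ops_add diff_ops_comp const_op_diff_ops mult_op_diff_ops zc_O_X) auto
    moreover have "order_le k ?Q" using Suc.prems(1) by simp
    ultimately obtain N u where "\<forall>f. ?Q f = (\<Sum>j<N. subst_poly zc (u j) * (Fg ^^ j) f)"
      using Suc.IH by blast
    then show ?case using diff_ops_normal_form_step[OF Suc.prems(2)] by blast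
  qed
qed

text \<open>The operator is zc d/dzc: regular off q, and vanishing at p because zc does. It is the
  logarithmic field against which the lattice is tested.\<close>

lemma mem_vector_fields:
  assumes "pt b d \<notin> U" "pt a c \<in> U"
  shows "first_order (zc * lq ^ 2) 0 \<in> vector_fields_vanishing_at (pt a c) U"
proof -
  have reg: "regular_at (lq ^ 2 * ratfun_deriv f) P" if "regular_at f P" "P \<noteq> pt b d" for f P
    using that pq_nonzero by (intro regular_at_deriv) auto
  have "first_order (zc * lq ^ 2) 0 \<in> diff_ops 0 U"
  proof (rule first_order_diff_opsI)
    fix W f assume W: "W \<subseteq> U" "f \<in> O_X W"
    have "zc \<in> O_X W" using W assms by (intro zc_O_X) auto
    moreover have "lq ^ 2 * ratfun_deriv f \<in> O_X W"
      unfolding O_X_iff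
    proof
      fix P assume "P \<in> W"
      then show "regular_at (lq ^ 2 * ratfun_deriv f) P"
        using W assms by (intro reg) (auto simp: O_X_iff)
    qed
    ultimately have "zc * (lq ^ 2 * ratfun_deriv f) \<in> O_X W" by (rule O_sec_mult)
    then show "first_order (zc * lq ^ 2) 0 f \<in> O_X W"
      by (simp add: first_order_def mult.assoc)
  qed
  moreover have "has_value (first_order (zc * lq ^ 2) 0 f) (pt a c) 0" if "f \<in> O_X U" for f
  proof -
    have "regular_at (lq ^ 2 * ratfun_deriv f) (pt a c)"
      using that assms by (intro reg pt_distinct) (simp add: O_X_iff)
    then obtain x where "has_value (lq ^ 2 * ratfun_deriv f) (pt a c) x" by (auto simp: regular_at_def)
    from has_value_mult[OF has_value_zc_0 this] show ?thesis by (simp add: first_order_def mult.assoc)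
  qed
  moreover have "first_order (zc * lq ^ 2) 0 (f * h) =
      first_order (zc * lq ^ 2) 0 f * h + f * first_order (zc * lq ^ 2) 0 h" for f h
    by (simp add: first_order_def ratfun_deriv_mult algebra_simps)
  ultimately show ?thesis by (simp add: vector_fields_vanishing_at_def)
qed

text \<open>In the trivialisation of O_n by lq^n the operator \<open>Fg\<close> becomes -
  d/dzc.\<close>

lemma Fg_lq_power: "Fg (lq ^ n * h) = - (lq ^ n * (lq ^ 2 * ratfun_deriv h))"
proof -
  have 1: "lq * ratfun_deriv (lq ^ n) = of_nat n * const_fun b * lq ^ n"
    unfolding ratfun_deriv_power ratfun_deriv_lform by (cases n) (simp_all add: mult_ac)
  have "Fg (lq ^ n * h) = - lq * (lq * ratfun_deriv (lq ^ n)) * h - lq ^ n * (lq ^ 2 * ratfun_deriv h)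
      + of_nat n * const_fun b * lq * (lq ^ n * h)"
    by (simp add: Fg_def first_order_def ratfun_deriv_mult algebra_simps power2_eq_square)
  also have "\<dots> = - (lq ^ n * (lq ^ 2 * ratfun_deriv h))" unfolding 1 by (simp add: algebra_simps)
  finally show ?thesis .
qed

lemma twist_op_vector_field:
  "twist_op n lq (first_order (zc * lq ^ 2) 0) f = - (zc * Fg f)"
proof -
  have "f = lq ^ n * (inverse lq ^ n * f)" using pq_nonzero by (simp add: field_simps)
  then have 1: "Fg f = - (lq ^ n * (lq ^ 2 * ratfun_deriv (inverse lq ^ n * f)))"
    using Fg_lq_power[of "inverse lq ^ n * f"] by (simp only: \<open>f = _\<close>[symmetric])
  show ?thesis unfolding 1 by (simp add: twist_op_def mult_op_def first_order_def mult_ac)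
qed

end

subsection \<open>Modules on a carrier set\<close>

text \<open>Sections form a subset of the ambient group and the axioms hold only on that subset, so
  linear algebra is developed relative to a carrier. The scalars will be complex numbers or
  polynomials in a coordinate.\<close>

locale cmodule =
  fixes C :: "'m::ab_group_add set" and sc :: "'r::comm_ring_1 \<Rightarrow> 'm \<Rightarrow> 'm"
  assumes zero_mem: "0 \<in> C"
    and add_mem: "x \<in> C \<Longrightarrow> y \<in> C \<Longrightarrow> x + y \<in> C"
    and sc_mem: "x \<in> C \<Longrightarrow> sc a x \<in> C"
    and sc_add_right: "x \<in> C \<Longrightarrow> y \<in> C \<Longrightarrow> sc a (x + y) = sc a x + sc a y"
    and sc_add_left: "x \<in> C \<Longrightarrow> sc (a + b) x = sc a x + sc b x"
    and sc_mult: "x \<in> C \<Longrightarrow> sc (a * b) x = sc a (sc b x)"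
    and sc_one: "x \<in> C \<Longrightarrow> sc 1 x = x"
begin

lemma sc_zero_right: "sc a 0 = 0"
  using sc_add_right[of 0 0 a] zero_mem by simp

lemma sc_zero_left: "x \<in> C \<Longrightarrow> sc 0 x = 0"
  using sc_add_left[of x 0 0] by simp

lemma sc_minus_left: "x \<in> C \<Longrightarrow> sc (- a) x = - sc a x"
  using sc_add_left[of x "- a" a] sc_zero_left by (simp add: eq_neg_iff_add_eq_0)

lemma minus_mem: "x \<in> C \<Longrightarrow> - x \<in> C"
  using sc_mem[of x "- 1"] sc_minus_left[of x 1] sc_one by simp

lemma diff_mem: "x \<in> C \<Longrightarrow> y \<in> C \<Longrightarrow> x - y \<in> C"
  using add_mem[of x "- y"] minus_mem by simp

lemma sc_minus_right: "x \<in> C \<Longrightarrow> sc a (- x) = - sc a x"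
  using sc_add_right[of x "- x" a] minus_mem sc_zero_right by (simp add: eq_neg_iff_add_eq_0 add.commute)

lemma sc_diff_right: "x \<in> C \<Longrightarrow> y \<in> C \<Longrightarrow> sc a (x - y) = sc a x - sc a y"
  using sc_add_right[of x "- y" a] sc_minus_right minus_mem by simp

lemma sc_diff_left: "x \<in> C \<Longrightarrow> sc (a - b) x = sc a x - sc b x"
  using sc_add_left[of x a "- b"] sc_minus_left by simp

lemma sc_commute: "x \<in> C \<Longrightarrow> sc a (sc b x) = sc b (sc a x)"
  by (simp flip: sc_mult add: mult.commute)

lemma sum_mem: "(\<And>i. i \<in> I \<Longrightarrow> f i \<in> C) \<Longrightarrow> sum f I \<in> C"
  by (induction I rule: infinite_finite_induct) (simp_all add: zero_mem add_mem)

lemma sc_sum: "(\<And>i. i \<in> I \<Longrightarrow> f i \<in> C) \<Longrightarrow> sc a (sum f I) = (\<Sum>i\<in>I. sc a (f i))"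
  by (induction I rule: infinite_finite_induct) (simp_all add: sc_zero_right sc_add_right sum_mem)

definition subm :: "'m set \<Rightarrow> bool" where
  "subm N \<longleftrightarrow> N \<subseteq> C \<and> 0 \<in> N \<and> (\<forall>x\<in>N. \<forall>y\<in>N. x + y \<in> N) \<and> (\<forall>a. \<forall>x\<in>N. sc a x \<in> N)"

lemma subm_C: "subm C"
  by (simp add: subm_def zero_mem add_mem sc_mem)

lemma subm_0: "subm {0}"
  by (simp add: subm_def zero_mem sc_zero_right)

lemma subm_subset: "subm N \<Longrightarrow> x \<in> N \<Longrightarrow> x \<in> C"
  and subm_zero: "subm N \<Longrightarrow> 0 \<in> N"
  and subm_add: "subm N \<Longrightarrow> x \<in> N \<Longrightarrow> y \<in> N \<Longrightarrow> x + y \<in> N"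
  and subm_sc: "subm N \<Longrightarrow> x \<in> N \<Longrightarrow> sc a x \<in> N"
  by (auto simp: subm_def)

lemma subm_minus: "subm N \<Longrightarrow> x \<in> N \<Longrightarrow> - x \<in> N"
  using subm_sc[of N x "- 1"] subm_subset[of N x] sc_minus_left[of x 1] sc_one by simp

lemma subm_diff: "subm N \<Longrightarrow> x \<in> N \<Longrightarrow> y \<in> N \<Longrightarrow> x - y \<in> N"
  using subm_add[of N x "- y"] subm_minus by simp

lemma subm_sum: "subm N \<Longrightarrow> (\<And>i. i \<in> I \<Longrightarrow> f i \<in> N) \<Longrightarrow> sum f I \<in> N"
  by (induction I rule: infinite_finite_induct) (simp_all add: subm_zero subm_add)

inductive_set spn :: "'m set \<Rightarrow> 'm set" for S where
  spn_zero: "0 \<in> spn S"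
| spn_base: "x \<in> S \<Longrightarrow> x \<in> spn S"
| spn_add: "x \<in> spn S \<Longrightarrow> y \<in> spn S \<Longrightarrow> x + y \<in> spn S"
| spn_sc: "x \<in> spn S \<Longrightarrow> sc a x \<in> spn S"

lemma spn_least: "subm N \<Longrightarrow> S \<subseteq> N \<Longrightarrow> spn S \<subseteq> N"
proof
  fix x assume *: "subm N" "S \<subseteq> N" "x \<in> spn S"
  from *(3) show "x \<in> N"
    by induction (use *(1,2) in \<open>auto intro: subm_zero subm_add subm_sc\<close>)
qed

lemma subm_spn: "S \<subseteq> C \<Longrightarrow> subm (spn S)"
  using spn_least[OF subm_C] by (auto simp: subm_def intro: spn.intros)

lemma spn_mono: "S \<subseteq> T \<Longrightarrow> spn S \<subseteq> spn T"
proof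
  fix x assume "S \<subseteq> T" "x \<in> spn S"
  from this(2) show "x \<in> spn T" by induction (use \<open>S \<subseteq> T\<close> in \<open>auto intro: spn.intros\<close>)
qed

lemma spn_insert:
  assumes "insert b S \<subseteq> C" "x \<in> spn (insert b S)"
  shows "\<exists>a y. y \<in> spn S \<and> x = sc a b + y"
proof -
  let ?N = "{sc a b + y |a y. y \<in> spn S}"
  have S: "subm (spn S)" "b \<in> C" using assms(1) by (auto intro: subm_spn)
  have "subm ?N"
    unfolding subm_def
  proof (intro conjI ballI allI subsetI)
    fix x assume "x \<in> ?N" then show "x \<in> C" using S by (auto intro!: add_mem sc_mem dest: subm_subset)
  next
    show "0 \<in> ?N" using S sc_zero_left[of b] subm_zero[of "spn S"] by (auto intro!: exI[of _ 0])
  next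
    fix x y assume "x \<in> ?N" "y \<in> ?N"
    then obtain a u a' u' where *: "x = sc a b + u" "y = sc a' b + u'" "u \<in> spn S" "u' \<in> spn S" by blast
    then have "x + y = sc (a + a') b + (u + u')" using S by (simp add: sc_add_left)
    then show "x + y \<in> ?N" using * spn_add by blast
  next
    fix r x assume "x \<in> ?N"
    then obtain a u where *: "x = sc a b + u" "u \<in> spn S" by blast
    then have "sc r x = sc (r * a) b + sc r u"
      using S by (simp add: sc_add_right sc_mem subm_subset sc_mult)
    then show "sc r x \<in> ?N" using * spn_sc by blast
  qed
  moreover have "insert b S \<subseteq> ?N"
  proof -
    have "b = sc 1 b + 0" "x = sc 0 b + x" for x using S by (simp_all add: sc_one sc_zero_left)
    then show ?thesis using spn_zero spn_base by blast
  qed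
  ultimately have "spn (insert b S) \<subseteq> ?N" by (rule spn_least)
  then show ?thesis using assms(2) by blast
qed

lemma spn_finite:
  assumes "finite S" "S \<subseteq> C" "x \<in> spn S"
  shows "\<exists>a. x = (\<Sum>b\<in>S. sc (a b) b)"
  using assms
proof (induction S arbitrary: x rule: finite_induct)
  case empty
  have "spn {} \<subseteq> {0}" by (rule spn_least[OF subm_0]) simp
  then show ?case using empty by auto
next
  case (insert b S)
  obtain a y where y: "y \<in> spn S" "x = sc a b + y" using spn_insert[of b S x] insert.prems by auto
  obtain a' where "y = (\<Sum>b\<in>S. sc (a' b) b)" using insert.IH[OF _ y(1)] insert.prems by auto
  moreover have "(\<Sum>c\<in>S. sc ((a'(b := a)) c) c) = (\<Sum>c\<in>S. sc (a' c) c)"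
    using insert.hyps by (intro sum.cong) auto
  ultimately have "x = (\<Sum>c\<in>insert b S. sc ((a'(b := a)) c) c)"
    using insert.hyps y by simp
  then show ?case by blast
qed

text \<open>An inclusion of N in \<open>sumset W (spn B)\<close> expresses that the classes of B
  span N modulo W, without forming a quotient.\<close>

definition sumset :: "'m set \<Rightarrow> 'm set \<Rightarrow> 'm set" where
  "sumset W S = {x + y |x y. x \<in> W \<and> y \<in> S}"

lemma sumset_I: "x \<in> W \<Longrightarrow> y \<in> S \<Longrightarrow> x + y \<in> sumset W S"
  by (auto simp: sumset_def)

lemma subm_sumset:
  assumes "subm W" "subm S" shows "subm (sumset W S)"
  unfolding subm_def
proof (intro conjI ballI allI subsetI)
  show "x \<in> C" if "x \<in> sumset W S" for x
    using that assms by (auto simp: sumset_def intro: add_mem subm_subset)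
  show "0 \<in> sumset W S" using sumset_I[of 0 W 0 S] assms subm_zero by simp
next
  fix x y assume "x \<in> sumset W S" "y \<in> sumset W S"
  then obtain u v u' v' where *: "x = u + v" "y = u' + v'" "u \<in> W" "u' \<in> W" "v \<in> S" "v' \<in> S"
    by (auto simp: sumset_def)
  have "x + y = (u + u') + (v + v')" using * by simp
  moreover have "u + u' \<in> W" "v + v' \<in> S" using * assms by (auto intro: subm_add)
  ultimately show "x + y \<in> sumset W S" using sumset_I by metis
next
  fix a x assume "x \<in> sumset W S"
  then show "sc a x \<in> sumset W S"
    using assms by (auto simp: sumset_def) (metis sc_add_right subm_sc subm_subset)
qed

lemma sumset_superset: "subm W \<Longrightarrow> subm S \<Longrightarrow> W \<subseteq> sumset W S \<and> S \<subseteq> sumset W S"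
  using sumset_I[of _ W 0 S] sumset_I[of 0 W _ S] subm_zero by force

lemma sumset_least: "subm N \<Longrightarrow> W \<subseteq> N \<Longrightarrow> S \<subseteq> N \<Longrightarrow> sumset W S \<subseteq> N"
  by (auto simp: sumset_def intro: subm_add)

lemma spn_range_nat:
  assumes "\<And>i. f i \<in> C" "x \<in> spn (range f)"
  shows "\<exists>N a. x = (\<Sum>i<N. sc (a i) (f (i::nat)))"
  using assms(2)
proof induction
  case spn_zero
  then show ?case by (intro exI[of _ 0]) simp
next
  case (spn_base x)
  then obtain i where i: "x = f i" by auto
  have "(\<Sum>j<Suc i. sc (if j = i then 1 else 0) (f j)) = x"
    using assms(1) by (simp add: sc_one sc_zero_left i)
  then show ?case by metis
next
  case (spn_add x y)
  then obtain N a M a' where *: "x = (\<Sum>i<N. sc (a i) (f i))" "y = (\<Sum>i<M. sc (a' i) (f i))" by blast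
  define c where "c = (\<lambda>i. (if i < N then a i else 0) + (if i < M then a' i else 0))"
  have "(\<Sum>i<max N M. sc (if i < N then a i else 0) (f i)) = x"
    unfolding * by (rule sum.mono_neutral_cong_right) (auto simp: assms(1) sc_zero_left)
  moreover have "(\<Sum>i<max N M. sc (if i < M then a' i else 0) (f i)) = y"
    unfolding * by (rule sum.mono_neutral_cong_right) (auto simp: assms(1) sc_zero_left)
  ultimately have "x + y = (\<Sum>i<max N M. sc (c i) (f i))"
    by (simp add: c_def sc_add_left assms(1) sum.distrib)
  then show ?case by blast
next
  case (spn_sc x r)
  then obtain N a where "x = (\<Sum>i<N. sc (a i) (f i))" by blast
  then have "sc r x = (\<Sum>i<N. sc ((\<lambda>i. r * a i) i) (f i))"
    by (simp add: sc_sum sc_mem assms(1) sc_mult)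
  then show ?case by metis
qed

definition lin_op :: "('m \<Rightarrow> 'm) \<Rightarrow> bool" where
  "lin_op P \<longleftrightarrow> (\<forall>x\<in>C. P x \<in> C) \<and> (\<forall>x\<in>C. \<forall>y\<in>C. P (x + y) = P x + P y) \<and> (\<forall>a. \<forall>x\<in>C. P (sc a x) = sc a (P x))"

lemma lin_op_mem: "lin_op P \<Longrightarrow> x \<in> C \<Longrightarrow> P x \<in> C"
  and lin_op_add: "lin_op P \<Longrightarrow> x \<in> C \<Longrightarrow> y \<in> C \<Longrightarrow> P (x + y) = P x + P y"
  and lin_op_sc: "lin_op P \<Longrightarrow> x \<in> C \<Longrightarrow> P (sc a x) = sc a (P x)"
  by (auto simp: lin_op_def)

lemma lin_op_zero: "lin_op P \<Longrightarrow> P 0 = 0"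
  using lin_op_add[of P 0 0] zero_mem by simp

lemma lin_op_minus: "lin_op P \<Longrightarrow> x \<in> C \<Longrightarrow> P (- x) = - P x"
  using lin_op_add[of P x "- x"] minus_mem[of x] lin_op_zero[of P]
  by (simp add: eq_neg_iff_add_eq_0 add.commute)

lemma lin_op_diff: "lin_op P \<Longrightarrow> x \<in> C \<Longrightarrow> y \<in> C \<Longrightarrow> P (x - y) = P x - P y"
  using lin_op_add[of P x "- y"] lin_op_minus minus_mem by simp

lemma lin_op_sum: "lin_op P \<Longrightarrow> (\<And>i. i \<in> I \<Longrightarrow> f i \<in> C) \<Longrightarrow> P (sum f I) = (\<Sum>i\<in>I. P (f i))"
  by (induction I rule: infinite_finite_induct) (simp_all add: lin_op_zero lin_op_add sum_mem)

lemma lin_op_funpow: "lin_op P \<Longrightarrow> lin_op (P ^^ k)"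
  by (induction k) (simp_all add: lin_op_def)

lemma lin_op_spn:
  assumes P: "lin_op P" and S: "S \<subseteq> C" and N: "subm N" and "\<And>s. s \<in> S \<Longrightarrow> P s \<in> N" and "x \<in> spn S"
  shows "P x \<in> N"
proof -
  have "spn S \<subseteq> {x\<in>C. P x \<in> N}"
  proof (rule spn_least)
    show "subm {x\<in>C. P x \<in> N}"
      using N by (auto simp: subm_def[of "Collect _"] zero_mem add_mem sc_mem lin_op_zero[OF P]
        lin_op_add[OF P] lin_op_sc[OF P] intro: subm_zero subm_add subm_sc)
  qed (use assms in auto)
  then show ?thesis using assms by blast
qed

end

locale cvector_space = cmodule C sc for C :: "'m::ab_group_add set" and sc :: "complex \<Rightarrow> 'm \<Rightarrow> 'm"
begin

lemma sc_cancel: "x \<in> C \<Longrightarrow> a \<noteq> 0 \<Longrightarrow> sc a x \<in> N \<Longrightarrow> subm N \<Longrightarrow> x \<in> N"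
  using subm_sc[of N "sc a x" "inverse a"] by (simp flip: sc_mult add: sc_one)

text \<open>The spanning set is found inside N, which allows its vectors to be lifted through a map
  with image N. In the induction, one vector of N with a nonzero coefficient at b serves to
  eliminate b from all others.\<close>

lemma subm_of_finite_span:
  assumes "finite B" "B \<subseteq> C" "subm N" "N \<subseteq> spn B"
  shows "\<exists>B'. finite B' \<and> B' \<subseteq> N \<and> N \<subseteq> spn B'"
  using assms
proof (induction B arbitrary: N rule: finite_induct)
  case empty
  then show ?case by (intro exI[of _ "{}"]) simp
next
  case (insert b B)
  have B: "subm (spn B)" "b \<in> C" using insert.prems by (auto intro: subm_spn)
  let ?N = "N \<inter> spn B"
  have "subm ?N" using insert.prems(2) B(1) by (auto simp: subm_def)
  then obtain B' where B': "finite B'" "B' \<subseteq> ?N" "?N \<subseteq> spn B'"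
    using insert.IH[of ?N] insert.prems by auto
  show ?case
  proof (cases "N \<subseteq> spn B")
    case True
    then show ?thesis using B' by (intro exI[of _ B']) auto
  next
    case False
    then obtain x where x: "x \<in> N" "x \<notin> spn B" by blast
    then obtain a y where y: "y \<in> spn B" "x = sc a b + y"
      using spn_insert[of b B x] insert.prems by auto
    have "a \<noteq> 0" using x y B by (auto simp: sc_zero_left)
    have C: "x \<in> C" "y \<in> C" using x y insert.prems B subm_subset by blast+
    have "N \<subseteq> spn (insert x B')"
    proof
      fix k assume k: "k \<in> N"
      then obtain a' y' where y': "y' \<in> spn B" "k = sc a' b + y'"
        using spn_insert[of b B k] insert.prems by auto
      define r where "r = a' / a"
      have "k - sc r x = y' - sc r y"
        using y y' B C \<open>a \<noteq> 0\<close> by (simp add: sc_add_right sc_mem r_def flip: sc_mult)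
      moreover have "y' - sc r y \<in> spn B" using y y' B by (intro subm_diff subm_sc)
      moreover have "k - sc r x \<in> N" using k x insert.prems by (intro subm_diff subm_sc)
      ultimately have "k - sc r x \<in> spn B'" using B' by auto
      then have "k - sc r x \<in> spn (insert x B')" using spn_mono[of B' "insert x B'"] by blast
      moreover have "sc r x \<in> spn (insert x B')" by (intro spn_sc spn_base) simp
      ultimately show "k \<in> spn (insert x B')" using spn_add by fastforce
    qed
    then show ?thesis using B' x by (intro exI[of _ "insert x B'"]) auto
  qed
qed

text \<open>Steinitz exchange modulo a growing subspace: v becomes trivial modulo W', so its
  expansion in B, nonzero modulo W, expresses one b through the others. This is the drop of
  dimension that makes the filtration finite.\<close>

lemma exchange:
  assumes "subm W" "subm W'" "W \<subseteq> W'" "finite B" "B \<subseteq> C"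
    and v: "v \<in> sumset W (spn B)" "v \<notin> W" "v \<in> W'"
  shows "\<exists>b\<in>B. sumset W' (spn B) \<subseteq> sumset W' (spn (B - {b}))"
proof -
  obtain w y where wy: "w \<in> W" "y \<in> spn B" "v = w + y" using v by (auto simp: sumset_def)
  obtain a where a: "y = (\<Sum>b\<in>B. sc (a b) b)" using spn_finite[OF assms(4,5) wy(2)] by blast
  obtain b where b: "b \<in> B" "a b \<noteq> 0"
  proof (rule ccontr)
    assume "\<not> thesis"
    then have "y = 0" unfolding a using assms(5) that by (intro sum.neutral) (metis sc_zero_left subsetD)
    then show False using wy v by simp
  qed
  define y' where "y' = (\<Sum>c\<in>B - {b}. sc (a c) c)"
  have S: "subm (spn (B - {b}))" using assms by (intro subm_spn) auto
  have y': "y' \<in> spn (B - {b})" unfolding y'_def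
    by (intro subm_sum[OF S] spn_sc spn_base)
  have y: "y = sc (a b) b + y'" unfolding a y'_def using assms b by (simp add: sum.remove)
  have N: "subm (sumset W' (spn (B - {b})))" using assms S by (intro subm_sumset)
  have sub: "W' \<subseteq> sumset W' (spn (B - {b}))" "spn (B - {b}) \<subseteq> sumset W' (spn (B - {b}))"
    using sumset_superset[OF assms(2) S] by auto
  have "sc (a b) b = v - w - y'" using wy y by simp
  also have "\<dots> \<in> sumset W' (spn (B - {b}))"
    using v wy assms(3) y' sub by (intro subm_diff[OF N]) auto
  finally have "b \<in> sumset W' (spn (B - {b}))"
    using sc_cancel[of b "a b"] b assms N by auto
  then have "B \<subseteq> sumset W' (spn (B - {b}))" using sub spn_base[of _ "B - {b}"] by blast
  then have "spn B \<subseteq> sumset W' (spn (B - {b}))" using N by (intro spn_least)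
  then show ?thesis using b sub N by (intro bexI[of _ b] sumset_least) auto
qed

end

subsection \<open>Operators with generalised eigenvectors\<close>

locale weight_operator = cvector_space C sc
  for C :: "'m::ab_group_add set" and sc :: "complex \<Rightarrow> 'm \<Rightarrow> 'm" +
  fixes H :: "'m \<Rightarrow> 'm"
  assumes H_lin: "lin_op H"
begin

text \<open>The product of the operators H - c over a list, since repeated factors must be allowed.
  That some list kills x says that x is a sum of generalised eigenvectors of H.\<close>

definition kill :: "complex list \<Rightarrow> 'm \<Rightarrow> 'm" where
  "kill cs x = foldr (\<lambda>c y. H y - sc c y) cs x"

lemma kill_simps: "kill [] x = x" "kill (c # cs) x = H (kill cs x) - sc c (kill cs x)"
  by (simp_all add: kill_def)

lemma kill_append: "kill (cs @ ds) x = kill cs (kill ds x)"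
  by (simp add: kill_def)

lemma kill_lin: "lin_op (kill cs)"
proof (induction cs)
  case Nil
  then show ?case by (simp add: lin_op_def kill_simps)
next
  case (Cons c cs)
  show ?case unfolding lin_op_def kill_simps
    using lin_op_mem[OF Cons] lin_op_add[OF Cons] lin_op_sc[OF Cons]
      lin_op_mem[OF H_lin] lin_op_add[OF H_lin] lin_op_sc[OF H_lin]
    by (auto simp: diff_mem sc_mem sc_add_right sc_diff_right sc_commute algebra_simps)
qed

lemma kill_H: "x \<in> C \<Longrightarrow> kill cs (H x) = H (kill cs x)"
proof (induction cs)
  case (Cons c cs)
  have "kill cs x \<in> C" using lin_op_mem[OF kill_lin Cons.prems] .
  then show ?case using Cons H_lin
    by (simp add: kill_simps lin_op_diff lin_op_mem lin_op_sc sc_mem)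
qed (simp add: kill_simps)

lemma kill_commute: "x \<in> C \<Longrightarrow> kill cs (kill ds x) = kill ds (kill cs x)"
proof (induction ds)
  case (Cons d ds)
  have "kill ds x \<in> C" using lin_op_mem[OF kill_lin Cons.prems] .
  then show ?case using Cons kill_lin H_lin
    by (simp add: kill_simps lin_op_diff lin_op_mem sc_mem kill_H lin_op_sc)
qed (simp add: kill_simps)

lemma kill_mono: "x \<in> C \<Longrightarrow> kill cs x = 0 \<Longrightarrow> kill (ds @ cs) x = 0 \<and> kill (cs @ ds) x = 0"
  using kill_commute[of x cs ds] by (simp add: kill_append lin_op_zero[OF kill_lin])

lemma kill_eigenvector:
  "x \<in> C \<Longrightarrow> H x = sc \<mu> x \<Longrightarrow> kill cs x = sc (\<Prod>c\<leftarrow>cs. \<mu> - c) x"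
proof (induction cs)
  case Nil
  then show ?case by (simp add: kill_simps sc_one)
next
  case (Cons c cs)
  then show ?case using H_lin
    by (simp add: kill_simps lin_op_sc sc_commute[of x _ \<mu>]) (simp add: sc_diff_left sc_mult sc_mem)
qed

lemma kill_shift:
  assumes Z: "lin_op Z" and HZ: "\<And>x. x \<in> C \<Longrightarrow> H (Z x) = Z (H x) + sc r (Z x)"
  shows "x \<in> C \<Longrightarrow> kill (map (\<lambda>c. c + r) cs) (Z x) = Z (kill cs x)"
proof (induction cs)
  case Nil
  then show ?case by (simp add: kill_simps)
next
  case (Cons c cs)
  let ?y = "kill cs x"
  have y: "?y \<in> C" using lin_op_mem[OF kill_lin] Cons.prems .
  then show ?case using Cons Z HZ[OF y] H_lin
    by (simp add: kill_simps lin_op_diff lin_op_mem lin_op_sc sc_mem sc_add_left)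
qed

lemma kill_common:
  assumes "finite S" "S \<subseteq> C" "\<And>s. s \<in> S \<Longrightarrow> \<exists>cs. kill cs s = 0"
  shows "\<exists>cs. \<forall>s\<in>S. kill cs s = 0"
  using assms
proof (induction S rule: finite_induct)
  case (insert s S)
  obtain cs where "\<forall>s\<in>S. kill cs s = 0" using insert by auto
  moreover obtain ds where "kill ds s = 0" using insert.prems by blast
  ultimately have "\<forall>t\<in>insert s S. kill (cs @ ds) t = 0"
    using kill_mono insert.prems(1) by (metis insert_iff subsetD)
  then show ?case by blast
qed simp

end

text \<open>The operators \<open>Z\<close>, \<open>F\<close> generate a copy of the Weyl algebra, of which \<open>H\<close> is the Euler
  operator up to an affine substitution.\<close>

locale weyl_module = weight_operator C sc H
  for C :: "'m::ab_group_add set" and sc :: "complex \<Rightarrow> 'm \<Rightarrow> 'm" and H :: "'m \<Rightarrow> 'm" +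
  fixes Z F :: "'m \<Rightarrow> 'm" and r :: complex
  assumes Z_lin: "lin_op Z" and F_lin: "lin_op F"
    and FZ: "x \<in> C \<Longrightarrow> F (Z x) = Z (F x) - x"
    and H_eq: "x \<in> C \<Longrightarrow> H x = sc (- 2) (Z (F x)) - sc r x"
begin

lemma HZ: "x \<in> C \<Longrightarrow> H (Z x) = Z (H x) + sc 2 (Z x)"
proof -
  assume x: "x \<in> C"
  note m = lin_op_mem[OF Z_lin] lin_op_mem[OF F_lin]
  have "H (Z x) = sc (- 2) (Z (Z (F x)) - Z x) - sc r (Z x)"
    using x by (simp add: H_eq m FZ lin_op_diff[OF Z_lin])
  also have "\<dots> = sc (- 2) (Z (Z (F x))) + sc 2 (Z x) - sc r (Z x)"
    using x by (simp add: m sc_diff_right sc_minus_left)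
  also have "\<dots> = Z (H x) + sc 2 (Z x)"
    using x by (simp add: H_eq m lin_op_diff[OF Z_lin] lin_op_sc[OF Z_lin] sc_mem)
  finally show ?thesis .
qed

lemma HF: "x \<in> C \<Longrightarrow> H (F x) = F (H x) + sc (- 2) (F x)"
proof -
  assume x: "x \<in> C"
  note m = lin_op_mem[OF Z_lin] lin_op_mem[OF F_lin]
  have "F (H x) = sc (- 2) (F (Z (F x))) - sc r (F x)"
    using x by (simp add: H_eq m lin_op_diff[OF F_lin] lin_op_sc[OF F_lin] sc_mem)
  also have "\<dots> = sc (- 2) (Z (F (F x))) - sc (- 2) (F x) - sc r (F x)"
    using x by (simp add: FZ m sc_diff_right)
  finally show ?thesis using x by (simp add: H_eq m)
qed

lemma H_funpow:
  assumes P: "lin_op P" and "\<And>x. x \<in> C \<Longrightarrow> H (P x) = P (H x) + sc e (P x)"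
  shows "x \<in> C \<Longrightarrow> H ((P ^^ i) x) = (P ^^ i) (H x) + sc (of_nat i * e) ((P ^^ i) x)"
proof (induction i)
  case 0
  then show ?case by (simp add: sc_zero_left)
next
  case (Suc i)
  have m: "(P ^^ i) x \<in> C" "(P ^^ i) (H x) \<in> C"
    using Suc.prems lin_op_mem[OF lin_op_funpow[OF P]] lin_op_mem[OF H_lin] by auto
  then have "H ((P ^^ Suc i) x) = P (H ((P ^^ i) x)) + sc e (P ((P ^^ i) x))"
    using assms(2) by simp
  also have "\<dots> = P ((P ^^ i) (H x)) + sc (of_nat i * e) (P ((P ^^ i) x)) + sc e (P ((P ^^ i) x))"
    using Suc m P by (simp add: lin_op_add lin_op_sc sc_mem)
  also have "\<dots> = P ((P ^^ i) (H x)) + sc (of_nat (Suc i) * e) (P ((P ^^ i) x))"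
    using sc_add_left[of "P ((P ^^ i) x)" "of_nat i * e" e] m P
    by (simp add: lin_op_mem algebra_simps)
  finally show ?case by simp
qed

text \<open>The module is spanned by the powers of Z and of F applied to a finite set with H-stable
  span, since the mixed products Z F and F Z act through H. The i-th power shifts all roots of the
  annihilating product by 2i or - 2i, so only finitely many i can produce the eigenvalue
  \<mu>.\<close>

lemma finite_eigenspace:
  assumes S: "finite S" "S \<subseteq> C"
    and gen: "\<And>N. subm N \<Longrightarrow> S \<subseteq> N \<Longrightarrow> (\<And>x. x \<in> N \<Longrightarrow> Z x \<in> N) \<Longrightarrow> (\<And>x. x \<in> N \<Longrightarrow> F x \<in> N) \<Longrightarrow> N = C"
    and loc: "\<And>s. s \<in> S \<Longrightarrow> \<exists>cs. kill cs s = 0"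
  shows "\<exists>B. finite B \<and> B \<subseteq> C \<and> {x \<in> C. H x = sc \<mu> x} \<subseteq> spn B"
proof -
  obtain ks where ks: "\<forall>s\<in>S. kill ks s = 0" using kill_common[OF S loc] by blast
  \<comment> \<open>All tails of the common annihilating product, applied to the generators. H sends
    each such vector to the next one plus a multiple of itself, so the span is H-stable; the empty
    tail gives the generators.\<close>
  define Y where "Y = (\<lambda>(s, j). kill (drop j ks) s) ` (S \<times> {..length ks})"
  have Y: "finite Y" "Y \<subseteq> C" using S lin_op_mem[OF kill_lin] by (auto simp: Y_def)
  have SY: "S \<subseteq> Y" unfolding Y_def by (force simp: kill_simps intro: image_eqI[of _ _ "(_, length ks)"])
  have YC: "y \<in> C" if "y \<in> Y" for y using Y that by blast
  have killY: "kill ks y = 0" if yY: "y \<in> Y" for y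
  proof -
    obtain s j where sj: "s \<in> S" "y = kill (drop j ks) s" using yY by (auto simp: Y_def)
    then show ?thesis using kill_commute[of s ks "drop j ks"] S ks lin_op_zero[OF kill_lin] by auto
  qed
  have HY: "H y \<in> spn Y" if yY: "y \<in> Y" for y
  proof -
    obtain s j where sj: "s \<in> S" "j \<le> length ks" "y = kill (drop j ks) s" using yY by (auto simp: Y_def)
    show ?thesis
    proof (cases j)
      case 0
      then have "y = 0" using sj ks by simp
      then show ?thesis using lin_op_zero[OF H_lin] spn_zero by simp
    next
      case (Suc i)
      then have "drop i ks = ks ! i # drop j ks" using sj by (simp add: Cons_nth_drop_Suc)
      then have "H y = kill (drop i ks) s + sc (ks ! i) y" using sj by (simp add: kill_simps)
      moreover have "kill (drop i ks) s \<in> Y" using sj Suc by (auto simp: Y_def intro!: image_eqI[of _ _ "(s, i)"])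
      ultimately show ?thesis using yY by (simp add: spn_add spn_sc spn_base)
    qed
  qed
  define G where "G = (\<lambda>I. {(P ^^ i) y |P i y. P \<in> {Z, F} \<and> i \<in> I \<and> y \<in> Y})"
  have Pl: "lin_op P" if "P \<in> {Z, F}" for P using that Z_lin F_lin by auto
  have Pm: "(P ^^ i) x \<in> C" if "P \<in> {Z, F}" "x \<in> C" for P i x
    using lin_op_mem[OF lin_op_funpow[OF Pl]] that by blast
  have GC: "G I \<subseteq> C" for I using Pm YC by (auto simp: G_def)
  have Gspn: "subm (spn (G I))" for I using GC by (rule subm_spn)
  have HP: "\<exists>e. \<forall>x\<in>C. H ((P ^^ i) x) = (P ^^ i) (H x) + sc e ((P ^^ i) x)" if "P \<in> {Z, F}" for P i
    using that H_funpow[OF Z_lin HZ] H_funpow[OF F_lin HF] by blast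
  have HG1: "H ((P ^^ i) y) \<in> spn (G I)" if PiY: "P \<in> {Z, F}" "i \<in> I" "y \<in> Y" for P i y I
  proof -
    obtain e where e: "H ((P ^^ i) y) = (P ^^ i) (H y) + sc e ((P ^^ i) y)" using HP[OF PiY(1)] YC[OF PiY(3)] by blast
    have "(P ^^ i) (H y) \<in> spn (G I)"
      by (rule lin_op_spn[OF lin_op_funpow[OF Pl[OF that(1)]] Y(2) Gspn _ HY[OF that(3)]])
        (use that in \<open>auto simp: G_def intro!: spn_base\<close>)
    moreover have "(P ^^ i) y \<in> spn (G I)" using that by (auto simp: G_def intro!: spn_base)
    ultimately show ?thesis unfolding e by (intro spn_add spn_sc)
  qed
  have HG: "H x \<in> spn (G I)" if "x \<in> spn (G I)" for x I
    by (rule lin_op_spn[OF H_lin GC Gspn _ that]) (use HG1 in \<open>auto simp: G_def\<close>)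
  \<comment> \<open>By \<open>H_eq\<close>, Z F is - (H + r) / 2, and H preserves the span for every
    index set I.\<close>
  have ZF: "Z (F x) \<in> spn (G I)" if "x \<in> spn (G I)" for x I
  proof -
    have x: "x \<in> C" "Z (F x) \<in> C" using that subm_subset[OF Gspn] lin_op_mem[OF Z_lin] lin_op_mem[OF F_lin] by auto
    then have "sc (- 2) (Z (F x)) = H x + sc r x" by (simp add: H_eq)
    also have "\<dots> \<in> spn (G I)" using that HG by (intro spn_add spn_sc)
    finally show ?thesis using sc_cancel x Gspn by (metis neg_equal_0_iff_equal zero_neq_numeral)
  qed
  have FZ': "F (Z x) \<in> spn (G I)" if "x \<in> spn (G I)" for x I
    using FZ[of x] ZF[OF that] that subm_diff[OF Gspn] subm_subset[OF Gspn] by metis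
  have 1: "(P ^^ i) y \<in> spn (G UNIV)" if "P \<in> {Z, F}" "y \<in> Y" for P i y
    using that by (auto simp: G_def intro!: spn_base)
  have "spn (G UNIV) = C"
  proof (rule gen[OF Gspn])
    show "S \<subseteq> spn (G UNIV)"
    proof
      fix s assume "s \<in> S"
      then show "s \<in> spn (G UNIV)" using 1[of Z s 0] SY by auto
    qed
    show "Z x \<in> spn (G UNIV)" if "x \<in> spn (G UNIV)" for x
    proof (rule lin_op_spn[OF Z_lin GC Gspn _ that])
      fix s assume "s \<in> G UNIV"
      then obtain P i y where s: "s = (P ^^ i) y" "P \<in> {Z, F}" "y \<in> Y" by (auto simp: G_def)
      show "Z s \<in> spn (G UNIV)"
      proof (cases "P = Z \<or> i = 0")
        case True
        then have "Z s = (Z ^^ Suc i) y" using s by auto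
        then show ?thesis using 1[of Z y "Suc i"] s by simp
      next
        case False
        then obtain j where "i = Suc j" by (cases i) auto
        then have "Z s = Z (F ((F ^^ j) y))" using s False by auto
        then show ?thesis using ZF 1[of F y j] s by auto
      qed
    qed
    show "F x \<in> spn (G UNIV)" if "x \<in> spn (G UNIV)" for x
    proof (rule lin_op_spn[OF F_lin GC Gspn _ that])
      fix s assume "s \<in> G UNIV"
      then obtain P i y where s: "s = (P ^^ i) y" "P \<in> {Z, F}" "y \<in> Y" by (auto simp: G_def)
      show "F s \<in> spn (G UNIV)"
      proof (cases "P = F \<or> i = 0")
        case True
        then have "F s = (F ^^ Suc i) y" using s by auto
        then show ?thesis using 1[of F y "Suc i"] s by simp
      next
        case False
        then obtain j where "i = Suc j" by (cases i) auto
        then have "F s = F (Z ((Z ^^ j) y))" using s False by auto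
        then show ?thesis using FZ' 1[of Z y j] s by auto
      qed
    qed
  qed
  \<comment> \<open>The exponents for which \<mu> is a root of the annihilating product shifted in
    one direction or the other.\<close>
  define bad where "bad = {i::nat. \<exists>c\<in>set ks. \<mu> = c + of_nat i * 2 \<or> \<mu> = c + of_nat i * (- 2)}"
  have 2: "bad \<subseteq> (\<Union>c\<in>set ks. {i. \<mu> = c + of_nat i * 2} \<union> {i. \<mu> = c + of_nat i * (- 2)})"
    by (auto simp: bad_def)
  have 3: "finite {i::nat. \<mu> = c + of_nat i * e}" if "e \<noteq> 0" for c e :: complex
  proof (rule finite_subset)
    show "{i::nat. \<mu> = c + of_nat i * e} \<subseteq> {i. of_nat i = (\<mu> - c) / e}"
      using that by auto
    have "inj (of_nat :: nat \<Rightarrow> complex)" by (rule inj_of_nat)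
    then have "finite (of_nat -` {(\<mu> - c) / e})" by (intro finite_vimageI) auto
    then show "finite {i::nat. of_nat i = (\<mu> - c) / e}" by (simp add: vimage_def)
  qed
  have "finite bad"
    by (rule finite_subset[OF 2]) (use 3[of 2] 3[of "- 2"] in simp)
  then obtain I where I: "\<forall>i\<in>bad. i < I" using finite_nat_set_iff_bounded by blast
  have splitI: "\<exists>u0 u1 qs. u = u0 + u1 \<and> u0 \<in> spn (G {..<I}) \<and> u1 \<in> C \<and> kill qs u1 = 0 \<and> \<mu> \<notin> set qs"
    if "u = u0 + u1" "u0 \<in> spn (G {..<I})" "u1 \<in> C" "kill qs u1 = 0" "\<mu> \<notin> set qs" for u u0 u1 qs
    using that by blast
  \<comment> \<open>Modulo the span of the finitely many vectors with small exponent, every vector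
    is killed by a product of factors H - c with c \<noteq> \<mu>.\<close>
  have split: "\<exists>u0 u1 qs. u = u0 + u1 \<and> u0 \<in> spn (G {..<I}) \<and> u1 \<in> C \<and> kill qs u1 = 0 \<and> \<mu> \<notin> set qs"
    if "u \<in> spn (G UNIV)" for u
    using that
  proof induction
    case spn_zero
    show ?case by (rule splitI[of 0 0 0 "[]"]) (simp_all add: spn.spn_zero zero_mem kill_simps)
  next
    case (spn_base x)
    then obtain P i y where s: "x = (P ^^ i) y" "P \<in> {Z, F}" "y \<in> Y" by (auto simp: G_def)
    show ?case
    proof (cases "i < I")
      case True
      then have "x \<in> spn (G {..<I})" using s by (auto simp: G_def intro!: spn.spn_base)
      then show ?thesis by (intro splitI[of x x 0 "[]"]) (simp_all add: zero_mem kill_simps)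
    next
      case False
      then have "i \<notin> bad" using I by auto
      obtain e where e: "e \<in> {2, - 2}" "\<And>x. x \<in> C \<Longrightarrow> H ((P ^^ i) x) = (P ^^ i) (H x) + sc (of_nat i * e) ((P ^^ i) x)"
        using s(2) H_funpow[OF Z_lin HZ] H_funpow[OF F_lin HF] by blast
      define qs where "qs = map (\<lambda>c. c + of_nat i * e) ks"
      have "kill qs x = 0" unfolding s(1) qs_def
        using kill_shift[OF lin_op_funpow[OF Pl[OF s(2)]] e(2) YC[OF s(3)]] killY[OF s(3)]
          lin_op_zero[OF lin_op_funpow[OF Pl[OF s(2)]]] by metis
      moreover have "\<mu> \<notin> set qs" using \<open>i \<notin> bad\<close> e(1) by (auto simp: qs_def bad_def)
      moreover have "x \<in> C" using s Pm YC by blast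
      ultimately show ?thesis by (intro splitI[of x 0 x qs]) (simp_all add: spn.spn_zero)
    qed
  next
    case (spn_add x y)
    then obtain u0 u1 qs v0 v1 rs where *: "x = u0 + u1" "u0 \<in> spn (G {..<I})" "u1 \<in> C" "kill qs u1 = 0" "\<mu> \<notin> set qs"
      "y = v0 + v1" "v0 \<in> spn (G {..<I})" "v1 \<in> C" "kill rs v1 = 0" "\<mu> \<notin> set rs" by blast
    have "kill (qs @ rs) (u1 + v1) = 0"
      using kill_mono[OF *(3,4), of rs] kill_mono[OF *(8,9), of qs] * by (simp add: lin_op_add[OF kill_lin])
    then show ?case using *
      by (intro splitI[of "x + y" "u0 + v0" "u1 + v1" "qs @ rs"]) (auto intro: spn.spn_add add_mem)
  next
    case (spn_sc x a)
    then obtain u0 u1 qs where *: "x = u0 + u1" "u0 \<in> spn (G {..<I})" "u1 \<in> C" "kill qs u1 = 0" "\<mu> \<notin> set qs" by blast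
    have "sc a x = sc a u0 + sc a u1" using * subm_subset[OF Gspn] by (simp add: sc_add_right)
    then show ?case using *
      by (intro splitI[of "sc a x" "sc a u0" "sc a u1" qs])
        (auto intro: spn.spn_sc sc_mem simp: lin_op_sc[OF kill_lin] sc_zero_right)
  qed
  have "{x \<in> C. H x = sc \<mu> x} \<subseteq> spn (G {..<I})"
  proof clarify
    fix u assume u: "u \<in> C" "H u = sc \<mu> u"
    then obtain u0 u1 qs where *: "u = u0 + u1" "u0 \<in> spn (G {..<I})" "u1 \<in> C" "kill qs u1 = 0" "\<mu> \<notin> set qs"
      using split \<open>spn (G UNIV) = C\<close> by blast
    have u0: "u0 \<in> C" using * subm_subset[OF Gspn] by blast
    have "kill qs u = kill qs u0" using * u0 by (simp add: lin_op_add[OF kill_lin])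
    moreover have "kill cs u0 \<in> spn (G {..<I})" for cs
      by (induction cs) (use * HG in \<open>auto simp: kill_simps intro!: subm_diff[OF Gspn] spn_sc\<close>)
    \<comment> \<open>On an eigenvector the product acts as a nonzero scalar, while it sends the
      vector into the finite span; so the vector was there already.\<close>
    ultimately have "sc (\<Prod>c\<leftarrow>qs. \<mu> - c) u \<in> spn (G {..<I})" using kill_eigenvector[OF u] by metis
    moreover have "(\<Prod>c\<leftarrow>qs. \<mu> - c) \<noteq> 0" using *(5) by (auto simp: prod_list_zero_iff)
    ultimately show "u \<in> spn (G {..<I})" using sc_cancel u(1) Gspn by blast
  qed
  moreover have "finite (G {..<I})"
  proof -
    have "G {..<I} = (\<lambda>(P, i, y). (P ^^ i) y) ` ({Z, F} \<times> {..<I} \<times> Y)" by (force simp: G_def)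
    then show ?thesis using Y by simp
  qed
  ultimately show ?thesis using GC by blast
qed

end

subsection \<open>Modules over a polynomial ring with a derivation\<close>

text \<open>The minus sign in \<open>E_sc\<close> reflects that E acts as - d/dw on the coordinate
  w.\<close>

locale poly_connection = cmodule C sc
  for C :: "'m::ab_group_add set" and sc :: "complex poly \<Rightarrow> 'm \<Rightarrow> 'm" +
  fixes E :: "'m \<Rightarrow> 'm"
  assumes E_mem: "x \<in> C \<Longrightarrow> E x \<in> C"
    and E_add: "x \<in> C \<Longrightarrow> y \<in> C \<Longrightarrow> E (x + y) = E x + E y"
    and E_sc: "x \<in> C \<Longrightarrow> E (sc p x) = sc p (E x) - sc (pderiv p) x"
    and fin_gen: "\<exists>G. finite G \<and> G \<subseteq> C \<and> C \<subseteq> spn G"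
begin

definition indep :: "'m set \<Rightarrow> bool" where
  "indep B \<longleftrightarrow> (\<forall>p. (\<Sum>b\<in>B. sc (p b) b) = 0 \<longrightarrow> (\<forall>b\<in>B. p b = 0))"

lemma E_zero: "E 0 = 0"
  using E_add[of 0 0] zero_mem by simp

text \<open>A maximal independent subset B of the generators: maximality gives each generator a
  nonzero multiple in the span of B, and q is the product of these multipliers. So B is a basis over
  C(t), with the single denominator q.\<close>

lemma generic_basis:
  "\<exists>B q. finite B \<and> B \<subseteq> C \<and> indep B \<and> q \<noteq> 0 \<and> (\<forall>x\<in>C. \<exists>p. sc q x = (\<Sum>b\<in>B. sc (p b) b))"
proof -
  obtain G where G: "finite G" "G \<subseteq> C" "C \<subseteq> spn G" using fin_gen by blast
  have "indep {}" by (simp add: indep_def)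
  moreover have "\<forall>B. B \<subseteq> G \<and> indep B \<longrightarrow> card B < Suc (card G)"
    using G card_mono less_Suc_eq_le by blast
  ultimately obtain B where B: "B \<subseteq> G" "indep B" and max: "\<And>B'. B' \<subseteq> G \<Longrightarrow> indep B' \<Longrightarrow> card B' \<le> card B"
    using ex_has_greatest_nat[of "\<lambda>B. B \<subseteq> G \<and> indep B" "{}" card "Suc (card G)"] by auto
  have fB: "finite B" "B \<subseteq> C" using B G finite_subset by auto
  let ?S = "\<lambda>p. (\<Sum>b\<in>B. sc (p b) b)"
  have lin1: "?S (\<lambda>b. p b + p' b) = ?S p + ?S p'" for p p'
    using fB by (simp add: sc_add_left subset_iff flip: sum.distrib)
  have lin2: "?S (\<lambda>b. r * p b) = sc r (?S p)" for r p
    using fB by (subst sc_sum) (auto simp: sc_mem sc_mult subset_iff)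
  have "\<exists>q p. q \<noteq> 0 \<and> sc q e = ?S p" if e: "e \<in> G" for e
  proof (cases "e \<in> B")
    case True
    have "?S (\<lambda>b. if b = e then 1 else 0) = (\<Sum>b\<in>B. if b = e then e else 0)"
      using fB by (intro sum.cong) (auto simp: sc_one sc_zero_left subset_iff)
    then have "sc 1 e = ?S (\<lambda>b. if b = e then 1 else 0)" using True fB by (auto simp: sc_one)
    then show ?thesis by (metis zero_neq_one)
  next
    case False
    have "\<not> indep (insert e B)"
      using max[of "insert e B"] e B(1) False fB(1) by auto
    then obtain p where p: "(\<Sum>b\<in>insert e B. sc (p b) b) = 0" "\<exists>b\<in>insert e B. p b \<noteq> 0"
      unfolding indep_def by blast
    have 0: "sc (p e) e + ?S p = 0" using p(1) False fB by simp
    have pe: "p e \<noteq> 0"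
    proof
      assume "p e = 0"
      then have "?S p = 0" using 0 e G sc_zero_left[of e] by auto
      then show False using B(2) p(2) \<open>p e = 0\<close> unfolding indep_def by blast
    qed
    have SC: "?S p \<in> C" using fB by (intro sum_mem sc_mem) auto
    have "?S (\<lambda>b. - 1 * p b) = - ?S p"
      unfolding lin2 sc_minus_left[OF SC] sc_one[OF SC] ..
    moreover have "sc (p e) e = - ?S p" using 0 by (simp only: eq_neg_iff_add_eq_0)
    ultimately have "sc (p e) e = ?S (\<lambda>b. - 1 * p b)" by simp
    then show ?thesis by (intro exI conjI) (rule pe)
  qed
  then obtain q where q: "\<And>e. e \<in> G \<Longrightarrow> q e \<noteq> 0 \<and> (\<exists>p. sc (q e) e = ?S p)" by metis
  define Q where "Q = prod q G"
  have "Q \<noteq> 0" using q G by (simp add: Q_def)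
  have memI: "x \<in> {x\<in>C. \<exists>p. sc Q x = ?S p}" if "sc Q x = ?S p" "x \<in> C" for x p
    using that(2) exI[of "\<lambda>p. sc Q x = ?S p", OF that(1)] by simp
  have "C \<subseteq> {x\<in>C. \<exists>p. sc Q x = ?S p}"
  proof (rule order_trans[OF G(3)], rule spn_least)
    show "G \<subseteq> {x\<in>C. \<exists>p. sc Q x = ?S p}"
    proof
      fix e assume e: "e \<in> G"
      then obtain p where "sc (q e) e = ?S p" using q by blast
      then have "sc Q e = ?S (\<lambda>b. prod q (G - {e}) * p b)"
        using e G unfolding lin2 Q_def by (subst prod.remove[OF G(1) e]) (auto simp: mult.commute[of "q e"] sc_mult)
      then show "e \<in> {x\<in>C. \<exists>p. sc Q x = ?S p}" using e G by (intro memI) auto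
    qed
    show "subm {x\<in>C. \<exists>p. sc Q x = ?S p}"
      unfolding subm_def
    proof (intro conjI ballI allI)
      have "sc Q 0 = ?S (\<lambda>_. 0)" using fB by (simp add: sc_zero_right sc_zero_left subset_iff)
      then show "0 \<in> {x\<in>C. \<exists>p. sc Q x = ?S p}" using zero_mem by (rule memI)
    next
      fix x y assume xy: "x \<in> {x\<in>C. \<exists>p. sc Q x = ?S p}" "y \<in> {x\<in>C. \<exists>p. sc Q x = ?S p}"
      then obtain p p' where "sc Q x = ?S p" "sc Q y = ?S p'" by blast
      then have "sc Q (x + y) = ?S (\<lambda>b. p b + p' b)" using xy unfolding lin1 by (simp add: sc_add_right)
      then show "x + y \<in> {x\<in>C. \<exists>p. sc Q x = ?S p}" using xy by (intro memI add_mem) simp_all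
    next
      fix r x assume x: "x \<in> {x\<in>C. \<exists>p. sc Q x = ?S p}"
      then obtain p where "sc Q x = ?S p" by blast
      then have "sc Q (sc r x) = ?S (\<lambda>b. r * p b)" using x unfolding lin2 by (simp add: sc_commute[of x Q])
      then show "sc r x \<in> {x\<in>C. \<exists>p. sc Q x = ?S p}" using x by (intro memI sc_mem) simp_all
    qed auto
  qed
  then show ?thesis using fB B \<open>Q \<noteq> 0\<close> by blast
qed

text \<open>If \<open>q\<close> kills the torsion submodule, so does its derivative; descend to a constant.\<close>

lemma torsion_free:
  assumes "x \<in> C" "sc f x = 0" "f \<noteq> 0"
  shows "x = 0"
proof -
  obtain B q where B: "finite B" "B \<subseteq> C" "indep B" "q \<noteq> 0" and q: "\<forall>x\<in>C. \<exists>p. sc q x = (\<Sum>b\<in>B. sc (p b) b)"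
    using generic_basis by blast
  define T where "T = {x\<in>C. \<exists>f. f \<noteq> 0 \<and> sc f x = 0}"
  have qT: "sc q x = 0" if "x \<in> T" for x
  proof -
    obtain f where f: "x \<in> C" "f \<noteq> 0" "sc f x = 0" using \<open>x \<in> T\<close> by (auto simp: T_def)
    obtain p where p: "sc q x = (\<Sum>b\<in>B. sc (p b) b)" using q f by blast
    have "(\<Sum>b\<in>B. sc (f * p b) b) = sc f (sc q x)"
      unfolding p using B by (subst sc_sum) (auto simp: sc_mem sc_mult subset_iff)
    also have "\<dots> = 0" using f by (simp add: sc_commute[of x f] sc_zero_right)
    finally have "\<forall>b\<in>B. f * p b = 0" using B(3) unfolding indep_def by (elim allE impE)
    then have "\<forall>b\<in>B. p b = 0" using f by simp
    then show ?thesis unfolding p using B by (intro sum.neutral) (auto simp: sc_zero_left subset_iff)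
  qed
  have ET: "E x \<in> T" if x: "x \<in> T" for x
  proof -
    obtain f where f: "x \<in> C" "f \<noteq> 0" "sc f x = 0" using x by (auto simp: T_def)
    have "sc f (E x) = sc (pderiv f) x" using E_sc[OF f(1), of f] f(3) E_zero by simp
    then have "sc (f * f) (E x) = 0"
      using f E_mem by (simp add: sc_mult sc_commute[of x f] sc_zero_right)
    moreover have "f * f \<noteq> 0" using f by simp
    ultimately show ?thesis using f E_mem unfolding T_def by blast
  qed
  obtain r where r: "r \<noteq> 0" "\<forall>x\<in>T. sc r x = 0"
    and min: "\<And>r'. r' \<noteq> 0 \<and> (\<forall>x\<in>T. sc r' x = 0) \<Longrightarrow> degree r \<le> degree r'"
    using ex_has_least_nat[of "\<lambda>r. r \<noteq> 0 \<and> (\<forall>x\<in>T. sc r x = 0)" q degree] qT B(4) by blast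
  have "sc (pderiv r) x = 0" if "x \<in> T" for x
  proof -
    have "x \<in> C" using that by (simp add: T_def)
    from E_sc[OF this, of r] show ?thesis using r ET[OF that] that E_zero by simp
  qed
  then have "pderiv r = 0 \<or> degree r \<le> degree (pderiv r)" using min by blast
  then have "degree r = 0" by (auto simp: pderiv_eq_0_iff degree_pderiv)
  then obtain a where a: "r = [:a:]" by (metis degree_eq_zeroE)
  have "x \<in> T" using assms by (auto simp: T_def)
  then have "sc ([:inverse a:] * r) x = 0"
    using r(2) sc_mult[OF assms(1), of "[:inverse a:]" r] sc_zero_right by simp
  moreover have "[:inverse a:] * r = 1" using a r by (simp add: pCons_one)
  ultimately show ?thesis using sc_one assms(1) by simp
qed

end

subsection \<open>Modules over \<open>sl\<^sub>2\<close> with a fixed Casimir value\<close>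

text \<open>The Casimir relation is (H + 1)^2 + 4 F E = l^2, with \<lambda> for l; positivity of l
  keeps the two square roots of l^2 apart.\<close>

locale sl2_module = cvector_space C sc
  for C :: "'m::ab_group_add set" and sc :: "complex \<Rightarrow> 'm \<Rightarrow> 'm" +
  fixes E F H :: "'m \<Rightarrow> 'm" and l :: nat
  assumes l_pos: "0 < l"
    and E_lin: "lin_op E" and F_lin: "lin_op F" and H_lin: "lin_op H"
    and EF: "x \<in> C \<Longrightarrow> E (F x) = F (E x) + H x"
    and HE: "x \<in> C \<Longrightarrow> H (E x) = E (H x) + sc 2 (E x)"
    and HF: "x \<in> C \<Longrightarrow> H (F x) = F (H x) + sc (- 2) (F x)"
    and casimir: "x \<in> C \<Longrightarrow> H (H x) + sc 2 (H x) + x + sc 4 (F (E x)) = sc (of_nat l ^ 2) x"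
begin

lemma op_mem: "x \<in> C \<Longrightarrow> E x \<in> C" "x \<in> C \<Longrightarrow> F x \<in> C" "x \<in> C \<Longrightarrow> H x \<in> C"
  using E_lin F_lin H_lin by (simp_all add: lin_op_mem)

definition inv_sub :: "'m set \<Rightarrow> bool" where
  "inv_sub W \<longleftrightarrow> subm W \<and> (\<forall>x\<in>W. E x \<in> W \<and> F x \<in> W \<and> H x \<in> W)"

lemma inv_sub_subm: "inv_sub W \<Longrightarrow> subm W"
  and inv_sub_op: "inv_sub W \<Longrightarrow> x \<in> W \<Longrightarrow> E x \<in> W \<and> F x \<in> W \<and> H x \<in> W"
  by (auto simp: inv_sub_def)

lemma inv_sub_0: "inv_sub {0}"
  by (auto simp: inv_sub_def subm_0 lin_op_zero[OF E_lin] lin_op_zero[OF F_lin] lin_op_zero[OF H_lin])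

lemma inv_sub_funpow: "inv_sub W \<Longrightarrow> x \<in> W \<Longrightarrow> (E ^^ k) x \<in> W \<and> (F ^^ k) x \<in> W"
  by (induction k) (auto simp: inv_sub_op)

text \<open>Vectors whose classes modulo W are killed by E; \<open>prim_weight\<close> adds the
  weight condition and so describes the highest weight vectors of the quotient. For invariant W both
  contain W, so dimensions are counted modulo W.\<close>

definition prim :: "'m set \<Rightarrow> 'm set" where
  "prim W = {x \<in> C. E x \<in> W}"

definition prim_weight :: "complex \<Rightarrow> 'm set \<Rightarrow> 'm set" where
  "prim_weight \<mu> W = {x \<in> C. E x \<in> W \<and> H x - sc \<mu> x \<in> W}"

text \<open>Modulo W the Casimir relation reads (H + 1)^2 = l^2 on such x, and l \<noteq> - l. The
  sign s only selects which of the two parts is named x1.\<close>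

lemma prim_split:
  assumes W: "inv_sub W" and x: "x \<in> prim W" and s: "s = 1 \<or> s = - 1"
  shows "\<exists>x1 x2. x = x1 + x2 \<and> x1 \<in> prim_weight (s * of_nat l - 1) W \<and> x2 \<in> prim_weight (- s * of_nat l - 1) W"
proof -
  have xC: "x \<in> C" "E x \<in> W" using x by (auto simp: prim_def)
  define L where "L = s * (of_nat l :: complex)"
  have L0: "L \<noteq> 0" and L2: "L ^ 2 = of_nat l ^ 2" using s l_pos by (auto simp: L_def power2_eq_square)
  have S: "subm W" using W by (rule inv_sub_subm)
  have cas: "H (H x) + sc 2 (H x) + x - sc (L ^ 2) x \<in> W"
  proof -
    have "H (H x) + sc 2 (H x) + x = sc (L ^ 2) x - sc 4 (F (E x))"
      using casimir[OF xC(1)] unfolding L2 by (simp only: eq_diff_eq)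
    then have "H (H x) + sc 2 (H x) + x - sc (L ^ 2) x = - sc 4 (F (E x))" by simp
    then show ?thesis using W xC S by (auto intro!: subm_minus[OF S] subm_sc[OF S] dest: inv_sub_op)
  qed
  \<comment> \<open>For K = l or K = - l this is (H + 1 + K) / (2 K), the projection onto the
    eigenspace H + 1 = K.\<close>
  define part where "part = (\<lambda>K. sc (1 / (2 * K)) (H x + x + sc K x))"
  have part: "part K \<in> prim_weight (K - 1) W" if K: "K \<noteq> 0" "K ^ 2 = L ^ 2" for K
  proof -
    define y where "y = H x + x + sc K x"
    have y: "y \<in> C" using xC by (simp add: y_def op_mem add_mem sc_mem)
    have "E y = (H (E x) - sc 2 (E x)) + E x + sc K (E x)"
      using xC HE[OF xC(1)] by (simp add: y_def op_mem add_mem sc_mem lin_op_add[OF E_lin] lin_op_sc[OF E_lin])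
    then have Ey: "E y \<in> W"
      using xC inv_sub_op[OF W xC(2)] by (auto intro!: subm_add[OF S] subm_diff[OF S] subm_sc[OF S])
    have "H y - sc (K - 1) y = H (H x) + sc 2 (H x) + x - sc (K ^ 2) x"
      using xC by (simp add: y_def op_mem add_mem sc_mem lin_op_add[OF H_lin] lin_op_sc[OF H_lin]
        sc_add_right sc_diff_left sc_one sc_mult power2_eq_square sc_add_left[of _ 1 1, simplified])
    then have Hy: "H y - sc (K - 1) y \<in> W" using cas K(2) by simp
    have "E (sc c y) = sc c (E y)" "H (sc c y) - sc (K - 1) (sc c y) = sc c (H y - sc (K - 1) y)" for c
      using y by (simp_all add: lin_op_sc[OF E_lin] lin_op_sc[OF H_lin] sc_diff_right op_mem sc_mem sc_commute[of y c])
    then show ?thesis using y Ey Hy unfolding part_def y_def[symmetric] prim_weight_def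
      by (auto intro: sc_mem subm_sc[OF S])
  qed
  have "part L + part (- L) = x"
  proof -
    have "part L + part (- L) = sc (1 / (2 * L)) (sc L x + sc L x)"
      using xC by (simp add: part_def op_mem add_mem sc_mem sc_add_right sc_minus_left minus_mem sc_minus_right sc_diff_right)
    also have "sc L x + sc L x = sc (2 * L) x" using xC sc_add_left[of x L L] by simp
    finally show ?thesis using xC L0 by (simp add: sc_one flip: sc_mult)
  qed
  moreover have "part L \<in> prim_weight (L - 1) W" "part (- L) \<in> prim_weight (- L - 1) W"
    using L0 by (intro part; simp)+
  ultimately show ?thesis unfolding L_def by (metis mult_minus_left)
qed

text \<open>The corrected vector y - t splits into two weights modulo W. Its component of the other
  weight has both weights modulo W', hence lies in W'. So y comes, modulo W', from a highest weight
  vector modulo W.\<close>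

lemma prim_weight_transfer:
  assumes W: "inv_sub W" "inv_sub W'" "W \<subseteq> W'" and s: "s = 1 \<or> s = - 1"
    and y: "y \<in> prim_weight (s * of_nat l - 1) W'" "t \<in> W'" "y - t \<in> prim W"
  shows "y \<in> sumset W' (prim_weight (s * of_nat l - 1) W)"
proof -
  have S: "subm W'" using W by (intro inv_sub_subm)
  obtain k1 k2 where k: "y - t = k1 + k2" "k1 \<in> prim_weight (s * of_nat l - 1) W" "k2 \<in> prim_weight (- s * of_nat l - 1) W"
    using prim_split[OF W(1) y(3) s] by blast
  let ?m = "s * of_nat l - 1" and ?m' = "- s * of_nat l - 1"
  have C: "k1 \<in> C" "k2 \<in> C" "t \<in> C" "y \<in> C" using k y subm_subset[OF S] by (auto simp: prim_weight_def)
  have e: "y = t + k1 + k2" using k(1) by (simp add: algebra_simps)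
  have "H k2 - sc ?m k2 = (H y - sc ?m y) - (H t - sc ?m t) - (H k1 - sc ?m k1)"
    unfolding e using C by (simp add: lin_op_add[OF H_lin] add_mem sc_add_right)
  also have "\<dots> \<in> W'"
  proof -
    have 1: "H y - sc ?m y \<in> W'" and 2: "H k1 - sc ?m k1 \<in> W'"
      using y(1) k(2) W(3) by (auto simp: prim_weight_def)
    have 3: "H t - sc ?m t \<in> W'"
      using inv_sub_op[OF W(2) y(2)] y(2) by (intro subm_diff[OF S] subm_sc[OF S]) auto
    show ?thesis by (rule subm_diff[OF S subm_diff[OF S 1 3] 2])
  qed
  finally have 1: "H k2 - sc ?m k2 \<in> W'" .
  have 2: "H k2 - sc ?m' k2 \<in> W'" using k(3) W(3) by (auto simp: prim_weight_def)
  have "sc (?m - ?m') k2 = (H k2 - sc ?m' k2) - (H k2 - sc ?m k2)"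
    unfolding sc_diff_left[OF C(2), of ?m ?m'] by simp
  also have "\<dots> \<in> W'" by (rule subm_diff[OF S 2 1])
  finally have "k2 \<in> W'" using sc_cancel[OF C(2) _ _ S, of "?m - ?m'"] s l_pos by auto
  then have "t + k2 \<in> W'" using y(2) S by (intro subm_add)
  moreover have "y = (t + k2) + k1" unfolding e by simp
  ultimately show ?thesis using k(2) sumset_I by metis
qed

end

section \<open>Adjoining one highest weight vector\<close>

locale sl2_step = sl2_module C sc E F H l
  for C :: "'m::ab_group_add set" and sc :: "complex \<Rightarrow> 'm \<Rightarrow> 'm" and E F H l +
  fixes W :: "'m set" and v :: 'm and \<mu> :: complex
  assumes W: "inv_sub W" and v: "v \<in> C" "v \<notin> W" and Ev: "E v \<in> W" and Hv: "H v - sc \<mu> v \<in> W"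
begin

lemma S: "subm W"
  using W by (rule inv_sub_subm)

definition "f i = (F ^^ i) v"

lemma f_mem: "f i \<in> C"
  using v lin_op_mem[OF lin_op_funpow[OF F_lin]] by (simp add: f_def)

lemma F_f: "F (f i) = f (Suc i)" and f_0: "f 0 = v"
  by (simp_all add: f_def)

lemma H_f: "H (f i) - sc (\<mu> - 2 * of_nat i) (f i) \<in> W"
proof (induction i)
  case 0
  then show ?case using Hv by (simp add: f_0)
next
  case (Suc i)
  let ?m = "\<mu> - 2 * of_nat i"
  have "H (f (Suc i)) - sc (\<mu> - 2 * of_nat (Suc i)) (f (Suc i)) = F (H (f i)) + sc (- 2) (f (Suc i)) - sc (?m + (- 2)) (f (Suc i))"
    using HF[OF f_mem[of i]] by (simp add: F_f algebra_simps)
  also have "\<dots> = F (H (f i)) - sc ?m (F (f i))"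
    unfolding sc_add_left[OF f_mem] by (simp add: F_f)
  also have "\<dots> = F (H (f i) - sc ?m (f i))"
    using f_mem by (simp add: lin_op_diff[OF F_lin] lin_op_sc[OF F_lin] op_mem sc_mem)
  finally show ?case using inv_sub_op[OF W Suc] by simp
qed

text \<open>The usual formula for E F^i v, modulo W. At i = 0 the index i - 1 is truncated, which is
  harmless as the coefficient is 0.\<close>

lemma E_f: "E (f i) - sc (of_nat i * (\<mu> - of_nat i + 1)) (f (i - 1)) \<in> W"
proof (induction i)
  case 0
  then show ?case using Ev by (simp add: f_0 sc_zero_left v)
next
  case (Suc i)
  let ?c = "of_nat i * (\<mu> - of_nat i + 1)"
  have 1: "sc ?c (F (f (i - 1))) = sc ?c (f i)"
    by (cases i) (simp_all add: sc_zero_left f_mem F_f)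
  have "E (f (Suc i)) = F (E (f i)) + H (f i)" using EF[OF f_mem[of i]] by (simp add: F_f)
  moreover have c: "of_nat (Suc i) * (\<mu> - of_nat (Suc i) + 1) = ?c + (\<mu> - 2 * of_nat i)"
    by (simp add: algebra_simps)
  ultimately have "E (f (Suc i)) - sc (of_nat (Suc i) * (\<mu> - of_nat (Suc i) + 1)) (f (Suc i - 1)) =
    (F (E (f i)) - sc ?c (F (f (i - 1)))) + (H (f i) - sc (\<mu> - 2 * of_nat i) (f i))"
    unfolding c 1 by (simp add: sc_add_left f_mem)
  also have "F (E (f i)) - sc ?c (F (f (i - 1))) = F (E (f i) - sc ?c (f (i - 1)))"
    using f_mem by (simp add: lin_op_diff[OF F_lin] lin_op_sc[OF F_lin] op_mem sc_mem)
  finally show ?case using inv_sub_op[OF W Suc] H_f by (auto intro: subm_add[OF S])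
qed

lemma E_f_Suc: "E (f (Suc i)) - sc (of_nat (Suc i) * (\<mu> - of_nat i)) (f i) \<in> W"
  using E_f[of "Suc i"] by simp

definition "W1 = sumset W (spn (range f))"

lemma spn_f: "subm (spn (range f))"
  using f_mem by (intro subm_spn) auto

lemma subm_W1: "subm W1" and W_W1: "W \<subseteq> W1" and f_W1: "f i \<in> W1" and v_W1: "v \<in> W1"
proof -
  show "subm W1" unfolding W1_def by (intro subm_sumset S spn_f)
  show "W \<subseteq> W1" using sumset_superset[OF S spn_f] by (simp add: W1_def)
  show f: "f i \<in> W1" for i using sumset_superset[OF S spn_f] spn_base[of "f i" "range f"] by (auto simp: W1_def)
  show "v \<in> W1" using f[of 0] by (simp add: f_0)
qed

lemma inv_sub_W1: "inv_sub W1"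
proof -
  have "P x \<in> W1" if P: "lin_op P" "\<And>x. x \<in> W \<Longrightarrow> P x \<in> W" "\<And>i. P (f i) \<in> W1" and x: "x \<in> W1" for P x
  proof -
    obtain w y where wy: "w \<in> W" "y \<in> spn (range f)" "x = w + y" using x by (auto simp: W1_def sumset_def)
    have "P y \<in> W1"
      by (rule lin_op_spn[OF P(1) _ subm_W1 _ wy(2)]) (use f_mem P(3) in auto)
    moreover have "P w \<in> W1" using P(2) wy(1) W_W1 by blast
    ultimately show ?thesis
      using wy P(1) subm_subset[OF S] subm_subset[OF spn_f] by (simp add: lin_op_add subm_add[OF subm_W1])
  qed
  moreover have rec: "u \<in> W1" if "u - sc a (f j) \<in> W" for u a j
    using subm_add[OF subm_W1 subsetD[OF W_W1 that] subm_sc[OF subm_W1 f_W1, of a j]] by simp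
  moreover have "E (f i) \<in> W1" "H (f i) \<in> W1" for i
    using rec[OF E_f] rec[OF H_f] .
  moreover have "F (f i) \<in> W1" for i by (simp add: F_f f_W1)
  ultimately show ?thesis
    unfolding inv_sub_def using subm_W1 E_lin F_lin H_lin inv_sub_op[OF W] by simp
qed

text \<open>The scalar by which E^k F^k acts on v modulo W. As long as it is nonzero, E^k brings F^k
  v back to v.\<close>

definition "kap k = (\<Prod>j<k. of_nat (Suc j) * (\<mu> - of_nat j))"

lemma funpow_E_f: "(E ^^ k) (f k) - sc (kap k) v \<in> W"
proof (induction k)
  case 0
  then show ?case using S by (simp add: f_0 kap_def sc_one v subm_zero)
next
  case (Suc k)
  let ?c = "of_nat (Suc k) * (\<mu> - of_nat k)"
  have l: "lin_op (E ^^ k)" using E_lin by (rule lin_op_funpow)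
  have "(E ^^ Suc k) (f (Suc k)) - sc (kap (Suc k)) v =
     (E ^^ k) (E (f (Suc k)) - sc ?c (f k)) + sc ?c ((E ^^ k) (f k) - sc (kap k) v)"
    using f_mem lin_op_mem[OF l] v
    by (simp add: funpow_swap1 lin_op_diff[OF l] lin_op_sc[OF l] op_mem sc_mem sc_diff_right kap_def
        mult.commute[of "prod _ _"] sc_mult del: of_nat_Suc)
  then show ?case using Suc inv_sub_funpow[OF W E_f_Suc] by (auto intro: subm_add[OF S] subm_sc[OF S])
qed

lemma funpow_E_f_less: "i < k \<Longrightarrow> (E ^^ k) (f i) \<in> W"
proof -
  assume "i < k"
  then obtain j where k: "k = Suc j + i" using less_imp_Suc_add by (metis add.commute add_Suc)
  have "(E ^^ i) (f i) = ((E ^^ i) (f i) - sc (kap i) v) + sc (kap i) v" by simp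
  then have "E ((E ^^ i) (f i)) = E ((E ^^ i) (f i) - sc (kap i) v) + sc (kap i) (E v)"
    using v f_mem lin_op_mem[OF lin_op_funpow[OF E_lin]]
    by (metis diff_mem lin_op_add[OF E_lin] lin_op_sc[OF E_lin] sc_mem)
  then have "E ((E ^^ i) (f i)) \<in> W"
    using inv_sub_op[OF W funpow_E_f] Ev by (auto intro: subm_add[OF S] subm_sc[OF S])
  then have "(E ^^ j) (E ((E ^^ i) (f i))) \<in> W" using inv_sub_funpow[OF W] by blast
  then show ?thesis unfolding k funpow_add by (simp add: funpow_swap1)
qed

text \<open>E^N annihilates the lower terms modulo W and takes the top one to a nonzero multiple of
  v.\<close>

lemma top_coefficient:
  assumes R: "inv_sub R" "W \<subseteq> R" and "(\<Sum>i<Suc N. sc (c i) (f i)) \<in> R" "c N \<noteq> 0" "kap N \<noteq> 0"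
  shows "v \<in> R"
proof -
  have SR: "subm R" using R by (intro inv_sub_subm)
  have l: "lin_op (E ^^ N)" using E_lin by (rule lin_op_funpow)
  have EfC: "(E ^^ N) (f i) \<in> C" for i using lin_op_mem[OF l f_mem] .
  have "(E ^^ N) (\<Sum>i<Suc N. sc (c i) (f i)) = (\<Sum>i<Suc N. sc (c i) ((E ^^ N) (f i)))"
    using f_mem by (simp add: lin_op_sum[OF l] lin_op_add[OF l] lin_op_sc[OF l] sc_mem sum_mem)
  also have "\<dots> = (\<Sum>i<N. sc (c i) ((E ^^ N) (f i))) + sc (c N) ((E ^^ N) (f N) - sc (kap N) v) + sc (c N * kap N) v"
    using EfC v by (simp add: sc_diff_right sc_mem sc_mult)
  finally have "sc (c N * kap N) v = (E ^^ N) (\<Sum>i<Suc N. sc (c i) (f i)) -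
     ((\<Sum>i<N. sc (c i) ((E ^^ N) (f i))) + sc (c N) ((E ^^ N) (f N) - sc (kap N) v))" by (simp add: algebra_simps)
  also have "\<dots> \<in> R"
  proof -
    have 1: "(E ^^ N) (f i) \<in> R" if "i \<in> {..<N}" for i using that funpow_E_f_less R(2) by auto
    have 2: "(E ^^ N) (f N) - sc (kap N) v \<in> R" using funpow_E_f R(2) by auto
    have 3: "(E ^^ N) (\<Sum>i<Suc N. sc (c i) (f i)) \<in> R" using inv_sub_funpow[OF R(1) assms(3)] by blast
    show ?thesis using 1
      by (intro subm_diff[OF SR, OF 3] subm_add[OF SR _ subm_sc[OF SR 2]] subm_sum[OF SR] subm_sc[OF SR])
  qed
  finally show ?thesis using sc_cancel[OF v(1) _ _ SR, of "c N * kap N"] assms(4,5) by simp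
qed

text \<open>E is inverted term by term on the string of the F^i v, dividing by the coefficients (i +
  1) (\<mu> - i), which the hypothesis keeps from vanishing.\<close>

lemma lift_E:
  assumes "\<And>i. i < N \<Longrightarrow> \<mu> \<noteq> of_nat i"
  shows "\<exists>t\<in>W1. E t - (\<Sum>i<N. sc (c i) (f i)) \<in> W"
proof -
  define d where "d = (\<lambda>i. c i / (of_nat (Suc i) * (\<mu> - of_nat i)))"
  have d: "d i * (of_nat (Suc i) * (\<mu> - of_nat i)) = c i" if "i < N" for i
    using assms[OF that] by (simp add: d_def del: of_nat_Suc)
  define t where "t = (\<Sum>i<N. sc (d i) (f (Suc i)))"
  have "E t - (\<Sum>i<N. sc (c i) (f i)) = (\<Sum>i<N. sc (d i) (E (f (Suc i)) - sc (of_nat (Suc i) * (\<mu> - of_nat i)) (f i)))"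
  proof -
    have "E t = (\<Sum>i<N. sc (d i) (E (f (Suc i))))"
      unfolding t_def using f_mem by (simp add: lin_op_sum[OF E_lin] lin_op_sc[OF E_lin] sc_mem)
    moreover have "sc (d i) (E (f (Suc i)) - sc (of_nat (Suc i) * (\<mu> - of_nat i)) (f i)) =
       sc (d i) (E (f (Suc i))) - sc (c i) (f i)" if "i < N" for i
      using f_mem d[OF that] by (simp add: sc_diff_right op_mem sc_mem flip: sc_mult)
    ultimately show ?thesis by (simp add: sum_subtractf)
  qed
  also have "\<dots> \<in> W" using E_f_Suc by (intro subm_sum[OF S] subm_sc[OF S])
  finally have "E t - (\<Sum>i<N. sc (c i) (f i)) \<in> W" .
  moreover have "t \<in> W1" unfolding t_def by (intro subm_sum[OF subm_W1] subm_sc[OF subm_W1 f_W1])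
  ultimately show ?thesis by (rule bexI)
qed

lemma W1_cases:
  assumes "x \<in> W1"
  obtains w N c where "w \<in> W" "x = w + (\<Sum>i<N. sc (c i) (f i))"
proof -
  obtain w y where wy: "w \<in> W" "y \<in> spn (range f)" "x = w + y" using assms by (auto simp: W1_def sumset_def)
  obtain N c where "y = (\<Sum>i<N. sc (c i) (f i))" using spn_range_nat[OF f_mem wy(2)] by (elim exE)
  then show ?thesis using that[of w c N] wy by simp
qed

text \<open>In the Verma case E is surjective on W1 modulo W. Subtracting a preimage of E y
  therefore turns a vector killed modulo W1 into one killed modulo W.\<close>

lemma prim_W1:
  assumes "\<And>i. \<mu> \<noteq> of_nat i" "y \<in> prim W1"
  shows "\<exists>t\<in>W1. y - t \<in> prim W"
proof -
  have y: "y \<in> C" "E y \<in> W1" using assms by (auto simp: prim_def)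
  obtain w N c where w: "w \<in> W" "E y = w + (\<Sum>i<N. sc (c i) (f i))" using W1_cases[OF y(2)] .
  obtain t where t: "t \<in> W1" "E t - (\<Sum>i<N. sc (c i) (f i)) \<in> W" using lift_E[of N c] assms(1) by auto
  have tC: "t \<in> C" using t subm_subset[OF subm_W1] by blast
  have "E (y - t) = w - (E t - (\<Sum>i<N. sc (c i) (f i)))" using w y tC by (simp add: lin_op_diff[OF E_lin])
  then have "E (y - t) \<in> W" using w t by (auto intro: subm_diff[OF S])
  then show ?thesis using t y tC diff_mem by (auto simp: prim_def)
qed

text \<open>For \<mu> = l - 1 the coefficient l (\<mu> - l + 1) vanishes, so F^l v is killed by E
  and has weight - l - 1 modulo W; by hypothesis such vectors lie in W.\<close>

lemma f_l_mem:
  assumes "\<mu> = of_nat l - 1" "prim_weight (- of_nat l - 1) W \<subseteq> W"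
  shows "f l \<in> W"
proof -
  have "E (f l) \<in> W" using E_f[of l] by (simp add: assms(1) sc_zero_left f_mem)
  moreover have "H (f l) - sc (- of_nat l - 1) (f l) \<in> W" using H_f[of l] by (simp add: assms(1))
  ultimately show ?thesis using assms(2) f_mem by (auto simp: prim_weight_def)
qed

lemma W1_bounded:
  assumes fl: "f l \<in> W" and x: "x \<in> W1"
  shows "\<exists>w\<in>W. \<exists>c. x = w + (\<Sum>i<l. sc (c i) (f i))"
proof -
  have fi: "f i \<in> W" if "i \<ge> l" for i
  proof -
    have "f i = (F ^^ (i - l)) (f l)" using that unfolding f_def
      by (metis comp_apply funpow_add le_add_diff_inverse2)
    then show ?thesis using inv_sub_funpow[OF W fl] by simp
  qed
  obtain w N c where w: "w \<in> W" "x = w + (\<Sum>i<N. sc (c i) (f i))" using W1_cases[OF x] .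
  define c' where "c' = (\<lambda>i. if i < N then c i else 0)"
  have "(\<Sum>i<N. sc (c i) (f i)) = (\<Sum>i<max N l. sc (c' i) (f i))"
    by (rule sum.mono_neutral_cong_left) (auto simp: c'_def sc_zero_left f_mem)
  also have "{..<max N l} = {..<l} \<union> {l..<max N l}" by auto
  also have "(\<Sum>i\<in>{..<l} \<union> {l..<max N l}. sc (c' i) (f i)) =
      (\<Sum>i<l. sc (c' i) (f i)) + (\<Sum>i=l..<max N l. sc (c' i) (f i))"
    by (rule sum.union_disjoint) auto
  finally have "x = (w + (\<Sum>i=l..<max N l. sc (c' i) (f i))) + (\<Sum>i<l. sc (c' i) (f i))"
    using w by (simp add: add_ac)
  moreover have "w + (\<Sum>i=l..<max N l. sc (c' i) (f i)) \<in> W"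
    using w fi by (intro subm_add[OF S] subm_sum[OF S] subm_sc[OF S]) auto
  ultimately show ?thesis by (intro bexI exI)
qed

text \<open>E reaches every F^i v with i < l - 1 from within W1, so only the coefficient of the
  lowest vector can obstruct the correction of y.\<close>

lemma prim_W1_finite:
  assumes mu: "\<mu> = of_nat l - 1" and fl: "f l \<in> W" and y: "y \<in> prim W1"
  shows "\<exists>t\<in>W1. \<exists>c. E (y - t) - sc c (f (l - 1)) \<in> W"
proof -
  have yC: "y \<in> C" "E y \<in> W1" using y by (auto simp: prim_def)
  obtain w c where w: "w \<in> W" "E y = w + (\<Sum>i<l. sc (c i) (f i))" using W1_bounded[OF fl yC(2)] by auto
  obtain k where k: "l = Suc k" using l_pos by (cases l) auto
  obtain t where t: "t \<in> W1" "E t - (\<Sum>i<k. sc (c i) (f i)) \<in> W" using lift_E[of k c] by (auto simp: mu k)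
  have tC: "t \<in> C" using t subm_subset[OF subm_W1] by blast
  have "E (y - t) - sc (c k) (f (l - 1)) = w - (E t - (\<Sum>i<k. sc (c i) (f i)))"
    using w yC tC by (simp add: lin_op_diff[OF E_lin] k)
  also have "\<dots> \<in> W" by (rule subm_diff[OF S w(1) t(2)])
  finally show ?thesis using t by blast
qed

text \<open>The obstruction of \<open>prim_W1_finite\<close> disappears for weight l - 1: E z would
  have weight l + 1, whereas the lowest vector u has weight - l + 1. The discrepancy h = H z - \<mu>
  z lies in W1 and E h is - 2 l c u modulo W, so adding h / (2 l) to z cancels the term c u.\<close>

lemma prim_weight_W1:
  assumes mu: "\<mu> = of_nat l - 1" and fl: "f l \<in> W" and y: "y \<in> prim_weight (of_nat l - 1) W1"
  shows "\<exists>t\<in>W1. y - t \<in> prim W"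
proof -
  have yC: "y \<in> C" "y \<in> prim W1" "H y - sc \<mu> y \<in> W1" using y by (auto simp: prim_weight_def prim_def mu)
  obtain t c where t: "t \<in> W1" "E (y - t) - sc c (f (l - 1)) \<in> W"
    using prim_W1_finite[OF mu fl yC(2)] by blast
  define z where "z = y - t"
  define u where "u = f (l - 1)"
  have tC: "t \<in> C" using t subm_subset[OF subm_W1] by blast
  have zC: "z \<in> C" "u \<in> C" "E z \<in> C" using yC tC f_mem by (auto simp: z_def u_def diff_mem op_mem)
  have Ez: "E z - sc c u \<in> W" using t by (simp add: z_def u_def)
  define h where "h = H z - sc \<mu> z"
  have hC: "h \<in> C" using zC by (simp add: h_def op_mem diff_mem sc_mem)
  have "h = (H y - sc \<mu> y) - (H t - sc \<mu> t)"
    unfolding h_def z_def using yC tC by (simp add: lin_op_diff[OF H_lin] sc_diff_right)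
  also have "\<dots> \<in> W1"
    using inv_sub_op[OF inv_sub_W1 t(1)] t(1)
    by (intro subm_diff[OF subm_W1 yC(3)] subm_diff[OF subm_W1] subm_sc[OF subm_W1]) auto
  finally have h: "h \<in> W1" .
  have Hu: "H u - sc (- of_nat l + 1) u \<in> W"
    using H_f[of "l - 1"] l_pos by (simp add: u_def mu of_nat_diff algebra_simps)
  have "E h = H (E z) - sc 2 (E z) - sc \<mu> (E z)"
    unfolding h_def using zC HE[of z] by (simp add: lin_op_diff[OF E_lin] lin_op_sc[OF E_lin] op_mem sc_mem)
  have "E h - sc (- 2 * of_nat l * c) u =
    (H (E z - sc c u) - sc (2 + \<mu>) (E z - sc c u)) + sc c (H u - sc (- of_nat l + 1) u)"
  proof -
    have 1: "H (E z - sc c u) = H (E z) - sc c (H u)"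
      using zC by (simp add: lin_op_diff[OF H_lin] lin_op_sc[OF H_lin] sc_mem)
    have 2: "sc (2 + \<mu>) (E z - sc c u) = sc 2 (E z) + sc \<mu> (E z) - sc ((2 + \<mu>) * c) u"
      using zC by (simp only: sc_diff_right sc_mem sc_add_left sc_mult)
    have 3: "sc c (H u - sc (- of_nat l + 1) u) = sc c (H u) - sc (c * (- of_nat l + 1)) u"
      using zC by (simp only: sc_diff_right sc_mem op_mem sc_mult)
    have "- 2 * of_nat l * c = c * (- of_nat l + 1) - (2 + \<mu>) * c" by (simp add: mu algebra_simps)
    then have 4: "sc (- 2 * of_nat l * c) u = sc (c * (- of_nat l + 1)) u - sc ((2 + \<mu>) * c) u"
      using zC by (simp only: sc_diff_left)
    show ?thesis unfolding \<open>E h = _\<close> 1 2 3 4 by (simp add: algebra_simps)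
  qed
  also have "\<dots> \<in> W"
    using inv_sub_op[OF W Ez]
    by (intro subm_add[OF S subm_diff[OF S _ subm_sc[OF S Ez]] subm_sc[OF S Hu]]) simp
  finally have Eh: "E h - sc (- 2 * of_nat l * c) u \<in> W" .
  define e where "e = 1 / (2 * of_nat l :: complex)"
  have ec: "e * (- 2 * of_nat l * c) = - c" using l_pos by (simp add: e_def)
  have "E (z + sc e h) = (E z - sc c u) + sc e (E h - sc (- 2 * of_nat l * c) u)"
  proof -
    have "sc e (E h - sc (- 2 * of_nat l * c) u) = sc e (E h) - sc (e * (- 2 * of_nat l * c)) u"
      using zC hC by (simp only: sc_diff_right op_mem sc_mem sc_mult)
    also have "\<dots> = sc e (E h) + sc c u" unfolding ec using zC by (simp add: sc_minus_left)
    finally show ?thesis using zC hC by (simp add: lin_op_add[OF E_lin] lin_op_sc[OF E_lin] sc_mem)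
  qed
  also have "\<dots> \<in> W" using Ez Eh by (intro subm_add[OF S] subm_sc[OF S])
  finally have "z + sc e h \<in> prim W" using zC hC by (simp add: prim_def add_mem sc_mem)
  moreover have "z + sc e h = y - (t - sc e h)" by (simp add: z_def)
  moreover have "t - sc e h \<in> W1" using t h by (intro subm_diff[OF subm_W1] subm_sc[OF subm_W1])
  ultimately show ?thesis by metis
qed

end

section \<open>Building the filtration\<close>

context sl2_module
begin

definition is_step :: "'m set \<Rightarrow> 'm \<Rightarrow> complex \<Rightarrow> 'm set \<Rightarrow> bool" where
  "is_step W v \<mu> W' \<longleftrightarrow> sl2_step C sc E F H l W v \<mu> \<and> W' = sumset W (spn (range (\<lambda>i. (F ^^ i) v))) \<and>
     (\<mu> = - of_nat l - 1 \<or> \<mu> = of_nat l - 1 \<and> (F ^^ l) v \<in> W)"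

text \<open>Chains of steps from W up to the whole module. A chain is extended at its lower end, so
  that the proof may start at 0 and pass to ever larger W.\<close>

inductive filtered :: "'m set \<Rightarrow> bool" where
  filtered_C: "filtered C"
| filtered_step: "is_step W v \<mu> W' \<Longrightarrow> filtered W' \<Longrightarrow> filtered W"

lemma sl2_stepI:
  assumes "inv_sub W" "v \<in> prim_weight \<mu> W" "v \<notin> W"
  shows "sl2_step C sc E F H l W v \<mu>"
  using assms by unfold_locales (auto simp: prim_weight_def)

text \<open>A step of weight - l - 1 lowers the second bound and keeps the first; a step of weight l
  - 1 lowers the first and replaces the second by a new finite one. When neither weight occurs
  modulo W, nilpotency of E forces W to be everything.\<close>

lemma filtered_of_finite:
  assumes nil: "\<And>x. x \<in> C \<Longrightarrow> \<exists>k. (E ^^ k) x = 0"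
    and "inv_sub W" "finite B1" "B1 \<subseteq> C" "prim_weight (of_nat l - 1) W \<subseteq> sumset W (spn B1)"
    "finite B2" "B2 \<subseteq> C" "prim_weight (- of_nat l - 1) W \<subseteq> sumset W (spn B2)"
  shows "filtered W"
proof -
  define bound where "bound = (\<lambda>\<mu> W n. \<exists>B. finite B \<and> B \<subseteq> C \<and> card B \<le> n \<and> prim_weight \<mu> W \<subseteq> sumset W (spn B))"
  let ?p = "of_nat l - 1 :: complex" and ?m = "- of_nat l - 1 :: complex"
  have "filtered W" if "inv_sub W" "bound ?p W n1" "bound ?m W n2" for W n1 n2
    using that
  proof (induction n1 arbitrary: W n2 rule: less_induct)
    case (less n1)
    note IH1 = less.IH
    show ?case using less.prems
    proof (induction n2 arbitrary: W rule: less_induct)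
      case (less n2)
      note IH2 = less.IH
      have W: "inv_sub W" and SW: "subm W" using less.prems inv_sub_subm by auto
      obtain B1 where B1: "finite B1" "B1 \<subseteq> C" "card B1 \<le> n1" "prim_weight ?p W \<subseteq> sumset W (spn B1)"
        using less.prems by (auto simp: bound_def)
      obtain B2 where B2: "finite B2" "B2 \<subseteq> C" "card B2 \<le> n2" "prim_weight ?m W \<subseteq> sumset W (spn B2)"
        using less.prems by (auto simp: bound_def)
      show ?case
      proof (cases "prim_weight ?m W \<subseteq> W")
        case False
        then obtain v where v: "v \<in> prim_weight ?m W" "v \<notin> W" by blast
        interpret st: sl2_step C sc E F H l W v ?m using sl2_stepI[OF W v] .
        have step: "is_step W v ?m st.W1"
          unfolding is_step_def st.W1_def st.f_def using st.sl2_step_axioms by simp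
        have "?m \<noteq> of_nat i" for i
          by (auto simp: complex_eq_iff)
        then have pr: "\<exists>t\<in>st.W1. y - t \<in> prim W" if "y \<in> prim_weight \<mu> st.W1" for y \<mu>
          using that by (intro st.prim_W1) (auto simp: prim_weight_def prim_def)
        have tr: "prim_weight (s * of_nat l - 1) st.W1 \<subseteq> sumset st.W1 (prim_weight (s * of_nat l - 1) W)"
          if "s = 1 \<or> s = - 1" for s
          using pr prim_weight_transfer[OF W st.inv_sub_W1 st.W_W1 that] by blast
        have sb: "subm (spn B)" "sumset st.W1 (sumset W (spn B)) \<subseteq> sumset st.W1 (spn B)" if "B \<subseteq> C" for B
        proof -
          show S: "subm (spn B)" using that by (rule subm_spn)
          show "sumset st.W1 (sumset W (spn B)) \<subseteq> sumset st.W1 (spn B)"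
            by (intro sumset_least subm_sumset S st.subm_W1)
              (use sumset_superset[OF st.subm_W1 S] st.W_W1 in auto)
        qed
        obtain b where b: "b \<in> B2" "sumset st.W1 (spn B2) \<subseteq> sumset st.W1 (spn (B2 - {b}))"
          using exchange[OF SW st.subm_W1 st.W_W1 B2(1,2) subsetD[OF B2(4) v(1)] v(2) st.v_W1] by blast
        have mono: "sumset X Y \<subseteq> sumset X Y'" if "Y \<subseteq> Y'" for X Y Y' :: "'m set"
          using that by (auto simp: sumset_def)
        have "prim_weight ?p st.W1 \<subseteq> sumset st.W1 (spn B1)"
          using tr[of 1] mono[OF B1(4)] sb[OF B1(2)] by simp (meson order_trans)
        then have 1: "bound ?p st.W1 n1" unfolding bound_def using B1 by blast
        have "prim_weight ?m st.W1 \<subseteq> sumset st.W1 (spn (B2 - {b}))"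
          using tr[of "- 1"] mono[OF B2(4)] sb[OF B2(2)] b(2) by simp (meson order_trans)
        then have 2: "bound ?m st.W1 (card (B2 - {b}))" unfolding bound_def using B2 by blast
        have "card (B2 - {b}) < card B2" using b B2 by (intro psubset_card_mono) auto
        then have "filtered st.W1" using IH2[OF _ st.inv_sub_W1 1 2] B2(3) by simp
        then show ?thesis using step by (rule filtered_step[rotated])
      next
        case m: True
        show ?thesis
        proof (cases "prim_weight ?p W \<subseteq> W")
          case False
          then obtain v where v: "v \<in> prim_weight ?p W" "v \<notin> W" by blast
          interpret st: sl2_step C sc E F H l W v ?p using sl2_stepI[OF W v] .
          have fl: "st.f l \<in> W" using st.f_l_mem m by simp
          then have step: "is_step W v ?p st.W1"
            unfolding is_step_def st.W1_def st.f_def using st.sl2_step_axioms by simp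
          have mono: "sumset X Y \<subseteq> sumset X Y'" if "Y \<subseteq> Y'" for X Y Y' :: "'m set"
            using that by (auto simp: sumset_def)
          have sb: "subm (spn B)" "sumset st.W1 (sumset W (spn B)) \<subseteq> sumset st.W1 (spn B)" if "B \<subseteq> C" for B
          proof -
            show S: "subm (spn B)" using that by (rule subm_spn)
            show "sumset st.W1 (sumset W (spn B)) \<subseteq> sumset st.W1 (spn B)"
              by (intro sumset_least subm_sumset S st.subm_W1)
                (use sumset_superset[OF st.subm_W1 S] st.W_W1 in auto)
          qed
          have "prim_weight ?p st.W1 \<subseteq> sumset st.W1 (prim_weight ?p W)"
            using st.prim_weight_W1[OF refl fl] prim_weight_transfer[OF W st.inv_sub_W1 st.W_W1, of 1] by fastforce
          then have p1: "prim_weight ?p st.W1 \<subseteq> sumset st.W1 (spn B1)"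
            using mono[OF B1(4), of st.W1] sb(2)[OF B1(2)] by (meson order_trans)
          obtain b where b: "b \<in> B1" "sumset st.W1 (spn B1) \<subseteq> sumset st.W1 (spn (B1 - {b}))"
            using exchange[OF SW st.subm_W1 st.W_W1 B1(1,2) subsetD[OF B1(4) v(1)] v(2) st.v_W1] by blast
          have 1: "bound ?p st.W1 (card (B1 - {b}))" unfolding bound_def using p1 b B1 by blast
          have card: "card (B1 - {b}) < n1"
            using b B1 by (intro less_le_trans[OF psubset_card_mono[OF B1(1)] B1(3)]) auto
          define u where "u = st.f (l - 1)"
          have uC: "u \<in> C" using st.f_mem by (simp add: u_def)
          \<comment> \<open>A vector that E maps to the lowest vector u modulo W, if there is one;
            otherwise x0 is arbitrary. Adding it to B1 compensates for the obstruction in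
            \<open>prim_W1_finite\<close>, which is one-dimensional.\<close>
          obtain x0 where x0: "x0 \<in> C" "(\<exists>x\<in>C. E x - u \<in> W) \<longrightarrow> E x0 - u \<in> W" using zero_mem by blast
          define B where "B = insert x0 B1"
          have B: "finite B" "B \<subseteq> C" using B1 x0 by (auto simp: B_def)
          have N: "subm (sumset st.W1 (spn B))" using sb(1)[OF B(2)] st.subm_W1 by (intro subm_sumset)
          have NW: "st.W1 \<subseteq> sumset st.W1 (spn B)" "spn B \<subseteq> sumset st.W1 (spn B)"
            using sumset_superset[OF st.subm_W1 sb(1)[OF B(2)]] by auto
          have prim: "prim W \<subseteq> sumset st.W1 (spn B)"
          proof
            fix x assume "x \<in> prim W"
            then obtain x1 x2 where x: "x = x1 + x2" "x1 \<in> prim_weight ?p W" "x2 \<in> prim_weight ?m W"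
              using prim_split[OF W, of x 1] by auto
            have "x1 \<in> sumset W (spn B1)" using x B1 by blast
            then obtain w y where "w \<in> W" "y \<in> spn B1" "x1 = w + y" by (auto simp: sumset_def)
            moreover have "y \<in> spn B" using spn_mono[of B1 B] \<open>y \<in> spn B1\<close> by (auto simp: B_def)
            moreover have "x2 \<in> W" using x m by blast
            ultimately show "x \<in> sumset st.W1 (spn B)"
              using x(1) NW st.W_W1 by (auto intro!: subm_add[OF N])
          qed
          have "prim_weight ?m st.W1 \<subseteq> sumset st.W1 (spn B)"
          proof
            fix y assume "y \<in> prim_weight ?m st.W1"
            then have y: "y \<in> prim st.W1" "y \<in> C" by (auto simp: prim_weight_def prim_def)
            obtain t c where t: "t \<in> st.W1" "E (y - t) - sc c u \<in> W"
              using st.prim_W1_finite[OF refl fl y(1)] by (auto simp: u_def)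
            have tC: "t \<in> C" using t subm_subset[OF st.subm_W1] by blast
            have zC: "y - t \<in> C" using y tC by (simp add: diff_mem)
            have "y - t \<in> sumset st.W1 (spn B)"
            proof (cases "c = 0")
              case True
              then have "y - t \<in> prim W" using t zC uC by (simp add: prim_def sc_zero_left)
              then show ?thesis using prim by blast
            next
              case False
              have "E (sc (1 / c) (y - t)) - u = sc (1 / c) (E (y - t) - sc c u)"
                using False zC uC by (simp add: lin_op_sc[OF E_lin] op_mem sc_mem sc_diff_right sc_one flip: sc_mult)
              then have "E (sc (1 / c) (y - t)) - u \<in> W" using t(2) by (simp add: subm_sc[OF SW])
              then have x0': "E x0 - u \<in> W" using x0(2) zC sc_mem by blast
              have "E (y - t - sc c x0) = (E (y - t) - sc c u) - sc c (E x0 - u)"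
                using zC x0 uC by (simp add: lin_op_diff[OF E_lin] lin_op_sc[OF E_lin] op_mem sc_mem sc_diff_right)
              also have "\<dots> \<in> W" by (rule subm_diff[OF SW t(2) subm_sc[OF SW x0']])
              finally have "y - t - sc c x0 \<in> sumset st.W1 (spn B)"
                using prim zC x0 by (auto simp: prim_def diff_mem sc_mem)
              moreover have "sc c x0 \<in> sumset st.W1 (spn B)"
                using NW(2) by (auto simp: B_def intro: spn_sc spn_base)
              ultimately have "(y - t - sc c x0) + sc c x0 \<in> sumset st.W1 (spn B)" by (rule subm_add[OF N])
              then show ?thesis by simp
            qed
            then have "(y - t) + t \<in> sumset st.W1 (spn B)" using t(1) NW(1) by (intro subm_add[OF N]) auto
            then show "y \<in> sumset st.W1 (spn B)" by simp
          qed
          then have 2: "bound ?m st.W1 (card B)" unfolding bound_def using B by blast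
          have "filtered st.W1" by (rule IH1[OF card st.inv_sub_W1 1 2])
          then show ?thesis using step by (rule filtered_step[rotated])
        next
          case p: True
          \<comment> \<open>No highest weight vectors remain modulo W, so E is injective modulo W;
            followed down a nilpotent string, this puts every x into W.\<close>
          have prim: "x \<in> W" if xE: "x \<in> C" "E x \<in> W" for x
          proof -
            obtain x1 x2 where x: "x = x1 + x2" "x1 \<in> prim_weight ?p W" "x2 \<in> prim_weight ?m W"
              using prim_split[OF W, of x 1] xE by (auto simp: prim_def)
            then show ?thesis using p m by (auto intro: subm_add[OF SW])
          qed
          have "x \<in> W" if "x \<in> C" "(E ^^ k) x = 0" for x k
            using that
          proof (induction k arbitrary: x)
            case 0
            then show ?case using subm_zero[OF SW] by simp
          next
            case (Suc k)
            then show ?case using prim[of x] Suc.IH[of "E x"] by (simp add: funpow_swap1 op_mem)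
          qed
          then have "W = C" using nil subm_subset[OF SW] by blast
          then show ?thesis using filtered_C by simp
        qed
      qed
    qed
  qed
  moreover have "bound ?p W (card B1)" "bound ?m W (card B2)" using assms unfolding bound_def by blast+
  ultimately show ?thesis using assms(2) by blast
qed

end

subsection \<open>Modules over twisted differential operators\<close>

lemma zariski_open_Int: "zariski_open U \<Longrightarrow> zariski_open W \<Longrightarrow> zariski_open (U \<inter> W)"
  by (auto simp: zariski_open_def)

lemma zariski_open_Diff_finite: "zariski_open U \<Longrightarrow> finite T \<Longrightarrow> zariski_open (U - T)"
  unfolding zariski_open_def by (auto simp: Compl_Diff_eq)

lemma zariski_open_simps: "zariski_open UNIV" "zariski_open U_zero" "zariski_open U_infty" "zariski_open (- {P})"
  by (simp_all add: zariski_open_def U_zero_def U_infty_def Compl_Diff_eq)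

lemma pt_notin_charts: "pt 0 1 \<notin> U_zero" "pt 1 0 \<notin> U_infty"
  by (simp_all add: U_zero_def U_infty_def)

lemma O_X_mono: "W \<subseteq> U \<Longrightarrow> f \<in> O_X U \<Longrightarrow> f \<in> O_X W"
  by (auto simp: O_X_iff)

lemma O_X_mult: "f \<in> O_X U \<Longrightarrow> h \<in> O_X U \<Longrightarrow> f * h \<in> O_X U"
  by (rule O_sec_mult)

lemma O_X_power: "f \<in> O_X U \<Longrightarrow> f ^ k \<in> O_X U"
  by (auto simp: O_X_iff intro: regular_at_power)

locale twisted_module = diff_ops_module "int n" M
  for n :: nat and M :: "'m::ab_group_add dsheaf"
begin

lemma sec_diff: "zariski_open U \<Longrightarrow> s \<in> sec M U \<Longrightarrow> t \<in> sec M U \<Longrightarrow> s - t \<in> sec M U"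
  using sec_add[of U s "- t"] sec_minus by simp

lemma act_0_right: "zariski_open U \<Longrightarrow> P \<in> diff_ops (int n) U \<Longrightarrow> act M U P 0 = 0"
  using act_add_right[of U P 0 0] sec_zero by simp

lemma act_minus_right: "zariski_open U \<Longrightarrow> P \<in> diff_ops (int n) U \<Longrightarrow> s \<in> sec M U \<Longrightarrow> act M U P (- s) = - act M U P s"
  using act_add_right[of U P s "- s"] sec_minus act_0_right
  by (simp add: eq_neg_iff_add_eq_0 add.commute)

lemma res_0: "zariski_open U \<Longrightarrow> zariski_open W \<Longrightarrow> W \<subseteq> U \<Longrightarrow> res M U W 0 = 0"
  using res_add[of U W 0 0] sec_zero by simp

lemma res_minus: "zariski_open U \<Longrightarrow> zariski_open W \<Longrightarrow> W \<subseteq> U \<Longrightarrow> s \<in> sec M U \<Longrightarrow> res M U W (- s) = - res M U W s"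
  using res_add[of U W s "- s"] sec_minus res_0 by (simp add: eq_neg_iff_add_eq_0 add.commute)

lemma res_diff: "zariski_open U \<Longrightarrow> zariski_open W \<Longrightarrow> W \<subseteq> U \<Longrightarrow> s \<in> sec M U \<Longrightarrow> t \<in> sec M U \<Longrightarrow>
    res M U W (s - t) = res M U W s - res M U W t"
  using res_add[of U W s "- t"] res_minus sec_minus by simp

lemma act_mult:
  "zariski_open U \<Longrightarrow> f \<in> O_X U \<Longrightarrow> h \<in> O_X U \<Longrightarrow> s \<in> sec M U \<Longrightarrow>
    act M U (mult_op (f * h)) s = act M U (mult_op f) (act M U (mult_op h) s)"
proof -
  assume *: "zariski_open U" "f \<in> O_X U" "h \<in> O_X U" "s \<in> sec M U"
  have "mult_op (f * h) = mult_op f \<circ> mult_op h" by (simp add: fun_eq_iff mult_op_def mult.assoc)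
  then show ?thesis using * by (simp add: act_comp mult_op_diff_ops)
qed

lemma act_mult_add:
  "zariski_open U \<Longrightarrow> f \<in> O_X U \<Longrightarrow> h \<in> O_X U \<Longrightarrow> s \<in> sec M U \<Longrightarrow>
    act M U (mult_op (f + h)) s = act M U (mult_op f) s + act M U (mult_op h) s"
proof -
  assume *: "zariski_open U" "f \<in> O_X U" "h \<in> O_X U" "s \<in> sec M U"
  have "mult_op (f + h) = (\<lambda>k. mult_op f k + mult_op h k)" by (simp add: fun_eq_iff mult_op_def ring_distribs)
  then show ?thesis using * by (simp add: act_add_left mult_op_diff_ops)
qed

lemma act_mult_1: "zariski_open U \<Longrightarrow> s \<in> sec M U \<Longrightarrow> act M U (mult_op 1) s = s"
proof -
  assume *: "zariski_open U" "s \<in> sec M U"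
  have "mult_op 1 = id" by (simp add: fun_eq_iff mult_op_def)
  then show ?thesis using * by (simp add: act_id)
qed

lemma act_mult_commute:
  "zariski_open U \<Longrightarrow> f \<in> O_X U \<Longrightarrow> h \<in> O_X U \<Longrightarrow> s \<in> sec M U \<Longrightarrow>
    act M U (mult_op f) (act M U (mult_op h) s) = act M U (mult_op h) (act M U (mult_op f) s)"
  by (simp flip: act_mult add: mult.commute)

lemma act_mult_cancel:
  "zariski_open U \<Longrightarrow> f \<in> O_X U \<Longrightarrow> h \<in> O_X U \<Longrightarrow> f * h = 1 \<Longrightarrow> s \<in> sec M U \<Longrightarrow>
    act M U (mult_op h) s = 0 \<Longrightarrow> s = 0"
  using act_mult[of U f h s] act_0_right[of U "mult_op f"] mult_op_diff_ops[of f U] act_mult_1[of U s] by simp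

lemma act_mult_mem: "zariski_open U \<Longrightarrow> f \<in> O_X U \<Longrightarrow> s \<in> sec M U \<Longrightarrow> act M U (mult_op f) s \<in> sec M U"
  by (intro act_sec mult_op_diff_ops)

lemma res_act_mult:
  "zariski_open U \<Longrightarrow> zariski_open W \<Longrightarrow> W \<subseteq> U \<Longrightarrow> f \<in> O_X U \<Longrightarrow> s \<in> sec M U \<Longrightarrow>
    res M U W (act M U (mult_op f) s) = act M W (mult_op f) (res M U W s)"
  by (intro res_act mult_op_diff_ops)

lemma cmodule_sec:
  assumes U: "zariski_open U" and \<phi>: "\<And>a. \<phi> a \<in> O_X U" "\<And>a b. \<phi> (a + b) = \<phi> a + \<phi> b"
    "\<And>a b. \<phi> (a * b) = \<phi> a * \<phi> b" "\<phi> 1 = 1"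
  shows "cmodule (sec M U) (\<lambda>a::'r::comm_ring_1. act M U (mult_op (\<phi> a)))"
  by unfold_locales (use U \<phi> in \<open>simp_all add: sec_zero sec_add act_mult_mem act_add_right mult_op_diff_ops
    act_mult_add act_mult act_mult_1\<close>)

lemma cvector_space_sec: "zariski_open U \<Longrightarrow> cvector_space (sec M U) (\<lambda>c. act M U (mult_op (const_fun c)))"
  unfolding cvector_space_def by (rule cmodule_sec) (simp_all add: const_fun_O_X const_fun_simps)

lemma lin_op_act:
  assumes U: "zariski_open U" and P: "P \<in> diff_ops (int n) U"
  shows "cmodule.lin_op (sec M U) (\<lambda>c. act M U (mult_op (const_fun c))) (act M U P)"
proof -
  interpret V: cvector_space "sec M U" "\<lambda>c. act M U (mult_op (const_fun c))" using U by (rule cvector_space_sec)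
  have "act M U P (act M U (mult_op (const_fun c)) s) = act M U (mult_op (const_fun c)) (act M U P s)"
    if "s \<in> sec M U" for c s
  proof -
    have "P \<circ> mult_op (const_fun c) = mult_op (const_fun c) \<circ> P"
      using P by (simp add: fun_eq_iff mult_op_def diff_ops_def c_linear_def)
    then show ?thesis using U P that const_op_diff_ops by (metis act_comp)
  qed
  then show ?thesis using U P by (simp add: V.lin_op_def act_sec act_add_right)
qed

lemma glue2:
  assumes A: "zariski_open A" "s \<in> sec M A" and B: "zariski_open B" "t \<in> sec M B"
    and eq: "res M A (A \<inter> B) s = res M B (A \<inter> B) t"
  shows "\<exists>u\<in>sec M (A \<union> B). res M (A \<union> B) A u = s \<and> res M (A \<union> B) B u = t"
proof -
  define \<sigma> where "\<sigma> = (\<lambda>W. if W = A then s else t)"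
  have st: "A = B \<Longrightarrow> s = t" using eq A B by (simp add: res_id)
  then have \<sigma>: "\<sigma> A = s" "\<sigma> B = t" by (auto simp: \<sigma>_def)
  have "\<exists>u\<in>sec M (\<Union>{A, B}). \<forall>W\<in>{A, B}. res M (\<Union>{A, B}) W u = \<sigma> W"
    by (rule gluing) (use A B \<sigma> eq in \<open>auto simp: Int_commute\<close>)
  then show ?thesis using \<sigma> by simp
qed

lemma separated2:
  assumes "zariski_open A" "zariski_open B" "s \<in> sec M (A \<union> B)"
    "res M (A \<union> B) A s = 0" "res M (A \<union> B) B s = 0"
  shows "s = 0"
  using separated[of "{A, B}" s] assms by auto

end

section \<open>Comparison of a module with its untwisted form off one point\<close>

locale twisted_chart = twisted_module n M
  for n :: nat and M :: "'m::ab_group_add dsheaf" +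
  fixes b d :: complex and T :: "('m \<times> 'm) dsheaf"
  assumes bd: "(b, d) \<noteq> (0, 0)"
    and T_eq: "T = line_bundle_tensor (- int n) M"
begin

abbreviation "m \<equiv> lform b d"

definition "unit0 = inverse m ^ n"
definition "unit1 = (inverse m * zcoord) ^ n"

lemma units_regular:
  assumes "pt b d \<notin> W"
  shows "unit0 \<in> O_X (W \<inter> U_zero)" "m ^ n \<in> O_X (W \<inter> U_zero)"
    "unit1 \<in> O_X (W \<inter> U_infty)" "(m * inverse zcoord) ^ n \<in> O_X (W \<inter> U_infty)"
proof -
  have 0: "regular_at (inverse m) P \<and> regular_at m P" if P: "P \<in> W \<inter> U_zero" for P
  proof -
    obtain c where c: "c \<noteq> 0" "has_value m P c" using lform_unit_zero[OF bd, of P] P assms by auto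
    show ?thesis using c(2) has_value_inverse[OF c(2,1)] by (auto simp: regular_at_def)
  qed
  have 1: "regular_at (inverse m * zcoord) P \<and> regular_at (m * inverse zcoord) P" if P: "P \<in> W \<inter> U_infty" for P
  proof -
    obtain c where c: "c \<noteq> 0" "has_value (m * inverse zcoord) P c"
      using lform_unit_infty[OF bd, of P] P assms by auto
    have "has_value (inverse m * zcoord) P (inverse c)" using has_value_inverse[OF c(2,1)] by simp
    then show ?thesis using c(2) by (auto simp: regular_at_def)
  qed
  show "unit0 \<in> O_X (W \<inter> U_zero)" "m ^ n \<in> O_X (W \<inter> U_zero)"
    "unit1 \<in> O_X (W \<inter> U_infty)" "(m * inverse zcoord) ^ n \<in> O_X (W \<inter> U_infty)"
    unfolding unit0_def unit1_def by (intro O_X_power; use 0 1 in \<open>simp add: O_X_iff\<close>)+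
qed

lemma unit_simps: "m ^ n * unit0 = 1" "(m * inverse zcoord) ^ n * unit1 = 1"
  "inverse zcoord ^ n * unit1 = unit0" "unit1 = zcoord ^ n * unit0"
  using lform_nonzero[OF bd] zcoord_nonzero
  by (simp_all add: unit0_def unit1_def field_simps)

text \<open>The section m^(-n) \<otimes> s of the untwisted module, where m^(-n) generates O_(-n)
  off [b:d]. The two components are its expressions in the two trivialisations of O_(-n), which
  differ by z^n.\<close>

definition triv :: "cp1 set \<Rightarrow> 'm \<Rightarrow> 'm \<times> 'm" where
  "triv W s = (act M (W \<inter> U_zero) (mult_op unit0) (res M W (W \<inter> U_zero) s),
               act M (W \<inter> U_infty) (mult_op unit1) (res M W (W \<inter> U_infty) s))"

lemma T_sec: "sec T W = {(x, y). x \<in> sec M (W \<inter> U_zero) \<and> y \<in> sec M (W \<inter> U_infty) \<and>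
    res M (W \<inter> U_zero) (W \<inter> U_zero \<inter> U_infty) x =
    act M (W \<inter> U_zero \<inter> U_infty) (mult_op (inverse zcoord ^ n)) (res M (W \<inter> U_infty) (W \<inter> U_zero \<inter> U_infty) y)}"
  by (simp add: T_eq line_bundle_tensor_def power_int_minus power_inverse)

lemma T_res: "res T U W (x, y) = (res M (U \<inter> U_zero) (W \<inter> U_zero) x, res M (U \<inter> U_infty) (W \<inter> U_infty) y)"
  by (simp add: T_eq line_bundle_tensor_def)

lemma T_act: "act T U P (x, y) = (act M (U \<inter> U_zero) P x, act M (U \<inter> U_infty) (twist_op n zcoord P) y)"
  by (simp add: T_eq line_bundle_tensor_def twist_op_def power_int_minus power_inverse)

context
  fixes W assumes W: "zariski_open W" "pt b d \<notin> W"
begin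

lemma W_open: "zariski_open (W \<inter> U_zero)" "zariski_open (W \<inter> U_infty)" "zariski_open (W \<inter> U_zero \<inter> U_infty)"
  using W zariski_open_Int zariski_open_simps by auto

lemma units_W: "unit0 \<in> O_X (W \<inter> U_zero)" "m ^ n \<in> O_X (W \<inter> U_zero)"
    "unit1 \<in> O_X (W \<inter> U_infty)" "(m * inverse zcoord) ^ n \<in> O_X (W \<inter> U_infty)"
    "unit0 \<in> O_X (W \<inter> U_zero \<inter> U_infty)" "m ^ n \<in> O_X (W \<inter> U_zero \<inter> U_infty)"
    "unit1 \<in> O_X (W \<inter> U_zero \<inter> U_infty)" "(m * inverse zcoord) ^ n \<in> O_X (W \<inter> U_zero \<inter> U_infty)"
    "inverse zcoord ^ n \<in> O_X (W \<inter> U_zero \<inter> U_infty)"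
proof -
  show *: "unit0 \<in> O_X (W \<inter> U_zero)" "m ^ n \<in> O_X (W \<inter> U_zero)"
    "unit1 \<in> O_X (W \<inter> U_infty)" "(m * inverse zcoord) ^ n \<in> O_X (W \<inter> U_infty)"
    using units_regular[OF W(2)] by auto
  show "unit0 \<in> O_X (W \<inter> U_zero \<inter> U_infty)" "m ^ n \<in> O_X (W \<inter> U_zero \<inter> U_infty)"
    "unit1 \<in> O_X (W \<inter> U_zero \<inter> U_infty)" "(m * inverse zcoord) ^ n \<in> O_X (W \<inter> U_zero \<inter> U_infty)"
    using * by (auto simp: O_X_iff)
  show "inverse zcoord ^ n \<in> O_X (W \<inter> U_zero \<inter> U_infty)"
    by (intro O_X_power) (auto simp: O_X_iff regular_at_inverse_zcoord)
qed

lemma triv_mem: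
  assumes s: "s \<in> sec M W" shows "triv W s \<in> sec T W"
proof -
  note o = W_open W
  have r: "res M W (W \<inter> U_zero) s \<in> sec M (W \<inter> U_zero)" "res M W (W \<inter> U_infty) s \<in> sec M (W \<inter> U_infty)"
    "res M W (W \<inter> U_zero \<inter> U_infty) s \<in> sec M (W \<inter> U_zero \<inter> U_infty)"
    using o s by (auto intro!: res_sec)
  have 0: "res M (W \<inter> U_zero) (W \<inter> U_zero \<inter> U_infty) (act M (W \<inter> U_zero) (mult_op unit0) (res M W (W \<inter> U_zero) s)) =
      act M (W \<inter> U_zero \<inter> U_infty) (mult_op unit0) (res M W (W \<inter> U_zero \<inter> U_infty) s)"
    using o s r units_W by (subst res_act_mult) (auto intro!: arg_cong[where f = "act M _ _"] res_res)
  have 1: "res M (W \<inter> U_infty) (W \<inter> U_zero \<inter> U_infty) (act M (W \<inter> U_infty) (mult_op unit1) (res M W (W \<inter> U_infty) s)) =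
      act M (W \<inter> U_zero \<inter> U_infty) (mult_op unit1) (res M W (W \<inter> U_zero \<inter> U_infty) s)"
    using o s r units_W by (subst res_act_mult) (auto intro!: arg_cong[where f = "act M _ _"] res_res)
  have 2: "act M (W \<inter> U_zero \<inter> U_infty) (mult_op unit0) (res M W (W \<inter> U_zero \<inter> U_infty) s) =
    act M (W \<inter> U_zero \<inter> U_infty) (mult_op (inverse zcoord ^ n))
      (act M (W \<inter> U_zero \<inter> U_infty) (mult_op unit1) (res M W (W \<inter> U_zero \<inter> U_infty) s))"
    using o r units_W unit_simps(3) by (simp flip: act_mult)
  show ?thesis unfolding T_sec triv_def using o r units_W 0 1 2 by (simp add: act_mult_mem)
qed

lemma triv_add:
  assumes "s \<in> sec M W" "t \<in> sec M W" shows "triv W (s + t) = triv W s + triv W t"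
  unfolding triv_def using assms W_open W units_W
  by (simp add: res_add act_add_right mult_op_diff_ops res_sec)

lemma triv_0: "triv W 0 = 0"
  using triv_add[of 0 0] sec_zero W by simp

lemma triv_minus: "s \<in> sec M W \<Longrightarrow> triv W (- s) = - triv W s"
  using triv_add[of s "- s"] sec_minus W triv_0 by (simp add: eq_neg_iff_add_eq_0 add.commute)

text \<open>Multiplying the two components by the inverse units gives sections of M that agree on
  the overlap, so they glue.\<close>

lemma triv_surj:
  assumes "xy \<in> sec T W" shows "\<exists>s\<in>sec M W. triv W s = xy"
proof -
  note o = W_open W
  obtain x y where xy: "xy = (x, y)" by (cases xy)
  have *: "x \<in> sec M (W \<inter> U_zero)" "y \<in> sec M (W \<inter> U_infty)"
    "res M (W \<inter> U_zero) (W \<inter> U_zero \<inter> U_infty) x =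
     act M (W \<inter> U_zero \<inter> U_infty) (mult_op (inverse zcoord ^ n)) (res M (W \<inter> U_infty) (W \<inter> U_zero \<inter> U_infty) y)"
    using assms by (auto simp: xy T_sec)
  define s t where "s = act M (W \<inter> U_zero) (mult_op (m ^ n)) x"
    and "t = act M (W \<inter> U_infty) (mult_op ((m * inverse zcoord) ^ n)) y"
  have st: "s \<in> sec M (W \<inter> U_zero)" "t \<in> sec M (W \<inter> U_infty)"
    unfolding s_def t_def using o * units_W by (auto intro: act_mult_mem)
  have i: "(W \<inter> U_zero) \<inter> (W \<inter> U_infty) = W \<inter> U_zero \<inter> U_infty" and u: "(W \<inter> U_zero) \<union> (W \<inter> U_infty) = W"
    using U_zero_Un_U_infty by auto
  have r: "res M (W \<inter> U_infty) (W \<inter> U_zero \<inter> U_infty) y \<in> sec M (W \<inter> U_zero \<inter> U_infty)"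
    using * o by (intro res_sec) auto
  have "res M (W \<inter> U_zero) (W \<inter> U_zero \<inter> U_infty) s =
     act M (W \<inter> U_zero \<inter> U_infty) (mult_op (m ^ n)) (act M (W \<inter> U_zero \<inter> U_infty) (mult_op (inverse zcoord ^ n)) (res M (W \<inter> U_infty) (W \<inter> U_zero \<inter> U_infty) y))"
    unfolding s_def *(3)[symmetric] by (rule res_act_mult) (use * o units_W in auto)
  also have "\<dots> = act M (W \<inter> U_zero \<inter> U_infty) (mult_op ((m * inverse zcoord) ^ n)) (res M (W \<inter> U_infty) (W \<inter> U_zero \<inter> U_infty) y)"
    using o units_W r by (simp flip: act_mult add: power_mult_distrib)
  also have "\<dots> = res M (W \<inter> U_infty) (W \<inter> U_zero \<inter> U_infty) t"
    unfolding t_def using * o units_W by (subst res_act_mult) auto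
  finally obtain v where v: "v \<in> sec M W" "res M W (W \<inter> U_zero) v = s" "res M W (W \<inter> U_infty) v = t"
    using glue2[OF o(1) st(1) o(2) st(2)] unfolding i u by blast
  have "triv W v = xy"
    unfolding triv_def v xy s_def t_def using * o units_W unit_simps
    by (simp flip: act_mult add: act_mult_1 mult.commute)
  then show ?thesis using v by blast
qed

lemma triv_inj:
  assumes s: "s \<in> sec M W" and 0: "triv W s = 0" shows "s = 0"
proof -
  note o = W_open W
  have u: "(W \<inter> U_zero) \<union> (W \<inter> U_infty) = W" using U_zero_Un_U_infty by auto
  have r: "res M W (W \<inter> U_zero) s \<in> sec M (W \<inter> U_zero)" "res M W (W \<inter> U_infty) s \<in> sec M (W \<inter> U_infty)"
    using o s by (auto intro!: res_sec)
  have z: "act M (W \<inter> U_zero) (mult_op unit0) (res M W (W \<inter> U_zero) s) = 0"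
    "act M (W \<inter> U_infty) (mult_op unit1) (res M W (W \<inter> U_infty) s) = 0"
    using arg_cong[OF 0, of fst] arg_cong[OF 0, of snd]
    unfolding triv_def fst_conv snd_conv fst_zero snd_zero .
  have "res M W (W \<inter> U_zero) s = 0" "res M W (W \<inter> U_infty) s = 0"
    by (rule act_mult_cancel[OF o(1) units_W(2,1) unit_simps(1) r(1) z(1)],
      rule act_mult_cancel[OF o(2) units_W(4,3) unit_simps(2) r(2) z(2)])
  then show ?thesis using separated2[OF o(1,2), of s] s unfolding u by simp
qed

lemma triv_eq_iff: "s \<in> sec M W \<Longrightarrow> t \<in> sec M W \<Longrightarrow> triv W s = triv W t \<longleftrightarrow> s = t"
  using triv_inj[of "s + - t"] triv_add[of s "- t"] triv_minus[of t] W
  by (auto simp: sec_minus sec_add sec_diff)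

text \<open>An operator P on functions acts on m^(-n) \<otimes> s through m^n P m^(-n) on s. The
  components are compared separately because the action on the second one is itself conjugated by
  z^n.\<close>

lemma triv_act:
  assumes s: "s \<in> sec M W" and P: "P \<in> diff_ops 0 W"
  shows "act T W P (triv W s) = triv W (act M W (twist_op n m P) s)"
proof -
  note o = W_open W
  have r: "res M W (W \<inter> U_zero) s \<in> sec M (W \<inter> U_zero)" "res M W (W \<inter> U_infty) s \<in> sec M (W \<inter> U_infty)"
    using o s by (auto intro!: res_sec)
  have P0: "P \<in> diff_ops (int n) (W \<inter> U_zero)"
  proof -
    \<comment> \<open>\<open>lform 0 1\<close> is the constant - 1, so this conjugation does
      nothing; it serves to see P as an operator on O_n over \<open>U_zero\<close>, where O_n is
      trivial.\<close>
    have "twist_op n (lform 0 1) P \<in> diff_ops (int n) (W \<inter> U_zero)"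
      using twist_op_diff_ops[of 0 1 "W \<inter> U_zero" P n] pt_notin_charts
        diff_ops_mono[of "W \<inter> U_zero" W P 0] P by simp
    moreover have "twist_op n (lform 0 1) P f = P f" for f
    proof -
      have e: "lform 0 1 = const_fun (- 1)" "inverse (const_fun (- 1)) = const_fun (- 1)"
        by (simp_all add: lform_infinity const_fun_simps)
      have "twist_op n (lform 0 1) P f = const_fun ((- 1) ^ n) * P (const_fun ((- 1) ^ n) * f)"
        unfolding twist_op_def e by (simp add: mult_op_def const_fun_power)
      also have "\<dots> = const_fun ((- 1) ^ n * (- 1) ^ n) * P f"
        using P unfolding const_fun_simps by (simp add: diff_ops_def c_linear_def)
      also have "(- 1 :: complex) ^ n * (- 1) ^ n = 1" by (simp flip: power_mult_distrib)
      finally show ?thesis by (simp add: const_fun_simps)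
    qed
    ultimately show ?thesis by (metis ext)
  qed
  have P1: "twist_op n zcoord P \<in> diff_ops (int n) (W \<inter> U_infty)"
    using twist_op_diff_ops[of 1 0 "W \<inter> U_infty" P n] P pt_notin_charts diff_ops_mono[of "W \<inter> U_infty" W]
    by (simp add: lform_zero)
  have Q: "twist_op n m P \<in> diff_ops (int n) W" "twist_op n m P \<in> diff_ops (int n) (W \<inter> U_zero)"
    "twist_op n m P \<in> diff_ops (int n) (W \<inter> U_infty)"
    using twist_op_diff_ops[OF bd W(2) P, of n] diff_ops_mono[of "W \<inter> U_zero" W]
      diff_ops_mono[of "W \<inter> U_infty" W] by simp_all
  have c0: "P \<circ> mult_op unit0 = mult_op unit0 \<circ> twist_op n m P"
    using unit_simps(1) by (simp add: fun_eq_iff twist_op_def mult_op_def unit0_def mult.assoc[symmetric] mult.commute)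
  have c1: "twist_op n zcoord P \<circ> mult_op unit1 = mult_op unit1 \<circ> twist_op n m P"
  proof
    fix f
    have 1: "inverse zcoord ^ n * (unit1 * f) = inverse m ^ n * f"
      by (simp only: unit_simps(3) unit0_def flip: mult.assoc)
    have 2: "unit1 * (m ^ n * g) = zcoord ^ n * g" for g
      using unit_simps(1) by (simp add: unit_simps(4) mult_ac)
    show "(twist_op n zcoord P \<circ> mult_op unit1) f = (mult_op unit1 \<circ> twist_op n m P) f"
      by (simp only: twist_op_def mult_op_def comp_def 1 2)
  qed
  have "act M (W \<inter> U_zero) P (act M (W \<inter> U_zero) (mult_op unit0) (res M W (W \<inter> U_zero) s)) =
     act M (W \<inter> U_zero) (mult_op unit0) (act M (W \<inter> U_zero) (twist_op n m P) (res M W (W \<inter> U_zero) s))"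
    using c0 o r P0 Q units_W mult_op_diff_ops by (metis act_comp)
  moreover have "act M (W \<inter> U_infty) (twist_op n zcoord P) (act M (W \<inter> U_infty) (mult_op unit1) (res M W (W \<inter> U_infty) s)) =
     act M (W \<inter> U_infty) (mult_op unit1) (act M (W \<inter> U_infty) (twist_op n m P) (res M W (W \<inter> U_infty) s))"
    using c1 o r P1 Q units_W mult_op_diff_ops by (metis act_comp)
  ultimately show ?thesis unfolding triv_def T_act using o s Q by (simp add: res_act)
qed

end

lemma triv_res:
  assumes W: "zariski_open W" "pt b d \<notin> W" and V: "zariski_open V" "V \<subseteq> W" and s: "s \<in> sec M W"
  shows "res T W V (triv W s) = triv V (res M W V s)"
proof -
  have Vq: "pt b d \<notin> V" using W V by auto
  note o = W_open[OF W] W_open[OF V(1) Vq] W V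
  note u = units_W[OF W] units_W[OF V(1) Vq]
  have "res M (W \<inter> U_zero) (V \<inter> U_zero) (act M (W \<inter> U_zero) (mult_op unit0) (res M W (W \<inter> U_zero) s)) =
     act M (V \<inter> U_zero) (mult_op unit0) (res M W (V \<inter> U_zero) s)"
    using o s u by (subst res_act_mult) (auto intro!: res_sec arg_cong[where f = "act M _ _"] res_res)
  moreover have "res M (W \<inter> U_infty) (V \<inter> U_infty) (act M (W \<inter> U_infty) (mult_op unit1) (res M W (W \<inter> U_infty) s)) =
     act M (V \<inter> U_infty) (mult_op unit1) (res M W (V \<inter> U_infty) s)"
    using o s u by (subst res_act_mult) (auto intro!: res_sec arg_cong[where f = "act M _ _"] res_res)
  moreover have "res M V (V \<inter> U_zero) (res M W V s) = res M W (V \<inter> U_zero) s"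
    "res M V (V \<inter> U_infty) (res M W V s) = res M W (V \<inter> U_infty) s"
    using o s by (auto intro!: res_res)
  ultimately show ?thesis by (simp add: triv_def T_res)
qed

lemma twist_op_mult: "twist_op n m (mult_op f) = mult_op f"
  using lform_nonzero[OF bd] by (simp add: fun_eq_iff twist_op_def mult_op_def field_simps)

lemma triv_act_mult:
  assumes "zariski_open W" "pt b d \<notin> W" "s \<in> sec M W" "f \<in> O_X W"
  shows "act T W (mult_op f) (triv W s) = triv W (act M W (mult_op f) s)"
  using triv_act[OF assms(1-3) mult_op_diff_ops[OF assms(4)]] by (simp add: twist_op_mult)

end

subsection \<open>Transport along the trivialisation\<close>

context twisted_chart
begin

definition triv_pre :: "cp1 set \<Rightarrow> ('m \<times> 'm) set \<Rightarrow> 'm set" where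
  "triv_pre V X = {s \<in> sec M V. triv V s \<in> X}"

lemma submodule_triv_pre:
  assumes V: "zariski_open V" "pt b d \<notin> V" and R: "R \<subseteq> diff_ops 0 V" and X: "submodule R T V X"
  shows "submodule (twist_op n m ` R) M V (triv_pre V X)"
  unfolding submodule_def
proof (intro conjI ballI)
  show "triv_pre V X \<subseteq> sec M V" by (auto simp: triv_pre_def)
  show "0 \<in> triv_pre V X" using X V by (simp add: triv_pre_def sec_zero triv_0 submodule_def)
  fix s assume s: "s \<in> triv_pre V X"
  show "- s \<in> triv_pre V X" using s X V by (auto simp: triv_pre_def triv_minus submodule_def sec_minus)
  show "s + t \<in> triv_pre V X" if "t \<in> triv_pre V X" for t
    using s that X V by (auto simp: triv_pre_def triv_add submodule_def sec_add)
  show "act M V P s \<in> triv_pre V X" if "P \<in> twist_op n m ` R" for P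
  proof -
    obtain Q where Q: "Q \<in> R" "P = twist_op n m Q" using \<open>P \<in> _\<close> by blast
    have "Q \<in> diff_ops 0 V" using Q R by blast
    then have "act T V Q (triv V s) = triv V (act M V P s)" using s V Q by (simp add: triv_act triv_pre_def)
    moreover have "act T V Q (triv V s) \<in> X" using X Q s by (auto simp: submodule_def triv_pre_def)
    moreover have "P \<in> diff_ops (int n) V" using Q R twist_op_diff_ops[OF bd V(2)] by auto
    ultimately show ?thesis using s V by (simp add: triv_pre_def act_sec)
  qed
qed

lemma submodule_triv_image:
  assumes V: "zariski_open V" "pt b d \<notin> V" and R: "R \<subseteq> diff_ops 0 V"
    and Y: "submodule (twist_op n m ` R) M V Y"
  shows "submodule R T V (triv V ` Y)"
proof -
  have YV: "y \<in> sec M V" if "y \<in> Y" for y using Y that by (auto simp: submodule_def)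
  show ?thesis
    unfolding submodule_def
  proof (intro conjI ballI)
    show "triv V ` Y \<subseteq> sec T V" using YV V triv_mem by auto
    show "0 \<in> triv V ` Y" using Y triv_0[OF V] by (force simp: submodule_def intro: image_eqI[of _ _ 0])
    fix s assume "s \<in> triv V ` Y"
    then obtain y where y: "y \<in> Y" "s = triv V y" by blast
    show "- s \<in> triv V ` Y" using y Y YV triv_minus[OF V] by (auto simp: submodule_def intro!: image_eqI[of _ _ "- y"])
    show "s + t \<in> triv V ` Y" if "t \<in> triv V ` Y" for t
      using that y Y YV triv_add[OF V] by (auto simp: submodule_def) (metis image_eqI)
    show "act T V P s \<in> triv V ` Y" if "P \<in> R" for P
    proof -
      have "act T V P s = triv V (act M V (twist_op n m P) y)"
        using that R y YV V by (auto simp: triv_act)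
      moreover have "act M V (twist_op n m P) y \<in> Y" using that Y y by (auto simp: submodule_def)
      ultimately show ?thesis by blast
    qed
  qed
qed

text \<open>The image of Y under \<open>triv\<close> is a submodule containing S, hence contains the
  hull, and \<open>triv\<close> is injective. Expressing generation by minimality avoids comparing
  two hulls.\<close>

lemma hull_triv_pre:
  assumes V: "zariski_open V" "pt b d \<notin> V" and R: "R \<subseteq> diff_ops 0 V" and S: "S \<subseteq> sec T V"
    and Y: "submodule (twist_op n m ` R) M V Y" "triv_pre V S \<subseteq> Y"
  shows "triv_pre V (submodule R T V hull S) \<subseteq> Y"
proof
  fix s assume s: "s \<in> triv_pre V (submodule R T V hull S)"
  have "S \<subseteq> triv V ` Y"
  proof
    fix x assume x: "x \<in> S"
    then obtain y where "y \<in> sec M V" "triv V y = x" using triv_surj[OF V] S by blast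
    then have "y \<in> triv_pre V S" using x by (simp add: triv_pre_def)
    then show "x \<in> triv V ` Y" using Y \<open>triv V y = x\<close> by blast
  qed
  then have "submodule R T V hull S \<subseteq> triv V ` Y"
    using submodule_triv_image[OF V R Y(1)] by (rule hull_minimal)
  then obtain y where "y \<in> Y" "triv V s = triv V y" using s by (auto simp: triv_pre_def)
  moreover have "s \<in> sec M V" "y \<in> sec M V" using s Y \<open>y \<in> Y\<close> by (auto simp: triv_pre_def submodule_def)
  ultimately show "s \<in> Y" using triv_eq_iff[OF V] by simp
qed

lemma finite_triv_pre:
  assumes V: "zariski_open V" "pt b d \<notin> V" and "finite S"
  shows "finite (triv_pre V S)"
proof (rule finite_imageD)
  show "finite (triv V ` triv_pre V S)" by (rule finite_subset[OF _ assms(3)]) (auto simp: triv_pre_def)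
  show "inj_on (triv V) (triv_pre V S)" using triv_eq_iff[OF V] by (auto simp: inj_on_def triv_pre_def)
qed

lemma O_ops_diff_ops: "O_ops U \<subseteq> diff_ops k U"
  by (auto simp: O_ops_def intro: mult_op_diff_ops)

lemma twist_O_ops: "twist_op n m ` O_ops U = O_ops U"
  by (auto simp: O_ops_def twist_op_mult image_image)

lemma qc_transport:
  assumes qc: "quasi_coherent_on T UNIV" and W: "affine_open W" "pt b d \<notin> W" and f: "f \<in> O_X W"
    and V: "V = {x \<in> W. \<not> has_value f x 0}" "zariski_open V"
  shows "s \<in> sec M W \<Longrightarrow> res M W V s = 0 \<Longrightarrow> \<exists>k. act M W (mult_op (f ^ k)) s = 0"
    and "s \<in> sec M V \<Longrightarrow> \<exists>k. \<exists>t\<in>sec M W. act M V (mult_op (f ^ k)) s = res M W V t"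
proof -
  have oW: "zariski_open W" using W by (simp add: affine_open_def)
  have VW: "V \<subseteq> W" "pt b d \<notin> V" using V W by auto
  have fk: "f ^ k \<in> O_X W" "f ^ k \<in> O_X V" for k using O_X_power[OF f] VW O_X_mono by blast+
  have 1: "\<forall>s\<in>sec T W. res T W V s = 0 \<longrightarrow> (\<exists>k. act T W (mult_op (f ^ k)) s = 0)"
    and 2: "\<forall>s\<in>sec T V. \<exists>k. \<exists>t\<in>sec T W. act T V (mult_op (f ^ k)) s = res T W V t"
    using qc W f unfolding quasi_coherent_on_def Let_def V(1) by blast+
  show "\<exists>k. act M W (mult_op (f ^ k)) s = 0" if s: "s \<in> sec M W" "res M W V s = 0"
  proof -
    have "res T W V (triv W s) = 0" using triv_res[OF oW W(2) V(2) VW(1) s(1)] s(2) triv_0[OF V(2) VW(2)] by simp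
    then obtain k where "act T W (mult_op (f ^ k)) (triv W s) = 0" using 1 triv_mem[OF oW W(2) s(1)] by blast
    then have "triv W (act M W (mult_op (f ^ k)) s) = 0" using triv_act_mult[OF oW W(2) s(1) fk(1)] by simp
    then show ?thesis using triv_inj[OF oW W(2)] act_mult_mem[OF oW fk(1) s(1)] by blast
  qed
  show "\<exists>k. \<exists>t\<in>sec M W. act M V (mult_op (f ^ k)) s = res M W V t" if s: "s \<in> sec M V"
  proof -
    obtain k t where t: "t \<in> sec T W" "act T V (mult_op (f ^ k)) (triv V s) = res T W V t"
      using 2 triv_mem[OF V(2) VW(2) s] by blast
    obtain t' where t': "t' \<in> sec M W" "triv W t' = t" using triv_surj[OF oW W(2) t(1)] by blast
    have "triv V (act M V (mult_op (f ^ k)) s) = triv V (res M W V t')"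
      using t(2) t' triv_act_mult[OF V(2) VW(2) s fk(2)] triv_res[OF oW W(2) V(2) VW(1) t'(1)] by simp
    then have "act M V (mult_op (f ^ k)) s = res M W V t'"
      using triv_eq_iff[OF V(2) VW(2)] act_mult_mem[OF V(2) fk(2) s] res_sec[OF oW V(2) VW(1) t'(1)] by blast
    then show ?thesis using t' by blast
  qed
qed

end

subsection \<open>Quasi-coherence on an affine chart\<close>

text \<open>A nonzero element of least degree divides the whole ideal; were it not constant, its
  root would be a common zero.\<close>

lemma poly_ideal_unit:
  fixes I :: "complex poly set"
  assumes add: "\<And>u v. u \<in> I \<Longrightarrow> v \<in> I \<Longrightarrow> u + v \<in> I" and mult: "\<And>r u. u \<in> I \<Longrightarrow> r * u \<in> I"
    and zeros: "\<And>t. \<exists>u\<in>I. poly u t \<noteq> 0"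
  shows "1 \<in> I"
proof -
  obtain u0 where "u0 \<in> I" "poly u0 0 \<noteq> 0" using zeros by blast
  then have "u0 \<in> I \<and> u0 \<noteq> 0" by auto
  then obtain r where r: "r \<in> I" "r \<noteq> 0" and min: "\<And>u. u \<in> I \<and> u \<noteq> 0 \<Longrightarrow> degree r \<le> degree u"
    using ex_has_least_nat[of "\<lambda>u. u \<in> I \<and> u \<noteq> 0" u0 degree] by blast
  have dvd: "r dvd u" if "u \<in> I" for u
  proof -
    have "u mod r = u + (- (u div r)) * r" by (simp add: minus_div_mult_eq_mod[symmetric])
    then have "u mod r \<in> I" using add[OF that mult[OF r(1), of "- (u div r)"]] by simp
    moreover have "u mod r = 0 \<or> degree (u mod r) < degree r" using degree_mod_less[OF r(2)] .
    ultimately have "u mod r = 0" using min[of "u mod r"] by force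
    then show ?thesis by (simp add: dvd_eq_mod_eq_0)
  qed
  have "degree r = 0"
  proof (rule ccontr)
    assume "degree r \<noteq> 0"
    then have "\<not> constant (poly r)" using constant_degree[of r] by simp
    then obtain t where "poly r t = 0" using fundamental_theorem_of_algebra by blast
    then show False using zeros[of t] dvd by (metis dvdE mult_eq_0_iff poly_mult)
  qed
  then obtain x where "r = [:x:]" by (metis degree_eq_zeroE)
  then have "[:inverse x:] * r = 1" using r(2) by (simp add: pCons_one)
  then show ?thesis using mult[OF r(1)] by metis
qed

locale framed_module = twisted_frame a b c d n + twisted_module n M
  for a b c d :: complex and n :: nat and M :: "'m::ab_group_add dsheaf" +
  assumes qc_T: "quasi_coherent_on (line_bundle_tensor (- int n) M) UNIV"
begin

lemma chart: "(x, y) \<noteq> (0, 0) \<Longrightarrow> twisted_chart n M x y (line_bundle_tensor (- int n) M)"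
  by unfold_locales auto

lemma affine_avoids: "affine_open W \<Longrightarrow> \<exists>x y. (x, y) \<noteq> (0, 0) \<and> pt x y \<notin> W"
  unfolding affine_open_def using pt_cases by (metis UNIV_eq_I)

text \<open>Quasi-coherence is assumed for the untwisted module. An affine open set misses some
  point, and off that point the two modules are identified.\<close>

lemma qc:
  assumes W: "affine_open W" and f: "f \<in> O_X W"
    and V: "V = {x \<in> W. \<not> has_value f x 0}" "zariski_open V"
  shows qc_kernel: "s \<in> sec M W \<Longrightarrow> res M W V s = 0 \<Longrightarrow> \<exists>k. act M W (mult_op (f ^ k)) s = 0"
    and qc_extend: "s \<in> sec M V \<Longrightarrow> \<exists>k. \<exists>t\<in>sec M W. act M V (mult_op (f ^ k)) s = res M W V t"
proof -
  obtain x y where xy: "(x, y) \<noteq> (0, 0)" "pt x y \<notin> W" using affine_avoids[OF W] by blast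
  interpret ch: twisted_chart n M x y "line_bundle_tensor (- int n) M" by (rule chart[OF xy(1)])
  show "s \<in> sec M W \<Longrightarrow> res M W V s = 0 \<Longrightarrow> \<exists>k. act M W (mult_op (f ^ k)) s = 0"
    using ch.qc_transport(1)[OF qc_T W xy(2) f V] .
  show "s \<in> sec M V \<Longrightarrow> \<exists>k. \<exists>t\<in>sec M W. act M V (mult_op (f ^ k)) s = res M W V t"
    using ch.qc_transport(2)[OF qc_T W xy(2) f V] .
qed

abbreviation "Up \<equiv> - {pt a c}"
abbreviation "Uq \<equiv> - {pt b d}"

lemma Up_open: "zariski_open Up" "affine_open Up" and Uq_open: "zariski_open Uq" "affine_open Uq"
  by (auto simp: affine_open_def zariski_open_simps)

lemma subst_wc_Up: "W \<subseteq> Up \<Longrightarrow> subst_poly wc u \<in> O_X W"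
  by (intro subst_poly_wc_O_X) auto

lemma subst_zc_Uq: "W \<subseteq> Uq \<Longrightarrow> subst_poly zc u \<in> O_X W"
  by (intro subst_poly_zc_O_X) auto

definition "psc W u = act M W (mult_op (subst_poly wc u))"

lemma cmodule_psc: "zariski_open W \<Longrightarrow> W \<subseteq> Up \<Longrightarrow> cmodule (sec M W) (psc W)"
  unfolding psc_def
  by (rule cmodule_sec) (simp_all add: subst_wc_Up subst_poly_add subst_poly_mult subst_poly_1)

lemma res_psc: "zariski_open V \<Longrightarrow> zariski_open W \<Longrightarrow> V \<subseteq> W \<Longrightarrow> W \<subseteq> Up \<Longrightarrow> s \<in> sec M W \<Longrightarrow>
    res M W V (psc W u s) = psc V u (res M W V s)"
  unfolding psc_def by (intro res_act_mult subst_wc_Up)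

text \<open>This exhibits W as the non-vanishing locus of one polynomial in \<open>wc\<close>, the
  form in which quasi-coherence compares sections over W with sections over X - p.\<close>

lemma open_complement_roots:
  assumes W: "zariski_open W" "W \<noteq> {}" "W \<subseteq> Up"
  obtains R where "finite R" "\<And>x t. has_value wc x t \<Longrightarrow> x \<in> W \<longleftrightarrow> t \<notin> R"
    "W = {x \<in> Up. \<not> has_value (subst_poly wc (root_poly R)) x 0}"
proof -
  interpret wc: affine_coordinate wc "pt a c" by (rule affine_coordinate_wc)
  define R where "R = {t. \<exists>x\<in>Up - W. has_value wc x t}"
  have "R \<subseteq> (\<lambda>x. THE t. has_value wc x t) ` (- W)"
  proof
    fix t assume "t \<in> R"
    then obtain x where x: "x \<in> Up - W" "has_value wc x t" by (auto simp: R_def)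
    then have "(THE t. has_value wc x t) = t" using has_value_unique by blast
    then show "t \<in> (\<lambda>x. THE t. has_value wc x t) ` (- W)" using x by (metis ComplI DiffD2 image_eqI)
  qed
  moreover have "finite (- W)" using W by (auto simp: zariski_open_def)
  ultimately have fR: "finite R" using finite_surj by blast
  have iff: "x \<in> W \<longleftrightarrow> t \<notin> R" if xt: "has_value wc x t" for x t
  proof
    assume "x \<in> W"
    then show "t \<notin> R" using wc.point_unique[OF xt] by (auto simp: R_def)
  next
    assume "t \<notin> R"
    moreover have "x \<in> Up" using not_has_value_of_inverse[OF wc.pole wc.nonzero] xt by auto
    ultimately show "x \<in> W" using xt by (auto simp: R_def)
  qed
  have "x \<in> W \<longleftrightarrow> \<not> has_value (subst_poly wc (root_poly R)) x 0" if x: "x \<in> Up" for x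
  proof -
    obtain t where t: "has_value wc x t" using wc.value_ex x by auto
    have "has_value (subst_poly wc (root_poly R)) x (poly (root_poly R) t)" using t by (rule has_value_subst_poly)
    then have "has_value (subst_poly wc (root_poly R)) x 0 \<longleftrightarrow> poly (root_poly R) t = 0"
      using has_value_unique by metis
    then show ?thesis using iff[OF t] poly_root_poly_eq_0_iff[OF fR] by simp
  qed
  then have "W = {x \<in> Up. \<not> has_value (subst_poly wc (root_poly R)) x 0}" using W(3) by blast
  then show ?thesis using that fR iff by blast
qed

text \<open>The generators over W extend to X - p after multiplication by powers of h, the
  polynomial that cuts out the complement of W. Every section over X - p is then brought into the
  span of these extensions by a power of h.\<close>

lemma finite_generation_local:
  assumes W: "zariski_open W" "W \<noteq> {}" "W \<subseteq> Up" and fg: "finitely_generated (O_ops W) M W (sec M W)"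
  shows "\<exists>R G. finite R \<and> finite G \<and> G \<subseteq> sec M Up \<and> (\<forall>x t. has_value wc x t \<longrightarrow> x \<in> W \<longrightarrow> t \<notin> R) \<and>
     (\<forall>s\<in>sec M Up. \<exists>k. psc Up (root_poly R ^ k) s \<in> cmodule.spn (psc Up) G)"
proof -
  interpret wc: affine_coordinate wc "pt a c" by (rule affine_coordinate_wc)
  interpret N: cmodule "sec M Up" "psc Up" using Up_open by (intro cmodule_psc) auto
  interpret A: cmodule "sec M W" "psc W" using W by (intro cmodule_psc) auto
  obtain R where R: "finite R" "\<And>x t. has_value wc x t \<Longrightarrow> x \<in> W \<longleftrightarrow> t \<notin> R"
    "W = {x \<in> Up. \<not> has_value (subst_poly wc (root_poly R)) x 0}"
    using open_complement_roots[OF W] by blast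
  define h where "h = root_poly R"
  have hk: "subst_poly wc h ^ k = subst_poly wc (h ^ k)" for k by (simp add: subst_poly_power)
  have ext: "\<exists>k. \<exists>t\<in>sec M Up. psc W (h ^ k) s = res M Up W t" if "s \<in> sec M W" for s
    using qc_extend[OF Up_open(2) subst_wc_Up R(3) W(1) that] unfolding h_def[symmetric] hk psc_def by simp
  have ker: "\<exists>k. psc Up (h ^ k) s = 0" if "s \<in> sec M Up" "res M Up W s = 0" for s
    using qc_kernel[OF Up_open(2) subst_wc_Up R(3) W(1) that] unfolding h_def[symmetric] hk psc_def by simp
  have rp: "res M Up W (psc Up u s) = psc W u (res M Up W s)" if "s \<in> sec M Up" for u s
    using W Up_open that by (intro res_psc) auto
  have rm: "res M Up W s \<in> sec M W" if "s \<in> sec M Up" for s using W Up_open that by (intro res_sec) auto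
  have ra: "res M Up W (s + t) = res M Up W s + res M Up W t" if "s \<in> sec M Up" "t \<in> sec M Up" for s t
    using W Up_open that by (intro res_add) auto
  obtain S where S: "finite S" "S \<subseteq> sec M W" "submodule (O_ops W) M W hull S = sec M W"
    using fg by (auto simp: finitely_generated_def)
  obtain \<tau> where \<tau>: "\<forall>s\<in>S. \<tau> s \<in> sec M Up \<and> (\<exists>k. psc W (h ^ k) s = res M Up W (\<tau> s))"
    using ext S(2) by (metis subsetD)
  define G where "G = \<tau> ` S"
  have G: "finite G" "G \<subseteq> sec M Up" using S \<tau> by (auto simp: G_def)
  have sG: "N.subm (N.spn G)" using G by (intro N.subm_spn)
  \<comment> \<open>The sections over W that a power of h moves into the restricted span. This set
    is stable under functions on W because they have powers of h as denominators.\<close>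
  define X where "X = {y \<in> sec M W. \<exists>k. \<exists>t\<in>N.spn G. psc W (h ^ k) y = res M Up W t}"
  have X: "submodule (O_ops W) M W X"
    unfolding submodule_def
  proof (intro conjI ballI)
    show "X \<subseteq> sec M W" by (auto simp: X_def)
    have "psc W (h ^ 0) 0 = res M Up W 0" using Up_open W by (simp add: A.sc_zero_right res_0)
    then show "0 \<in> X" unfolding X_def using A.zero_mem N.subm_zero[OF sG] by blast
  next
    fix x y assume "x \<in> X" "y \<in> X"
    then obtain k t k' t' where x: "x \<in> sec M W" "t \<in> N.spn G" "psc W (h ^ k) x = res M Up W t"
      and y: "y \<in> sec M W" "t' \<in> N.spn G" "psc W (h ^ k') y = res M Up W t'" by (auto simp: X_def)
    have tC: "t \<in> sec M Up" "t' \<in> sec M Up" using x y N.subm_subset[OF sG] by auto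
    have "psc W (h ^ (k + k')) (x + y) = psc W (h ^ k') (psc W (h ^ k) x) + psc W (h ^ k) (psc W (h ^ k') y)"
      using x y by (simp add: A.sc_add_right A.sc_mult power_add A.sc_commute[of x "h ^ k"])
    also have "\<dots> = res M Up W (psc Up (h ^ k') t + psc Up (h ^ k) t')"
      using x y tC by (simp add: rp ra N.sc_mem)
    finally have "psc W (h ^ (k + k')) (x + y) = res M Up W (psc Up (h ^ k') t + psc Up (h ^ k) t')" .
    moreover have "psc Up (h ^ k') t + psc Up (h ^ k) t' \<in> N.spn G" using x y by (intro N.spn_add N.spn_sc)
    moreover have "x + y \<in> sec M W" using x y by (intro A.add_mem)
    ultimately show "x + y \<in> X" unfolding X_def by blast
  next
    fix x assume "x \<in> X"
    then obtain k t where x: "x \<in> sec M W" "t \<in> N.spn G" "psc W (h ^ k) x = res M Up W t" by (auto simp: X_def)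
    have tC: "t \<in> sec M Up" using x N.subm_subset[OF sG] by auto
    have "psc W (h ^ k) (- x) = res M Up W (- t)"
      using x tC W Up_open by (simp add: A.sc_minus_right res_minus)
    then show "- x \<in> X" unfolding X_def using x N.subm_minus[OF sG] A.minus_mem by blast
    fix P assume "P \<in> O_ops W"
    then obtain f where f: "f \<in> O_X W" "P = mult_op f" by (auto simp: O_ops_def)
    have "regular_at f x" if "has_value wc x t" "t \<notin> R" for x t using f R(2) that by (auto simp: O_X_iff)
    then obtain u e where u: "f * subst_poly wc (h ^ e) = subst_poly wc u"
      using wc.regular_off_roots[OF R(1), of f] by (auto simp: h_def)
    have he: "subst_poly wc (h ^ e) \<in> O_X W" "subst_poly wc (h ^ k) \<in> O_X W" using W by (auto intro: subst_wc_Up)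
    have "psc W (h ^ (k + e)) (act M W P x) = psc W (h ^ k) (act M W (mult_op (f * subst_poly wc (h ^ e))) x)"
      using x f he W unfolding psc_def
      by (simp add: power_add subst_poly_mult act_mult act_mult_mem act_mult_commute[of W f])
    also have "\<dots> = psc W u (res M Up W t)" unfolding u using x(3) A.sc_commute[OF x(1), of "h ^ k" u] by (simp add: psc_def)
    also have "\<dots> = res M Up W (psc Up u t)" using rp[OF tC] by simp
    finally have "psc W (h ^ (k + e)) (act M W P x) = res M Up W (psc Up u t)" .
    moreover have "act M W P x \<in> sec M W" using f x W by (simp add: act_mult_mem)
    ultimately show "act M W P x \<in> X" unfolding X_def using N.spn_sc[OF x(2)] by blast
  qed
  have "S \<subseteq> X"
  proof
    fix s assume s: "s \<in> S"
    then obtain k where "psc W (h ^ k) s = res M Up W (\<tau> s)" using \<tau> by blast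
    moreover have "\<tau> s \<in> N.spn G" using s by (auto simp: G_def intro: N.spn_base)
    ultimately show "s \<in> X" unfolding X_def using s S by blast
  qed
  then have XW: "sec M W \<subseteq> X" using hull_minimal[of S X "submodule (O_ops W) M W"] X S(3) by simp
  have "\<exists>k. psc Up (h ^ k) s \<in> N.spn G" if s: "s \<in> sec M Up" for s
  proof -
    obtain k t where t: "t \<in> N.spn G" "psc W (h ^ k) (res M Up W s) = res M Up W t"
      using XW rm[OF s] by (auto simp: X_def)
    have tC: "t \<in> sec M Up" using t N.subm_subset[OF sG] by auto
    \<comment> \<open>The two sides agree only after restriction to W; by quasi-coherence their
      difference is killed by a further power of h.\<close>
    have "res M Up W (psc Up (h ^ k) s - t) = 0"
      using t s tC W Up_open by (simp add: res_diff rp N.sc_mem)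
    then obtain k' where "psc Up (h ^ k') (psc Up (h ^ k) s - t) = 0"
      using ker[of "psc Up (h ^ k) s - t"] s tC by (auto simp: N.diff_mem N.sc_mem)
    then have "psc Up (h ^ (k' + k)) s = psc Up (h ^ k') t"
      using s tC by (simp add: N.sc_diff_right N.sc_mem N.sc_mult power_add)
    then show ?thesis using t N.spn_sc by metis
  qed
  then show ?thesis
    by (intro exI[of _ R] exI[of _ G] conjI) (use R(1,2) G in \<open>auto simp: h_def\<close>)
qed

text \<open>A partition of unity: the polynomials carrying s into the span form an ideal, and the
  local statements leave it without common zeros.\<close>

lemma finite_generation_Up:
  assumes coh: "\<And>x. x \<in> Up \<Longrightarrow> \<exists>V. zariski_open V \<and> x \<in> V \<and> O_coherent_on M V"
  shows "\<exists>G. finite G \<and> G \<subseteq> sec M Up \<and> sec M Up \<subseteq> cmodule.spn (psc Up) G"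
proof -
  interpret wc: affine_coordinate wc "pt a c" by (rule affine_coordinate_wc)
  interpret N: cmodule "sec M Up" "psc Up" using Up_open by (intro cmodule_psc) auto
  have "\<exists>R G. finite R \<and> finite G \<and> G \<subseteq> sec M Up \<and> z \<notin> R \<and>
     (\<forall>s\<in>sec M Up. \<exists>k. psc Up (root_poly R ^ k) s \<in> N.spn G)" for z
  proof -
    obtain x where x: "x \<in> Up" "has_value wc x z" using wc.point_ex by auto
    obtain V where V: "zariski_open V" "x \<in> V" "O_coherent_on M V" using coh[OF x(1)] by blast
    have W: "zariski_open (V \<inter> Up)" "V \<inter> Up \<noteq> {}" "V \<inter> Up \<subseteq> Up" "affine_open (V \<inter> Up)" "V \<inter> Up \<subseteq> V"
      using V x Up_open by (auto simp: affine_open_def intro: zariski_open_Int)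
    then have "finitely_generated (O_ops (V \<inter> Up)) M (V \<inter> Up) (sec M (V \<inter> Up))"
      using V(3) by (auto simp: O_coherent_on_def)
    from finite_generation_local[OF W(1-3) this] show ?thesis using x V(2) by blast
  qed
  then obtain R G where RG: "\<And>z. finite (R z) \<and> finite (G z) \<and> G z \<subseteq> sec M Up \<and> z \<notin> R z \<and>
     (\<forall>s\<in>sec M Up. \<exists>k. psc Up (root_poly (R z) ^ k) s \<in> N.spn (G z))" by metis
  \<comment> \<open>The neighbourhood chosen for 0 misses only the finite set \<open>R 0\<close>;
    one further neighbourhood for each of these points completes a finite cover.\<close>
  define Z where "Z = insert 0 (R 0)"
  define GG where "GG = (\<Union>z\<in>Z. G z)"
  have GG: "finite GG" "GG \<subseteq> sec M Up" using RG by (auto simp: GG_def Z_def)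
  have sG: "N.subm (N.spn GG)" using GG by (intro N.subm_spn)
  have "s \<in> N.spn GG" if s: "s \<in> sec M Up" for s
  proof -
    define I where "I = {u. psc Up u s \<in> N.spn GG}"
    have "1 \<in> I"
    proof (rule poly_ideal_unit)
      fix u v assume "u \<in> I" "v \<in> I"
      then show "u + v \<in> I" using s by (simp add: I_def N.sc_add_left N.spn_add)
    next
      fix r u assume "u \<in> I"
      then show "r * u \<in> I" using s by (simp add: I_def N.sc_mult N.spn_sc)
    next
      fix t
      obtain z where z: "z \<in> Z" "t \<notin> R z"
      proof (cases "t \<in> R 0")
        case True
        then show ?thesis using that[of t] RG[of t] by (simp add: Z_def)
      next
        case False
        then show ?thesis using that[of 0] by (simp add: Z_def)
      qed
      obtain k where "psc Up (root_poly (R z) ^ k) s \<in> N.spn (G z)" using RG s by blast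
      moreover have "N.spn (G z) \<subseteq> N.spn GG" using z by (intro N.spn_mono) (auto simp: GG_def)
      ultimately have "root_poly (R z) ^ k \<in> I" by (auto simp: I_def)
      moreover have "poly (root_poly (R z) ^ k) t \<noteq> 0" using RG[of z] z by (simp add: poly_root_poly_eq_0_iff)
      ultimately show "\<exists>u\<in>I. poly u t \<noteq> 0" by blast
    qed
    then show ?thesis using s by (simp add: I_def N.sc_one)
  qed
  then show ?thesis using GG by blast
qed

end

subsection \<open>Commutation relations\<close>

context twisted_frame
begin

lemma Fg_simps: "Fg (- f) = - Fg f" "Fg (f - h) = Fg f - Fg h" "Fg (of_nat k * f) = of_nat k * Fg f"
  "Fg (2 * f) = 2 * Fg f"
proof -
  show 1: "Fg (- f) = - Fg f" for f using Fg_linear(2)[of "- 1" f] by (simp add: const_fun_simps)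
  show "Fg (f - h) = Fg f - Fg h" using Fg_linear(1)[of f "- h"] 1 by simp
  show "Fg (of_nat k * f) = of_nat k * Fg f" for k using Fg_linear(2)[of "of_nat k" f] by (simp add: const_fun_of_nat)
  from this[of 2] show "Fg (2 * f) = 2 * Fg f" by simp
qed

lemma Eg_add: "Eg (f + h) = Eg f + Eg h" and Eg_const: "Eg (const_fun x * f) = const_fun x * Eg f"
  unfolding Eg_def by (rule first_order_linear)+

lemma Eg_simps: "Eg (- f) = - Eg f" "Eg (f - h) = Eg f - Eg h" "Eg (of_nat k * f) = of_nat k * Eg f"
  "Eg (2 * f) = 2 * Eg f"
proof -
  show 1: "Eg (- f) = - Eg f" for f using Eg_const[of "- 1" f] by (simp add: const_fun_simps)
  show "Eg (f - h) = Eg f - Eg h" using Eg_add[of f "- h"] 1 by simp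
  show "Eg (of_nat k * f) = of_nat k * Eg f" for k using Eg_const[of "of_nat k" f] by (simp add: const_fun_of_nat)
  from this[of 2] show "Eg (2 * f) = 2 * Eg f" by simp
qed

lemma Eg_zc: "Eg (zc * f) = zc * Eg f + zc ^ 2 * f"
  unfolding Eg_Fg Fg_zc by (simp add: algebra_simps power2_eq_square)

lemma Eg_Fg_commutator: "Eg (Fg f) = Fg (Eg f) + Hg f"
  unfolding Eg_Fg Hg_Fg Fg_simps Fg_zc by (simp add: algebra_simps)

lemma Hg_Fg_commutator: "Hg (Fg f) = Fg (Hg f) + - 2 * Fg f"
  unfolding Hg_Fg minus_mult_left[symmetric] Fg_simps Fg_zc by (simp add: algebra_simps)

lemma Hg_zc: "Hg (zc * f) = zc * Hg f + 2 * (zc * f)"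
  unfolding Hg_Fg minus_mult_left[symmetric] Fg_simps Fg_zc by (simp add: algebra_simps)

lemma Hg_Eg_commutator: "Hg (Eg f) = Eg (Hg f) + 2 * Eg f"
proof -
  have 1: "Fg (Eg f) = Eg (Fg f) - Hg f" using Eg_Fg_commutator[of f] by simp
  have 2: "Eg (Hg f) = - 2 * (zc * Eg (Fg f) + zc ^ 2 * Fg f) - of_nat n * Eg f"
    unfolding Hg_Fg minus_mult_left[symmetric] Eg_simps Eg_zc ..
  have 3: "Hg (Eg f) = - 2 * (zc * (Eg (Fg f) - Hg f)) - of_nat n * Eg f"
    unfolding Hg_Fg[of "Eg f"] 1 ..
  have "Hg (Eg f) - Eg (Hg f) = 2 * (zc * Hg f) + 2 * (zc ^ 2 * Fg f)"
    unfolding 2 3 by (simp add: algebra_simps)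
  also have "\<dots> = 2 * Eg f"
    unfolding Hg_Fg Eg_Fg by (simp add: algebra_simps power2_eq_square)
  finally show ?thesis by (simp add: diff_eq_eq add.commute)
qed

text \<open>The relation (H + 1)^2 + 4 F E = (n + 1)^2, solved for H^2 as one product plus a
  remainder, the shape that \<open>act_identity\<close> transports to sections.\<close>

lemma casimir_op: "Hg (Hg f) = of_nat (n + 1) ^ 2 * f + (- 2 * Hg f + (- 1 * f + - 4 * Fg (Eg f)))"
  unfolding Eg_Fg Hg_Fg minus_mult_left[symmetric] Fg_simps Fg_zc
  by (simp add: algebra_simps power2_eq_square)


lemma Eg_subst_wc: "Eg (subst_poly wc u * f) = subst_poly wc u * Eg f - subst_poly wc (pderiv u) * f"
proof (induction u)
  case 0
  then show ?case using Eg_const[of 0 f] by (simp add: subst_poly_0 const_fun_simps)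
next
  case (pCons x u)
  have 1: "subst_poly wc (pCons x u) * f = const_fun x * f + wc * (subst_poly wc u * f)"
    by (simp add: subst_poly_pCons algebra_simps)
  have 2: "subst_poly wc (pderiv (pCons x u)) = subst_poly wc u + wc * subst_poly wc (pderiv u)"
    by (simp add: pderiv_pCons subst_poly_add subst_poly_pCons const_fun_simps)
  show ?case unfolding 1 2 Eg_add Eg_const Eg_wc pCons.IH
    by (simp add: subst_poly_pCons algebra_simps)
qed


lemma Eg_zc_power: "Eg (zc ^ k * f) = zc ^ k * Eg f + of_nat k * (zc ^ Suc k * f)"
proof (induction k)
  case (Suc k)
  have "Eg (zc ^ Suc k * f) = Eg (zc * (zc ^ k * f))" by (simp add: mult.assoc)
  then show ?case unfolding Eg_zc Suc by (simp add: algebra_simps power2_eq_square)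
qed simp

lemma Eg_wc_power: "wc * Eg (wc ^ k * f) = wc ^ Suc k * Eg f - of_nat k * (wc ^ k * f)"
proof (induction k)
  case (Suc k)
  have 1: "Eg (wc ^ Suc k * f) = wc ^ Suc k * Eg f - of_nat k * (wc ^ k * f) - wc ^ k * f"
    using Eg_wc[of "wc ^ k * f"] unfolding Suc by (simp add: mult.assoc)
  show ?case unfolding 1 by (simp add: algebra_simps)
qed simp

lemma Fg_zc_power: "Fg (zc ^ k * f) = zc ^ k * Fg f - of_nat k * (zc ^ (k - 1) * f)"
proof (induction k)
  case (Suc k)
  have "Fg (zc ^ Suc k * f) = zc * Fg (zc ^ k * f) - zc ^ k * f" by (simp add: mult.assoc Fg_zc)
  then show ?case unfolding Suc by (cases k) (simp_all add: algebra_simps)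
qed simp

text \<open>On the right all powers of zc stand next to f and exceed k, so a section killed by the
  power k + 1 is sent by E to one killed by the power k.\<close>

lemma zc_power_Eg: "zc ^ k * Eg f = - 1 * Fg (zc ^ (k + 2) * f) + of_int (- int (k + 2 + n)) * (zc ^ Suc k * f)"
  unfolding Fg_zc_power Eg_Fg by (simp add: algebra_simps power2_eq_square power_add)

text \<open>Equating the two expressions of \<open>Hg\<close>, through \<open>Eg\<close> and through
  \<open>Fg\<close>, rewrites the twisted form of the logarithmic field zc d/dzc as w E + n.\<close>

lemma vector_field_eq: "twist_op n lq (first_order (zc * lq ^ 2) 0) f = wc * Eg f + of_nat n * f"
proof -
  have "2 * (wc * Eg f + of_nat n * f) = 2 * - (zc * Fg f)"
    using Hg_Eg[of f] Hg_Fg[of f] by (simp add: algebra_simps)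
  then have "const_fun 2 * (wc * Eg f + of_nat n * f) = const_fun 2 * - (zc * Fg f)"
    by (simp add: const_fun_numeral)
  then have "wc * Eg f + of_nat n * f = - (zc * Fg f)"
    by (rule mult_left_cancel[THEN iffD1, rotated]) (use const_fun_eq_iff[of 2 0] in \<open>simp add: const_fun_simps\<close>)
  then show ?thesis by (simp add: twist_op_vector_field)
qed

end

context framed_module
begin

text \<open>The action respects sums and composition only for members of \<open>diff_ops\<close>, so
  identities between operators have to be transported to sections. One shape covers the uses; an
  identity, constant or multiplication operator fills a slot that a shorter identity leaves
  open.\<close>

lemma act_identity:
  assumes U: "zariski_open U" and mem: "A \<in> diff_ops (int n) U" "B \<in> diff_ops (int n) U"
    "C \<in> diff_ops (int n) U" "D \<in> diff_ops (int n) U" "G \<in> diff_ops (int n) U"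
    and eq: "\<And>f. A (B f) = C (D f) + G f" and s: "s \<in> sec M U"
  shows "act M U A (act M U B s) = act M U C (act M U D s) + act M U G s"
proof -
  have "A \<circ> B = (\<lambda>f. (C \<circ> D) f + G f)" using eq by (simp add: fun_eq_iff)
  then have "act M U (A \<circ> B) s = act M U (C \<circ> D) s + act M U G s"
    using act_add_left[OF U diff_ops_comp[OF mem(3,4)] mem(5) s] by simp
  then show ?thesis using act_comp[OF U] mem s by simp
qed

abbreviation "csc U x \<equiv> act M U (mult_op (const_fun x))"

lemma act_const_comp:
  assumes "zariski_open U" "P \<in> diff_ops (int n) U" "s \<in> sec M U"
  shows "act M U (\<lambda>f. const_fun x * P f) s = csc U x (act M U P s)"
proof -
  have "(\<lambda>f. const_fun x * P f) = mult_op (const_fun x) \<circ> P" by (simp add: fun_eq_iff mult_op_def)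
  then show ?thesis using assms const_op_diff_ops by (simp add: act_comp)
qed

lemma const_comp_diff_ops: "P \<in> diff_ops m U \<Longrightarrow> (\<lambda>f. const_fun x * P f) \<in> diff_ops m U"
  using diff_ops_comp[OF const_op_diff_ops[of x m U]] by (simp add: comp_def mult_op_def)

lemma sl2_relations:
  assumes U: "zariski_open U" and s: "s \<in> sec M U"
  shows "act M U Eg (act M U Fg s) = act M U Fg (act M U Eg s) + act M U Hg s"
    and "act M U Hg (act M U Eg s) = act M U Eg (act M U Hg s) + csc U 2 (act M U Eg s)"
    and "act M U Hg (act M U Fg s) = act M U Fg (act M U Hg s) + csc U (- 2) (act M U Fg s)"
    and "act M U Hg (act M U Hg s) + csc U 2 (act M U Hg s) + s + csc U 4 (act M U Fg (act M U Eg s)) =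
      csc U (of_nat (n + 1) ^ 2) s"
proof -
  note d = Eg_diff_ops[of U] Fg_diff_ops[of U] Hg_diff_ops[of U]
  interpret V: cvector_space "sec M U" "\<lambda>c. csc U c" using U by (rule cvector_space_sec)
  show "act M U Eg (act M U Fg s) = act M U Fg (act M U Eg s) + act M U Hg s"
    by (rule act_identity[OF U d(1,2,2,1,3) Eg_Fg_commutator s])
  have "act M U Hg (act M U Eg s) = act M U Eg (act M U Hg s) + act M U (\<lambda>f. const_fun 2 * Eg f) s"
    by (rule act_identity[OF U d(3,1,1,3) const_comp_diff_ops[OF d(1)] _ s])
      (simp add: Hg_Eg_commutator const_fun_numeral)
  then show "act M U Hg (act M U Eg s) = act M U Eg (act M U Hg s) + csc U 2 (act M U Eg s)"
    using U d s by (simp add: act_const_comp)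
  have "act M U Hg (act M U Fg s) = act M U Fg (act M U Hg s) + act M U (\<lambda>f. const_fun (- 2) * Fg f) s"
    by (rule act_identity[OF U d(3,2,2,3) const_comp_diff_ops[OF d(2)] _ s])
      (simp add: Hg_Fg_commutator const_fun_numeral const_fun_simps)
  then show "act M U Hg (act M U Fg s) = act M U Fg (act M U Hg s) + csc U (- 2) (act M U Fg s)"
    using U d s by (simp add: act_const_comp)
  let ?K = "\<lambda>f. const_fun (- 1) * f + const_fun (- 4) * (Fg \<circ> Eg) f"
  let ?L = "\<lambda>f. const_fun (- 2) * Hg f + ?K f"
  have FE: "Fg \<circ> Eg \<in> diff_ops (int n) U" using d by (intro diff_ops_comp)
  have K1: "(\<lambda>f. const_fun (- 1) * f) \<in> diff_ops (int n) U"
    using const_op_diff_ops[of "- 1" "int n" U] by (simp add: mult_op_def)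
  have K: "?K \<in> diff_ops (int n) U" by (intro diff_ops_add K1 const_comp_diff_ops FE)
  have L: "?L \<in> diff_ops (int n) U" by (intro diff_ops_add[OF _ K] const_comp_diff_ops d)
  have "act M U Hg (act M U Hg s) = act M U (mult_op (const_fun (of_nat (n + 1) ^ 2))) (act M U id s) + act M U ?L s"
    by (rule act_identity[OF U d(3,3) const_op_diff_ops id_diff_ops L _ s])
      (simp add: mult_op_def casimir_op const_fun_power const_fun_of_nat const_fun_numeral const_fun_simps del: of_nat_add)
  also have "act M U ?L s = csc U (- 2) (act M U Hg s) + (csc U (- 1) s + csc U (- 4) (act M U Fg (act M U Eg s)))"
  proof -
    have "act M U ?L s = act M U (\<lambda>f. const_fun (- 2) * Hg f) s + act M U ?K s"
      by (rule act_add_left[OF U const_comp_diff_ops[OF d(3)] K s])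
    moreover have "act M U ?K s = act M U (\<lambda>f. const_fun (- 1) * f) s + act M U (\<lambda>f. const_fun (- 4) * (Fg \<circ> Eg) f) s"
      by (rule act_add_left[OF U K1 const_comp_diff_ops[OF FE] s])
    moreover have "(\<lambda>f. const_fun (- 1) * f) = mult_op (const_fun (- 1))" by (simp add: fun_eq_iff mult_op_def)
    ultimately show ?thesis using act_const_comp[OF U FE s] act_const_comp[OF U d(3) s] act_comp[OF U d(2,1) s] by simp
  qed
  finally have 1: "act M U Hg (act M U Hg s) = csc U (of_nat (n + 1) ^ 2) (act M U id s) +
    (csc U (- 2) (act M U Hg s) + (csc U (- 1) s + csc U (- 4) (act M U Fg (act M U Eg s))))" .
  have m: "act M U Hg s \<in> sec M U" "act M U Fg (act M U Eg s) \<in> sec M U"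
    using U d s by (simp_all add: act_sec)
  show "act M U Hg (act M U Hg s) + csc U 2 (act M U Hg s) + s + csc U 4 (act M U Fg (act M U Eg s)) =
      csc U (of_nat (n + 1) ^ 2) s"
    unfolding 1 using m s U by (simp add: V.sc_minus_left V.sc_one act_id)
qed

lemma lin_ops:
  assumes "zariski_open U"
  shows "cmodule.lin_op (sec M U) (csc U) (act M U Eg)" "cmodule.lin_op (sec M U) (csc U) (act M U Fg)"
    "cmodule.lin_op (sec M U) (csc U) (act M U Hg)"
    "f \<in> O_X U \<Longrightarrow> cmodule.lin_op (sec M U) (csc U) (act M U (mult_op f))"
  using assms by (auto intro!: lin_op_act Eg_diff_ops Fg_diff_ops Hg_diff_ops mult_op_diff_ops)

lemma sl2_module_sec:
  assumes U: "zariski_open U"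
  shows "sl2_module (sec M U) (csc U) (act M U Eg) (act M U Fg) (act M U Hg) (n + 1)"
proof -
  interpret V: cvector_space "sec M U" "\<lambda>c. csc U c" using U by (rule cvector_space_sec)
  show ?thesis
    by unfold_locales (use lin_ops[OF U] sl2_relations[OF U] in simp_all)
qed

lemma weight_operator_sec: "zariski_open U \<Longrightarrow> weight_operator (sec M U) (csc U) (act M U Hg)"
  unfolding weight_operator_def weight_operator_axioms_def
  using cvector_space_sec lin_ops by simp

lemma poly_connection_Up:
  assumes "\<And>x. x \<in> Up \<Longrightarrow> \<exists>V. zariski_open V \<and> x \<in> V \<and> O_coherent_on M V"
  shows "poly_connection (sec M Up) (psc Up) (act M Up Eg)"
proof -
  interpret N: cmodule "sec M Up" "psc Up" using Up_open by (intro cmodule_psc) auto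
  show ?thesis
  proof unfold_locales
    show "act M Up Eg x \<in> sec M Up" if "x \<in> sec M Up" for x
      using that Up_open Eg_diff_ops by (intro act_sec)
    show "act M Up Eg (x + y) = act M Up Eg x + act M Up Eg y" if "x \<in> sec M Up" "y \<in> sec M Up" for x y
      using that Up_open Eg_diff_ops by (intro act_add_right)
    show "act M Up Eg (psc Up u x) = psc Up u (act M Up Eg x) - psc Up (pderiv u) x" if x: "x \<in> sec M Up" for x u
    proof -
      have o: "subst_poly wc u \<in> O_X Up" for u by (intro subst_wc_Up) auto
      have "act M Up Eg (act M Up (mult_op (subst_poly wc u)) x) =
        act M Up (mult_op (subst_poly wc u)) (act M Up Eg x) + act M Up (mult_op (subst_poly wc (- pderiv u))) x"
        by (rule act_identity[OF Up_open(1) Eg_diff_ops mult_op_diff_ops[OF o] mult_op_diff_ops[OF o] Eg_diff_ops mult_op_diff_ops[OF o] _ x])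
          (simp add: mult_op_def Eg_subst_wc subst_poly_minus)
      then show ?thesis using N.sc_minus_left[OF x, of "pderiv u"] by (simp add: psc_def)
    qed
    show "\<exists>G. finite G \<and> G \<subseteq> sec M Up \<and> sec M Up \<subseteq> N.spn G"
      using finite_generation_Up assms by blast
  qed
qed

end

subsection \<open>Nilpotency from the regular singularity\<close>

lemma infinite_cp1: "infinite (UNIV :: cp1 set)"
proof
  assume "finite (UNIV :: cp1 set)"
  moreover have "inj (pt 1)" by (auto simp: inj_on_def pt_eq_iff)
  ultimately have "finite (UNIV :: complex set)"
    by (metis finite_imageD finite_subset subset_UNIV)
  then show False using infinite_UNIV_char_0 by blast
qed

context framed_module
begin

lemma wc_power: "wc ^ k = subst_poly wc ([:0, 1:] ^ k)"
  by (simp add: subst_poly_power subst_poly_X)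

lemma res_funpow_Eg:
  assumes "zariski_open U" "zariski_open W" "W \<subseteq> U" "s \<in> sec M U"
  shows "res M U W ((act M U Eg ^^ k) s) = (act M W Eg ^^ k) (res M U W s)" "(act M U Eg ^^ k) s \<in> sec M U"
  by (induction k) (use assms Eg_diff_ops in \<open>simp_all add: res_act act_sec\<close>)

text \<open>Stability of L under w E + n makes E gain one order of vanishing at p each time it is
  applied, until the section lies in L and then beyond. The degree filtration \<open>Y\<close> on
  the sections over V shows that a section over X - p which vanishes to order D + 1 relative to L is
  0.\<close>

lemma nilpotent_of_lattice:
  assumes U: "affine_open U" "pt a c \<in> U" "pt b d \<notin> U" and V: "V = U - {pt a c}"
    and coh: "\<And>x. x \<in> Up \<Longrightarrow> \<exists>V. zariski_open V \<and> x \<in> V \<and> O_coherent_on M V"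
    and L: "submodule (O_ops U) M V L" and S: "finite S" "S \<subseteq> L"
    and gen_L: "\<And>Y. submodule (O_ops U) M V Y \<Longrightarrow> S \<subseteq> Y \<Longrightarrow> L \<subseteq> Y"
    and gen: "\<And>Y. submodule (O_ops V) M V Y \<Longrightarrow> L \<subseteq> Y \<Longrightarrow> sec M V \<subseteq> Y"
    and stable: "\<And>s. s \<in> L \<Longrightarrow> act M V (\<lambda>f. wc * Eg f + of_nat n * f) s \<in> L"
    and s: "s \<in> sec M Up"
  shows "\<exists>k. (act M Up Eg ^^ k) s = 0"
proof -
  have oU: "zariski_open U" using U by (simp add: affine_open_def)
  have oV: "zariski_open V" and VUp: "V \<subseteq> Up" and VU: "V \<subseteq> U"
    unfolding V using oU by (auto intro: zariski_open_Diff_finite)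
  have "V \<noteq> {}"
  proof
    assume "V = {}"
    then have "finite U" unfolding V by (metis Diff_eq_empty_iff finite.emptyI finite.insertI finite_subset)
    moreover have "finite (- U)" using oU U(2) by (auto simp: zariski_open_def)
    ultimately have "finite (UNIV :: cp1 set)" by (metis Compl_partition finite_UnI)
    then show False using infinite_cp1 by blast
  qed
  interpret wc: affine_coordinate wc "pt a c" by (rule affine_coordinate_wc)
  interpret N: poly_connection "sec M Up" "psc Up" "act M Up Eg" using coh by (rule poly_connection_Up)
  interpret A: cmodule "sec M V" "psc V" using oV VUp by (rule cmodule_psc)
  obtain R where R: "finite R" "\<And>x t. has_value wc x t \<Longrightarrow> x \<in> V \<longleftrightarrow> t \<notin> R"
    "V = {x \<in> Up. \<not> has_value (subst_poly wc (root_poly R)) x 0}"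
    using open_complement_roots[OF oV \<open>V \<noteq> {}\<close> VUp] by blast
  define h where "h = root_poly R"
  have h0: "h \<noteq> 0" by (simp add: h_def root_poly_nonzero)
  have hk: "subst_poly wc h ^ k = subst_poly wc (h ^ k)" for k by (simp add: subst_poly_power)
  have ext: "\<exists>k. \<exists>t\<in>sec M Up. psc V (h ^ k) s = res M Up V t" if "s \<in> sec M V" for s
    using qc_extend[OF Up_open(2) subst_wc_Up R(3) oV that] unfolding h_def[symmetric] hk psc_def by simp
  have rp: "res M Up V (psc Up u s) = psc V u (res M Up V s)" if "s \<in> sec M Up" for u s
    using VUp Up_open oV that by (intro res_psc) auto
  have rm: "res M Up V s \<in> sec M V" if "s \<in> sec M Up" for s using VUp oV Up_open that by (intro res_sec) auto
  have ra: "res M Up V (s + t) = res M Up V s + res M Up V t" if "s \<in> sec M Up" "t \<in> sec M Up" for s t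
    using VUp oV Up_open that by (intro res_add) auto
  \<comment> \<open>The kernel of restriction to V is torsion, and a finitely generated module with
    a connection has no torsion.\<close>
  have inj: "s = 0" if s: "s \<in> sec M Up" "res M Up V s = 0" for s
  proof -
    obtain k where "psc Up (h ^ k) s = 0"
      using qc_kernel[OF Up_open(2) subst_wc_Up R(3) oV s] unfolding h_def[symmetric] hk psc_def by auto
    then show ?thesis using N.torsion_free[OF s(1)] h0 by simp
  qed
  have zO: "zc \<in> O_X U" using U(3) by (intro zc_O_X)
  have wO: "wc \<in> O_X V" using VUp by (intro wc_O_X) auto
  have zk: "zc ^ k \<in> O_X U" "zc ^ k \<in> O_X V" and wk: "wc ^ k \<in> O_X V" for k
    using zO wO O_X_mono[OF VU zO] by (auto intro: O_X_power)
  have LV: "x \<in> sec M V" if "x \<in> L" for x using L that by (auto simp: submodule_def)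
  have L_mult: "act M V (mult_op f) x \<in> L" if "f \<in> O_X U" "x \<in> L" for f x
    using L that by (auto simp: submodule_def O_ops_def)
  have L_add: "x + y \<in> L" "x - y \<in> L" if "x \<in> L" "y \<in> L" for x y
  proof -
    show "x + y \<in> L" using L that by (simp add: submodule_def)
    have "- y \<in> L" using L that by (simp add: submodule_def)
    then have "x + - y \<in> L" using L that by (simp only: submodule_def)
    then show "x - y \<in> L" by simp
  qed
  note E = Eg_diff_ops[of V]
  have wE_ops: "mult_op wc \<circ> Eg \<in> diff_ops (int n) V" using E wO by (intro diff_ops_comp mult_op_diff_ops)
  have wE: "act M V (mult_op wc \<circ> Eg) x \<in> L" if x: "x \<in> L" for x
  proof -
    have "act M V (\<lambda>f. (mult_op wc \<circ> Eg) f + mult_op (const_fun (of_nat n)) f) x =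
      act M V (mult_op wc \<circ> Eg) x + act M V (mult_op (const_fun (of_nat n))) x"
      by (rule act_add_left[OF oV wE_ops const_op_diff_ops LV[OF x]])
    moreover have "(\<lambda>f. (mult_op wc \<circ> Eg) f + mult_op (const_fun (of_nat n)) f) = (\<lambda>f. wc * Eg f + of_nat n * f)"
      by (simp add: mult_op_def const_fun_of_nat)
    ultimately have "act M V (mult_op wc \<circ> Eg) x =
        act M V (\<lambda>f. wc * Eg f + of_nat n * f) x - act M V (mult_op (const_fun (of_nat n))) x" by simp
    then show ?thesis using L_add(2)[OF stable[OF x] L_mult[OF const_fun_O_X x]] by simp
  qed
  have Em: "act M V Eg x \<in> sec M V" if "x \<in> sec M V" for x using oV E that by (intro act_sec)
  \<comment> \<open>From w E z^(k+1) = z^k E + (k + 1) z^(k+1), with z and w standing for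
    \<open>zc\<close> and \<open>wc\<close>: E lowers the bound on the pole of x relative to
    L.\<close>
  have step1: "act M V (mult_op (zc ^ k)) (act M V Eg x) \<in> L"
    if x: "x \<in> sec M V" "act M V (mult_op (zc ^ Suc k)) x \<in> L" for k x
  proof -
    let ?e = "const_fun (- of_nat (Suc k)) * zc ^ Suc k"
    have eO: "?e \<in> O_X V" by (intro O_X_mult const_fun_O_X zk)
    have "zc ^ k * Eg f = (mult_op wc \<circ> Eg) (zc ^ Suc k * f) + ?e * f" for f
    proof -
      have "wc * Eg (zc ^ Suc k * f) = (wc * zc) * (zc ^ k * Eg f) + of_nat (Suc k) * ((wc * zc) * (zc ^ Suc k * f))"
        unfolding Eg_zc_power by (simp add: algebra_simps)
      then show ?thesis by (simp add: mult_op_def wc_zc const_fun_simps const_fun_of_nat algebra_simps)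
    qed
    then have "act M V (mult_op (zc ^ k)) (act M V Eg x) =
      act M V (mult_op wc \<circ> Eg) (act M V (mult_op (zc ^ Suc k)) x) + act M V (mult_op ?e) x"
      by (intro act_identity[OF oV mult_op_diff_ops[OF zk(2)] E wE_ops mult_op_diff_ops[OF zk(2)] mult_op_diff_ops[OF eO] _ x(1)])
        (simp add: mult_op_def)
    also have "act M V (mult_op ?e) x = act M V (mult_op (const_fun (- of_nat (Suc k)))) (act M V (mult_op (zc ^ Suc k)) x)"
      using oV x zk by (intro act_mult const_fun_O_X)
    finally show ?thesis using L_add(1)[OF wE[OF x(2)] L_mult[OF const_fun_O_X x(2)]] by (simp only:)
  qed
  \<comment> \<open>From w E w^k = w^(k+1) E - k w^k: inside L, each application of E increases the
    order of vanishing by one.\<close>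
  have step2: "act M V (mult_op (wc ^ Suc k)) (act M V Eg x) \<in> L"
    if x: "x \<in> sec M V" "act M V (mult_op (wc ^ k)) x \<in> L" for k x
  proof -
    let ?e = "const_fun (of_nat k) * wc ^ k"
    have eO: "?e \<in> O_X V" by (intro O_X_mult const_fun_O_X wk)
    have "wc ^ Suc k * Eg f = (mult_op wc \<circ> Eg) (wc ^ k * f) + ?e * f" for f
      using Eg_wc_power[of k f] by (simp add: mult_op_def const_fun_of_nat algebra_simps)
    then have "act M V (mult_op (wc ^ Suc k)) (act M V Eg x) =
      act M V (mult_op wc \<circ> Eg) (act M V (mult_op (wc ^ k)) x) + act M V (mult_op ?e) x"
      by (intro act_identity[OF oV mult_op_diff_ops[OF wk] E wE_ops mult_op_diff_ops[OF wk] mult_op_diff_ops[OF eO] _ x(1)])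
        (simp add: mult_op_def)
    also have "act M V (mult_op ?e) x = act M V (mult_op (const_fun (of_nat k))) (act M V (mult_op (wc ^ k)) x)"
      using oV x wk by (intro act_mult const_fun_O_X)
    finally show ?thesis using L_add(1)[OF wE[OF x(2)] L_mult[OF const_fun_O_X x(2)]] by (simp only:)
  qed
  have iter1: "(act M V Eg ^^ k) x \<in> L" if "x \<in> sec M V" "act M V (mult_op (zc ^ k)) x \<in> L" for k x
    using that
  proof (induction k arbitrary: x)
    case 0
    then show ?case using oV by (simp add: act_mult_1)
  next
    case (Suc k)
    then show ?case using step1[OF Suc.prems] Em by (simp add: funpow_swap1)
  qed
  have iter2: "act M V (mult_op (wc ^ k)) ((act M V Eg ^^ k) x) \<in> L" if x: "x \<in> L" for k x
  proof (induction k)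
    case 0
    then show ?case using oV LV[OF x] x by (simp add: act_mult_1)
  next
    case (Suc k)
    have "(act M V Eg ^^ k) x \<in> sec M V" using Em LV[OF x] by (induction k) auto
    then show ?case using step2[OF _ Suc] by simp
  qed
  \<comment> \<open>L generates over the functions on V, whose poles at p are cleared by powers of
    zc.\<close>
  have gen': "\<exists>k. act M V (mult_op (zc ^ k)) x \<in> L" if "x \<in> sec M V" for x
  proof -
    define Y where "Y = {x \<in> sec M V. \<exists>k. act M V (mult_op (zc ^ k)) x \<in> L}"
    have "submodule (O_ops V) M V Y"
      unfolding submodule_def
    proof (intro conjI ballI)
      show "Y \<subseteq> sec M V" by (auto simp: Y_def)
      have "act M V (mult_op (zc ^ 0)) 0 \<in> L" using oV L sec_zero by (simp add: act_mult_1 submodule_def)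
      then show "0 \<in> Y" unfolding Y_def using sec_zero[OF oV] by blast
    next
      fix x y assume "x \<in> Y" "y \<in> Y"
      then obtain k k' where k: "x \<in> sec M V" "act M V (mult_op (zc ^ k)) x \<in> L"
        "y \<in> sec M V" "act M V (mult_op (zc ^ k')) y \<in> L" by (auto simp: Y_def)
      have "act M V (mult_op (zc ^ (k + k'))) (x + y) =
        act M V (mult_op (zc ^ k')) (act M V (mult_op (zc ^ k)) x) + act M V (mult_op (zc ^ k)) (act M V (mult_op (zc ^ k')) y)"
        using oV k zk by (simp add: act_add_right mult_op_diff_ops O_X_mult power_add act_mult act_mult_commute[of V "zc ^ k"])
      also have "\<dots> \<in> L" by (rule L_add(1)[OF L_mult[OF zk(1) k(2)] L_mult[OF zk(1) k(4)]])
      finally show "x + y \<in> Y" unfolding Y_def using sec_add[OF oV] k by blast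
    next
      fix x assume "x \<in> Y"
      then obtain k where k: "x \<in> sec M V" "act M V (mult_op (zc ^ k)) x \<in> L" by (auto simp: Y_def)
      have "act M V (mult_op (zc ^ k)) (- x) = 0 - act M V (mult_op (zc ^ k)) x"
        using oV k zk by (simp add: act_minus_right mult_op_diff_ops)
      also have "\<dots> \<in> L" using k L by (intro L_add) (auto simp: submodule_def)
      finally show "- x \<in> Y" unfolding Y_def using k sec_minus[OF oV] by blast
      fix P assume "P \<in> O_ops V"
      then obtain f where f: "f \<in> O_X V" "P = mult_op f" by (auto simp: O_ops_def)
      have "regular_at f x" if "has_value wc x t" "t \<notin> R" for x t using f R(2) that by (auto simp: O_X_iff)
      then obtain u e where u: "f * subst_poly wc (h ^ e) = subst_poly wc u"
        using wc.regular_off_roots[OF R(1), of f] by (auto simp: h_def)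
      have "zc ^ degree u * f \<in> O_X U"
        unfolding O_X_iff
      proof
        fix x assume x: "x \<in> U"
        show "regular_at (zc ^ degree u * f) x"
        proof (cases "x = pt a c")
          case True
          then show ?thesis using wc.regular_at_pole[OF u, of "degree u"] h0 by (simp add: wc_zc)
        next
          case False
          then have "x \<in> V" using x by (simp add: V)
          then show ?thesis using f zk(2)[of "degree u"] by (auto simp: O_X_iff intro: regular_at_mult)
        qed
      qed
      then have "act M V (mult_op (zc ^ degree u * f)) (act M V (mult_op (zc ^ k)) x) \<in> L" using k(2) by (rule L_mult)
      moreover have "act M V (mult_op (zc ^ (degree u + k))) (act M V P x) =
        act M V (mult_op (zc ^ degree u * f)) (act M V (mult_op (zc ^ k)) x)"
        using oV k zk f by (simp add: power_add act_mult act_mult_mem act_mult_commute[of V f])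
      moreover have "act M V P x \<in> sec M V" using f oV k by (simp add: act_mult_mem)
      ultimately have "\<exists>k. act M V (mult_op (zc ^ k)) (act M V P x) \<in> L" "act M V P x \<in> sec M V"
        by metis+
      then show "act M V P x \<in> Y" unfolding Y_def by simp
    qed
    moreover have "L \<subseteq> Y"
    proof
      fix x assume x: "x \<in> L"
      then have "act M V (mult_op (zc ^ 0)) x \<in> L" using oV LV[OF x] by (simp add: act_mult_1)
      then show "x \<in> Y" unfolding Y_def using LV[OF x] by blast
    qed
    ultimately have "sec M V \<subseteq> Y" by (rule gen)
    then show ?thesis using that by (auto simp: Y_def)
  qed
  obtain B q where B: "finite B" "B \<subseteq> sec M Up" "N.indep B" "q \<noteq> 0"
    and q: "\<forall>x\<in>sec M Up. \<exists>p. psc Up q x = (\<Sum>b\<in>B. psc Up (p b) b)"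
    using N.generic_basis by blast
  let ?\<Sigma> = "\<lambda>F. \<Sum>b\<in>B. psc Up (F b) b"
  have \<Sigma>: "?\<Sigma> F \<in> sec M Up" for F using B by (intro N.sum_mem N.sc_mem) auto
  have \<Sigma>_add: "?\<Sigma> F + ?\<Sigma> F' = ?\<Sigma> (\<lambda>b. F b + F' b)" for F F'
    using B by (simp add: N.sc_add_left subset_iff flip: sum.distrib)
  have \<Sigma>_sc: "psc Up u (?\<Sigma> F) = ?\<Sigma> (\<lambda>b. u * F b)" for F u
    using B by (subst N.sc_sum) (auto simp: N.sc_mem N.sc_mult subset_iff)
  \<comment> \<open>Sections x such that the coordinates of q x in the generic basis have degree at
    most D in w, that is, poles of order at most D at p. The coordinates are fractions with
    denominator h^e, hence the summand \<open>e * degree h\<close>.\<close>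
  define Y where "Y = (\<lambda>D. {x \<in> sec M V. \<exists>e F. psc V (q * h ^ e) x = res M Up V (?\<Sigma> F) \<and>
     (\<forall>b\<in>B. degree (F b) \<le> D + e * degree h)})"
  have YI: "x \<in> Y D" if "x \<in> sec M V" "psc V (q * h ^ e) x = res M Up V (?\<Sigma> F)"
    "\<And>b. b \<in> B \<Longrightarrow> degree (F b) \<le> D + e * degree h" for x D e F
  proof -
    have "\<exists>F. psc V (q * h ^ e) x = res M Up V (?\<Sigma> F) \<and> (\<forall>b\<in>B. degree (F b) \<le> D + e * degree h)"
      by (rule exI[of _ F]) (use that in blast)
    then have "\<exists>e F. psc V (q * h ^ e) x = res M Up V (?\<Sigma> F) \<and> (\<forall>b\<in>B. degree (F b) \<le> D + e * degree h)"
      by (rule exI[of _ e])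
    then show ?thesis using that(1) unfolding Y_def by simp
  qed
  have YE: "\<exists>e F. x \<in> sec M V \<and> psc V (q * h ^ e) x = res M Up V (?\<Sigma> F) \<and> (\<forall>b\<in>B. degree (F b) \<le> D + e * degree h)"
    if "x \<in> Y D" for x D
    using that unfolding Y_def by simp
  have deg_h: "degree (h ^ e * G) \<le> D + (e + e') * degree h" if "degree G \<le> D + e' * degree h" for e e' D G
    using degree_mult_le[of "h ^ e" G] degree_power_le[of h e] that by (simp add: algebra_simps)
  have Y_sub: "submodule (O_ops U) M V (Y D)" for D
    unfolding submodule_def
  proof (intro conjI ballI)
    show "Y D \<subseteq> sec M V" by (auto simp: Y_def)
    have "?\<Sigma> (\<lambda>_. 0) = 0" using B by (intro sum.neutral) (auto intro: N.sc_zero_left)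
    then show "0 \<in> Y D" using Up_open oV VUp
      by (intro YI[of 0 0 "\<lambda>_. 0"]) (simp_all add: A.zero_mem A.sc_zero_right res_0)
  next
    fix x y assume x': "x \<in> Y D" and y': "y \<in> Y D"
    obtain e F where x: "x \<in> sec M V" "psc V (q * h ^ e) x = res M Up V (?\<Sigma> F)" "\<forall>b\<in>B. degree (F b) \<le> D + e * degree h"
      using YE[OF x'] by (elim exE conjE)
    obtain e' F' where y: "y \<in> sec M V" "psc V (q * h ^ e') y = res M Up V (?\<Sigma> F')" "\<forall>b\<in>B. degree (F' b) \<le> D + e' * degree h"
      using YE[OF y'] by (elim exE conjE)
    have m: "q * h ^ (e + e') = h ^ e' * (q * h ^ e)" "q * h ^ (e + e') = h ^ e * (q * h ^ e')"
      by (simp_all add: power_add mult_ac)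
    have 1: "psc V (q * h ^ (e + e')) x = res M Up V (?\<Sigma> (\<lambda>b. h ^ e' * F b))"
      unfolding m(1) A.sc_mult[OF x(1), of "h ^ e'" "q * h ^ e"] x(2) rp[OF \<Sigma>, symmetric] \<Sigma>_sc ..
    have 2: "psc V (q * h ^ (e + e')) y = res M Up V (?\<Sigma> (\<lambda>b. h ^ e * F' b))"
      unfolding m(2) A.sc_mult[OF y(1), of "h ^ e" "q * h ^ e'"] y(2) rp[OF \<Sigma>, symmetric] \<Sigma>_sc ..
    show "x + y \<in> Y D"
    proof (rule YI)
      show "x + y \<in> sec M V" using x y by (intro A.add_mem)
      show "psc V (q * h ^ (e + e')) (x + y) = res M Up V (?\<Sigma> (\<lambda>b. h ^ e' * F b + h ^ e * F' b))"
        unfolding A.sc_add_right[OF x(1) y(1)] 1 2 ra[OF \<Sigma> \<Sigma>, symmetric] \<Sigma>_add ..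
      show "degree (h ^ e' * F b + h ^ e * F' b) \<le> D + (e + e') * degree h" if "b \<in> B" for b
        using x(3) y(3) that deg_h[of "F b" D e e'] deg_h[of "F' b" D e' e]
        by (intro degree_add_le) (auto simp: add.commute)
    qed
  next
    fix x assume x': "x \<in> Y D"
    obtain e F where x: "x \<in> sec M V" "psc V (q * h ^ e) x = res M Up V (?\<Sigma> F)" "\<forall>b\<in>B. degree (F b) \<le> D + e * degree h"
      using YE[OF x'] by (elim exE conjE)
    \<comment> \<open>A function regular on U, in particular at p, is u / h^k with
      \<open>degree u\<close> at most the degree of h^k, so it does not raise the degree of the
      coordinates.\<close>
    have scale: "act M V (mult_op f) x \<in> Y D" if f: "f \<in> O_X U" for f
    proof -
      have fV: "f \<in> O_X V" using O_X_mono[OF VU f] .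
      have "regular_at f x" if "has_value wc x t" "t \<notin> R" for x t using fV R(2) that by (auto simp: O_X_iff)
      then obtain u k where u: "f * subst_poly wc (h ^ k) = subst_poly wc u"
        using wc.regular_off_roots[OF R(1), of f] by (auto simp: h_def)
      have "degree u \<le> degree (h ^ k)"
        by (rule wc.degree_le_of_regular[OF _ u]) (use f U(2) h0 in \<open>auto simp: O_X_iff\<close>)
      then have du: "degree u \<le> k * degree h" using degree_power_le[of h k] by (simp add: mult.commute)
      have hO: "subst_poly wc r \<in> O_X V" for r using VUp by (rule subst_wc_Up)
      have "psc V (q * h ^ (k + e)) (act M V (mult_op f) x) = psc V u (psc V (q * h ^ e) x)"
      proof -
        have "psc V (q * h ^ (k + e)) (act M V (mult_op f) x) =
          act M V (mult_op (subst_poly wc (q * h ^ (k + e)) * f)) x"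
          unfolding psc_def using oV hO fV x(1) by (simp add: act_mult)
        also have "subst_poly wc (q * h ^ (k + e)) * f = subst_poly wc u * subst_poly wc (q * h ^ e)"
          unfolding u[symmetric] by (simp add: subst_poly_mult power_add mult_ac)
        also have "act M V (mult_op \<dots>) x = psc V u (psc V (q * h ^ e) x)"
          unfolding psc_def using oV hO x(1) by (simp add: act_mult)
        finally show ?thesis .
      qed
      then have 1: "psc V (q * h ^ (k + e)) (act M V (mult_op f) x) = res M Up V (?\<Sigma> (\<lambda>b. u * F b))"
        unfolding x(2) rp[OF \<Sigma>, symmetric] \<Sigma>_sc .
      show ?thesis
      proof (rule YI[OF _ 1])
        show "act M V (mult_op f) x \<in> sec M V" using oV fV x(1) by (intro act_mult_mem)
        show "degree (u * F b) \<le> D + (k + e) * degree h" if "b \<in> B" for b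
          using degree_mult_le[of u "F b"] du x(3) that by (fastforce simp: algebra_simps)
      qed
    qed
    show "- x \<in> Y D"
    proof -
      have "act M V (mult_op (const_fun (- 1))) x = - x"
        using cvector_space_sec[OF oV] x(1) cmodule.sc_minus_left[of "sec M V" "csc V" x 1]
          cmodule.sc_one[of "sec M V" "csc V" x] unfolding cvector_space_def by simp
      then show ?thesis using scale[OF const_fun_O_X] by metis
    qed
    show "act M V P x \<in> Y D" if "P \<in> O_ops U" for P
      using that scale by (auto simp: O_ops_def)
  qed
  have Y_mono: "Y D \<subseteq> Y D'" if "D \<le> D'" for D D'
  proof
    fix x assume xY: "x \<in> Y D"
    obtain e F where x: "x \<in> sec M V" "psc V (q * h ^ e) x = res M Up V (?\<Sigma> F)" "\<forall>b\<in>B. degree (F b) \<le> D + e * degree h"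
      using YE[OF xY] by (elim exE conjE)
    show "x \<in> Y D'" by (rule YI[OF x(1,2)]) (use x(3) that in fastforce)
  qed
  have "\<exists>D. l \<in> Y D" if l: "l \<in> S" for l
  proof -
    have lV: "l \<in> sec M V" using l S LV by blast
    obtain e t where t: "t \<in> sec M Up" "psc V (h ^ e) l = res M Up V t" using ext[OF lV] by blast
    obtain F where F: "psc Up q t = ?\<Sigma> F" using q t by blast
    have "psc V (q * h ^ e) l = res M Up V (?\<Sigma> F)"
      unfolding A.sc_mult[OF lV] t(2) rp[OF t(1), symmetric] F ..
    then have "l \<in> Y (\<Sum>b\<in>B. degree (F b))"
      by (rule YI[OF lV]) (use B(1) member_le_sum[of _ B "\<lambda>b. degree (F b)"] in \<open>simp add: trans_le_add1\<close>)
    then show ?thesis by blast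
  qed
  then obtain \<delta> where \<delta>: "\<And>l. l \<in> S \<Longrightarrow> l \<in> Y (\<delta> l)" by metis
  define D where "D = sum \<delta> S"
  have "S \<subseteq> Y D"
  proof
    fix l assume l: "l \<in> S"
    then have "\<delta> l \<le> D" unfolding D_def using S(1) by (intro member_le_sum) auto
    then show "l \<in> Y D" using \<delta>[OF l] Y_mono by blast
  qed
  then have LY: "L \<subseteq> Y D" by (rule gen_L[OF Y_sub])
  \<comment> \<open>Over X - p the coordinates of q y are polynomials. Multiplied by the power D + 1
    of w, a nonzero one would have degree at least D + 1, whereas L has been put into
    \<open>Y D\<close>.\<close>
  have vanish: "y = 0" if y: "y \<in> sec M Up" "act M V (mult_op (wc ^ Suc D)) (res M Up V y) \<in> L" for y
  proof -
    let ?w = "[:0, 1:] ^ Suc D :: complex poly"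
    have wY: "psc V ?w (res M Up V y) \<in> Y D" using y(2) LY unfolding psc_def wc_power by blast
    obtain e F where F: "psc V (q * h ^ e) (psc V ?w (res M Up V y)) = res M Up V (?\<Sigma> F)"
      "\<forall>b\<in>B. degree (F b) \<le> D + e * degree h"
      using YE[OF wY] by (elim exE conjE)
    obtain p where p: "psc Up q y = ?\<Sigma> p" using q y by blast
    have "res M Up V (?\<Sigma> (\<lambda>b. h ^ e * ?w * p b)) = psc V (h ^ e * ?w) (psc V q (res M Up V y))"
      unfolding \<Sigma>_sc[symmetric] p[symmetric] using y(1) by (simp only: rp N.sc_mem)
    also have "\<dots> = psc V (q * h ^ e) (psc V ?w (res M Up V y))"
      using rm[OF y(1)] by (simp flip: A.sc_mult add: mult_ac)
    finally have 1: "res M Up V (?\<Sigma> (\<lambda>b. h ^ e * ?w * p b)) = res M Up V (?\<Sigma> F)" unfolding F(1) .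
    have neg: "- ?\<Sigma> F = ?\<Sigma> (\<lambda>b. - F b)" using \<Sigma>_sc[of "- 1" F] N.sc_minus_left[OF \<Sigma>, of 1 F] N.sc_one[OF \<Sigma>] by simp
    have "res M Up V (?\<Sigma> (\<lambda>b. h ^ e * ?w * p b) - ?\<Sigma> F) = 0"
      using 1 res_diff[OF Up_open(1) oV VUp \<Sigma> \<Sigma>] by simp
    then have "?\<Sigma> (\<lambda>b. h ^ e * ?w * p b) - ?\<Sigma> F = 0" by (rule inj[OF N.diff_mem[OF \<Sigma> \<Sigma>]])
    then have "?\<Sigma> (\<lambda>b. h ^ e * ?w * p b + - F b) = 0" unfolding \<Sigma>_add[symmetric] neg[symmetric] by simp
    then have e: "\<forall>b\<in>B. h ^ e * ?w * p b + - F b = 0" using B(3) unfolding N.indep_def by (elim allE impE)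
    have "p b = 0" if b: "b \<in> B" for b
    proof (rule ccontr)
      assume "p b \<noteq> 0"
      have "F b = h ^ e * ?w * p b" using e b by simp
      also have "degree \<dots> = e * degree h + Suc D + degree (p b)"
        using \<open>p b \<noteq> 0\<close> h0 by (simp add: degree_mult_eq degree_power_eq)
      finally show False using F(2) b by fastforce
    qed
    then have "psc Up q y = 0" unfolding p using B by (intro sum.neutral) (auto intro: N.sc_zero_left)
    then show ?thesis using N.torsion_free y(1) B(4) by blast
  qed
  have re: "res M Up V ((act M Up Eg ^^ k) s) = (act M V Eg ^^ k) (res M Up V s)" "(act M Up Eg ^^ k) s \<in> sec M Up"
    if "s \<in> sec M Up" for k s using res_funpow_Eg[OF Up_open(1) oV VUp that] by auto
  obtain k where "act M V (mult_op (zc ^ k)) (res M Up V s) \<in> L" using gen' rm s by blast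
  then have "(act M V Eg ^^ k) (res M Up V s) \<in> L" using iter1 rm s by blast
  then have "act M V (mult_op (wc ^ Suc D)) ((act M V Eg ^^ Suc D) ((act M V Eg ^^ k) (res M Up V s))) \<in> L" by (rule iter2)
  then have "act M V (mult_op (wc ^ Suc D)) (res M Up V ((act M Up Eg ^^ Suc D) ((act M Up Eg ^^ k) s))) \<in> L"
    using s by (simp only: re)
  then have "(act M Up Eg ^^ Suc D) ((act M Up Eg ^^ k) s) = 0" using s by (intro vanish re)
  then have "(act M Up Eg ^^ (Suc D + k)) s = 0" unfolding funpow_add by simp
  then show ?thesis by blast
qed

end

subsection \<open>The representation on global sections\<close>

context twisted_frame
begin

lemma Hg_wc: "Hg (wc * f) = wc * Hg f + - 2 * (wc * f)"
  unfolding Hg_Eg Eg_wc by (simp add: algebra_simps)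

end

locale rh_module = framed_module +
  assumes coh_D: "D_coherent (line_bundle_tensor (- int n) M)"
    and reg: "regular_sing_at (line_bundle_tensor (- int n) M) (pt a c)"
    and sing: "singular_points M = {pt a c}"
begin

lemma coherent_off_p: "x \<in> Up \<Longrightarrow> \<exists>V. zariski_open V \<and> x \<in> V \<and> O_coherent_on M V"
  using sing by (auto simp: singular_points_def)

text \<open>The neighbourhood U in the definition of regularity may contain q. The argument is
  therefore run in a frame with the same p and a second point outside U; \<open>Eg\<close> does not
  involve (b, d), so it is unchanged.\<close>

lemma nilpotent_Up:
  assumes s: "s \<in> sec M Up"
  shows "\<exists>k. (act M Up Eg ^^ k) s = 0"
proof -
  let ?T = "line_bundle_tensor (- int n) M"
  obtain U L where U: "affine_open U" "pt a c \<in> U" and fg: "finitely_generated (O_ops U) ?T (U - {pt a c}) L"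
    and hull: "submodule (O_ops (U - {pt a c})) ?T (U - {pt a c}) hull L = sec ?T (U - {pt a c})"
    and vf: "\<forall>v\<in>vector_fields_vanishing_at (pt a c) U. \<forall>s\<in>L. act ?T (U - {pt a c}) v s \<in> L"
    using reg unfolding regular_sing_at_def by blast
  obtain x y where xy: "(x, y) \<noteq> (0, 0)" "pt x y \<notin> U" using affine_avoids[OF U(1)] by blast
  \<comment> \<open>Rescaling the coordinates of the new point by the inverse of this determinant
    makes the determinant of the new frame 1.\<close>
  define \<delta> where "\<delta> = a * y - x * c"
  have "pt x y \<noteq> pt a c" using xy U by auto
  then have \<delta>: "\<delta> \<noteq> 0" using xy pq_nonzero(1) by (auto simp: pt_eq_iff \<delta>_def mult.commute)
  define b' d' where "b' = inverse \<delta> * x" and "d' = inverse \<delta> * y"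
  have q': "pt b' d' = pt x y" unfolding b'_def d'_def using \<delta> xy by (intro pt_scale) auto
  have "a * d' - b' * c = inverse \<delta> * \<delta>" by (simp add: b'_def d'_def \<delta>_def algebra_simps)
  then have det': "a * d' - b' * c = 1" using \<delta> by simp
  interpret fr: framed_module a b' c d' n M
    by unfold_locales (use det' qc_T in auto)
  interpret tc: twisted_chart n M b' d' ?T
    using fr.pq_nonzero by (intro chart) auto
  define V where "V = U - {pt a c}"
  have oU: "zariski_open U" using U by (simp add: affine_open_def)
  have oV: "zariski_open V" and VU: "V \<subseteq> U" unfolding V_def using oU by (auto intro: zariski_open_Diff_finite)
  have qU: "pt b' d' \<notin> U" "pt b' d' \<notin> V" using xy q' VU by auto
  have OU: "O_ops U \<subseteq> diff_ops 0 V" "O_ops V \<subseteq> diff_ops 0 V"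
    using tc.O_ops_diff_ops[of U 0] tc.O_ops_diff_ops[of V 0] diff_ops_mono[OF VU] by blast+
  have subL: "submodule (O_ops U) ?T V L" and LT: "L \<subseteq> sec ?T V"
    using fg by (auto simp: finitely_generated_def submodule_def V_def)
  obtain S where S: "finite S" "S \<subseteq> L" "submodule (O_ops U) ?T V hull S = L"
    using fg by (auto simp: finitely_generated_def V_def)
  have sV: "tc.triv_pre V (sec ?T V) = sec M V" using tc.triv_mem[OF oV qU(2)] by (auto simp: tc.triv_pre_def)
  show ?thesis
  proof (rule fr.nilpotent_of_lattice[where S = "tc.triv_pre V S" and L = "tc.triv_pre V L", OF U qU(1) V_def coherent_off_p _ _ _ _ _ _ s])
    show "submodule (O_ops U) M V (tc.triv_pre V L)"
      using tc.submodule_triv_pre[OF oV qU(2) OU(1) subL] by (simp add: tc.twist_O_ops)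
    show "finite (tc.triv_pre V S)" using S by (intro tc.finite_triv_pre[OF oV qU(2)])
    show "tc.triv_pre V S \<subseteq> tc.triv_pre V L" using S by (auto simp: tc.triv_pre_def)
    show "tc.triv_pre V L \<subseteq> Y" if "submodule (O_ops U) M V Y" "tc.triv_pre V S \<subseteq> Y" for Y
      using tc.hull_triv_pre[OF oV qU(2) OU(1), of S Y] that S LT by (simp add: tc.twist_O_ops)
    show "sec M V \<subseteq> Y" if "submodule (O_ops V) M V Y" "tc.triv_pre V L \<subseteq> Y" for Y
      using tc.hull_triv_pre[OF oV qU(2) OU(2) LT, of Y] that hull sV by (simp add: tc.twist_O_ops V_def)
    show "act M V (\<lambda>f. fr.wc * fr.Eg f + of_nat n * f) s \<in> tc.triv_pre V L" if s: "s \<in> tc.triv_pre V L" for s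
    proof -
      let ?v = "first_order (fr.zc * lform b' d' ^ 2) 0"
      have v: "?v \<in> vector_fields_vanishing_at (pt a c) U" using qU U by (intro fr.mem_vector_fields)
      then have vV: "?v \<in> diff_ops 0 V" using diff_ops_mono[OF VU] by (auto simp: vector_fields_vanishing_at_def)
      have sM: "s \<in> sec M V" "tc.triv V s \<in> L" using s by (auto simp: tc.triv_pre_def)
      have e: "twist_op n (lform b' d') ?v = (\<lambda>f. fr.wc * fr.Eg f + of_nat n * f)"
        using fr.vector_field_eq by (simp add: fun_eq_iff)
      have "act ?T V ?v (tc.triv V s) \<in> L" using vf v sM by (simp add: V_def)
      then have "tc.triv V (act M V (\<lambda>f. fr.wc * fr.Eg f + of_nat n * f) s) \<in> L"
        unfolding tc.triv_act[OF oV qU(2) sM(1) vV] e .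
      moreover have "(\<lambda>f. fr.wc * fr.Eg f + of_nat n * f) \<in> diff_ops (int n) V"
        using twist_op_diff_ops[OF fr.pq_nonzero(2) qU(2) vV, of n] unfolding e .
      ultimately show ?thesis using oV sM by (simp add: tc.triv_pre_def act_sec)
    qed
  qed
qed

lemma Up_Int_Uq: "Up \<inter> Uq = {x \<in> Uq. \<not> has_value zc x 0}" "Up \<inter> Uq = {x \<in> Up. \<not> has_value wc x 0}"
proof -
  interpret zc: affine_coordinate zc "pt b d" by (rule affine_coordinate_zc)
  interpret wc: affine_coordinate wc "pt a c" by (rule affine_coordinate_wc)
  have "x = pt a c" if "has_value zc x 0" for x using zc.point_unique[OF that has_value_zc_0] .
  then show "Up \<inter> Uq = {x \<in> Uq. \<not> has_value zc x 0}" using has_value_zc_0 by blast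
  have w0: "has_value wc (pt b d) 0" using zc.pole by (simp add: wc_zc)
  have "x = pt b d" if "has_value wc x 0" for x using wc.point_unique[OF that w0] .
  then show "Up \<inter> Uq = {x \<in> Up. \<not> has_value wc x 0}" using w0 by blast
qed

lemma A_open: "zariski_open (Up \<inter> Uq)"
  using Up_open Uq_open by (intro zariski_open_Int)

lemma Up_Un_Uq: "Up \<union> Uq = UNIV"
  using pt_distinct by auto

lemma zc_Uq: "zc ^ k \<in> O_X Uq" and wc_Up: "wc ^ k \<in> O_X Up"
  by (intro O_X_power zc_O_X wc_O_X; simp)+

section \<open>Sections supported at p, and passage to global sections\<close>

lemma Eg_torsion:
  "s \<in> sec M Uq \<Longrightarrow> act M Uq (mult_op (zc ^ k)) s = 0 \<Longrightarrow> (act M Uq Eg ^^ k) s = 0"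
proof (induction k arbitrary: s)
  case 0
  then show ?case using Uq_open by (simp add: act_mult_1)
next
  case (Suc k)
  have higher: "act M Uq (mult_op (f * zc ^ Suc k)) s = 0" if "f \<in> O_X Uq" for f
    using Suc.prems that Uq_open zc_Uq mult_op_diff_ops by (simp add: act_mult act_0_right del: power_Suc)
  let ?e = "of_int (- int (k + 2 + n)) * zc ^ Suc k"
  have i: "of_int j \<in> O_X Uq" for j
    using const_fun_O_X[of "of_int j" Uq] by (simp add: const_fun_of_int)
  have m: "mult_op (- 1) \<circ> Fg \<in> diff_ops (int n) Uq" "mult_op ?e \<in> diff_ops (int n) Uq"
    using i[of "- 1"] i[of "- int (k + 2 + n)"] zc_Uq[of "Suc k"]
    by (intro diff_ops_comp mult_op_diff_ops Fg_diff_ops O_X_mult; simp)+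
  have "act M Uq (mult_op (zc ^ k)) (act M Uq Eg s) =
     act M Uq (mult_op (- 1) \<circ> Fg) (act M Uq (mult_op (zc ^ (k + 2))) s) + act M Uq (mult_op ?e) s"
    by (rule act_identity[OF Uq_open(1) mult_op_diff_ops[OF zc_Uq] Eg_diff_ops m(1) mult_op_diff_ops[OF zc_Uq] m(2) _ Suc.prems(1)])
      (simp only: mult_op_def comp_def zc_power_Eg mult.assoc)
  also have "act M Uq (mult_op ?e) s = 0" by (rule higher[OF i])
  also have "zc ^ (k + 2) = zc ^ 1 * zc ^ Suc k" by (simp add: power2_eq_square)
  also have "act M Uq (mult_op (zc ^ 1 * zc ^ Suc k)) s = 0" by (rule higher[OF zc_Uq])
  finally have "act M Uq (mult_op (zc ^ k)) (act M Uq Eg s) = 0"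
    using act_0_right[OF Uq_open(1) m(1)] by (simp only: add.right_neutral)
  then have "(act M Uq Eg ^^ k) (act M Uq Eg s) = 0"
    using Suc.IH[of "act M Uq Eg s"] Suc.prems(1) Uq_open Eg_diff_ops by (simp add: act_sec)
  then show ?case by (simp add: funpow_swap1)
qed

lemma torsion_on_Uq:
  assumes "s \<in> sec M Uq" "res M Uq (Up \<inter> Uq) s = 0"
  shows "\<exists>k. act M Uq (mult_op (zc ^ k)) s = 0"
  using qc_kernel[OF Uq_open(2) _ Up_Int_Uq(1) A_open assms] zc_Uq[of 1] by simp

text \<open>A power of E kills s on X - p; what remains is supported at p, where it is killed by a
  power of zc and hence by a further power of E.\<close>

lemma nilpotent_UNIV:
  assumes s: "s \<in> sec M UNIV"
  shows "\<exists>k. (act M UNIV Eg ^^ k) s = 0"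
proof -
  have r: "res M UNIV W ((act M UNIV Eg ^^ k) t) = (act M W Eg ^^ k) (res M UNIV W t)" "(act M UNIV Eg ^^ k) t \<in> sec M UNIV"
    if "zariski_open W" "t \<in> sec M UNIV" for W k t
    using res_funpow_Eg[of UNIV W t] that zariski_open_simps by auto
  have rm: "res M UNIV W t \<in> sec M W" if "zariski_open W" "t \<in> sec M UNIV" for W t
    using that zariski_open_simps by (intro res_sec) auto
  obtain k where k: "(act M Up Eg ^^ k) (res M UNIV Up s) = 0" using nilpotent_Up rm[OF Up_open(1) s] by blast
  define u where "u = (act M UNIV Eg ^^ k) s"
  have u: "u \<in> sec M UNIV" "res M UNIV Up u = 0" unfolding u_def using r[OF Up_open(1) s] k by auto
  have "res M Uq (Up \<inter> Uq) (res M UNIV Uq u) = res M Up (Up \<inter> Uq) (res M UNIV Up u)"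
    using u(1) A_open Up_open Uq_open zariski_open_simps by (simp add: res_res)
  also have "\<dots> = 0" using u A_open Up_open by (simp add: res_0)
  finally obtain j where "act M Uq (mult_op (zc ^ j)) (res M UNIV Uq u) = 0"
    using torsion_on_Uq rm[OF Uq_open(1) u(1)] by blast
  then have "(act M Uq Eg ^^ j) (res M UNIV Uq u) = 0" using Eg_torsion rm[OF Uq_open(1) u(1)] by blast
  then have 1: "res M UNIV Uq ((act M UNIV Eg ^^ j) u) = 0" using r[OF Uq_open(1) u(1)] by simp
  have "(act M Up Eg ^^ j) 0 = 0" by (induction j) (use Up_open Eg_diff_ops in \<open>simp_all add: act_0_right\<close>)
  then have 2: "res M UNIV Up ((act M UNIV Eg ^^ j) u) = 0" using r[OF Up_open(1) u(1)] u by simp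
  have "(act M UNIV Eg ^^ j) u = 0"
    using separated2[OF Up_open(1) Uq_open(1)] 1 2 r(2)[OF Up_open(1) u(1)] unfolding Up_Un_Uq by blast
  then have "(act M UNIV Eg ^^ (j + k)) s = 0" by (simp add: u_def funpow_add)
  then show ?thesis by blast
qed

text \<open>A section vanishing off q restricts to a section over X - p killed by a power of w, and
  there is no torsion there. This carries finiteness from X - q to global sections.\<close>

lemma res_Uq_inj:
  assumes s: "s \<in> sec M UNIV" and 0: "res M UNIV Uq s = 0"
  shows "s = 0"
proof -
  interpret N: poly_connection "sec M Up" "psc Up" "act M Up Eg"
    by (rule poly_connection_Up) (rule coherent_off_p)
  have m: "res M UNIV Up s \<in> sec M Up" using s Up_open zariski_open_simps by (intro res_sec) auto
  have "res M Up (Up \<inter> Uq) (res M UNIV Up s) = res M Uq (Up \<inter> Uq) (res M UNIV Uq s)"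
    using s A_open Up_open Uq_open zariski_open_simps by (simp add: res_res)
  also have "\<dots> = 0" using 0 A_open Uq_open by (simp add: res_0)
  finally obtain k where "act M Up (mult_op (wc ^ k)) (res M UNIV Up s) = 0"
    using qc_kernel[OF Up_open(2) _ Up_Int_Uq(2) A_open m] wc_Up[of 1] by auto
  then have "psc Up ([:0, 1:] ^ k) (res M UNIV Up s) = 0" by (simp add: psc_def wc_power)
  then have "res M UNIV Up s = 0" using N.torsion_free[OF m] by simp
  then show ?thesis using separated2[OF Up_open(1) Uq_open(1)] s 0 unfolding Up_Un_Uq by blast
qed

section \<open>Local finiteness of H and finiteness of its eigenspaces\<close>

abbreviation "hkill W \<equiv> weight_operator.kill (csc W) (act M W Hg)"

lemma hkill_res:
  assumes U: "zariski_open U" and W: "zariski_open W" "W \<subseteq> U" and s: "s \<in> sec M U"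
  shows "res M U W (hkill U cs s) = hkill W cs (res M U W s)"
proof (induction cs)
  interpret KU: weight_operator "sec M U" "csc U" "act M U Hg" using U by (rule weight_operator_sec)
  interpret KW: weight_operator "sec M W" "csc W" "act M W Hg" using W(1) by (rule weight_operator_sec)
  case Nil
  show ?case by (simp add: KU.kill_simps KW.kill_simps)
next
  interpret KU: weight_operator "sec M U" "csc U" "act M U Hg" using U by (rule weight_operator_sec)
  interpret KW: weight_operator "sec M W" "csc W" "act M W Hg" using W(1) by (rule weight_operator_sec)
  case (Cons x cs)
  have y: "hkill U cs s \<in> sec M U" using KU.lin_op_mem[OF KU.kill_lin s] .
  have "res M U W (act M U Hg (hkill U cs s) - csc U x (hkill U cs s)) =
     act M W Hg (res M U W (hkill U cs s)) - csc W x (res M U W (hkill U cs s))"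
    using U W y Hg_diff_ops const_op_diff_ops by (simp add: res_diff act_sec res_act)
  then show ?case by (simp add: KU.kill_simps KW.kill_simps Cons)
qed

lemma Hg_mult_shift:
  assumes U: "zariski_open U" and f: "f \<in> O_X U" "\<And>k. Hg (f * k) = f * Hg k + const_fun r * (f * k)" and s: "s \<in> sec M U"
  shows "act M U Hg (act M U (mult_op f) s) = act M U (mult_op f) (act M U Hg s) + csc U r (act M U (mult_op f) s)"
proof -
  note m = mult_op_diff_ops[OF f(1), of "int n"]
  have "act M U Hg (act M U (mult_op f) s) = act M U (mult_op f) (act M U Hg s) + act M U (\<lambda>k. const_fun r * mult_op f k) s"
    by (rule act_identity[OF U Hg_diff_ops m m Hg_diff_ops const_comp_diff_ops[OF m] _ s]) (simp add: mult_op_def f(2))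
  then show ?thesis using act_const_comp[OF U m s] by simp
qed

text \<open>Since H - n = 2 w E, a product killing E s kills (H - n) s once its roots are shifted by
  - 2 on account of w. The induction is on the nilpotency exponent.\<close>

lemma hkill_Up:
  "s \<in> sec M Up \<Longrightarrow> (act M Up Eg ^^ j) s = 0 \<Longrightarrow> \<exists>cs. hkill Up cs s = 0"
proof (induction j arbitrary: s)
  interpret K: weight_operator "sec M Up" "csc Up" "act M Up Hg" using Up_open by (intro weight_operator_sec)
  case 0
  then show ?case by (intro exI[of _ "[]"]) (simp add: K.kill_simps)
next
  interpret K: weight_operator "sec M Up" "csc Up" "act M Up Hg" using Up_open by (intro weight_operator_sec)
  case (Suc j)
  let ?w = "act M Up (mult_op wc)"
  have wO: "wc \<in> O_X Up" using wc_Up[of 1] by simp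
  note wd = mult_op_diff_ops[OF wO, of "int n"]
  have Es: "act M Up Eg s \<in> sec M Up" using Suc.prems Up_open Eg_diff_ops by (intro act_sec) auto
  then obtain cs where cs: "hkill Up cs (act M Up Eg s) = 0"
    using Suc.IH[OF Es] Suc.prems(2) by (auto simp: funpow_swap1)
  have wl: "K.lin_op ?w" using Up_open wO by (intro lin_ops(4))
  have "act M Up Hg (act M Up id s) = act M Up (mult_op (const_fun 2) \<circ> mult_op wc) (act M Up Eg s) + act M Up (mult_op (const_fun (of_nat n))) s"
    by (rule act_identity[OF Up_open(1) Hg_diff_ops id_diff_ops diff_ops_comp[OF const_op_diff_ops wd] Eg_diff_ops const_op_diff_ops _ Suc.prems(1)])
      (simp add: mult_op_def Hg_Eg const_fun_numeral const_fun_of_nat)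
  then have H: "act M Up Hg s - csc Up (of_nat n) s = csc Up 2 (?w (act M Up Eg s))"
    using Suc.prems Up_open Es wd const_op_diff_ops by (simp add: act_id act_comp)
  have "hkill Up (map (\<lambda>c. c + (- 2)) cs) (?w (act M Up Eg s)) = ?w (hkill Up cs (act M Up Eg s))"
    by (rule K.kill_shift[OF wl Hg_mult_shift[OF Up_open(1) wO] Es])
      (simp_all add: Hg_wc const_fun_numeral const_fun_simps)
  also have "\<dots> = 0" unfolding cs by (rule K.lin_op_zero[OF wl])
  finally have "hkill Up (map (\<lambda>c. c + (- 2)) cs @ [of_nat n]) s = 0"
    unfolding K.kill_append K.kill_simps H
    using K.lin_op_sc[OF K.kill_lin K.lin_op_mem[OF wl Es]] by (simp add: K.sc_zero_right)
  then show ?case by blast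
qed

text \<open>A section killed by zc has weight - n - 2, because H = - 2 F zc - (n + 2). The induction
  passes from s to zc s, whose weights are higher by 2.\<close>

lemma hkill_torsion:
  "s \<in> sec M Uq \<Longrightarrow> act M Uq (mult_op (zc ^ k)) s = 0 \<Longrightarrow> \<exists>cs. hkill Uq cs s = 0"
proof (induction k arbitrary: s)
  interpret K: weight_operator "sec M Uq" "csc Uq" "act M Uq Hg" using Uq_open by (intro weight_operator_sec)
  case 0
  then show ?case using Uq_open by (intro exI[of _ "[]"]) (simp add: K.kill_simps act_mult_1)
next
  interpret K: weight_operator "sec M Uq" "csc Uq" "act M Uq Hg" using Uq_open by (intro weight_operator_sec)
  case (Suc k)
  let ?z = "act M Uq (mult_op zc)"
  have zO: "zc \<in> O_X Uq" using zc_Uq[of 1] by simp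
  note zd = mult_op_diff_ops[OF zO, of "int n"]
  have zs: "?z s \<in> sec M Uq" using Suc.prems Uq_open zO by (intro act_mult_mem)
  have "act M Uq (mult_op (zc ^ k)) (?z s) = 0"
    using Suc.prems Uq_open zO zc_Uq by (simp add: mult.commute[of zc] act_mult)
  then obtain cs where cs: "hkill Uq cs (?z s) = 0" using Suc.IH[OF zs] by blast
  have zl: "K.lin_op ?z" using Uq_open zO by (intro lin_ops(4))
  define y where "y = hkill Uq (map (\<lambda>c. c - 2) cs) s"
  have y: "y \<in> sec M Uq" unfolding y_def using K.lin_op_mem[OF K.kill_lin Suc.prems(1)] .
  have "hkill Uq (map (\<lambda>c. c + 2) (map (\<lambda>c. c - 2) cs)) (?z s) = ?z y"
    unfolding y_def by (rule K.kill_shift[OF zl Hg_mult_shift[OF Uq_open(1) zO] Suc.prems(1)])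
      (simp_all add: Hg_zc const_fun_numeral)
  then have zy: "?z y = 0" using cs by (simp add: comp_def)
  have "act M Uq Hg (act M Uq id y) = act M Uq (mult_op (const_fun (- 2)) \<circ> Fg) (act M Uq (mult_op zc) y)
      + act M Uq (mult_op (const_fun (- of_nat n - 2))) y"
    by (rule act_identity[OF Uq_open(1) Hg_diff_ops id_diff_ops diff_ops_comp[OF const_op_diff_ops Fg_diff_ops] zd const_op_diff_ops _ y])
      (simp only: mult_op_def comp_def id_apply Hg_Fg Fg_zc,
       simp add: const_fun_numeral const_fun_of_nat const_fun_simps algebra_simps)
  then have "act M Uq Hg y = csc Uq (- of_nat n - 2) y"
    unfolding zy using y Uq_open act_0_right[OF Uq_open(1) diff_ops_comp[OF const_op_diff_ops Fg_diff_ops]] by (simp add: act_id)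
  then have "hkill Uq ([- of_nat n - 2] @ map (\<lambda>c. c - 2) cs) s = 0"
    unfolding K.kill_append K.kill_simps y_def by simp
  then show ?case by blast
qed

text \<open>On the overlap w is invertible and some w^k s extends to X - p, where a product kills
  the extension; undoing the shift by w^k gives a product that kills s on the overlap. What this
  product leaves of s on X - q is supported at p.\<close>

lemma hkill_Uq:
  assumes s: "s \<in> sec M Uq" shows "\<exists>cs. hkill Uq cs s = 0"
proof -
  let ?A = "Up \<inter> Uq"
  interpret K: weight_operator "sec M Uq" "csc Uq" "act M Uq Hg" using Uq_open by (intro weight_operator_sec)
  interpret KA: weight_operator "sec M ?A" "csc ?A" "act M ?A Hg" using A_open by (intro weight_operator_sec)
  interpret KU: weight_operator "sec M Up" "csc Up" "act M Up Hg" using Up_open by (intro weight_operator_sec)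
  define x where "x = res M Uq ?A s"
  have x: "x \<in> sec M ?A" unfolding x_def using s Uq_open A_open by (intro res_sec) auto
  obtain k t where t: "t \<in> sec M Up" "act M ?A (mult_op (wc ^ k)) x = res M Up ?A t"
    using qc_extend[OF Up_open(2) _ Up_Int_Uq(2) A_open x] wc_Up[of 1] by auto
  obtain cs where "hkill Up cs t = 0" using hkill_Up[OF t(1)] nilpotent_Up[OF t(1)] by blast
  then have cs: "hkill ?A cs (act M ?A (mult_op (wc ^ k)) x) = 0"
    unfolding t(2) using hkill_res[OF Up_open(1) A_open _ t(1), of cs] A_open Up_open by (simp add: res_0)
  have wO: "wc ^ k \<in> O_X ?A" "zc ^ k \<in> O_X ?A" using wc_Up zc_Uq O_X_mono by (meson Int_lower1 Int_lower2)+
  have wl: "KA.lin_op (act M ?A (mult_op (wc ^ k)))" using A_open wO by (intro lin_ops(4))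
  have H: "Hg (wc ^ k * f) = wc ^ k * Hg f + const_fun (- 2 * of_nat k) * (wc ^ k * f)" for f
  proof (induction k)
    case (Suc k)
    have "Hg (wc ^ Suc k * f) = Hg (wc * (wc ^ k * f))" by (simp add: mult.assoc)
    then show ?case unfolding Hg_wc Suc by (simp add: const_fun_simps const_fun_numeral const_fun_of_nat algebra_simps)
  qed (simp add: const_fun_simps)
  let ?cs = "map (\<lambda>c. c - (- 2 * of_nat k)) cs"
  have "hkill ?A (map (\<lambda>c. c + (- 2 * of_nat k)) ?cs) (act M ?A (mult_op (wc ^ k)) x) = act M ?A (mult_op (wc ^ k)) (hkill ?A ?cs x)"
    by (rule KA.kill_shift[OF wl Hg_mult_shift[OF A_open wO(1) H] x]) simp
  then have "act M ?A (mult_op (wc ^ k)) (hkill ?A ?cs x) = 0" using cs by (simp add: comp_def)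
  moreover have "zc ^ k * wc ^ k = 1" by (simp add: power_mult_distrib[symmetric] mult.commute wc_zc)
  ultimately have "hkill ?A ?cs x = 0"
    using act_mult_cancel[OF A_open wO(2,1)] KA.lin_op_mem[OF KA.kill_lin x] by blast
  then have "res M Uq ?A (hkill Uq ?cs s) = 0"
    using hkill_res[OF Uq_open(1) A_open _ s] by (simp add: x_def)
  moreover have y: "hkill Uq ?cs s \<in> sec M Uq" using K.lin_op_mem[OF K.kill_lin s] .
  ultimately obtain ds where "hkill Uq ds (hkill Uq ?cs s) = 0" using torsion_on_Uq hkill_torsion by blast
  then have "hkill Uq (ds @ ?cs) s = 0" by (simp add: K.kill_append)
  then show ?thesis by blast
qed

lemma finite_generation_Uq:
  "\<exists>S. finite S \<and> S \<subseteq> sec M Uq \<and> (\<forall>Y. submodule (diff_ops (int n) Uq) M Uq Y \<longrightarrow> S \<subseteq> Y \<longrightarrow> sec M Uq \<subseteq> Y)"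
proof -
  let ?T = "line_bundle_tensor (- int n) M"
  interpret tc: twisted_chart n M b d ?T using pq_nonzero by (intro chart) auto
  have q: "pt b d \<notin> Uq" by simp
  obtain S where S: "finite S" "S \<subseteq> sec ?T Uq" "submodule (diff_ops 0 Uq) ?T Uq hull S = sec ?T Uq"
    using coh_D Uq_open by (auto simp: D_coherent_def finitely_generated_def)
  have "sec M Uq \<subseteq> Y" if Y: "submodule (diff_ops (int n) Uq) M Uq Y" "tc.triv_pre Uq S \<subseteq> Y" for Y
  proof -
    have "submodule (twist_op n lq ` diff_ops 0 Uq) M Uq Y"
      using Y(1) twist_op_diff_ops[OF pq_nonzero(2) q] by (auto simp: submodule_def)
    then have "tc.triv_pre Uq (sec ?T Uq) \<subseteq> Y"
      using tc.hull_triv_pre[OF Uq_open(1) q subset_refl S(2) _ Y(2)] S(3) by simp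
    then show ?thesis using tc.triv_mem[OF Uq_open(1) q] by (auto simp: tc.triv_pre_def)
  qed
  moreover have "finite (tc.triv_pre Uq S)" "tc.triv_pre Uq S \<subseteq> sec M Uq"
    using tc.finite_triv_pre[OF Uq_open(1) q S(1)] by (auto simp: tc.triv_pre_def)
  ultimately show ?thesis by blast
qed

lemma finite_eigenspace_Uq:
  "\<exists>B. finite B \<and> B \<subseteq> sec M Uq \<and> {x \<in> sec M Uq. act M Uq Hg x = csc Uq \<mu> x} \<subseteq> cmodule.spn (csc Uq) B"
proof -
  interpret K: weight_operator "sec M Uq" "csc Uq" "act M Uq Hg" using Uq_open by (intro weight_operator_sec)
  have zO: "zc \<in> O_X Uq" using zc_Uq[of 1] by simp
  note zd = mult_op_diff_ops[OF zO, of "int n"]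
  interpret weyl: weyl_module "sec M Uq" "csc Uq" "act M Uq Hg" "act M Uq (mult_op zc)" "act M Uq Fg" "of_nat n"
  proof unfold_locales
    show "K.lin_op (act M Uq (mult_op zc))" "K.lin_op (act M Uq Fg)"
      using Uq_open zO by (auto intro!: lin_ops)
    fix x assume x: "x \<in> sec M Uq"
    have "act M Uq Fg (act M Uq (mult_op zc) x) = act M Uq (mult_op zc) (act M Uq Fg x) + act M Uq (mult_op (const_fun (- 1))) x"
      by (rule act_identity[OF Uq_open(1) Fg_diff_ops zd zd Fg_diff_ops const_op_diff_ops _ x])
        (simp add: mult_op_def Fg_zc const_fun_simps)
    then show "act M Uq Fg (act M Uq (mult_op zc) x) = act M Uq (mult_op zc) (act M Uq Fg x) - x"
      using x by (simp add: K.sc_minus_left K.sc_one)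
    have "act M Uq Hg (act M Uq id x) = act M Uq (mult_op (const_fun (- 2)) \<circ> mult_op zc) (act M Uq Fg x)
        + act M Uq (mult_op (const_fun (- of_nat n))) x"
      by (rule act_identity[OF Uq_open(1) Hg_diff_ops id_diff_ops diff_ops_comp[OF const_op_diff_ops zd] Fg_diff_ops const_op_diff_ops _ x])
        (simp add: mult_op_def Hg_Fg const_fun_numeral const_fun_of_nat const_fun_simps)
    then show "act M Uq Hg x = csc Uq (- 2) (act M Uq (mult_op zc) (act M Uq Fg x)) - csc Uq (of_nat n) x"
      using x Uq_open zd Fg_diff_ops const_op_diff_ops by (simp add: act_id act_comp act_sec K.sc_minus_left)
  qed
  obtain S where S: "finite S" "S \<subseteq> sec M Uq"
    and gen: "\<And>Y. submodule (diff_ops (int n) Uq) M Uq Y \<Longrightarrow> S \<subseteq> Y \<Longrightarrow> sec M Uq \<subseteq> Y"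
    using finite_generation_Uq by blast
  show ?thesis
  proof (rule weyl.finite_eigenspace[OF S])
    show "\<exists>cs. hkill Uq cs s = 0" if "s \<in> S" for s using hkill_Uq that S by blast
    fix Y assume Y: "K.subm Y" "S \<subseteq> Y" and Z: "\<And>x. x \<in> Y \<Longrightarrow> act M Uq (mult_op zc) x \<in> Y"
      and F: "\<And>x. x \<in> Y \<Longrightarrow> act M Uq Fg x \<in> Y"
    have YC: "x \<in> sec M Uq" if "x \<in> Y" for x using K.subm_subset[OF Y(1) that] .
    have sO: "subst_poly zc u \<in> O_X Uq" for u by (intro subst_zc_Uq) simp
    have poly: "act M Uq (mult_op (subst_poly zc u)) x \<in> Y" if x: "x \<in> Y" for u x
    proof (induction u)
      case 0
      have "act M Uq (mult_op (subst_poly zc 0)) x = 0"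
        using K.sc_zero_left[OF YC[OF x]] by (simp add: subst_poly_0 const_fun_simps)
      then show ?case using K.subm_zero[OF Y(1)] by simp
    next
      case (pCons r u)
      have "act M Uq (mult_op (subst_poly zc (pCons r u))) x = csc Uq r x + act M Uq (mult_op zc) (act M Uq (mult_op (subst_poly zc u)) x)"
        unfolding subst_poly_pCons using Uq_open YC[OF x] const_fun_O_X zO sO O_X_mult
        by (simp add: act_mult_add act_mult)
      then show ?case using pCons.IH x Z by (auto intro: K.subm_add[OF Y(1)] K.subm_sc[OF Y(1)])
    qed
    have Fk: "act M Uq (Fg ^^ j) x \<in> Y" if x: "x \<in> Y" for j x
    proof (induction j)
      case 0
      then show ?case using x act_id[OF Uq_open(1) YC[OF x]] by (simp only: funpow.simps)
    next
      case (Suc j)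
      have "act M Uq (Fg ^^ Suc j) x = act M Uq Fg (act M Uq (Fg ^^ j) x)"
        using Uq_open YC[OF x] Fg_diff_ops diff_ops_funpow by (simp add: act_comp)
      then show ?case using F[OF Suc] by (simp only:)
    qed
    \<comment> \<open>By the normal form, stability under zc and \<open>Fg\<close> implies stability
      under every operator, so generators over the ring of operators are generators over the Weyl
      algebra.\<close>
    have "act M Uq P x \<in> Y" if P: "P \<in> diff_ops (int n) Uq" and x: "x \<in> Y" for P x
    proof -
      obtain N u where P_eq: "\<And>f. P f = (\<Sum>j<N. subst_poly zc (u j) * (Fg ^^ j) f)"
        using diff_ops_normal_form[OF P] by auto
      let ?Q = "\<lambda>m f. \<Sum>j<m. subst_poly zc (u j) * (Fg ^^ j) f"
      have "?Q m \<in> diff_ops (int n) Uq \<and> act M Uq (?Q m) x \<in> Y" for m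
      proof (induction m)
        case 0
        have e: "?Q 0 = mult_op (const_fun 0)" by (simp add: fun_eq_iff mult_op_def const_fun_simps)
        show ?case unfolding e using const_op_diff_ops K.subm_sc[OF Y(1) x] by blast
      next
        case (Suc m)
        let ?t = "mult_op (subst_poly zc (u m)) \<circ> (Fg ^^ m)"
        have t: "?t \<in> diff_ops (int n) Uq"
          by (intro diff_ops_comp mult_op_diff_ops sO diff_ops_funpow Fg_diff_ops)
        have e: "?Q (Suc m) = (\<lambda>f. ?Q m f + ?t f)" by (simp add: mult_op_def)
        have "act M Uq ?t x = act M Uq (mult_op (subst_poly zc (u m))) (act M Uq (Fg ^^ m) x)"
          by (rule act_comp[OF Uq_open(1) mult_op_diff_ops[OF sO] diff_ops_funpow[OF Fg_diff_ops] YC[OF x]])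
        then have "act M Uq ?t x \<in> Y" using poly Fk x by simp
        then show ?case unfolding e using diff_ops_add[OF conjunct1[OF Suc] t]
          act_add_left[OF Uq_open(1) conjunct1[OF Suc] t YC[OF x]] K.subm_add[OF Y(1) conjunct2[OF Suc]] by simp
      qed
      moreover have "P = ?Q N" using P_eq by (simp add: fun_eq_iff)
      ultimately show ?thesis by simp
    qed
    then have "submodule (diff_ops (int n) Uq) M Uq Y"
      using Y YC K.subm_minus[OF Y(1)] by (auto simp: submodule_def K.subm_zero K.subm_add)
    then show "Y = sec M Uq" using gen Y(2) YC by blast
  qed
qed

sublocale rep: sl2_module "sec M UNIV" "csc UNIV" "act M UNIV Eg" "act M UNIV Fg" "act M UNIV Hg" "n + 1"
  by (rule sl2_module_sec) (rule zariski_open_simps)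

text \<open>The eigenspace of H on global sections embeds by restriction into the finite-dimensional
  one over X - q. Taking the spanning set inside the image lets it be lifted.\<close>

lemma finite_prim_weight:
  "\<exists>B. finite B \<and> B \<subseteq> sec M UNIV \<and> rep.prim_weight \<mu> {0} \<subseteq> rep.spn B"
proof -
  interpret K: weight_operator "sec M Uq" "csc Uq" "act M Uq Hg" using Uq_open by (intro weight_operator_sec)
  let ?r = "res M UNIV Uq"
  note o = zariski_open_simps(1) Uq_open(1)
  obtain B where B: "finite B" "B \<subseteq> sec M Uq" "{x \<in> sec M Uq. act M Uq Hg x = csc Uq \<mu> x} \<subseteq> K.spn B"
    using finite_eigenspace_Uq by blast
  define P where "P = {x \<in> sec M UNIV. act M UNIV Hg x = csc UNIV \<mu> x}"
  have rm: "?r x \<in> sec M Uq" if "x \<in> sec M UNIV" for x using that o by (intro res_sec) auto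
  have ra: "?r (x + y) = ?r x + ?r y" if "x \<in> sec M UNIV" "y \<in> sec M UNIV" for x y
    using that o by (intro res_add) auto
  have rc: "?r (csc UNIV z x) = csc Uq z (?r x)" if "x \<in> sec M UNIV" for x z
    using that o const_op_diff_ops by (intro res_act) auto
  have P: "rep.subm P"
    unfolding rep.subm_def P_def
    by (auto simp: rep.zero_mem rep.add_mem rep.sc_mem rep.lin_op_zero[OF rep.H_lin] rep.lin_op_add[OF rep.H_lin]
      rep.lin_op_sc[OF rep.H_lin] rep.sc_zero_right rep.sc_add_right rep.sc_commute[of _ \<mu>])
  have PC: "x \<in> sec M UNIV" if "x \<in> P" for x using that by (simp add: P_def)
  have sP: "K.subm (?r ` P)"
    unfolding K.subm_def
  proof (intro conjI ballI allI)
    show "?r ` P \<subseteq> sec M Uq" using rm PC by auto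
    show "0 \<in> ?r ` P" using rep.subm_zero[OF P] res_0[OF o] by (intro image_eqI[of _ _ 0]) auto
    show "x + y \<in> ?r ` P" if xy: "x \<in> ?r ` P" "y \<in> ?r ` P" for x y
    proof -
      obtain x' y' where "x' \<in> P" "y' \<in> P" "x = ?r x'" "y = ?r y'" using xy by blast
      then show ?thesis using ra PC rep.subm_add[OF P] by (intro image_eqI[of _ _ "x' + y'"]) auto
    qed
    show "csc Uq z x \<in> ?r ` P" if xP: "x \<in> ?r ` P" for x z
    proof -
      obtain x' where "x' \<in> P" "x = ?r x'" using xP by blast
      then show ?thesis using rc PC rep.subm_sc[OF P] by (intro image_eqI[of _ _ "csc UNIV z x'"]) auto
    qed
  qed
  have PB: "?r ` P \<subseteq> K.spn B"
  proof
    fix y assume "y \<in> ?r ` P"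
    then obtain x where x: "x \<in> P" "y = ?r x" by blast
    have "act M Uq Hg y = ?r (act M UNIV Hg x)"
      unfolding x(2) by (rule res_act[symmetric]) (use PC[OF x(1)] o Hg_diff_ops in auto)
    also have "act M UNIV Hg x = csc UNIV \<mu> x" using x(1) by (simp add: P_def)
    also have "?r (csc UNIV \<mu> x) = csc Uq \<mu> y" unfolding x(2) by (rule rc[OF PC[OF x(1)]])
    finally show "y \<in> K.spn B" using B(3) rm[OF PC[OF x(1)]] x(2) by blast
  qed
  obtain B' where B': "finite B'" "B' \<subseteq> ?r ` P" "?r ` P \<subseteq> K.spn B'"
    using K.subm_of_finite_span[OF B(1,2) sP PB] by auto
  obtain B'' where B'': "B'' \<subseteq> P" "finite B''" "B' = ?r ` B''"
    using finite_subset_image[OF B'(1,2)] by (elim exE conjE)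
  have sB: "rep.subm (rep.spn B'')" using B'' PC by (intro rep.subm_spn) auto
  have "P \<subseteq> rep.spn B''"
  proof
    fix x assume x: "x \<in> P"
    have "K.spn B' \<subseteq> ?r ` rep.spn B''"
    proof
      fix y assume "y \<in> K.spn B'"
      then show "y \<in> ?r ` rep.spn B''"
      proof induction
        case spn_zero
        then show ?case using rep.spn_zero res_0[OF o] by (intro image_eqI[of _ _ 0]) auto
      next
        case (spn_base y)
        then show ?case using B''(3) rep.spn_base by auto
      next
        case (spn_add x y)
        then obtain x' y' where "x' \<in> rep.spn B''" "y' \<in> rep.spn B''" "x = ?r x'" "y = ?r y'" by blast
        then show ?case using ra rep.subm_subset[OF sB] rep.spn_add by (metis image_eqI)
      next
        case (spn_sc x z)
        then obtain x' where "x' \<in> rep.spn B''" "x = ?r x'" by blast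
        then show ?case using rc rep.subm_subset[OF sB] rep.spn_sc by (metis image_eqI)
      qed
    qed
    then obtain y where y: "y \<in> rep.spn B''" "?r x = ?r y" using B'(3) x by blast
    have yC: "y \<in> sec M UNIV" using y rep.subm_subset[OF sB] by blast
    have "x - y = 0" using res_Uq_inj[of "x - y"] res_diff[OF o _ PC[OF x] yC] y(2) rep.diff_mem PC[OF x] yC by simp
    then show "x \<in> rep.spn B''" using y by simp
  qed
  moreover have "rep.prim_weight \<mu> {0} \<subseteq> P" by (auto simp: rep.prim_weight_def P_def)
  moreover have "B'' \<subseteq> sec M UNIV" using B'' PC by auto
  ultimately show ?thesis using B''(2) by (meson order_trans)
qed

lemma filtered: "rep.filtered {0}"
proof -
  obtain B1 where B1: "finite B1" "B1 \<subseteq> sec M UNIV" "rep.prim_weight (of_nat (n + 1) - 1) {0} \<subseteq> rep.spn B1"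
    using finite_prim_weight by blast
  obtain B2 where B2: "finite B2" "B2 \<subseteq> sec M UNIV" "rep.prim_weight (- of_nat (n + 1) - 1) {0} \<subseteq> rep.spn B2"
    using finite_prim_weight by blast
  have s: "rep.sumset {0} X = X" for X by (auto simp: rep.sumset_def)
  show ?thesis
    by (rule rep.filtered_of_finite[OF nilpotent_UNIV rep.inv_sub_0 B1(1,2) _ B2(1,2)])
      (use B1 B2 in \<open>simp_all add: s\<close>)
qed

end

subsection \<open>Quotients of representations\<close>

text \<open>\<open>quotient_rep\<close> defines its operations as unions over representatives; under
  these conditions all members of such a union coincide, and the operations are computed on
  representatives.\<close>

locale quotient_setup =
  fixes V :: "'v::ab_group_add sl2_rep" and W :: "'v set"
  assumes radd: "radd V = (+)" and rzero: "rzero V = 0"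
    and W_zero: "0 \<in> W" and W_add: "x \<in> W \<Longrightarrow> y \<in> W \<Longrightarrow> x + y \<in> W" and W_minus: "x \<in> W \<Longrightarrow> - x \<in> W"
    and W_space: "W \<subseteq> space V"
    and scale_add: "x \<in> space V \<Longrightarrow> y \<in> space V \<Longrightarrow> rscale V r (x + y) = rscale V r x + rscale V r y"
    and act_add: "x \<in> space V \<Longrightarrow> y \<in> space V \<Longrightarrow> ract V b (x + y) = ract V b x + ract V b y"
    and W_scale: "x \<in> W \<Longrightarrow> rscale V r x \<in> W"
    and W_act: "x \<in> W \<Longrightarrow> ract V b x \<in> W"
begin

abbreviation "coset \<equiv> rcoset V W"
abbreviation "Q \<equiv> quotient_rep V W"

lemma coset_eq: "coset x = (+) x ` W"
  by (simp add: rcoset_def radd)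

lemma mem_coset_iff: "y \<in> coset x \<longleftrightarrow> y - x \<in> W"
  by (auto simp: coset_eq intro: image_eqI[of _ _ "y - x"])

lemma W_diff: "x \<in> W \<Longrightarrow> y \<in> W \<Longrightarrow> x - y \<in> W"
  using W_add[of x "- y"] W_minus by simp

lemma coset_eq_iff: "coset x = coset y \<longleftrightarrow> x - y \<in> W"
proof
  assume "coset x = coset y"
  moreover have "x \<in> coset x" by (simp add: mem_coset_iff W_zero)
  ultimately show "x - y \<in> W" by (simp add: mem_coset_iff)
next
  assume xy: "x - y \<in> W"
  have "z - x \<in> W \<longleftrightarrow> z - y \<in> W" for z
    using W_add[OF _ xy, of "z - x"] W_diff[OF _ xy, of "z - y"] by auto
  then show "coset x = coset y" by (auto simp: mem_coset_iff)
qed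

lemma self_mem: "x \<in> coset x"
  by (simp add: mem_coset_iff W_zero)

lemma Q_space: "space Q = coset ` space V"
  by (simp add: quotient_rep_def)

lemma Q_zero: "rzero Q = coset 0"
  by (simp add: quotient_rep_def coset_eq)

lemma Q_add: "radd Q (coset x) (coset y) = coset (x + y)"
proof -
  have "rcoset V W (radd V u w) = coset (x + y)" if "u \<in> coset x" "w \<in> coset y" for u w
    using that W_add[of "u - x" "w - y"] by (simp add: coset_eq_iff radd mem_coset_iff algebra_simps)
  then have "(\<Union>u\<in>coset x. \<Union>w\<in>coset y. coset (radd V u w)) = coset (x + y)"
    by (intro UN_constant_eq[OF self_mem] ballI)
  then show ?thesis by (simp add: quotient_rep_def)
qed

lemma Q_scale:
  assumes x: "x \<in> space V" shows "rscale Q r (coset x) = coset (rscale V r x)"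
proof -
  have "rcoset V W (rscale V r u) = coset (rscale V r x)" if "u \<in> coset x" for u
  proof -
    have ux: "u - x \<in> W" using that by (simp add: mem_coset_iff)
    then have "rscale V r u = rscale V r x + rscale V r (u - x)"
      using scale_add[OF x, of "u - x"] W_space by auto
    then show ?thesis using W_scale[OF ux] by (simp add: coset_eq_iff)
  qed
  then have "(\<Union>u\<in>coset x. coset (rscale V r u)) = coset (rscale V r x)"
    by (intro UN_constant_eq[OF self_mem] ballI)
  then show ?thesis by (simp add: quotient_rep_def)
qed

lemma Q_act:
  assumes x: "x \<in> space V" shows "ract Q b (coset x) = coset (ract V b x)"
proof -
  have "rcoset V W (ract V b u) = coset (ract V b x)" if "u \<in> coset x" for u
  proof -
    have ux: "u - x \<in> W" using that by (simp add: mem_coset_iff)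
    then have "ract V b u = ract V b x + ract V b (u - x)"
      using act_add[OF x, of "u - x"] W_space by auto
    then show ?thesis using W_act[OF ux] by (simp add: coset_eq_iff)
  qed
  then have "(\<Union>u\<in>coset x. coset (ract V b u)) = coset (ract V b x)"
    by (intro UN_constant_eq[OF self_mem] ballI)
  then show ?thesis by (simp add: quotient_rep_def)
qed

lemma coset_zero_iff: "coset x = rzero Q \<longleftrightarrow> x \<in> W"
  by (simp add: Q_zero coset_eq_iff)

end

subsection \<open>The enveloping algebra in a rotated basis\<close>

lemma uconst_simps: "uconst 0 = 0" "uconst 1 = 1" "uconst (x + y) = uconst x + uconst y"
  "uconst (x * y) = uconst x * uconst y"
proof -
  show "uconst 0 = 0" "uconst 1 = 1" by (transfer, rule ueq_refl)+
  show "uconst (x + y) = uconst x + uconst y" by transfer (rule ueq_sym, rule const_add)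
  show "uconst (x * y) = uconst x * uconst y" by transfer (rule ueq_sym, rule const_mul)
qed

lemma uconst_minus: "uconst (- x) = - uconst x"
  using uconst_simps(3)[of x "- x"] by (simp add: uconst_simps eq_neg_iff_add_eq_0 add.commute)

lemma uconst_diff: "uconst (x - y) = uconst x - uconst y"
  using uconst_simps(3)[of x "- y"] by (simp add: uconst_minus)

lemma uconst_central: "u * uconst x = uconst x * u"
  by transfer (rule ueq_sym, rule const_central)

lemma uconst_central_left: "u * (uconst x * w) = uconst x * (u * w)"
  by (metis mult.assoc uconst_central)

lemma ugen_relations:
  "ugen bE * ugen bF = ugen bF * ugen bE + ugen bH"
  "ugen bH * ugen bE = ugen bE * ugen bH + uconst 2 * ugen bE"
  "ugen bH * ugen bF = ugen bF * ugen bH - uconst 2 * ugen bF"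
proof -
  show "ugen bE * ugen bF = ugen bF * ugen bE + ugen bH" by transfer (rule rel_EF)
  show "ugen bH * ugen bE = ugen bE * ugen bH + uconst 2 * ugen bE" by transfer (rule rel_HE)
  have "ugen bH * ugen bF = ugen bF * ugen bH + uconst (- 2) * ugen bF" by transfer (rule rel_HF)
  then show "ugen bH * ugen bF = ugen bF * ugen bH - uconst 2 * ugen bF" by (simp add: uconst_minus)
qed

definition ulin :: "complex \<Rightarrow> complex \<Rightarrow> complex \<Rightarrow> usl2" where
  "ulin x y z = uconst x * ugen bE + uconst y * ugen bF + uconst z * ugen bH"

text \<open>Both products are expanded in ordered monomials. Their quadratic parts are symmetric in
  the two factors and cancel, which leaves the Lie bracket in coordinates.\<close>

lemma ulin_commutator:
  "ulin x y z * ulin x' y' z' = ulin x' y' z' * ulin x y z +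
     ulin (2 * (z * x' - x * z')) (2 * (y * z' - z * y')) (x * y' - y * x')"
proof -
  have c: "uconst p * u * (uconst q * w) = uconst (p * q) * (u * w)" for p q u w
    by (metis mult.assoc uconst_central_left uconst_simps(4))
  have c2: "uconst p * (uconst q * u) = uconst (p * q) * u" for p q u
    by (simp only: mult.assoc uconst_simps(4))
  have prod: "ulin x y z * ulin x' y' z' =
    uconst (x * x') * (ugen bE * ugen bE) + uconst (y * y') * (ugen bF * ugen bF) + uconst (z * z') * (ugen bH * ugen bH) +
    uconst (x * y' + y * x') * (ugen bF * ugen bE) + uconst (x * z' + z * x') * (ugen bE * ugen bH) +
    uconst (y * z' + z * y') * (ugen bF * ugen bH) +
    (uconst (x * y') * ugen bH + uconst (z * x' * 2) * ugen bE - uconst (z * y' * 2) * ugen bF)" for x y z x' y' z'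
    unfolding ulin_def ring_distribs c ugen_relations c2 right_diff_distrib uconst_simps(3)
    by (simp only: add_ac diff_conv_add_uminus)
  have "ulin x y z * ulin x' y' z' - ulin x' y' z' * ulin x y z =
    (uconst (x * y') * ugen bH + uconst (z * x' * 2) * ugen bE - uconst (z * y' * 2) * ugen bF) -
    (uconst (x' * y) * ugen bH + uconst (z' * x * 2) * ugen bE - uconst (z' * y * 2) * ugen bF)"
    unfolding prod mult.commute[of x' x] mult.commute[of y' y] mult.commute[of z' z]
    by (simp add: add.commute mult.commute)
  also have "\<dots> = ulin (2 * (z * x' - x * z')) (2 * (y * z' - z * y')) (x * y' - y * x')"
    unfolding ulin_def right_diff_distrib uconst_diff left_diff_distrib by (simp add: mult_ac)
  finally show ?thesis by (simp add: diff_eq_eq add.commute)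
qed

subsection \<open>Steps of the filtration\<close>

context sl2_step
begin

lemma top_sum:
  assumes R: "inv_sub R" "W \<subseteq> R"
  shows "(\<Sum>i<N. sc (x i) (f i)) \<in> R \<Longrightarrow> (\<exists>i<N. x i \<noteq> 0) \<Longrightarrow> (\<And>i. i < N \<Longrightarrow> kap i \<noteq> 0) \<Longrightarrow> v \<in> R"
proof (induction N)
  case (Suc N)
  show ?case
  proof (cases "x N = 0")
    case True
    then have "(\<Sum>i<N. sc (x i) (f i)) \<in> R" "\<exists>i<N. x i \<noteq> 0"
      using Suc.prems f_mem by (auto simp: sc_zero_left less_Suc_eq)
    then show ?thesis using Suc.IH Suc.prems(3) by simp
  next
    case False
    then show ?thesis using top_coefficient[OF R Suc.prems(1)] Suc.prems(3)[of N] by simp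
  qed
qed simp

lemma sum_mem_W_iff:
  assumes "\<And>i. i < N \<Longrightarrow> kap i \<noteq> 0"
  shows "(\<Sum>i<N. sc (x i) (f i)) \<in> W \<longleftrightarrow> (\<forall>i<N. x i = 0)"
proof
  assume "(\<Sum>i<N. sc (x i) (f i)) \<in> W"
  then show "\<forall>i<N. x i = 0" using top_sum[OF W subset_refl] assms v(2) by blast
next
  assume "\<forall>i<N. x i = 0"
  then have "(\<Sum>i<N. sc (x i) (f i)) = 0" by (intro sum.neutral) (auto simp: sc_zero_left f_mem)
  then show "(\<Sum>i<N. sc (x i) (f i)) \<in> W" using subm_zero[OF S] by simp
qed

text \<open>A factor vanishes only if \<mu> is a natural number below k. This never happens for
  \<mu> = - l - 1, and for \<mu> = l - 1 only once k reaches l.\<close>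

lemma kap_nonzero:
  assumes "\<mu> = - of_nat l - 1 \<or> \<mu> = of_nat l - 1 \<and> k < l"
  shows "kap k \<noteq> 0"
proof -
  have "of_nat (Suc j) * (\<mu> - of_nat j) \<noteq> 0" if "j < k" for j
  proof -
    have "\<mu> \<noteq> of_nat j"
    proof (cases "\<mu> = - of_nat l - 1")
      case True
      then show ?thesis by (auto simp: complex_eq_iff)
    next
      case False
      then have l: "\<mu> + 1 = of_nat l" "Suc j < l" using assms that by auto
      show ?thesis
      proof
        assume "\<mu> = of_nat j"
        then have "(of_nat (Suc j) :: complex) = of_nat l" using l(1) by (simp add: add.commute)
        then show False using l(2) by (simp only: of_nat_eq_iff)
      qed
    qed
    then show ?thesis by (simp del: of_nat_Suc)
  qed
  then show ?thesis unfolding kap_def by (simp only: prod_zero_iff finite_lessThan) auto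
qed

lemma W1_least:
  assumes "inv_sub R" "W \<subseteq> R" "v \<in> R"
  shows "W1 \<subseteq> R"
proof -
  have "f i \<in> R" for i using inv_sub_funpow[OF assms(1,3)] by (simp add: f_def)
  then show ?thesis unfolding W1_def
    by (intro sumset_least spn_least inv_sub_subm assms) auto
qed

text \<open>Modulo W, a vector of R outside W is a nonzero combination of the F^i v; a power of E
  returns v from it, and v generates W1 over W.\<close>

lemma simple_quotient:
  assumes mu: "\<mu> = - of_nat l - 1 \<or> \<mu> = of_nat l - 1 \<and> f l \<in> W"
    and R: "inv_sub R" "W \<subseteq> R" "R \<subseteq> W1"
  shows "R = W \<or> R = W1"
proof (cases "R = W")
  case False
  then obtain x where x: "x \<in> R" "x \<notin> W" using R by blast
  have "\<exists>w N y. w \<in> W \<and> x = w + (\<Sum>i<N. sc (y i) (f i)) \<and> (\<forall>i<N. kap i \<noteq> 0)"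
  proof (cases "\<mu> = - of_nat l - 1")
    case True
    obtain w N y where "w \<in> W" "x = w + (\<Sum>i<N. sc (y i) (f i))" using W1_cases x R by blast
    then show ?thesis using kap_nonzero True by (intro exI conjI) auto
  next
    case False
    then obtain w y where "w \<in> W" "x = w + (\<Sum>i<l. sc (y i) (f i))"
      using W1_bounded[of x] x R mu by (elim disjE) auto
    then show ?thesis using kap_nonzero False mu by (intro exI conjI) auto
  qed
  then obtain w N y where w: "w \<in> W" "x = w + (\<Sum>i<N. sc (y i) (f i))" "\<forall>i<N. kap i \<noteq> 0" by (elim exE conjE)
  have SR: "subm R" using R by (intro inv_sub_subm)
  have e: "(\<Sum>i<N. sc (y i) (f i)) = x - w" using w by simp
  have "w \<in> R" using w R by blast
  then have 1: "(\<Sum>i<N. sc (y i) (f i)) \<in> R" unfolding e by (rule subm_diff[OF SR x(1)])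
  have "(\<Sum>i<N. sc (y i) (f i)) \<notin> W" using x w subm_add[OF S w(1)] by auto
  then have "\<exists>i<N. y i \<noteq> 0" using sum_mem_W_iff[of N y] w(3) by blast
  then have "v \<in> R" using top_sum[OF R(1,2) 1] w(3) by blast
  then show ?thesis using W1_least[OF R(1,2)] R(3) by blast
qed simp

end

subsection \<open>Standard and rotated generators\<close>

lemma twisted_frame_std: "twisted_frame 1 0 0 1"
  by unfold_locales simp

lemma std_ops: "twisted_frame.Eg 1 0 n = Phi (int n + 1) bE" "twisted_frame.Fg 0 1 n = Phi (int n + 1) bF"
  "twisted_frame.Hg 1 0 0 1 n = Phi (int n + 1) bH"
  using twisted_frame.Eg_Phi[OF twisted_frame_std, of n] twisted_frame.Fg_Phi[OF twisted_frame_std, of n]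
    twisted_frame.Hg_Phi[OF twisted_frame_std, of n]
  by (simp_all add: fun_eq_iff const_fun_simps)

context twisted_frame
begin

text \<open>The coefficients are those of conjugation by the inverse of g. Substituting the
  expansions of \<open>Eg\<close>, \<open>Fg\<close>, \<open>Hg\<close> leaves the square of the
  determinant on the diagonal and 0 elsewhere.\<close>

lemma Phi_rotated:
  "Phi (int n + 1) bE f = const_fun (d ^ 2) * Eg f + (const_fun (- (c ^ 2)) * Fg f + const_fun (d * c) * Hg f)" (is ?E)
  "Phi (int n + 1) bF f = const_fun (- (b ^ 2)) * Eg f + (const_fun (a ^ 2) * Fg f + const_fun (- (a * b)) * Hg f)" (is ?F)
  "Phi (int n + 1) bH f = const_fun (2 * b * d) * Eg f + (const_fun (- (2 * a * c)) * Fg f + const_fun (a * d + b * c) * Hg f)" (is ?H)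
proof -
  have comb: "const_fun x * Eg f + (const_fun y * Fg f + const_fun z * Hg f) =
    const_fun (x * a ^ 2 - y * b ^ 2 - 2 * z * a * b) * Phi (int n + 1) bE f +
    const_fun (- x * c ^ 2 + y * d ^ 2 + 2 * z * c * d) * Phi (int n + 1) bF f +
    const_fun (- x * a * c + y * b * d + z * (a * d + b * c)) * Phi (int n + 1) bH f" for x y z
    unfolding Eg_Phi Fg_Phi Hg_Phi
    by (simp add: const_fun_simps algebra_simps del: Phi.simps)
  have D: "(a * d - b * c) ^ 2 = 1" using det by simp
  show ?E
  proof -
    have 1: "d ^ 2 * a ^ 2 - (- (c ^ 2)) * b ^ 2 - 2 * (d * c) * a * b = (a * d - b * c) ^ 2"
      and 2: "- (d ^ 2) * c ^ 2 + (- (c ^ 2)) * d ^ 2 + 2 * (d * c) * c * d = 0"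
      and 3: "- (d ^ 2) * a * c + (- (c ^ 2)) * b * d + (d * c) * (a * d + b * c) = 0"
      by (simp_all add: algebra_simps power2_eq_square)
    show ?thesis unfolding comb 1 2 3 D by (simp add: const_fun_simps del: Phi.simps)
  qed
  show ?F
  proof -
    have 1: "- (b ^ 2) * a ^ 2 - a ^ 2 * b ^ 2 - 2 * (- (a * b)) * a * b = 0"
      and 2: "- (- (b ^ 2)) * c ^ 2 + a ^ 2 * d ^ 2 + 2 * (- (a * b)) * c * d = (a * d - b * c) ^ 2"
      and 3: "- (- (b ^ 2)) * a * c + a ^ 2 * b * d + (- (a * b)) * (a * d + b * c) = 0"
      by (simp_all add: algebra_simps power2_eq_square)
    show ?thesis unfolding comb 1 2 3 D by (simp add: const_fun_simps del: Phi.simps)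
  qed
  show ?H
  proof -
    have 1: "2 * b * d * a ^ 2 - (- (2 * a * c)) * b ^ 2 - 2 * (a * d + b * c) * a * b = 0"
      and 2: "- (2 * b * d) * c ^ 2 + (- (2 * a * c)) * d ^ 2 + 2 * (a * d + b * c) * c * d = 0"
      and 3: "- (2 * b * d) * a * c + (- (2 * a * c)) * b * d + (a * d + b * c) * (a * d + b * c) = (a * d - b * c) ^ 2"
      by (simp_all add: algebra_simps power2_eq_square)
    show ?thesis unfolding comb 1 2 3 D by (simp add: const_fun_simps del: Phi.simps)
  qed
qed

end

context framed_module
begin

abbreviation "gen t \<equiv> act M UNIV (Phi (int n + 1) t)"
abbreviation "V0 \<equiv> sec M UNIV"
abbreviation "sc0 \<equiv> csc UNIV"

lemma UNIV_open: "zariski_open UNIV"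
  by (rule zariski_open_simps)

lemma act_combination:
  assumes "P \<in> diff_ops (int n) UNIV" "Q \<in> diff_ops (int n) UNIV" "R \<in> diff_ops (int n) UNIV" "s \<in> V0"
    and "\<And>f. X f = const_fun x * P f + (const_fun y * Q f + const_fun z * R f)"
  shows "act M UNIV X s = sc0 x (act M UNIV P s) + (sc0 y (act M UNIV Q s) + sc0 z (act M UNIV R s))"
proof -
  note c = const_comp_diff_ops[OF assms(1), of x] const_comp_diff_ops[OF assms(2), of y] const_comp_diff_ops[OF assms(3), of z]
  have X: "X = (\<lambda>f. const_fun x * P f + (const_fun y * Q f + const_fun z * R f))" using assms(5) by (simp add: fun_eq_iff)
  show ?thesis
    unfolding X act_add_left[OF UNIV_open c(1) diff_ops_add[OF c(2,3)] assms(4)] act_add_left[OF UNIV_open c(2,3) assms(4)]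
    using act_const_comp[OF UNIV_open] assms by simp
qed

lemma act_rotated:
  assumes "s \<in> V0"
  shows "act M UNIV Eg s = sc0 (a ^ 2) (gen bE s) + (sc0 (- (c ^ 2)) (gen bF s) + sc0 (- (a * c)) (gen bH s))"
    and "act M UNIV Fg s = sc0 (- (b ^ 2)) (gen bE s) + (sc0 (d ^ 2) (gen bF s) + sc0 (b * d) (gen bH s))"
    and "act M UNIV Hg s = sc0 (- (2 * a * b)) (gen bE s) + (sc0 (2 * c * d) (gen bF s) + sc0 (a * d + b * c) (gen bH s))"
  by (intro act_combination Phi_diff_ops assms Eg_Phi Fg_Phi Hg_Phi)+

lemma gen_rotated:
  assumes "s \<in> V0"
  shows "gen bE s = sc0 (d ^ 2) (act M UNIV Eg s) + (sc0 (- (c ^ 2)) (act M UNIV Fg s) + sc0 (d * c) (act M UNIV Hg s))"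
    and "gen bF s = sc0 (- (b ^ 2)) (act M UNIV Eg s) + (sc0 (a ^ 2) (act M UNIV Fg s) + sc0 (- (a * b)) (act M UNIV Hg s))"
    and "gen bH s = sc0 (2 * b * d) (act M UNIV Eg s) + (sc0 (- (2 * a * c)) (act M UNIV Fg s) + sc0 (a * d + b * c) (act M UNIV Hg s))"
  by (intro act_combination Eg_diff_ops Fg_diff_ops Hg_diff_ops assms Phi_rotated)+

lemma gen_relations:
  assumes s: "s \<in> V0"
  shows "gen bE (gen bF s) = gen bF (gen bE s) + gen bH s"
    "gen bH (gen bE s) = gen bE (gen bH s) + sc0 2 (gen bE s)"
    "gen bH (gen bF s) = gen bF (gen bH s) + sc0 (- 2) (gen bF s)"
proof -
  \<comment> \<open>The standard basis is the rotated basis for the identity matrix, so its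
    relations are instances of those proved in a frame.\<close>
  interpret std: framed_module 1 0 0 1 n M by unfold_locales (use qc_T in auto)
  show "gen bE (gen bF s) = gen bF (gen bE s) + gen bH s"
    "gen bH (gen bE s) = gen bE (gen bH s) + sc0 2 (gen bE s)"
    "gen bH (gen bF s) = gen bF (gen bH s) + sc0 (- 2) (gen bF s)"
    using std.sl2_relations(1-3)[OF UNIV_open s] unfolding std_ops .
qed

lemma gen_lin: "cmodule.lin_op V0 sc0 (gen t)"
  by (intro lin_op_act UNIV_open Phi_diff_ops)

section \<open>The action of the enveloping algebra on global sections\<close>

primrec ev :: "uterm \<Rightarrow> 'm \<Rightarrow> 'm" where
  "ev (UGen t) s = gen t s"
| "ev (UConst x) s = sc0 x s"
| "ev (UAdd u w) s = ev u s + ev w s"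
| "ev (UMul u w) s = ev u (ev w s)"

lemma ev_lin: "cmodule.lin_op V0 sc0 (ev u)"
proof -
  interpret V: cvector_space V0 sc0 using UNIV_open by (rule cvector_space_sec)
  show ?thesis
  proof (induction u)
    case (UGen t)
    have "ev (UGen t) = gen t" by (simp add: fun_eq_iff)
    then show ?case using gen_lin by simp
  next
    case (UConst x)
    then show ?case by (simp add: V.lin_op_def V.sc_mem V.sc_add_right V.sc_commute[of _ x])
  next
    case (UAdd u w)
    then show ?case by (simp add: V.lin_op_def V.add_mem V.sc_add_right)
  next
    case (UMul u w)
    then show ?case by (simp add: V.lin_op_def)
  qed
qed

lemma ev_ueq: "ueq u w \<Longrightarrow> s \<in> V0 \<Longrightarrow> ev u s = ev w s"
proof -
  interpret V: cvector_space V0 sc0 using UNIV_open by (rule cvector_space_sec)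
  note mem = V.lin_op_mem[OF ev_lin] and sc = V.lin_op_sc[OF ev_lin] and add = V.lin_op_add[OF ev_lin]
  show "ueq u w \<Longrightarrow> s \<in> V0 \<Longrightarrow> ev u s = ev w s"
  proof (induction arbitrary: s rule: ueq.induct)
    case (ueq_mul u u' w w')
    then show ?case using mem by simp
  next
    case (add_uminus u)
    then show ?case using mem[OF add_uminus] by (simp add: V.sc_minus_left V.sc_one V.sc_zero_left)
  qed (simp_all add: gen_relations mem sc add V.sc_zero_left V.sc_one V.sc_add_left V.sc_mult add_ac[where 'a = 'm] del: Phi.simps)
qed

definition uact :: "usl2 \<Rightarrow> 'm \<Rightarrow> 'm" where
  "uact u s = ev (rep_usl2 u) s"

lemma uact_abs: "s \<in> V0 \<Longrightarrow> uact (abs_usl2 t) s = ev t s"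
proof -
  have "ueq (rep_usl2 (abs_usl2 t)) t"
    using Quotient3_rep_abs[OF Quotient3_usl2] ueq_refl by blast
  then show "s \<in> V0 \<Longrightarrow> uact (abs_usl2 t) s = ev t s" unfolding uact_def by (rule ev_ueq)
qed

lemma uact_simps:
  assumes s: "s \<in> V0"
  shows "uact (u + w) s = uact u s + uact w s" "uact (u * w) s = uact u (uact w s)"
    "uact (uconst x) s = sc0 x s" "uact (ugen t) s = gen t s" "uact 1 s = s" "uact u s \<in> V0"
proof -
  interpret V: cvector_space V0 sc0 using UNIV_open by (rule cvector_space_sec)
  note mem = V.lin_op_mem[OF ev_lin]
  obtain u' w' where uw: "u = abs_usl2 u'" "w = abs_usl2 w'" by (metis Quotient3_abs_rep Quotient3_usl2)
  show "uact (u + w) s = uact u s + uact w s" unfolding uw plus_usl2.abs_eq by (simp add: uact_abs s)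
  show "uact (u * w) s = uact u (uact w s)" unfolding uw times_usl2.abs_eq by (simp add: uact_abs s mem)
  show "uact (uconst x) s = sc0 x s" unfolding uconst.abs_eq by (simp add: uact_abs s)
  show "uact (ugen t) s = gen t s" unfolding ugen.abs_eq by (simp add: uact_abs s)
  show "uact 1 s = s" unfolding one_usl2.abs_eq using s by (simp add: uact_abs V.sc_one)
  show "uact u s \<in> V0" unfolding uact_def using s by (rule mem)
qed

lemma uact_minus: "s \<in> V0 \<Longrightarrow> uact (u - w) s = uact u s - uact w s"
  using uact_simps(1)[of s "u - w" w] by simp

text \<open>The conjugates of E, F, H by g inside the enveloping algebra, with the coefficients of
  \<open>Eg_Phi\<close>, \<open>Fg_Phi\<close> and \<open>Hg_Phi\<close>.\<close>

definition "eU = ulin (a ^ 2) (- (c ^ 2)) (- (a * c))"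
definition "fU = ulin (- (b ^ 2)) (d ^ 2) (b * d)"
definition "hU = ulin (- (2 * a * b)) (2 * c * d) (a * d + b * c)"

lemma uact_ulin: "s \<in> V0 \<Longrightarrow> uact (ulin x y z) s = sc0 x (gen bE s) + (sc0 y (gen bF s) + sc0 z (gen bH s))"
proof -
  assume s: "s \<in> V0"
  have g: "gen t s \<in> V0" for t using s UNIV_open Phi_diff_ops by (intro act_sec)
  show ?thesis by (simp add: ulin_def uact_simps s g add.assoc del: Phi.simps)
qed

lemma uact_efh: "s \<in> V0 \<Longrightarrow> uact eU s = act M UNIV Eg s" "s \<in> V0 \<Longrightarrow> uact fU s = act M UNIV Fg s"
  "s \<in> V0 \<Longrightarrow> uact hU s = act M UNIV Hg s"
  by (simp_all add: eU_def fU_def hU_def uact_ulin act_rotated)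

lemma eU_fU: "eU * fU = fU * eU + hU" and hU_fU: "hU * fU = fU * hU - uconst 2 * fU"
proof -
  have 1: "2 * (- (a * c) * - (b ^ 2) - a ^ 2 * (b * d)) = - (2 * a * b) * (a * d - b * c)"
    "2 * (- (c ^ 2) * (b * d) - - (a * c) * d ^ 2) = 2 * c * d * (a * d - b * c)"
    "a ^ 2 * d ^ 2 - - (c ^ 2) * - (b ^ 2) = (a * d + b * c) * (a * d - b * c)"
    by (simp_all add: algebra_simps power2_eq_square)
  show "eU * fU = fU * eU + hU"
    unfolding eU_def fU_def hU_def ulin_commutator[of "a ^ 2"] 1 det by simp
  have 2: "2 * ((a * d + b * c) * - (b ^ 2) - - (2 * a * b) * (b * d)) = - 2 * - (b ^ 2) * (a * d - b * c)"
    "2 * (2 * c * d * (b * d) - (a * d + b * c) * d ^ 2) = - 2 * d ^ 2 * (a * d - b * c)"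
    "- (2 * a * b) * d ^ 2 - 2 * c * d * - (b ^ 2) = - 2 * (b * d) * (a * d - b * c)"
    by (simp_all add: algebra_simps power2_eq_square)
  have 3: "ulin (- 2 * x * 1) (- 2 * y * 1) (- 2 * z * 1) = - (uconst 2 * ulin x y z)" for x y z
    by (simp add: ulin_def uconst_simps uconst_minus ring_distribs mult.assoc)
  show "hU * fU = fU * hU - uconst 2 * fU"
    unfolding fU_def hU_def ulin_commutator[of "- (2 * a * b)"] 2 det 3 by simp
qed

lemma ugen_efh:
  "ugen bE = uconst (d ^ 2) * eU + uconst (- (c ^ 2)) * fU + uconst (d * c) * hU"
  "ugen bF = uconst (- (b ^ 2)) * eU + uconst (a ^ 2) * fU + uconst (- (a * b)) * hU"
  "ugen bH = uconst (2 * b * d) * eU + uconst (- (2 * a * c)) * fU + uconst (a * d + b * c) * hU"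
proof -
  have comb: "uconst x * ulin p q r + uconst y * ulin p' q' r' + uconst z * ulin p'' q'' r'' =
    ulin (x * p + y * p' + z * p'') (x * q + y * q' + z * q'') (x * r + y * r' + z * r'')" for x y z p q r p' q' r' p'' q'' r''
    by (simp add: ulin_def uconst_simps ring_distribs mult.assoc add_ac)
  have u: "ulin 1 0 0 = ugen bE" "ulin 0 1 0 = ugen bF" "ulin 0 0 1 = ugen bH"
    by (simp_all add: ulin_def uconst_simps)
  have D: "(a * d - b * c) ^ 2 = 1" using det by simp
  have E: "d ^ 2 * a ^ 2 + - (c ^ 2) * - (b ^ 2) + d * c * - (2 * a * b) = (a * d - b * c) ^ 2"
    "d ^ 2 * - (c ^ 2) + - (c ^ 2) * d ^ 2 + d * c * (2 * c * d) = 0"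
    "d ^ 2 * - (a * c) + - (c ^ 2) * (b * d) + d * c * (a * d + b * c) = 0"
    by (simp_all add: algebra_simps power2_eq_square)
  show "ugen bE = uconst (d ^ 2) * eU + uconst (- (c ^ 2)) * fU + uconst (d * c) * hU"
    unfolding eU_def fU_def hU_def comb E D u ..
  have F: "- (b ^ 2) * a ^ 2 + a ^ 2 * - (b ^ 2) + - (a * b) * - (2 * a * b) = 0"
    "- (b ^ 2) * - (c ^ 2) + a ^ 2 * d ^ 2 + - (a * b) * (2 * c * d) = (a * d - b * c) ^ 2"
    "- (b ^ 2) * - (a * c) + a ^ 2 * (b * d) + - (a * b) * (a * d + b * c) = 0"
    by (simp_all add: algebra_simps power2_eq_square)
  show "ugen bF = uconst (- (b ^ 2)) * eU + uconst (a ^ 2) * fU + uconst (- (a * b)) * hU"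
    unfolding eU_def fU_def hU_def comb F D u ..
  have H: "2 * b * d * a ^ 2 + - (2 * a * c) * - (b ^ 2) + (a * d + b * c) * - (2 * a * b) = 0"
    "2 * b * d * - (c ^ 2) + - (2 * a * c) * d ^ 2 + (a * d + b * c) * (2 * c * d) = 0"
    "2 * b * d * - (a * c) + - (2 * a * c) * (b * d) + (a * d + b * c) * (a * d + b * c) = (a * d - b * c) ^ 2"
    by (simp_all add: algebra_simps power2_eq_square)
  show "ugen bH = uconst (2 * b * d) * eU + uconst (- (2 * a * c)) * fU + uconst (a * d + b * c) * hU"
    unfolding eU_def fU_def hU_def comb H D u ..
qed

definition hw_ideal :: "complex \<Rightarrow> usl2 set" where
  "hw_ideal \<mu> = {x * eU + y * (hU - uconst \<mu>) |x y. True}"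

lemma hw_ideal_add: "i \<in> hw_ideal \<mu> \<Longrightarrow> j \<in> hw_ideal \<mu> \<Longrightarrow> i + j \<in> hw_ideal \<mu>"
proof -
  assume "i \<in> hw_ideal \<mu>" "j \<in> hw_ideal \<mu>"
  then obtain x y x' y' where ij: "i = x * eU + y * (hU - uconst \<mu>)" "j = x' * eU + y' * (hU - uconst \<mu>)"
    unfolding hw_ideal_def by blast
  have "i + j = (x + x') * eU + (y + y') * (hU - uconst \<mu>)"
    unfolding ij ring_distribs(2)[of x] ring_distribs(2)[of y] by (simp only: add_ac)
  then show ?thesis unfolding hw_ideal_def by blast
qed

lemma hw_ideal_mult: "i \<in> hw_ideal \<mu> \<Longrightarrow> u * i \<in> hw_ideal \<mu>"
proof -
  assume "i \<in> hw_ideal \<mu>"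
  then obtain x y where i: "i = x * eU + y * (hU - uconst \<mu>)" unfolding hw_ideal_def by blast
  have "u * i = (u * x) * eU + (u * y) * (hU - uconst \<mu>)" unfolding i by (simp add: ring_distribs mult.assoc)
  then show ?thesis unfolding hw_ideal_def by blast
qed

lemma hw_ideal_gens: "eU \<in> hw_ideal \<mu>" "hU - uconst \<mu> \<in> hw_ideal \<mu>"
proof -
  have "eU = 1 * eU + 0 * (hU - uconst \<mu>)" "hU - uconst \<mu> = 0 * eU + 1 * (hU - uconst \<mu>)" by simp_all
  then show "eU \<in> hw_ideal \<mu>" "hU - uconst \<mu> \<in> hw_ideal \<mu>" unfolding hw_ideal_def by blast+
qed

lemma hw_ideal_zero: "0 \<in> hw_ideal \<mu>"
  using hw_ideal_mult[OF hw_ideal_gens(1), of 0] by simp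

lemma hw_ideal_minus: "i \<in> hw_ideal \<mu> \<Longrightarrow> - i \<in> hw_ideal \<mu>"
  using hw_ideal_mult[of i \<mu> "- 1"] by simp

text \<open>The spanning half of the Poincare-Birkhoff-Witt theorem.\<close>

lemma hw_ideal_spanning: "\<exists>N x i. i \<in> hw_ideal \<mu> \<and> u = i + (\<Sum>k<N. uconst (x k) * fU ^ k)"
proof -
  interpret U: cvector_space "UNIV :: usl2 set" "\<lambda>x u. uconst x * u"
    by unfold_locales (simp_all add: ring_distribs uconst_simps mult.assoc)
  have lm: "U.lin_op (\<lambda>u. w * u)" for w
    by (simp add: U.lin_op_def ring_distribs uconst_central_left)
  have I: "U.subm (hw_ideal \<mu>)"
    by (simp add: U.subm_def hw_ideal_zero hw_ideal_add hw_ideal_mult)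
  define P where "P = U.spn (range (\<lambda>k. fU ^ k))"
  have P: "U.subm P" unfolding P_def by (intro U.subm_spn) simp
  \<comment> \<open>The left ideal plus the span of the powers of \<open>fU\<close>. It contains 1,
    so it suffices that it is stable under left multiplication by the generators.\<close>
  define S where "S = U.sumset (hw_ideal \<mu>) P"
  have S: "U.subm S" unfolding S_def by (intro U.subm_sumset I P)
  have sub: "hw_ideal \<mu> \<subseteq> S" "P \<subseteq> S" using U.sumset_superset[OF I P] by (simp_all add: S_def)
  have pw: "fU ^ k \<in> S" for k using sub(2) U.spn_base[of "fU ^ k" "range (\<lambda>k. fU ^ k)"] by (auto simp: P_def)
  \<comment> \<open>The ideal part is stable under every left factor, so only the products with
    powers of \<open>fU\<close> need checking.\<close>
  have left: "w * s \<in> S" if w: "\<And>k. w * fU ^ k \<in> S" and s: "s \<in> S" for w s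
  proof -
    obtain i p where ip: "i \<in> hw_ideal \<mu>" "p \<in> P" "s = i + p" using s by (auto simp: S_def U.sumset_def)
    have "w * p \<in> S" by (rule U.lin_op_spn[OF lm _ S _ ip(2)[unfolded P_def]]) (use w in auto)
    moreover have "w * i \<in> S" using hw_ideal_mult[OF ip(1)] sub by blast
    ultimately show ?thesis unfolding ip(3) ring_distribs by (intro U.subm_add[OF S])
  qed
  have f: "fU * s \<in> S" if "s \<in> S" for s
    by (rule left[OF _ that]) (use pw[of "Suc _"] in simp)
  have hp: "hU * fU ^ k = fU ^ k * hU - uconst (2 * of_nat k) * fU ^ k" for k
  proof (induction k)
    case 0
    then show ?case by (simp add: uconst_simps)
  next
    case (Suc k)
    have "hU * fU ^ Suc k = (fU * hU - uconst 2 * fU) * fU ^ k" by (simp add: hU_fU flip: mult.assoc)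
    also have "\<dots> = fU * (hU * fU ^ k) - uconst 2 * fU ^ Suc k" by (simp add: ring_distribs mult.assoc)
    also have "\<dots> = fU ^ Suc k * hU - (uconst (2 * of_nat k) * fU ^ Suc k + uconst 2 * fU ^ Suc k)"
      unfolding Suc right_diff_distrib uconst_central_left by (simp add: mult.assoc)
    also have "uconst (2 * of_nat k) * fU ^ Suc k + uconst 2 * fU ^ Suc k = uconst (2 * of_nat (Suc k)) * fU ^ Suc k"
      by (simp only: ring_distribs(2)[symmetric] uconst_simps(3)[symmetric]) (simp add: algebra_simps)
    finally show ?case .
  qed
  have hk: "hU * fU ^ k \<in> S" for k
  proof -
    have "hU * fU ^ k = fU ^ k * (hU - uconst \<mu>) + (uconst \<mu> * fU ^ k - uconst (2 * of_nat k) * fU ^ k)"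
      unfolding hp by (simp add: right_diff_distrib uconst_central)
    then show ?thesis using hw_ideal_mult[OF hw_ideal_gens(2)] sub pw
      by (auto intro!: U.subm_add[OF S] U.subm_diff[OF S] U.subm_sc[OF S])
  qed
  have ek: "eU * fU ^ k \<in> S" for k
  proof (induction k)
    case 0
    then show ?case using hw_ideal_gens(1) sub by auto
  next
    case (Suc k)
    have "eU * fU ^ Suc k = fU * (eU * fU ^ k) + hU * fU ^ k"
      by (simp add: eU_fU ring_distribs flip: mult.assoc)
    then show ?case using U.subm_add[OF S f[OF Suc] hk] by simp
  qed
  have gens: "ugen t * s \<in> S" if s: "s \<in> S" for t s
  proof -
    note e = left[OF ek s] and h = left[OF hk s]
    have comb: "(uconst x * eU + uconst y * fU + uconst z * hU) * s \<in> S" for x y z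
    proof -
      have "(uconst x * eU + uconst y * fU + uconst z * hU) * s =
        uconst x * (eU * s) + uconst y * (fU * s) + uconst z * (hU * s)" by (simp add: ring_distribs mult.assoc)
      then show ?thesis using e f[OF s] h by (simp add: U.subm_add[OF S] U.subm_sc[OF S])
    qed
    show ?thesis by (cases t) (simp_all only: ugen_efh comb)
  qed
  have all: "abs_usl2 t * s \<in> S" if "s \<in> S" for t s
    using that
  proof (induction t arbitrary: s)
    case (UGen t)
    then show ?case using gens by (simp flip: ugen.abs_eq)
  next
    case (UConst x)
    then show ?case using U.subm_sc[OF S] by (simp flip: uconst.abs_eq)
  next
    case (UAdd t t')
    then show ?case by (simp flip: plus_usl2.abs_eq add: ring_distribs U.subm_add[OF S])
  next
    case (UMul t t')
    then show ?case by (simp flip: times_usl2.abs_eq add: mult.assoc)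
  qed
  have "abs_usl2 (rep_usl2 u) * fU ^ 0 \<in> S" by (rule all[OF pw])
  then have "u \<in> S" by (simp add: Quotient3_abs_rep[OF Quotient3_usl2])
  then obtain i p where ip: "i \<in> hw_ideal \<mu>" "p \<in> P" "u = i + p" by (auto simp: S_def U.sumset_def)
  obtain N x where "p = (\<Sum>k<N. uconst (x k) * fU ^ k)"
    using U.spn_range_nat[OF _ ip(2)[unfolded P_def]] by auto
  then show ?thesis using ip by (intro exI conjI) auto
qed

end

context sl2_module
begin

lemma is_step_inv: "is_step W v \<mu> W' \<Longrightarrow> inv_sub W \<and> inv_sub W' \<and> W \<subseteq> W'"
proof -
  assume *: "is_step W v \<mu> W'"
  then interpret st: sl2_step C sc E F H l W v \<mu> by (simp add: is_step_def)
  have "W' = st.W1" using * by (simp add: is_step_def st.W1_def st.f_def)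
  then show ?thesis using st.W st.inv_sub_W1 st.W_W1 by simp
qed

text \<open>Numbering starts at the top, with the whole module as V 1; each new step is appended at
  the lower end, at index k + 2.\<close>

lemma filtered_chain:
  "filtered W \<Longrightarrow> \<exists>(k::nat) V. V 1 = C \<and> V (k + 1) = W \<and> (\<forall>i\<in>{1..k}. \<exists>v \<mu>. is_step (V (i + 1)) v \<mu> (V i))"
proof (induction rule: filtered.induct)
  case filtered_C
  show ?case by (intro exI[of _ 0] exI[of _ "\<lambda>_. C"]) auto
next
  case (filtered_step W v \<mu> W')
  then obtain k :: nat and V where V: "V 1 = C" "V (k + 1) = W'" "\<forall>i\<in>{1..k}. \<exists>v \<mu>. is_step (V (i + 1)) v \<mu> (V i)"
    by (elim exE conjE)
  let ?V = "V(k + 2 := W)"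
  have "\<exists>v \<mu>. is_step (?V (i + 1)) v \<mu> (?V i)" if "i \<in> {1..k + 1}" for i
  proof (cases "i = k + 1")
    case True
    then show ?thesis using filtered_step.hyps(1) V(2) by (intro exI) auto
  next
    case False
    then show ?thesis using that V(3) by simp
  qed
  then show ?case using V(1) by (intro exI[of _ "k + 1"] exI[of _ ?V]) simp
qed

end

context sl2_step
begin

text \<open>The vector \<open>exp(- (c / d) F) v\<close>, rescaled by \<open>d\<^sup>n\<close> so as to make sense also for \<open>d = 0\<close>.\<close>

lemma highest_weight_vector:
  assumes l: "l = Suc n" and mu: "\<mu> = of_nat n" and fl: "f l \<in> W" and det: "a * d - b * c = (1::complex)"
  shows "\<exists>u\<in>W1. u \<notin> W \<and> sc (d ^ 2) (E u) + (sc (- (c ^ 2)) (F u) + sc (d * c) (H u)) \<in> W \<and>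
    sc (2 * b * d) (E u) + (sc (- (2 * a * c)) (F u) + sc (a * d + b * c) (H u)) - sc (of_nat n) u \<in> W"
proof -
  define \<alpha> where "\<alpha> = (\<lambda>k. d ^ (n - k) * (- c) ^ k / fact k)"
  define u where "u = (\<Sum>k<l. sc (\<alpha> k) (f k))"
  \<comment> \<open>The Euler operator F d/dF applied to u, which weights F^k v by k. Modulo W the
    vectors d E u, c F u and H u are combinations of u and K: they equal c (K - n u), - d K and n u
    - 2 K.\<close>
  define K where "K = (\<Sum>k<l. sc (of_nat k * \<alpha> k) (f k))"
  have rec: "d * \<alpha> (Suc j) * of_nat (Suc j) = - c * \<alpha> j" if "j < n" for j
  proof -
    have "n - j = Suc (n - Suc j)" using that by simp
    then have "- c * \<alpha> j = d * d ^ (n - Suc j) * (- c) ^ Suc j / fact j" by (simp add: \<alpha>_def mult_ac)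
    moreover have "\<alpha> (Suc j) * of_nat (Suc j) = d ^ (n - Suc j) * (- c) ^ Suc j / fact j"
      by (simp add: \<alpha>_def fact_Suc del: of_nat_Suc)
    ultimately show ?thesis by (simp only: mult.assoc times_divide_eq_right)
  qed
  have sums: "(\<Sum>k<N. sc (x k) (f k)) \<in> C" for N x using f_mem by (intro sum_mem sc_mem)
  have uC: "u \<in> C" "K \<in> C" unfolding u_def K_def by (rule sums)+
  \<comment> \<open>Combinations of E u, F u, H u, u, K recorded by their coefficients, so that the
    final identities become identities between coefficients.\<close>
  define L where "L = (\<lambda>x y z p q. sc x (E u) + sc y (F u) + sc z (H u) + sc p u + sc q K)"
  have La: "L x y z p q + L x' y' z' p' q' = L (x + x') (y + y') (z + z') (p + p') (q + q')" for x y z p q x' y' z' p' q'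
    using uC by (simp add: L_def sc_add_left op_mem add_ac)
  have Ls: "sc r (L x y z p q) = L (r * x) (r * y) (r * z) (r * p) (r * q)" for r x y z p q
    using uC by (simp add: L_def sc_add_right sc_mult op_mem sc_mem add_mem)
  have w1: "L d 0 0 (c * of_nat n) (- c) \<in> W"
  proof -
    have "sc d (E u) = (\<Sum>k<Suc n. sc (d * \<alpha> k) (E (f k)))"
      unfolding u_def l using f_mem by (simp add: lin_op_sum[OF E_lin] lin_op_add[OF E_lin] lin_op_sc[OF E_lin] sc_sum
        sc_add_right sc_mult sc_mem op_mem sum_mem del: sum.lessThan_Suc)
    also have "\<dots> = sc (d * \<alpha> 0) (E (f 0)) + (\<Sum>k<n. sc (d * \<alpha> (Suc k)) (E (f (Suc k))))"
      by (rule sum.lessThan_Suc_shift)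
    finally have 1: "sc d (E u) = \<dots>" .
    have 2: "sc (c * of_nat n) u + sc (- c) K = (\<Sum>k<n. sc (c * \<alpha> k * (of_nat n - of_nat k)) (f k))"
    proof -
      have "sc (c * of_nat n) u + sc (- c) K = (\<Sum>k<l. sc (c * of_nat n * \<alpha> k + - c * (of_nat k * \<alpha> k)) (f k))"
        unfolding u_def K_def by (simp only: sc_sum sc_mem f_mem sc_mult sum.distrib sc_add_left)
      also have "\<dots> = (\<Sum>k<l. sc (c * \<alpha> k * (of_nat n - of_nat k)) (f k))"
        by (simp add: algebra_simps)
      finally show ?thesis unfolding l by (simp add: sc_zero_left f_mem)
    qed
    have "L d 0 0 (c * of_nat n) (- c) = sc d (E u) + (sc (c * of_nat n) u + sc (- c) K)"
      using uC by (simp add: L_def sc_zero_left op_mem add.assoc)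
    also have "\<dots> = sc (d * \<alpha> 0) (E (f 0)) + (\<Sum>k<n. sc (d * \<alpha> (Suc k)) (E (f (Suc k))) + sc (c * \<alpha> k * (of_nat n - of_nat k)) (f k))"
      unfolding 1 2 sum.distrib by (simp add: add.assoc)
    also have "\<dots> \<in> W"
    proof (rule subm_add[OF S subm_sc[OF S] subm_sum[OF S]])
      show "E (f 0) \<in> W" using Ev by (simp add: f_0)
      fix k assume k: "k \<in> {..<n}"
      have "c * \<alpha> k * (of_nat n - of_nat k) = - (d * \<alpha> (Suc k) * (of_nat (Suc k) * (\<mu> - of_nat k)))"
        using rec[of k] k by (simp add: mu mult.assoc[symmetric] del: of_nat_Suc)
      then have "sc (d * \<alpha> (Suc k)) (E (f (Suc k))) + sc (c * \<alpha> k * (of_nat n - of_nat k)) (f k) =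
        sc (d * \<alpha> (Suc k)) (E (f (Suc k)) - sc (of_nat (Suc k) * (\<mu> - of_nat k)) (f k))"
        using f_mem by (simp only: sc_diff_right op_mem sc_mem sc_minus_left sc_mult) simp
      then show "sc (d * \<alpha> (Suc k)) (E (f (Suc k))) + sc (c * \<alpha> k * (of_nat n - of_nat k)) (f k) \<in> W"
        using subm_sc[OF S E_f_Suc] by simp
    qed
    finally show ?thesis .
  qed
  have w2: "L 0 (- c) 0 0 (- d) \<in> W"
  proof -
    have 1: "sc (- c) (F u) = (\<Sum>k<Suc n. sc (- c * \<alpha> k) (f (Suc k)))"
      unfolding u_def l by (simp only: lin_op_sum[OF F_lin] lin_op_sc[OF F_lin] sc_sum sc_mult sc_mem f_mem F_f)
    have "sc (- d) K = (\<Sum>k<Suc n. sc (- d * (of_nat k * \<alpha> k)) (f k))"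
      unfolding K_def l by (simp only: sc_sum sc_mem sc_mult f_mem)
    also have "\<dots> = sc (- d * (of_nat 0 * \<alpha> 0)) (f 0) + (\<Sum>k<n. sc (- d * (of_nat (Suc k) * \<alpha> (Suc k))) (f (Suc k)))"
      by (rule sum.lessThan_Suc_shift)
    also have "\<dots> = (\<Sum>k<n. sc (c * \<alpha> k) (f (Suc k)))"
    proof -
      have "- d * (of_nat (Suc k) * \<alpha> (Suc k)) = c * \<alpha> k" if "k < n" for k
        using rec[OF that] by (simp add: mult_ac del: of_nat_Suc)
      then show ?thesis by (simp add: sc_zero_left f_mem del: of_nat_Suc)
    qed
    finally have 2: "sc (- d) K = (\<Sum>k<n. sc (c * \<alpha> k) (f (Suc k)))" .
    have "L 0 (- c) 0 0 (- d) = sc (- c) (F u) + sc (- d) K"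
      using uC by (simp add: L_def sc_zero_left op_mem)
    also have "\<dots> = sc (- c * \<alpha> n) (f l)"
      unfolding 1 2 l using f_mem by (simp add: sc_minus_left sum_negf)
    finally show ?thesis using subm_sc[OF S fl] by simp
  qed
  have w3: "L 0 0 1 (- of_nat n) 2 \<in> W"
  proof -
    have 1: "H u = (\<Sum>k<l. sc (\<alpha> k) (H (f k)))"
      unfolding u_def using f_mem by (simp add: lin_op_sum[OF H_lin] lin_op_sc[OF H_lin] sc_mem)
    have "L 0 0 1 (- of_nat n) 2 = H u + (sc (- of_nat n) u + sc 2 K)"
      using uC by (simp add: L_def sc_zero_left sc_one op_mem add.assoc)
    also have "sc (- of_nat n) u + sc 2 K = (\<Sum>k<l. sc (- of_nat n * \<alpha> k + 2 * (of_nat k * \<alpha> k)) (f k))"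
      unfolding u_def K_def using f_mem by (simp only: sc_sum sc_mem sum.distrib sc_add_left sc_mult)
    also have "\<dots> = (\<Sum>k<l. - sc (\<alpha> k * (\<mu> - 2 * of_nat k)) (f k))"
      using f_mem by (simp add: mu algebra_simps flip: sc_minus_left)
    also have "H u + \<dots> = (\<Sum>k<l. sc (\<alpha> k) (H (f k) - sc (\<mu> - 2 * of_nat k) (f k)))"
      unfolding 1 using f_mem by (simp only: sc_diff_right op_mem sc_mem sc_mult sum_subtractf sum_negf) simp
    also have "\<dots> \<in> W" using H_f by (intro subm_sum[OF S] subm_sc[OF S])
    finally show ?thesis .
  qed
  \<comment> \<open>Up to nonzero factors the extreme coefficients of u are d^n and c^n; if both
    vanished, c = d = 0 would contradict the determinant.\<close>
  have "u \<notin> W"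
  proof
    assume "u \<in> W"
    then have z: "\<alpha> i = 0" if "i < l" for i
      using sum_mem_W_iff[of l \<alpha>] kap_nonzero that by (simp add: u_def mu l)
    have "d = 0" using z[of 0] by (simp add: \<alpha>_def l)
    moreover have "c = 0" using z[of n] by (simp add: \<alpha>_def l)
    ultimately show False using det by simp
  qed
  moreover have "u \<in> W1" unfolding u_def by (intro subm_sum[OF subm_W1] subm_sc[OF subm_W1] f_W1)
  moreover have "sc (d ^ 2) (E u) + (sc (- (c ^ 2)) (F u) + sc (d * c) (H u)) \<in> W"
  proof -
    have "sc (d ^ 2) (E u) + (sc (- (c ^ 2)) (F u) + sc (d * c) (H u)) = L (d ^ 2) (- (c ^ 2)) (d * c) 0 0"
      using uC by (simp add: L_def sc_zero_left op_mem add.assoc)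
    also have "\<dots> = sc d (L d 0 0 (c * of_nat n) (- c)) + (sc c (L 0 (- c) 0 0 (- d)) + sc (d * c) (L 0 0 1 (- of_nat n) 2))"
      unfolding Ls La by (simp add: power2_eq_square algebra_simps)
    finally show ?thesis using subm_add[OF S subm_sc[OF S w1] subm_add[OF S subm_sc[OF S w2] subm_sc[OF S w3]]] by simp
  qed
  moreover have "sc (2 * b * d) (E u) + (sc (- (2 * a * c)) (F u) + sc (a * d + b * c) (H u)) - sc (of_nat n) u \<in> W"
  proof -
    have "sc (2 * b * d) (E u) + (sc (- (2 * a * c)) (F u) + sc (a * d + b * c) (H u)) - sc (of_nat n) u =
      L (2 * b * d) (- (2 * a * c)) (a * d + b * c) (- ((a * d - b * c) * of_nat n)) 0"
      unfolding det using uC by (simp add: L_def sc_zero_left sc_minus_left op_mem add.assoc)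
    also have "\<dots> = sc (2 * b) (L d 0 0 (c * of_nat n) (- c)) +
        (sc (2 * a) (L 0 (- c) 0 0 (- d)) + sc (a * d + b * c) (L 0 0 1 (- of_nat n) 2))"
      unfolding Ls La by (simp add: algebra_simps)
    finally show ?thesis using subm_add[OF S subm_sc[OF S w1] subm_add[OF S subm_sc[OF S w2] subm_sc[OF S w3]]] by simp
  qed
  ultimately show ?thesis by blast
qed

end

context rh_module
begin

abbreviation "G \<equiv> global_sections (int n + 1) M"

lemma G_simps: "space G = V0" "rzero G = 0" "radd G = (+)" "rscale G r = sc0 r" "ract G t = gen t"
  by (simp_all only: global_sections_def sl2_rep.simps)

text \<open>The standard and the rotated basis are linear combinations of one another, so the same
  subspaces are stable under both.\<close>

lemma inv_sub_iff: "rep.inv_sub W \<longleftrightarrow> rep.subm W \<and> (\<forall>t. \<forall>x\<in>W. gen t x \<in> W)"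
proof (intro iffI conjI allI ballI)
  assume W: "rep.inv_sub W"
  show S: "rep.subm W" using W by (rule rep.inv_sub_subm)
  show "gen t x \<in> W" if x: "x \<in> W" for t x
  proof -
    have xV: "x \<in> V0" using rep.subm_subset[OF S x] .
    note o = rep.inv_sub_op[OF W x]
    show ?thesis by (cases t) (use o S in \<open>simp_all only: gen_rotated[OF xV] rep.subm_add rep.subm_sc\<close>)
  qed
next
  assume W: "rep.subm W \<and> (\<forall>t. \<forall>x\<in>W. gen t x \<in> W)"
  then have S: "rep.subm W" and g: "\<And>t x. x \<in> W \<Longrightarrow> gen t x \<in> W" by (auto simp del: Phi.simps)
  have "act M UNIV Eg x \<in> W \<and> act M UNIV Fg x \<in> W \<and> act M UNIV Hg x \<in> W" if x: "x \<in> W" for x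
  proof -
    have xV: "x \<in> V0" using rep.subm_subset[OF S x] .
    show ?thesis using g[OF x] S by (simp only: act_rotated[OF xV] rep.subm_add rep.subm_sc)
  qed
  then show "rep.inv_sub W" using S unfolding rep.inv_sub_def by blast
qed

lemma inv_sub_gen: "rep.inv_sub W \<Longrightarrow> x \<in> W \<Longrightarrow> gen t x \<in> W"
  using inv_sub_iff by blast

lemma subrep_inv_sub: "rep.inv_sub W \<Longrightarrow> subrep G W"
  unfolding subrep_def linear_subspace_def G_simps inv_sub_iff rep.subm_def by blast

lemma inv_sub_uact: "rep.inv_sub W \<Longrightarrow> x \<in> W \<Longrightarrow> uact u x \<in> W"
proof -
  assume W: "rep.inv_sub W"
  note S = rep.inv_sub_subm[OF W]
  have "ev t x \<in> W" if "x \<in> W" for t x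
    using that by (induction t arbitrary: x) (simp_all add: inv_sub_gen[OF W] rep.subm_add[OF S] rep.subm_sc[OF S] del: Phi.simps)
  then show "x \<in> W \<Longrightarrow> uact u x \<in> W" by (simp add: uact_def)
qed

lemma quotient_setup_sub:
  assumes W: "rep.inv_sub W" and W': "rep.inv_sub W'" and "W \<subseteq> W'"
  shows "quotient_setup (G\<lparr>space := W'\<rparr>) W"
proof -
  note S = rep.inv_sub_subm[OF W] rep.inv_sub_subm[OF W']
  show ?thesis
    by unfold_locales
      (simp_all add: G_simps assms(3) rep.subm_zero[OF S(1)] rep.subm_add[OF S(1)] rep.subm_minus[OF S(1)] rep.subm_sc[OF S(1)]
        rep.subm_add[OF S(2)] rep.subm_sc[OF S(2)] inv_sub_gen[OF W] inv_sub_gen[OF W']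
        rep.sc_add_right[OF rep.subm_subset[OF S(2)] rep.subm_subset[OF S(2)]]
        rep.lin_op_add[OF gen_lin rep.subm_subset[OF S(2)] rep.subm_subset[OF S(2)]] del: Phi.simps)
qed

text \<open>As the determinant is 1, the inverse of g is its adjugate; this matches conjugation of
  matrices with the coefficients chosen for \<open>eU\<close> and \<open>hU\<close>.\<close>

lemma verma_ideal_eq:
  assumes "g$1$1 = a" "g$1$2 = b" "g$2$1 = c" "g$2$2 = d"
  shows "verma_ideal g \<mu> = hw_ideal \<mu>"
proof -
  let ?h = "vector [vector [d, - b], vector [- c, a]] :: complex^2^2"
  have 1: "g ** ?h = mat 1" "?h ** g = mat 1"
    using det assms by (simp_all add: vec_eq_iff matrix_matrix_mult_def sum_2 forall_2 mat_def vector_2 algebra_simps)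
  have inv: "matrix_inv g = ?h"
    unfolding matrix_inv_def
  proof (rule some_equality)
    show "g ** ?h = mat 1 \<and> ?h ** g = mat 1" using 1 by simp
    fix h assume h: "g ** h = mat 1 \<and> h ** g = mat 1"
    have "h = h ** (g ** ?h)" unfolding 1 by simp
    also have "\<dots> = ?h" unfolding matrix_mul_assoc using h by simp
    finally show "h = ?h" .
  qed
  have "sl2_to_U (g ** sl2_matrix bE ** matrix_inv g) = eU" "sl2_to_U (g ** sl2_matrix bH ** matrix_inv g) = hU"
    unfolding inv sl2_to_U_def eU_def hU_def ulin_def
    by (simp_all add: assms matrix_matrix_mult_def sum_2 vector_2 power2_eq_square algebra_simps)
  then show ?thesis unfolding verma_ideal_def hw_ideal_def by simp
qed

end

subsection \<open>The composition factors\<close>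

locale rh_step = rh_module +
  fixes W v \<mu> W'
  assumes step: "rep.is_step W v \<mu> W'"
begin

sublocale st: sl2_step V0 sc0 "act M UNIV Eg" "act M UNIV Fg" "act M UNIV Hg" "n + 1" W v \<mu>
  using step unfolding rep.is_step_def by (rule conjunct1)

lemma weight: "\<mu> = - of_nat (n + 1) - 1 \<or> \<mu> = of_nat (n + 1) - 1 \<and> st.f (n + 1) \<in> W"
  and W'_eq: "W' = st.W1"
  using step unfolding rep.is_step_def st.W1_def st.f_def[abs_def] by blast+

lemmas step_subm_W1 = st.subm_W1[folded W'_eq] and step_inv_sub_W1 = st.inv_sub_W1[folded W'_eq]
  and step_W_W1 = st.W_W1[folded W'_eq] and step_v_W1 = st.v_W1[folded W'_eq] and step_f_W1 = st.f_W1[folded W'_eq]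
  and step_W1_bounded = st.W1_bounded[folded W'_eq] and step_W1_cases = st.W1_cases[folded W'_eq]
  and step_simple_quotient = st.simple_quotient[folded W'_eq]
  and step_highest_weight_vector = st.highest_weight_vector[folded W'_eq]

definition "G' = G\<lparr>space := W'\<rparr>"

lemma G': "space G' = W'" "rscale G' = sc0" "ract G' t = gen t"
  by (simp_all add: G'_def G_simps fun_eq_iff del: Phi.simps)

sublocale q: quotient_setup G' W
  unfolding G'_def by (intro quotient_setup_sub st.W step_inv_sub_W1 step_W_W1)

lemma subquotient_eq: "subquotient G W' W = q.Q"
  by (simp add: subquotient_def G'_def)

text \<open>A subrepresentation of the quotient is the image of its preimage R, which lies between W
  and W' and hence is one of the two.\<close>

lemma irreducible_Q:
  "irreducible_rep q.Q"
proof -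
  note S' = step_subm_W1
  have "X = {rzero q.Q} \<or> X = space q.Q" if X: "subrep q.Q X" for X
  proof -
    have X': "X \<subseteq> q.coset ` W'" "rzero q.Q \<in> X" "\<And>A B. A \<in> X \<Longrightarrow> B \<in> X \<Longrightarrow> radd q.Q A B \<in> X"
      "\<And>r A. A \<in> X \<Longrightarrow> rscale q.Q r A \<in> X" "\<And>t A. A \<in> X \<Longrightarrow> ract q.Q t A \<in> X"
      using X by (simp_all add: subrep_def linear_subspace_def q.Q_space G')
    define R where "R = {x \<in> W'. q.coset x \<in> X}"
    have sR: "rep.subm R"
      unfolding rep.subm_def R_def
    proof (intro conjI ballI allI CollectI)
      show "{x \<in> W'. q.coset x \<in> X} \<subseteq> V0" using rep.subm_subset[OF step_subm_W1] by auto
      show "0 \<in> W'" "q.coset 0 \<in> X" using rep.subm_zero[OF step_subm_W1] X'(2) by (simp_all add: q.Q_zero)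
      fix x assume x: "x \<in> {x \<in> W'. q.coset x \<in> X}"
      show "x + y \<in> W'" "q.coset (x + y) \<in> X" if y: "y \<in> {x \<in> W'. q.coset x \<in> X}" for y
        using x y rep.subm_add[OF step_subm_W1] X'(3)[of "q.coset x" "q.coset y"] by (simp_all add: q.Q_add)
      show "sc0 r x \<in> W'" "q.coset (sc0 r x) \<in> X" for r
        using x rep.subm_sc[OF step_subm_W1] X'(4)[of "q.coset x" r] q.Q_scale[of x r] by (simp_all add: G')
    qed
    have "gen t x \<in> R" if "x \<in> R" for t x
    proof -
      have x: "x \<in> W'" "q.coset x \<in> X" using that by (simp_all add: R_def)
      have "q.coset (gen t x) \<in> X" using X'(5)[OF x(2), of t] q.Q_act[of x t] x(1) unfolding G' by simp
      moreover have "gen t x \<in> W'" using inv_sub_gen[OF step_inv_sub_W1] x(1) .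
      ultimately show ?thesis by (simp only: R_def mem_Collect_eq)
    qed
    then have "rep.inv_sub R" using sR inv_sub_iff by blast
    moreover have "W \<subseteq> R"
    proof
      fix x assume x: "x \<in> W"
      then have "q.coset x = rzero q.Q" by (simp only: q.coset_zero_iff)
      then show "x \<in> R" using x step_W_W1 X'(2) by (auto simp: R_def)
    qed
    moreover have "R \<subseteq> W'" by (auto simp: R_def)
    ultimately have "R = W \<or> R = W'" using step_simple_quotient[OF weight] by simp
    moreover have XR: "X = q.coset ` R" using X'(1) by (auto simp: R_def)
    moreover have "q.coset ` W = {rzero q.Q}"
    proof -
      have "q.coset x = rzero q.Q" if "x \<in> W" for x using that by (simp only: q.coset_zero_iff)
      then show ?thesis using rep.subm_zero[OF st.S] by auto
    qed
    ultimately show ?thesis by (auto simp: q.Q_space G')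
  qed
  moreover have "q.coset v \<in> space q.Q" "q.coset v \<noteq> rzero q.Q"
    using step_v_W1 st.v(2) by (auto simp: q.Q_space G' q.coset_zero_iff)
  ultimately show ?thesis unfolding irreducible_rep_def by blast
qed

text \<open>The classes of the F^i v with i \<le> n span. The weight is asserted for the standard
  basis, whose E need not kill the class of v; the vector from \<open>highest_weight_vector\<close>
  takes its place.\<close>

lemma finite_Q:
  assumes "\<mu> \<noteq> - of_nat (n + 1) - 1"
  shows "finite_dimensional q.Q" and "has_highest_weight q.Q (of_nat n)"
proof -
  have mu: "\<mu> = of_nat n" and fl: "st.f (n + 1) \<in> W"
    using weight assms by auto
  let ?B = "(\<lambda>i. q.coset (st.f i)) ` {..<n + 1}"
  have "linear_subspace q.Q (space q.Q)"
    unfolding linear_subspace_def q.Q_space G'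
    using rep.subm_zero[OF step_subm_W1] rep.subm_add[OF step_subm_W1] rep.subm_sc[OF step_subm_W1] q.Q_scale
    by (auto simp: G' q.Q_zero q.Q_add)
  then have "linear_subspace q.Q hull ?B \<subseteq> space q.Q"
    using step_f_W1 by (intro hull_minimal) (auto simp: q.Q_space G')
  moreover have "space q.Q \<subseteq> X" if X: "linear_subspace q.Q X" "?B \<subseteq> X" for X
  proof
    have X': "rzero q.Q \<in> X" "\<And>A B. A \<in> X \<Longrightarrow> B \<in> X \<Longrightarrow> radd q.Q A B \<in> X" "\<And>r A. A \<in> X \<Longrightarrow> rscale q.Q r A \<in> X"
      using X by (simp_all add: linear_subspace_def)
    have sums: "q.coset (\<Sum>i<N. sc0 (y i) (st.f i)) \<in> X" if "N \<le> n + 1" for N y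
      using that
    proof (induction N)
      case 0
      then show ?case using X'(1) by (simp add: q.Q_zero)
    next
      case (Suc N)
      have "q.coset (st.f N) \<in> X" using Suc.prems X(2) by auto
      then have "q.coset (sc0 (y N) (st.f N)) \<in> X"
        using X'(3)[of "q.coset (st.f N)" "y N"] q.Q_scale[of "st.f N" "y N"] step_f_W1[of N] unfolding G' by simp
      then have "radd q.Q (q.coset (\<Sum>i<N. sc0 (y i) (st.f i))) (q.coset (sc0 (y N) (st.f N))) \<in> X"
        using Suc by (intro X'(2)) simp_all
      then show ?case by (simp only: q.Q_add sum.lessThan_Suc)
    qed
    fix A assume "A \<in> space q.Q"
    then obtain x where x: "x \<in> W'" "A = q.coset x" by (auto simp: q.Q_space G')
    obtain w y where w: "w \<in> W" "x = w + (\<Sum>i<n + 1. sc0 (y i) (st.f i))" using step_W1_bounded[OF fl x(1)] by blast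
    then have "A = q.coset (\<Sum>i<n + 1. sc0 (y i) (st.f i))" unfolding x q.coset_eq_iff by simp
    then show "A \<in> X" using sums[OF order_refl] by (simp only:)
  qed
  ultimately have "linear_subspace q.Q hull ?B = space q.Q"
    unfolding hull_def by (intro subset_antisym Inter_greatest) blast+
  moreover have "?B \<subseteq> space q.Q" using step_f_W1 by (auto simp: q.Q_space G')
  ultimately show "finite_dimensional q.Q"
    unfolding finite_dimensional_def by blast
  obtain u where u: "u \<in> W'" "u \<notin> W" and
    "sc0 (d ^ 2) (act M UNIV Eg u) + (sc0 (- (c ^ 2)) (act M UNIV Fg u) + sc0 (d * c) (act M UNIV Hg u)) \<in> W"
    "sc0 (2 * b * d) (act M UNIV Eg u) + (sc0 (- (2 * a * c)) (act M UNIV Fg u) + sc0 (a * d + b * c) (act M UNIV Hg u))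
      - sc0 (of_nat n) u \<in> W"
    using step_highest_weight_vector[OF _ mu fl det] by auto
  then have EH: "gen bE u \<in> W" "gen bH u - sc0 (of_nat n) u \<in> W"
    using rep.subm_subset[OF step_subm_W1 u(1)] by (simp_all only: gen_rotated)
  show "has_highest_weight q.Q (of_nat n)"
    unfolding has_highest_weight_def
  proof (intro bexI conjI)
    show "q.coset u \<in> space q.Q" using u by (simp add: q.Q_space G')
    show "q.coset u \<noteq> rzero q.Q" using u by (simp add: q.coset_zero_iff)
    show "ract q.Q bE (q.coset u) = rzero q.Q"
      using q.Q_act[of u bE] u(1) EH(1) q.coset_zero_iff[of "gen bE u"] unfolding G' by (simp del: Phi.simps)
    show "ract q.Q bH (q.coset u) = rscale q.Q (of_nat n) (q.coset u)"
      using q.Q_act[of u bH] q.Q_scale[of u "of_nat n"] u(1) EH(2) q.coset_eq_iff unfolding G'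
      by (simp del: Phi.simps)
  qed
qed

text \<open>The map sending u to the class of u v has the highest weight ideal as its kernel: modulo
  the ideal, u is a combination of powers of \<open>fU\<close> by \<open>hw_ideal_spanning\<close>,
  and the classes of the F^k v are independent since \<open>kap\<close> never vanishes here.
  Independence is thus obtained in the module, not in the enveloping algebra.\<close>

lemma verma_Q:
  assumes mu: "\<mu> = - of_nat (n + 1) - 1"
  shows "rep_iso q.Q (quotient_rep U_rep (hw_ideal \<mu>))"
proof -
  interpret U: quotient_setup U_rep "hw_ideal \<mu>"
    by unfold_locales (simp_all add: U_rep_def hw_ideal_zero hw_ideal_add hw_ideal_minus hw_ideal_mult ring_distribs)
  have U': "space U_rep = UNIV" "rscale U_rep r u = uconst r * u" "ract U_rep t u = ugen t * u" for r t u
    by (simp_all add: U_rep_def)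
  note v = st.v(1)
  have v': "v \<in> W'" using step_v_W1 by simp
  have \<theta>: "uact u v \<in> W'" for u using inv_sub_uact[OF step_inv_sub_W1] v' by simp
  have pow: "uact (fU ^ k) v = st.f k" for k
  proof (induction k)
    case 0
    then show ?case using v by (simp add: uact_simps st.f_0)
  next
    case (Suc k)
    then show ?case using uact_efh(2)[OF st.f_mem[of k]] v by (simp add: uact_simps st.F_f)
  qed
  have sums: "uact (\<Sum>k<N. uconst (x k) * fU ^ k) v = (\<Sum>k<N. sc0 (x k) (st.f k))" for N x
  proof (induction N)
    case 0
    have "uact (uconst 0) v = 0" using v by (simp only: uact_simps rep.sc_zero_left)
    then show ?case by (simp add: uconst_simps)
  next
    case (Suc N)
    then show ?case using v st.f_mem by (simp add: uact_simps pow)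
  qed
  have ideal_W: "uact i v \<in> W" if "i \<in> hw_ideal \<mu>" for i
  proof -
    obtain x y where i: "i = x * eU + y * (hU - uconst \<mu>)" using \<open>i \<in> hw_ideal \<mu>\<close> unfolding hw_ideal_def by blast
    have "uact (hU - uconst \<mu>) v \<in> W" "uact eU v \<in> W"
      using st.Ev st.Hv v by (simp_all add: uact_minus uact_efh uact_simps)
    then show ?thesis unfolding i using inv_sub_uact[OF st.W] v rep.subm_add[OF st.S] by (simp add: uact_simps)
  qed
  have kernel: "uact u v \<in> W \<longleftrightarrow> u \<in> hw_ideal \<mu>" for u
  proof
    assume u: "uact u v \<in> W"
    obtain N x i where i: "i \<in> hw_ideal \<mu>" "u = i + (\<Sum>k<N. uconst (x k) * fU ^ k)" using hw_ideal_spanning by blast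
    have "(\<Sum>k<N. sc0 (x k) (st.f k)) = uact u v - uact i v"
      unfolding i(2) using v by (simp add: uact_simps sums)
    also have "\<dots> \<in> W" by (rule rep.subm_diff[OF st.S u ideal_W[OF i(1)]])
    finally have "\<forall>k<N. x k = 0" using st.sum_mem_W_iff st.kap_nonzero mu by simp
    then have "(\<Sum>k<N. uconst (x k) * fU ^ k) = 0" by (intro sum.neutral) (simp add: uconst_simps)
    then show "u \<in> hw_ideal \<mu>" using i by simp
  qed (rule ideal_W)
  have surj: "\<exists>u. A = q.coset (uact u v)" if A: "A \<in> space q.Q" for A
  proof -
    obtain x where x: "x \<in> W'" "A = q.coset x" using A by (auto simp: q.Q_space G')
    obtain w N y where "w \<in> W" "x = w + (\<Sum>i<N. sc0 (y i) (st.f i))" using step_W1_cases[OF x(1)] .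
    then have "A = q.coset (uact (\<Sum>i<N. uconst (y i) * fU ^ i) v)" unfolding x sums q.coset_eq_iff by simp
    then show ?thesis by blast
  qed
  \<comment> \<open>The isomorphism is written in the direction starting from W' modulo W: a coset A
    goes to the set of all u with u v in A, which is a coset of the ideal, so no representative has
    to be chosen.\<close>
  define \<phi> where "\<phi> A = {u. uact u v \<in> A}" for A
  have \<phi>: "\<phi> (q.coset (uact u v)) = U.coset u" for u
    by (rule set_eqI) (simp only: \<phi>_def mem_Collect_eq q.mem_coset_iff U.mem_coset_iff kernel[symmetric] uact_minus[OF v])
  have Uspace: "space U.Q = range U.coset" by (simp add: U.Q_space U')
  show ?thesis
    unfolding rep_iso_def
  proof (intro exI[of _ \<phi>] conjI ballI allI)
    show "bij_betw \<phi> (space q.Q) (space U.Q)"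
      unfolding bij_betw_def
    proof
      show "inj_on \<phi> (space q.Q)"
      proof (rule inj_onI)
        fix A B assume "A \<in> space q.Q" "B \<in> space q.Q" and e: "\<phi> A = \<phi> B"
        then obtain x y where xy: "A = q.coset (uact x v)" "B = q.coset (uact y v)" using surj by metis
        then have "x - y \<in> hw_ideal \<mu>" using e by (simp add: \<phi> U.coset_eq_iff)
        then show "A = B" unfolding xy q.coset_eq_iff uact_minus[OF v, symmetric] kernel .
      qed
      show "\<phi> ` space q.Q = space U.Q"
      proof
        show "\<phi> ` space q.Q \<subseteq> space U.Q" using surj by (fastforce simp: \<phi> Uspace)
        show "space U.Q \<subseteq> \<phi> ` space q.Q"
        proof
          fix B assume "B \<in> space U.Q"
          then obtain u where "B = U.coset u" by (auto simp: Uspace)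
          then show "B \<in> \<phi> ` space q.Q" using \<theta>
            by (intro image_eqI[of _ _ "q.coset (uact u v)"]) (simp_all add: \<phi> q.Q_space G')
        qed
      qed
    qed
    fix A assume "A \<in> space q.Q"
    then obtain x where x: "A = q.coset (uact x v)" using surj by blast
    have xW: "uact x v \<in> space G'" using \<theta> unfolding G' .
    show "\<phi> (rscale q.Q r A) = rscale U.Q r (\<phi> A)" for r
    proof -
      have "rscale q.Q r A = q.coset (uact (uconst r * x) v)"
        unfolding x q.Q_scale[OF xW] G' using v by (simp add: uact_simps)
      then show ?thesis unfolding x \<phi> by (simp add: \<phi> U.Q_scale U')
    qed
    show "\<phi> (ract q.Q t A) = ract U.Q t (\<phi> A)" for t
    proof -
      have "ract q.Q t A = q.coset (uact (ugen t * x) v)"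
        unfolding x q.Q_act[OF xW] G' using v by (simp add: uact_simps del: Phi.simps)
      then show ?thesis unfolding x \<phi> by (simp add: \<phi> U.Q_act U')
    qed
    fix B assume "B \<in> space q.Q"
    then obtain y where y: "B = q.coset (uact y v)" using surj by blast
    have "radd q.Q A B = q.coset (uact (x + y) v)" unfolding x y q.Q_add using v by (simp add: uact_simps)
    then show "\<phi> (radd q.Q A B) = radd U.Q (\<phi> A) (\<phi> B)" unfolding x y \<phi> by (simp add: \<phi> U.Q_add)
  qed
qed

end

theorem theorem4p2:
  fixes lam :: int and M :: "'m::ab_group_add dsheaf" and p :: cp1 and g :: "complex^2^2"
  assumes "lam > 0"
    and "D_lambda_module lam M"
    and "holonomic_twisted lam M" and "regular_holonomic_twisted lam M"
    and "singular_points M = {p}"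
    and "det g = 1" and "p = pt (g$1$1) (g$2$1)"
  shows "\<exists>(n::nat) (V :: nat \<Rightarrow> 'm set).
           V 1 = space (global_sections lam M) \<and> V (n + 1) = {0} \<and>
           (\<forall>i \<in> {1..n + 1}. subrep (global_sections lam M) (V i)) \<and>
           (\<forall>i \<in> {1..n}. V (i + 1) \<subseteq> V i \<and>
              (let Q = subquotient (global_sections lam M) (V i) (V (i + 1)) in
                 (irreducible_rep Q \<and> rep_iso Q (verma g (of_int (- lam - 1)))) \<or>
                 (irreducible_rep Q \<and> finite_dimensional Q \<and>
                  has_highest_weight Q (of_int (lam - 1)))))"
proof -
  define N where "N = nat (lam - 1)"
  have lam: "lam = int N + 1" using assms(1) by (simp add: N_def)
  have T: "untwist lam M = line_bundle_tensor (- int N) M" by (simp add: untwist_def lam)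
  have coh: "D_coherent (line_bundle_tensor (- int N) M)"
    using assms(3) by (simp add: holonomic_twisted_def holonomic_def T)
  have mod: "diff_ops_module (int N) M" using assms(2) by (simp add: lam)
  interpret rh_module "g$1$1" "g$1$2" "g$2$1" "g$2$2" N M
  proof (intro rh_module.intro framed_module.intro twisted_frame.intro frame.intro twisted_module.intro
      framed_module_axioms.intro rh_module_axioms.intro mod coh)
    show "g$1$1 * g$2$2 - g$1$2 * g$2$1 = 1" using assms(6) by (simp add: det_2)
    show "quasi_coherent_on (line_bundle_tensor (- int N) M) UNIV" using coh by (simp add: D_coherent_def)
    show "regular_sing_at (line_bundle_tensor (- int N) M) (pt (g$1$1) (g$2$1))"
      using assms(4) by (simp add: regular_holonomic_twisted_def regular_holonomic_def T)
    show "singular_points M = {pt (g$1$1) (g$2$1)}" using assms(5,7) by simp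
  qed
  obtain k :: nat and V where V: "V 1 = V0" "V (k + 1) = {0}"
    and steps: "\<forall>i\<in>{1..k}. \<exists>v \<mu>. rep.is_step (V (i + 1)) v \<mu> (V i)"
    using rep.filtered_chain[OF filtered] by (elim exE conjE)
  have inv: "rep.inv_sub (V i)" if "i \<in> {1..k + 1}" for i
  proof (cases "i = k + 1")
    case True
    then show ?thesis using V(2) rep.inv_sub_0 by simp
  next
    case False
    then have "i \<in> {1..k}" using that by auto
    then obtain v \<mu> where "rep.is_step (V (i + 1)) v \<mu> (V i)" using steps by blast
    then show ?thesis using rep.is_step_inv by blast
  qed
  have step: "let Q = subquotient (global_sections lam M) (V i) (V (i + 1)) in
      (irreducible_rep Q \<and> rep_iso Q (verma g (of_int (- lam - 1)))) \<or>
      (irreducible_rep Q \<and> finite_dimensional Q \<and> has_highest_weight Q (of_int (lam - 1)))"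
    if i: "i \<in> {1..k}" for i
  proof -
    obtain v \<mu> where "rep.is_step (V (i + 1)) v \<mu> (V i)" using steps i by blast
    then interpret s: rh_step "g$1$1" "g$1$2" "g$2$1" "g$2$2" N M "V (i + 1)" v \<mu> "V i" by unfold_locales
    have w: "of_int (- lam - 1) = - of_nat (N + 1) - (1::complex)" "of_int (lam - 1) = (of_nat N :: complex)"
      by (simp_all add: lam)
    show ?thesis
    proof (cases "\<mu> = - of_nat (N + 1) - 1")
      case True
      then have "rep_iso (subquotient (global_sections lam M) (V i) (V (i + 1))) (verma g (of_int (- lam - 1)))"
        using s.verma_Q[OF True, folded s.subquotient_eq] True unfolding w verma_def verma_ideal_eq[OF refl refl refl refl] lam by simp
      then show ?thesis using s.irreducible_Q[folded s.subquotient_eq] by (simp add: Let_def lam)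
    next
      case False
      then show ?thesis using s.irreducible_Q[folded s.subquotient_eq] s.finite_Q[OF False, folded s.subquotient_eq] unfolding w by (simp add: Let_def lam)
    qed
  qed
  show ?thesis
  proof (intro exI[of _ k] exI[of _ V] conjI ballI)
    show "V 1 = space (global_sections lam M)" using V by (simp add: global_sections_def)
    show "V (k + 1) = {0}" by (rule V)
    show "subrep (global_sections lam M) (V i)" if "i \<in> {1..k + 1}" for i
      using subrep_inv_sub[OF inv[OF that]] by (simp add: lam)
    fix i assume i: "i \<in> {1..k}"
    obtain v \<mu> where "rep.is_step (V (i + 1)) v \<mu> (V i)" using steps i by blast
    then show "V (i + 1) \<subseteq> V i" using rep.is_step_inv by blast
    show "let Q = subquotient (global_sections lam M) (V i) (V (i + 1)) in
      (irreducible_rep Q \<and> rep_iso Q (verma g (of_int (- lam - 1)))) \<or>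
      (irreducible_rep Q \<and> finite_dimensional Q \<and> has_highest_weight Q (of_int (lam - 1)))"
      by (rule step[OF i])
  qed
qed

end
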